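(* Let $0<p<1$ and $0<q\le\infty$. Then (i) $(H^{p,q},\mathcal{B})=(H_0^{p,\infty},\mathcal{B})=H(\infty,\infty,1,1/p)=(H^p)^*$; (ii) $(H^{p,q},\mathcal{B}_0)=(H_0^{p,\infty},\mathcal{B}_0)=H(\infty,\infty,1,1/p)=(H^p)^*$ if $q\neq\infty$; (iii) $(H^{p,\infty},\mathcal{B}_0)=H_0(\infty,\infty,1,1/p)$.
   Context: $\mathbb{D}$ is the open unit disk, $\mathbb{T}$ its boundary, $m$ normalized Lebesgue measure on $\mathbb{T}$, $H(\mathbb{D})$ the analytic functions on $\mathbb{D}$, $H^p$ the usual Hardy space on $\mathbb{D}$. $W$ is the space of complex sequences indexed by $\mathbb{N}_0=\{0,1,2,\dots\}$; $f(z)=\sum a_nz^n\in H(\mathbb{D})$ is identified with $\{a_n\}\in W$. For vector subspaces $E,X$ of $W$, $(E,X)=\{\lambda\in W:\{\lambda_nw_n\}\in X\text{ for all }w\in E\}$. $(H^p)^*$ is the space of continuous linear functionals on $H^p$, regarded as a subspace of $W$ by identifying $\varphi$ with the sequence $\{\varphi(u_n)\}$, $u_n(z)=z^n$. Hardy-Lorentz spaces: for measurable $f$ on $\mathbb{T}$ let $\lambda_f(s)=m(\{|f|>s\})$, $f^*(s)=\inf\{t\ge0:\lambda_f(t)\le s\}$, $\|f\|_{p,q}=(\int_0^1[f^*(s)s^{1/p}]^q\frac{ds}{s})^{1/q}$ for $0<q<\infty$ and $\|f\|_{p,\infty}=\sup_{s>0}f^*(s)s^{1/p}$. The Smirnov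 class $N^+$ consists of $f\in H(\mathbb{D})$ in the Nevanlinna class with $\lim_{r\to1^-}\int_{\mathbb{T}}\log^+|f(rz)|\,dm=\int_{\mathbb{T}}\log^+|f|\,dm$, where $f$ on $\mathbb{T}$ is the nontangential boundary function. $H^{p,q}$ is the set of $f\in N^+$ with $\|f\|_{p,q}<\infty$ for the boundary function; $H^{p,\infty}_0$ is the set of $f\in H^{p,\infty}$ whose boundary function satisfies $\lim_{s\to0}f^*(s)s^{1/p}=0$. For $f=\sum a_nz^n$ and $\beta>0$, $f^{[\beta]}(z)=\sum\frac{\Gamma(n+\beta+1)}{n!}a_nz^n$. With $M_\infty(r,f)=\sup_{z\in\mathbb{T}}|f(rz)|$, $H(\infty,\infty,1,\beta)$ is the set of $f\in H(\mathbb{D})$ with $\sup_{0<r<1}(1-r)M_\infty(r,f^{[\beta]})<\infty$ and $H_0(\infty,\infty,1,\beta)$ is the subset with $(1-r)M_\infty(r,f^{[\beta]})\to0$ as $r\to1^-$. The Bloch space is $\mathcal{B}=H(\infty,\infty,1,1)$ and the little Bloch space is $\mathcal{B}_0=H_0(\infty,\infty,1,1)$. *)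

theory Defs
  imports "HOL-Probability.Probability" "HOL-Complex_Analysis.Complex_Analysis"
begin

text \<open>Meant for positive exponents \<open>e\<close> only, so that infinity is mapped to infinity.\<close>

definition ennreal_powr :: "ennreal \<Rightarrow> real \<Rightarrow> ennreal" where
  "ennreal_powr x e = (if x = \<infinity> then \<infinity> else ennreal (enn2real x powr e))"

text \<open>Positive part of the logarithm; the form below avoids the value of \<open>ln\<close> at 0.\<close>

definition log_plus :: "real \<Rightarrow> real" where
  "log_plus x = ln (max 1 x)"

text \<open>Normalized Lebesgue measure on the unit circle (complete, like Lebesgue measure).\<close>

definition circle_measure :: "complex measure" where
  "circle_measure =
     completion (distr (uniform_measure lborel {0..<1::real})
       (restrict_space borel (sphere 0 1)) (\<lambda>t. cis (2 * pi * t)))"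

text \<open>
  The sequence space \<open>W\<close> is the type \<^typ>\<open>nat \<Rightarrow> complex\<close>. An analytic function on the
  unit disc is identified with its sequence of Taylor coefficients, so all spaces
  of analytic functions below are sets of sequences; \<open>disc_fun a\<close> recovers the function
  (only its values on the open unit disc are meaningful).
\<close>

definition disc_fun :: "(nat \<Rightarrow> complex) \<Rightarrow> complex \<Rightarrow> complex" where
  "disc_fun a z = (\<Sum>n. a n * z ^ n)"

definition analytic_disc :: "(nat \<Rightarrow> complex) set" where
  "analytic_disc = {a. \<exists>f. f holomorphic_on ball 0 1 \<and>
     (\<forall>z\<in>ball 0 1. (\<lambda>n. a n * z ^ n) sums f z)}"

definition multipliers ::
    "(nat \<Rightarrow> complex) set \<Rightarrow> (nat \<Rightarrow> complex) set \<Rightarrow> (nat \<Rightarrow> complex) set" where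
  "multipliers E X = {l. \<forall>w\<in>E. (\<lambda>n. l n * w n) \<in> X}"

definition stolz_region :: "real \<Rightarrow> complex \<Rightarrow> complex set" where
  "stolz_region \<alpha> \<zeta> = {z \<in> ball 0 1. cmod (z - \<zeta>) < \<alpha> * (1 - cmod z)}"

definition has_nontangential_limit :: "(complex \<Rightarrow> complex) \<Rightarrow> complex \<Rightarrow> complex \<Rightarrow> bool" where
  "has_nontangential_limit f \<zeta> L \<longleftrightarrow>
     (\<forall>\<alpha>>1. (f \<longlongrightarrow> L) (at \<zeta> within stolz_region \<alpha> \<zeta>))"

text \<open>For functions of the Nevanlinna class the default value 0 is taken only on a null set.\<close>

definition boundary_fun :: "(complex \<Rightarrow> complex) \<Rightarrow> complex \<Rightarrow> complex" where
  "boundary_fun f \<zeta> =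
     (if \<exists>L. has_nontangential_limit f \<zeta> L then THE L. has_nontangential_limit f \<zeta> L else 0)"

definition nevanlinna_class :: "(nat \<Rightarrow> complex) set" where
  "nevanlinna_class = {a \<in> analytic_disc.
     (SUP r\<in>{0<..<1}. \<integral>\<^sup>+z. ennreal (log_plus (cmod (disc_fun a (of_real r * z))))
        \<partial>circle_measure) < \<infinity>}"

definition smirnov_class :: "(nat \<Rightarrow> complex) set" where
  "smirnov_class = {a \<in> nevanlinna_class.
     ((\<lambda>r. \<integral>\<^sup>+z. ennreal (log_plus (cmod (disc_fun a (of_real r * z)))) \<partial>circle_measure)
       \<longlongrightarrow> (\<integral>\<^sup>+z. ennreal (log_plus (cmod (boundary_fun (disc_fun a) z))) \<partial>circle_measure))
     (at_left 1)}"

definition distribution_fun :: "(complex \<Rightarrow> complex) \<Rightarrow> real \<Rightarrow> real" where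
  "distribution_fun f s = measure circle_measure {z \<in> sphere 0 1. cmod (f z) > s}"

text \<open>
  Only used for \<open>s > 0\<close>; there the set under the infimum is nonempty for measurable \<open>f\<close>.
\<close>

definition decr_rearr :: "(complex \<Rightarrow> complex) \<Rightarrow> real \<Rightarrow> real" where
  "decr_rearr f s = Inf {t. 0 \<le> t \<and> distribution_fun f t \<le> s}"

definition lorentz_norm :: "real \<Rightarrow> ennreal \<Rightarrow> (complex \<Rightarrow> complex) \<Rightarrow> ennreal" where
  "lorentz_norm p q f =
     (if q = \<infinity> then (SUP s\<in>{0<..}. ennreal (decr_rearr f s * s powr (1 / p)))
      else ennreal_powr
        (\<integral>\<^sup>+s\<in>{0<..<1}. ennreal ((decr_rearr f s * s powr (1 / p)) powr enn2real q / s) \<partial>lborel)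
        (1 / enn2real q))"

definition hardy_lorentz :: "real \<Rightarrow> ennreal \<Rightarrow> (nat \<Rightarrow> complex) set" where
  "hardy_lorentz p q =
     {a \<in> smirnov_class. lorentz_norm p q (boundary_fun (disc_fun a)) < \<infinity>}"

definition hardy_lorentz0 :: "real \<Rightarrow> (nat \<Rightarrow> complex) set" where
  "hardy_lorentz0 p = {a \<in> hardy_lorentz p \<infinity>.
     ((\<lambda>s. decr_rearr (boundary_fun (disc_fun a)) s * s powr (1 / p)) \<longlongrightarrow> 0) (at_right 0)}"

definition hardy_norm :: "real \<Rightarrow> (complex \<Rightarrow> complex) \<Rightarrow> ennreal" where
  "hardy_norm p f = (SUP r\<in>{0<..<1}.
     ennreal_powr (\<integral>\<^sup>+z. ennreal (cmod (f (of_real r * z)) powr p) \<partial>circle_measure) (1 / p))"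

definition hardy_space :: "real \<Rightarrow> (nat \<Rightarrow> complex) set" where
  "hardy_space p = {a \<in> analytic_disc. hardy_norm p (disc_fun a) < \<infinity>}"

definition linear_functional_on ::
    "(nat \<Rightarrow> complex) set \<Rightarrow> ((nat \<Rightarrow> complex) \<Rightarrow> complex) \<Rightarrow> bool" where
  "linear_functional_on E \<phi> \<longleftrightarrow>
     (\<forall>a\<in>E. \<forall>b\<in>E. \<phi> (\<lambda>n. a n + b n) = \<phi> a + \<phi> b) \<and>
     (\<forall>c. \<forall>a\<in>E. \<phi> (\<lambda>n. c * a n) = c * \<phi> a)"

definition hardy_continuous :: "real \<Rightarrow> ((nat \<Rightarrow> complex) \<Rightarrow> complex) \<Rightarrow> bool" where
  "hardy_continuous p \<phi> \<longleftrightarrow>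
     (\<forall>a\<in>hardy_space p. \<forall>\<epsilon>>0. \<exists>\<delta>>0. \<forall>b\<in>hardy_space p.
        hardy_norm p (disc_fun (\<lambda>n. b n - a n)) < ennreal \<delta> \<longrightarrow> cmod (\<phi> b - \<phi> a) < \<epsilon>)"

definition monomial_seq :: "nat \<Rightarrow> nat \<Rightarrow> complex" where
  "monomial_seq n = (\<lambda>k. if k = n then 1 else 0)"

definition hardy_dual :: "real \<Rightarrow> (nat \<Rightarrow> complex) set" where
  "hardy_dual p = {l. \<exists>\<phi>. linear_functional_on (hardy_space p) \<phi> \<and> hardy_continuous p \<phi> \<and>
     (\<forall>n. l n = \<phi> (monomial_seq n))}"

definition frac_deriv :: "real \<Rightarrow> (nat \<Rightarrow> complex) \<Rightarrow> nat \<Rightarrow> complex" where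
  "frac_deriv \<beta> a n = complex_of_real (Gamma (real n + \<beta> + 1) / fact n) * a n"

definition max_modulus :: "real \<Rightarrow> (complex \<Rightarrow> complex) \<Rightarrow> ennreal" where
  "max_modulus r f = (SUP z\<in>sphere 0 1. ennreal (cmod (f (of_real r * z))))"

text \<open>
  \<open>bloch_type \<beta>\<close> and \<open>bloch_type0 \<beta>\<close> are the spaces \<open>H(\<infinity>, \<infinity>, 1, \<beta>)\<close> and
  \<open>H\<^sub>0(\<infinity>, \<infinity>, 1, \<beta>)\<close>.
\<close>

definition bloch_type :: "real \<Rightarrow> (nat \<Rightarrow> complex) set" where
  "bloch_type \<beta> = {a \<in> analytic_disc.
     (SUP r\<in>{0<..<1}. ennreal (1 - r) * max_modulus r (disc_fun (frac_deriv \<beta> a))) < \<infinity>}"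

definition bloch_type0 :: "real \<Rightarrow> (nat \<Rightarrow> complex) set" where
  "bloch_type0 \<beta> = {a \<in> bloch_type \<beta>.
     ((\<lambda>r. ennreal (1 - r) * max_modulus r (disc_fun (frac_deriv \<beta> a))) \<longlongrightarrow> 0) (at_left 1)}"

definition bloch :: "(nat \<Rightarrow> complex) set" where
  "bloch = bloch_type 1"

definition little_bloch :: "(nat \<Rightarrow> complex) set" where
  "little_bloch = bloch_type0 1"

end

theory Submission imports Defs
begin

text \<open>
  Let \<open>\<beta> = 1 / p\<close>. A function \<open>f\<close> in the Smirnov class satisfies \<open>log\<^sup>+ \<bar>f\<bar> \<le> P[log\<^sup>+ \<bar>f\<^sup>*\<bar>]\<close>, where \<open>P\<close>
  is the Poisson integral and \<open>f\<^sup>*\<close> the boundary function. If \<open>f\<^sup>*\<close> is in weak \<open>L\<^sup>p\<close>, Jensen's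
  inequality and a truncation bound the means of \<open>\<bar>f\<bar>\<close> over the circle of radius \<open>r\<close> by a multiple of
  \<open>(1 - r)\<^sup>1\<^sup>-\<^sup>\<beta>\<close>, and by \<open>o((1 - r)\<^sup>1\<^sup>-\<^sup>\<beta>)\<close> in the small class. If the derivative \<open>g\<close> of order \<open>\<beta>\<close> of \<open>l\<close> is
  \<open>O(1 / (1 - r))\<close>, then the convolution of \<open>g\<close> and \<open>f\<close>, which is the derivative of order \<open>\<beta>\<close> of the
  coefficient product, is \<open>O((1 - r)\<^sup>-\<^sup>\<beta>)\<close>, and a fractional integration of order \<open>\<beta> - 1\<close> yields the
  Bloch condition.

  Conversely, multiplying \<open>l\<close> with kernels like \<open>(1 - \<alpha> z)\<^sup>-\<^sup>s\<close> recovers fractional derivatives of \<open>l\<close>: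
  for the weak space one kernel with \<open>\<alpha> = 1\<close> suffices, for \<open>q < \<infinity>\<close> a gliding hump of kernels with
  \<open>\<alpha> \<rightarrow> 1\<close> is used, and for functionals on \<open>H\<^sup>p\<close> single kernels with \<open>\<bar>\<alpha>\<bar> < 1\<close>. The functional of
  \<open>l\<close> is an integral of \<open>\<tau>\<^sup>\<beta>\<^sup>-\<^sup>1\<close> times the derivative of order \<open>\<beta>\<close> of the product at \<open>1 - \<tau>\<close>, which
  converges by the theorem of Hardy and Littlewood on integral means.
\<close>

section \<open>Normalized Lebesgue measure on the circle\<close>

text \<open>Membership in \<open>hardy_lorentz p q\<close> says nothing directly about f inside the
  disc: only the boundary function and the Smirnov condition are given, so every interior bound has
  to pass through log+ |f|. As the boundary function is merely in weak L^p, max(1, |f|)^p may fail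
  to be integrable. The power w = max(1, |f|)^(p/2) is in weak L^2, hence integrable, and Jensen's
  inequality applies to it; this is the origin of the exponents p / 2 and 2 / p. The index q is felt
  only through O versus o: finite q forces the small class, which is why (iii) alone ends in a
  smaller space. The gliding hump builds the contradicting function explicitly, where a closed graph
  argument would ask for completeness of the quasi-normed spaces. Its kernels have order 2 / p
  instead of 1 / p: multiplied by (1 - \<alpha>)^(1/p) they have uniformly bounded norm. In the H^p
  estimate the same order leaves two powers that can be read as a Poisson kernel. The surplus order
  is removed by fractional integration.\<close>

abbreviation circle_borel :: "complex measure" where
  "circle_borel \<equiv> restrict_space borel (sphere 0 1)"

lemma cis_measurable_circle: "(\<lambda>t. cis (2 * pi * t)) \<in> lborel \<rightarrow>\<^sub>M circle_borel"
  by (intro measurable_restrict_space2) (auto simp: cis.ctr intro!: borel_measurable_continuous_onI continuous_intros)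

lemma cis_measurable_uniform:
  "(\<lambda>t. cis (2 * pi * t)) \<in> uniform_measure lborel {0..<1::real} \<rightarrow>\<^sub>M circle_borel"
  using cis_measurable_circle by (simp add: measurable_def)

interpretation circle: prob_space circle_measure
proof -
  interpret U: prob_space "uniform_measure lborel {0..<1::real}"
    by (intro prob_space_uniform_measure) auto
  interpret D: prob_space "distr (uniform_measure lborel {0..<1::real}) circle_borel (\<lambda>t. cis (2 * pi * t))"
    by (intro U.prob_space_distr cis_measurable_uniform)
  show "prob_space circle_measure"
    unfolding circle_measure_def
    using D.prob_space_completion by simp
qed

lemma space_circle [simp]: "space circle_measure = sphere 0 1"
  by (simp add: circle_measure_def space_restrict_space)

lemma measurable_circle:
  "f \<in> borel_measurable circle_borel \<Longrightarrow> f \<in> borel_measurable circle_measure"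
  unfolding circle_measure_def by (intro measurable_completion) simp

lemma measurable_circle_id: "(\<lambda>z. z) \<in> circle_measure \<rightarrow>\<^sub>M circle_borel"
  unfolding circle_measure_def by (intro measurable_completion) simp

lemma measurable_circle_continuous:
  "continuous_on (sphere 0 1) f \<Longrightarrow> f \<in> borel_measurable circle_borel"
  by (rule borel_measurable_continuous_on_restrict)

lemma uniform_measure_unit:
  "uniform_measure lborel {0..<1::real} = density lborel (\<lambda>t. ennreal (indicator {0..<1} t))"
  by (simp add: uniform_measure_def indicator_def of_bool_def if_distrib cong: if_cong)
     (auto intro!: arg_cong[where f="density lborel"])

lemma nn_integral_circle:
  assumes "f \<in> borel_measurable circle_borel"
  shows "(\<integral>\<^sup>+z. f z \<partial>circle_measure) = (\<integral>\<^sup>+t\<in>{0..<1}. f (cis (2 * pi * t)) \<partial>lborel)"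
proof -
  have [measurable]: "(\<lambda>t. f (cis (2 * pi * t))) \<in> borel_measurable lborel"
    by (rule measurable_compose[OF cis_measurable_circle assms])
  show ?thesis unfolding circle_measure_def nn_integral_completion
    by (subst nn_integral_distr[OF cis_measurable_uniform])
       (use assms in \<open>simp_all add: nn_integral_uniform_measure divide_ennreal_def\<close>)
qed

lemma integral_circle:
  fixes f :: "complex \<Rightarrow> 'a::euclidean_space"
  assumes f: "continuous_on (sphere 0 1) f"
  shows "integrable circle_measure f"
    and "((\<lambda>t. f (cis (2 * pi * t))) has_integral (LINT z|circle_measure. f z)) {0..1}"
proof -
  have m: "f \<in> borel_measurable circle_borel" by (intro measurable_circle_continuous f)
  obtain B where B: "\<And>z. z \<in> sphere 0 1 \<Longrightarrow> norm (f z) \<le> B"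
    using compact_imp_bounded[OF compact_continuous_image[OF f compact_sphere]]
    unfolding bounded_iff by blast
  show int: "integrable circle_measure f"
    by (rule circle.integrable_const_bound[of _ B]) (auto intro!: measurable_circle m B AE_I2)
  have cf: "continuous_on {0..1} (\<lambda>t. f (cis (2 * pi * t)))"
    by (rule continuous_on_compose2[OF f]) (auto intro!: continuous_intros)
  have [measurable]: "(\<lambda>t. f (cis (2 * pi * t))) \<in> borel_measurable lborel"
    by (rule measurable_compose[OF cis_measurable_circle m])
  have "(LINT z|circle_measure. f z) =
      (LINT t|uniform_measure lborel {0..<1::real}. f (cis (2 * pi * t)))"
    unfolding circle_measure_def
    by (subst integral_completion) (use m in \<open>auto simp: measurable_def intro!: integral_distr cis_measurable_uniform\<close>)
  also have "\<dots> = (LINT t|lborel. indicator {0..<1} t *\<^sub>R f (cis (2 * pi * t)))"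
    unfolding uniform_measure_unit by (subst integral_density) auto
  also have "\<dots> = (LINT t|lborel. indicator {0..1} t *\<^sub>R f (cis (2 * pi * t)))"
  proof (rule integral_cong_AE)
    show "AE t in lborel. indicator {0..<1} t *\<^sub>R f (cis (2 * pi * t)) =
        indicator {0..1} t *\<^sub>R f (cis (2 * pi * t))"
      using AE_lborel_singleton[of "1::real"] by eventually_elim (auto simp: indicator_def)
  qed auto
  also have "\<dots> = integral {0..1} (\<lambda>t. f (cis (2 * pi * t)))"
    using set_borel_integral_eq_integral(2)[OF borel_integrable_atLeastAtMost'[OF cf]]
    by (simp add: set_lebesgue_integral_def)
  finally show "((\<lambda>t. f (cis (2 * pi * t))) has_integral (LINT z|circle_measure. f z)) {0..1}"
    using integrable_integral[OF integrable_continuous_real[OF cf]] by simp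
qed

text \<open>The test functions are continuous on the closed disc except at the point 1, so a single
  point is all that the almost everywhere statements about them leave out.\<close>

lemma circle_singleton_null: "AE z in circle_measure. z \<noteq> w"
proof -
  have [measurable]: "(\<lambda>z. indicator {w} z :: ennreal) \<in> borel_measurable circle_borel"
    by (intro measurable_restrict_space1) auto
  have "finite ((\<lambda>t. cis (2 * pi * t)) -` {w} \<inter> {0..<1})"
  proof -
    have "inj_on (\<lambda>t. cis (2 * pi * t)) {0..<1::real}"
    proof (rule inj_onI)
      fix s t :: real assume st: "s \<in> {0..<1}" "t \<in> {0..<1}" and "cis (2 * pi * s) = cis (2 * pi * t)"
      then obtain n :: int where "\<i> * complex_of_real (2 * pi * s) =
          \<i> * complex_of_real (2 * pi * t) + complex_of_real (2 * n * pi) * \<i>"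
        unfolding cis_conv_exp exp_eq by auto
      then have "Im (\<i> * complex_of_real (2 * pi * s)) =
          Im (\<i> * complex_of_real (2 * pi * t) + complex_of_real (2 * n * pi) * \<i>)"
        by simp
      then have "2 * pi * (s - t - n) = 0" by (simp add: algebra_simps)
      then have "s = t + n" by simp
      with st have "\<bar>real_of_int n\<bar> < 1" by auto
      then have "n = 0" by linarith
      with \<open>s = t + n\<close> show "s = t" by simp
    qed
    then show ?thesis by (intro finite_vimage_IntI) auto
  qed
  then have ae: "AE t in lborel. t \<notin> (\<lambda>t. cis (2 * pi * t)) -` {w} \<inter> {0..<1}"
    by (intro AE_not_in null_setsI countable_imp_null_set_lborel countable_finite)
  have "(\<integral>\<^sup>+t\<in>{0..<1}. indicator {w} (cis (2 * pi * t)) \<partial>lborel) = (\<integral>\<^sup>+t. 0 \<partial>(lborel::real measure))"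
    by (rule nn_integral_cong_AE, use ae in eventually_elim) (auto simp: indicator_def)
  then have "(\<integral>\<^sup>+z. indicator {w} z \<partial>circle_measure) = 0"
    by (subst nn_integral_circle) auto
  then have "AE z in circle_measure. (indicator {w} z :: ennreal) = 0"
    by (subst (asm) nn_integral_0_iff_AE) (auto intro!: measurable_circle)
  then show ?thesis by eventually_elim (auto simp: indicator_def split: if_splits)
qed

text \<open>On the circle the normalized measure is dz / (2 pi i z). The factor z in the integrand
  compensates for this, and the formula becomes Cauchy's.\<close>

lemma circle_Cauchy:
  assumes "continuous_on (cball 0 1) F" "F holomorphic_on ball 0 1" "cmod w < 1"
  shows "(LINT z|circle_measure. F z * z / (z - w)) = F w"
proof -
  have c: "continuous_on (sphere 0 1) (\<lambda>z. F z * z / (z - w))"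
    by (intro continuous_intros continuous_on_subset[OF assms(1)]) (use assms(3) in auto)
  have "((\<lambda>u. F u / (u - w)) has_contour_integral (2 * of_real pi * \<i> * F w)) (circlepath 0 1)"
    by (rule Cauchy_integral_circlepath[OF assms(1,2)]) (use assms(3) in auto)
  then have "((\<lambda>t. F (circlepath 0 1 t) / (circlepath 0 1 t - w) *
      (2 * pi * \<i> * exp (2 * of_real pi * \<i> * t))) has_integral (2 * of_real pi * \<i> * F w)) {0..1}"
    unfolding has_contour_integral_def
    by (rule has_integral_eq[rotated]) (simp add: vector_derivative_circlepath01)
  then have "((\<lambda>t. (2 * of_real pi * \<i>) * (F (cis (2 * pi * t)) * cis (2 * pi * t) / (cis (2 * pi * t) - w)))
      has_integral (2 * of_real pi * \<i> * F w)) {0..1}"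
    by (simp add: circlepath cis_conv_exp mult_ac)
  from has_integral_mult_right[OF this, of "1 / (2 * of_real pi * \<i>)"]
  have "((\<lambda>t. F (cis (2 * pi * t)) * cis (2 * pi * t) / (cis (2 * pi * t) - w)) has_integral F w) {0..1}"
    by simp
  with integral_circle(2)[OF c] show ?thesis by (rule has_integral_unique)
qed

section \<open>The Poisson kernel\<close>

definition poisson :: "complex \<Rightarrow> complex \<Rightarrow> real" where
  "poisson z \<zeta> = (1 - (cmod z)\<^sup>2) / (cmod (\<zeta> - z))\<^sup>2"

lemma poisson_nonneg: "cmod z < 1 \<Longrightarrow> 0 \<le> poisson z \<zeta>"
  by (simp add: poisson_def abs_square_le_1 less_imp_le)

text \<open>The bound (1 + |z|) / (1 - |z|) is rewritten over 1 - |z|^2, the parameter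
  \<open>\<tau>\<close> in which the integral means are expressed later.\<close>

lemma poisson_le:
  assumes "cmod z < 1" "cmod \<zeta> = 1"
  shows "poisson z \<zeta> \<le> 4 / (1 - (cmod z)\<^sup>2)"
proof -
  let ?r = "cmod z"
  have r2: "0 < 1 - ?r\<^sup>2" using assms(1) by (simp add: abs_square_less_1)
  have "1 - ?r \<le> cmod (\<zeta> - z)" using norm_triangle_ineq2[of \<zeta> z] assms by simp
  then have "(1 - ?r)\<^sup>2 \<le> (cmod (\<zeta> - z))\<^sup>2" using assms by (intro power_mono) auto
  then have "poisson z \<zeta> \<le> (1 - ?r\<^sup>2) / (1 - ?r)\<^sup>2"
    unfolding poisson_def using assms r2 by (intro divide_left_mono mult_pos_pos) (auto intro: zero_less_power)
  also have "\<dots> = (1 + ?r) / (1 - ?r)"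
    using assms by (simp add: power2_eq_square divide_simps) (simp add: algebra_simps)
  also have "\<dots> = (1 + ?r)\<^sup>2 / (1 - ?r\<^sup>2)"
    using assms r2 by (simp add: power2_eq_square divide_simps) (simp add: algebra_simps)
  also have "\<dots> \<le> 2\<^sup>2 / (1 - ?r\<^sup>2)"
    using assms r2 by (intro divide_right_mono power_mono) auto
  finally show ?thesis by simp
qed

text \<open>For z and w on the circle |w - r z| = |z - r w|. This exchanges the two variables in the
  Fubini argument of \<open>nn_integral_poisson_circle\<close>.\<close>

lemma poisson_symmetric:
  assumes "cmod z = 1" "cmod w = 1"
  shows "poisson (of_real r * z) w = poisson (of_real r * w) z"
proof -
  have "(Re z)\<^sup>2 + (Im z)\<^sup>2 = 1" "(Re w)\<^sup>2 + (Im w)\<^sup>2 = 1"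
    using assms by (simp_all flip: cmod_power2)
  then have "(cmod (w - of_real r * z))\<^sup>2 = (cmod (z - of_real r * w))\<^sup>2"
    unfolding cmod_power2 by (simp add: power2_eq_square) algebra
  then show ?thesis using assms by (simp add: poisson_def norm_mult)
qed

lemma continuous_on_poisson: "cmod z < 1 \<Longrightarrow> continuous_on (sphere 0 1) (poisson z)"
  unfolding poisson_def by (intro continuous_intros) auto

text \<open>For |\<zeta>| = 1 one has |\<zeta> - z|^2 \<zeta> = (\<zeta> - z) (1 - cnj z \<zeta>).
  Thus the Poisson integral of F is the Cauchy integral of \<open>?G\<close>, which is holomorphic
  because 1 - cnj z \<zeta> has no zero in the closed disc, and \<open>?G z\<close> equals
  \<open>F z\<close>.\<close>

lemma integral_poisson:
  assumes "continuous_on (cball 0 1) F" "F holomorphic_on ball 0 1" "cmod z < 1"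
  shows "(LINT \<zeta>|circle_measure. of_real (poisson z \<zeta>) * F \<zeta>) = F z"
proof -
  let ?G = "\<lambda>\<zeta>. F \<zeta> * (1 - of_real ((cmod z)\<^sup>2)) / (1 - cnj z * \<zeta>)"
  have nz: "1 - cnj z * \<zeta> \<noteq> 0" if "cmod \<zeta> \<le> 1" for \<zeta>
  proof
    assume "1 - cnj z * \<zeta> = 0"
    then have "cmod (cnj z * \<zeta>) = 1" by simp
    then have "cmod z * cmod \<zeta> = 1" by (simp add: norm_mult)
    moreover have "cmod z * cmod \<zeta> \<le> cmod z" using that by (simp add: mult_left_le)
    ultimately show False using assms(3) by simp
  qed
  have eq: "of_real (poisson z \<zeta>) * F \<zeta> = ?G \<zeta> * \<zeta> / (\<zeta> - z)" if "\<zeta> \<in> sphere 0 1" for \<zeta>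
  proof -
    have \<zeta>: "\<zeta> * cnj \<zeta> = 1" using that by (simp flip: complex_norm_square)
    have "\<zeta> - z \<noteq> 0" using that assms(3) by auto
    have "complex_of_real ((cmod (\<zeta> - z))\<^sup>2) * \<zeta> = (\<zeta> - z) * (\<zeta> * cnj \<zeta> - cnj z * \<zeta>)"
      unfolding complex_norm_square by (simp add: algebra_simps)
    then have "complex_of_real ((cmod (\<zeta> - z))\<^sup>2) * \<zeta> = (\<zeta> - z) * (1 - cnj z * \<zeta>)" using \<zeta> by simp
    then show ?thesis
      using \<open>\<zeta> - z \<noteq> 0\<close> nz[of \<zeta>] that unfolding poisson_def
      by (simp add: divide_simps) (simp add: algebra_simps)
  qed
  have "(LINT \<zeta>|circle_measure. of_real (poisson z \<zeta>) * F \<zeta>) =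
      (LINT \<zeta>|circle_measure. ?G \<zeta> * \<zeta> / (\<zeta> - z))"
    by (intro Bochner_Integration.integral_cong) (auto simp: eq)
  also have "\<dots> = ?G z"
  proof (rule circle_Cauchy)
    show "continuous_on (cball 0 1) ?G" using nz by (intro continuous_intros assms) auto
    show "?G holomorphic_on ball 0 1" using nz by (intro holomorphic_intros assms) auto
  qed (fact assms)
  also have "\<dots> = F z"
    using nz[of z] assms(3) by (simp add: complex_norm_square mult.commute del: of_real_power)
  finally show ?thesis .
qed

lemma integral_poisson_Re:
  assumes "continuous_on (cball 0 1) F" "F holomorphic_on ball 0 1" "cmod z < 1"
  shows "(LINT \<zeta>|circle_measure. poisson z \<zeta> * Re (F \<zeta>)) = Re (F z)"
proof -
  have "integrable circle_measure (\<lambda>\<zeta>. of_real (poisson z \<zeta>) * F \<zeta>)"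
    by (intro integral_circle continuous_intros continuous_on_poisson assms
        continuous_on_subset[OF assms(1)]) auto
  from integral_Re[OF this] show ?thesis
    using integral_poisson[OF assms] by simp
qed

lemma integral_poisson_1: "cmod z < 1 \<Longrightarrow> (LINT \<zeta>|circle_measure. poisson z \<zeta>) = 1"
  using integral_poisson_Re[of "\<lambda>_. 1" z] by simp

lemma integrable_poisson: "cmod z < 1 \<Longrightarrow> integrable circle_measure (poisson z)"
  by (intro integral_circle continuous_on_poisson)

text \<open>Re x Re y = Re (x y + x cnj y) / 2. On the circle cnj \<zeta> is 1 / \<zeta>, so x cnj y
  has frequency i - j; when this is negative, conjugating under Re makes it a nonnegative power.
  Hence the real parts of polynomials form an algebra there.\<close>

lemma Re_poly_mult_on_circle:
  "\<exists>R. \<forall>\<zeta>\<in>sphere 0 1. Re (poly P \<zeta>) * Re (poly Q \<zeta>) = Re (poly R \<zeta>)"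
proof -
  define m where "m a i b j = monom (a * b / 2) (i + j) +
    (if i \<ge> j then monom (a * cnj b / 2) (i - j) else monom (cnj a * b / 2) (j - i))"
    for a b :: complex and i j
  have Re_mult: "Re x * Re y = Re (x * y / 2) + Re (x * cnj y / 2)" for x y
    by (simp add: field_simps)
  have m: "Re (a * \<zeta> ^ i) * Re (b * \<zeta> ^ j) = Re (poly (m a i b j) \<zeta>)" if "\<zeta> \<in> sphere 0 1" for a b i j \<zeta>
  proof -
    have \<zeta>: "\<zeta> * cnj \<zeta> = 1" using that by (simp flip: complex_norm_square)
    have pw: "\<zeta> ^ k * cnj (\<zeta> ^ k) = 1" for k using \<zeta> by (simp flip: power_mult_distrib)
    have 1: "Re ((a * \<zeta> ^ i) * cnj (b * \<zeta> ^ j) / 2) = Re (a * cnj b / 2 * \<zeta> ^ (i - j))" if "i \<ge> j"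
    proof -
      have "(a * \<zeta> ^ i) * cnj (b * \<zeta> ^ j) = a * cnj b * \<zeta> ^ (i - j) * (\<zeta> ^ j * cnj (\<zeta> ^ j))"
        using power_add[of \<zeta> "i - j" j] that by (simp del: complex_cnj_power)
      then have "(a * \<zeta> ^ i) * cnj (b * \<zeta> ^ j) / 2 = a * cnj b / 2 * \<zeta> ^ (i - j)"
        unfolding pw by (simp only: mult_1_right times_divide_eq_left)
      then show ?thesis by (rule arg_cong)
    qed
    have 2: "Re ((a * \<zeta> ^ i) * cnj (b * \<zeta> ^ j) / 2) = Re (cnj a * b / 2 * \<zeta> ^ (j - i))" if "i \<le> j"
    proof -
      have "cnj ((a * \<zeta> ^ i) * cnj (b * \<zeta> ^ j)) = cnj a * b * \<zeta> ^ (j - i) * (\<zeta> ^ i * cnj (\<zeta> ^ i))"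
        using power_add[of \<zeta> "j - i" i] that by simp
      then have "cnj ((a * \<zeta> ^ i) * cnj (b * \<zeta> ^ j)) / 2 = cnj a * b / 2 * \<zeta> ^ (j - i)"
        unfolding pw by (simp only: mult_1_right times_divide_eq_left)
      moreover have "Re (x / 2) = Re (cnj x / 2)" for x by simp
      ultimately show ?thesis by metis
    qed
    have 3: "Re ((a * \<zeta> ^ i) * (b * \<zeta> ^ j) / 2) = Re (a * b / 2 * \<zeta> ^ (i + j))"
      by (simp add: power_add mult_ac)
    show ?thesis
      by (subst Re_mult, subst 3) (use 1 2 in \<open>auto simp: m_def poly_monom simp del: Re_divide_numeral times_complex.sel\<close>)
  qed
  have "Re (poly P \<zeta>) * Re (poly Q \<zeta>) =
      Re (poly (\<Sum>i\<le>degree P. \<Sum>j\<le>degree Q. m (coeff P i) i (coeff Q j) j) \<zeta>)"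
    if "\<zeta> \<in> sphere 0 1" for \<zeta>
  proof -
    have "Re (poly P \<zeta>) * Re (poly Q \<zeta>) =
        (\<Sum>i\<le>degree P. Re (coeff P i * \<zeta> ^ i)) * (\<Sum>j\<le>degree Q. Re (coeff Q j * \<zeta> ^ j))"
      unfolding poly_altdef Re_sum ..
    also have "\<dots> = (\<Sum>i\<le>degree P. \<Sum>j\<le>degree Q. Re (poly (m (coeff P i) i (coeff Q j) j) \<zeta>))"
      unfolding sum_product m[OF that] ..
    finally show ?thesis unfolding poly_sum Re_sum .
  qed
  then show ?thesis by blast
qed

text \<open>Stone-Weierstrass yields polynomials in the real coordinates. As real parts of complex
  polynomials on the circle they extend harmonically into the disc, where the maximum principle can
  use them.\<close>

lemma real_polynomial_function_on_circle:
  assumes "real_polynomial_function q"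
  shows "\<exists>P. \<forall>\<zeta>\<in>sphere 0 1. q \<zeta> = Re (poly P \<zeta>)"
  using assms
proof induction
  case (linear f)
  interpret bounded_linear f by fact
  have "f \<zeta> = Re (poly [:0, of_real (f 1) - \<i> * of_real (f \<i>):] \<zeta>)" for \<zeta>
  proof -
    have "f \<zeta> = f (Re \<zeta> *\<^sub>R 1 + Im \<zeta> *\<^sub>R \<i>)" 
      by (rule arg_cong[of _ _ f]) (simp add: complex_eq_iff)
    then show ?thesis unfolding add scaleR by simp
  qed
  then show ?case by blast
next
  case (const c)
  show ?case by (rule exI[of _ "[:of_real c:]"]) simp
next
  case (add f g)
  then obtain P Q where "\<forall>\<zeta>\<in>sphere 0 1. f \<zeta> = Re (poly P \<zeta>)" "\<forall>\<zeta>\<in>sphere 0 1. g \<zeta> = Re (poly Q \<zeta>)" by blast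
  then show ?case by (intro exI[of _ "P + Q"]) simp
next
  case (mult f g)
  then show ?case using Re_poly_mult_on_circle by metis
qed

text \<open>
  If \<open>Re P\<close> slightly exceeds \<open>ln (max 1 \<bar>g\<bar>)\<close> on the circle, the maximum principle for
  \<open>g exp (-P)\<close> and \<open>exp (-P)\<close> carries the inequality into the disc.
\<close>

lemma ln_max_le_poisson:
  assumes g: "continuous_on (cball 0 1) g" "g holomorphic_on ball 0 1" and z: "cmod z < 1"
  shows "ln (max 1 (cmod (g z))) \<le>
    (LINT \<zeta>|circle_measure. poisson z \<zeta> * ln (max 1 (cmod (g \<zeta>))))"
proof (rule field_le_epsilon)
  fix e :: real assume "e > 0"
  define u where "u \<zeta> = ln (max 1 (cmod (g \<zeta>)))" for \<zeta>
  have cu: "continuous_on (sphere 0 1) u" unfolding u_def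
    by (intro continuous_intros continuous_on_subset[OF g(1)]) auto
  \<comment> \<open>Approximating u + e / 2 with error e / 2 places Re P between u and u +
    e.\<close>
  obtain q where q: "real_polynomial_function q" "\<And>\<zeta>. \<zeta> \<in> sphere 0 1 \<Longrightarrow> \<bar>(u \<zeta> + e / 2) - q \<zeta>\<bar> < e / 2"
    by (rule Stone_Weierstrass_real_polynomial_function[of "sphere 0 1" "\<lambda>\<zeta>. u \<zeta> + e / 2" "e / 2"])
       (use \<open>e > 0\<close> in \<open>auto intro!: continuous_intros cu\<close>)
  from real_polynomial_function_on_circle[OF q(1)] obtain P
    where P: "\<And>\<zeta>. \<zeta> \<in> sphere 0 1 \<Longrightarrow> q \<zeta> = Re (poly P \<zeta>)" by blast
  have bd: "u \<zeta> \<le> Re (poly P \<zeta>)" "Re (poly P \<zeta>) \<le> u \<zeta> + e" if "\<zeta> \<in> sphere 0 1" for \<zeta>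
    using q(2)[OF that, unfolded P[OF that]] by linarith+
  \<comment> \<open>Used for k = g and for the constant k = 1, which together give the
    maximum.\<close>
  have mm: "cmod (k z) \<le> exp (Re (poly P z))"
    if k: "continuous_on (cball 0 1) k" "k holomorphic_on ball 0 1"
      and kb: "\<And>\<zeta>. \<zeta> \<in> sphere 0 1 \<Longrightarrow> cmod (k \<zeta>) \<le> max 1 (cmod (g \<zeta>))" for k
  proof -
    have "cmod (k z * exp (- poly P z)) \<le> 1"
    proof (rule maximum_modulus_frontier[of "\<lambda>z. k z * exp (- poly P z)" "cball 0 1"])
      show "(\<lambda>z. k z * exp (- poly P z)) holomorphic_on interior (cball 0 1)"
        using k by (auto intro!: holomorphic_intros)
      show "continuous_on (closure (cball 0 1)) (\<lambda>z. k z * exp (- poly P z))"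
        using k by (auto intro!: continuous_intros)
      fix \<zeta> :: complex assume "\<zeta> \<in> frontier (cball 0 1)"
      then have \<zeta>: "\<zeta> \<in> sphere 0 1" by simp
      have "cmod (k \<zeta>) \<le> exp (u \<zeta>)" unfolding u_def using kb[OF \<zeta>] by simp
      also have "\<dots> \<le> exp (Re (poly P \<zeta>))" using bd[OF \<zeta>] by simp
      finally show "cmod (k \<zeta> * exp (- poly P \<zeta>)) \<le> 1"
        by (simp add: norm_mult norm_divide exp_minus divide_simps)
    qed (use z in auto)
    then show ?thesis by (simp add: norm_mult norm_divide exp_minus divide_simps)
  qed
  have "max 1 (cmod (g z)) \<le> exp (Re (poly P z))"
    using mm[OF g] mm[of "\<lambda>_. 1"] by (auto intro!: continuous_intros)
  then have "ln (max 1 (cmod (g z))) \<le> Re (poly P z)"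
    by (subst ln_exp[symmetric], subst ln_le_cancel_iff) auto
  also have "\<dots> = (LINT \<zeta>|circle_measure. poisson z \<zeta> * Re (poly P \<zeta>))"
    by (rule integral_poisson_Re[symmetric]) (use z in \<open>auto intro!: continuous_intros holomorphic_intros\<close>)
  also have "\<dots> \<le> (LINT \<zeta>|circle_measure. poisson z \<zeta> * (u \<zeta> + e))"
    using z bd by (intro integral_mono integral_circle continuous_intros continuous_on_poisson cu mult_left_mono
        poisson_nonneg) auto
  also have "\<dots> = (LINT \<zeta>|circle_measure. poisson z \<zeta> * u \<zeta> + poisson z \<zeta> * e)"
    by (simp add: algebra_simps)
  also have "\<dots> = (LINT \<zeta>|circle_measure. poisson z \<zeta> * u \<zeta>) + e"
    using z by (subst Bochner_Integration.integral_add)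
       (auto intro!: integral_circle continuous_intros continuous_on_poisson cu simp: integral_poisson_1)
  finally show "ln (max 1 (cmod (g z))) \<le>
    (LINT \<zeta>|circle_measure. poisson z \<zeta> * ln (max 1 (cmod (g \<zeta>)))) + e"
    unfolding u_def .
qed

section \<open>Boundary functions\<close>

lemma has_nontangential_limit_radial:
  assumes "has_nontangential_limit f \<zeta> L" "cmod \<zeta> = 1"
    and r: "r \<longlonglongrightarrow> 1" "\<And>j. 0 \<le> r j" "\<And>j. r j < 1"
  shows "(\<lambda>j. f (of_real (r j) * \<zeta>)) \<longlonglongrightarrow> L"
proof -
  have lim: "(f \<longlongrightarrow> L) (at \<zeta> within stolz_region 2 \<zeta>)"
    using assms(1) by (simp add: has_nontangential_limit_def)
  have "cmod (of_real (r j) * \<zeta> - \<zeta>) = 1 - r j" for j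
  proof -
    have "of_real (r j) * \<zeta> - \<zeta> = of_real (r j - 1) * \<zeta>" by (simp add: algebra_simps)
    then show ?thesis using assms(2) r(3)[of j] by (simp add: norm_mult del: of_real_diff)
  qed
  then have mem: "of_real (r j) * \<zeta> \<in> stolz_region 2 \<zeta>" for j
    using assms(2) r(2)[of j] r(3)[of j] by (simp add: stolz_region_def norm_mult)
  have "(\<lambda>j. of_real (r j) * \<zeta>) \<longlonglongrightarrow> of_real 1 * \<zeta>" by (intro tendsto_intros r)
  moreover have "of_real (r j) * \<zeta> \<noteq> \<zeta>" for j
    using assms(2) r(3)[of j] by auto
  ultimately have "filterlim (\<lambda>j. of_real (r j) * \<zeta>) (at \<zeta> within stolz_region 2 \<zeta>) sequentially"
    using mem by (auto simp: filterlim_at)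
  with lim show ?thesis by (rule filterlim_compose)
qed

lemma boundary_fun_eqI:
  assumes "has_nontangential_limit f \<zeta> L" "cmod \<zeta> = 1"
  shows "boundary_fun f \<zeta> = L"
proof -
  define r where "r j = 1 - inverse (real (Suc j))" for j
  have r: "r \<longlonglongrightarrow> 1" "\<And>j. 0 \<le> r j" "\<And>j. r j < 1"
    unfolding r_def using LIMSEQ_inverse_real_of_nat_add_minus[of 1] by (auto simp: field_simps)
  have "L' = L" if "has_nontangential_limit f \<zeta> L'" for L'
    using has_nontangential_limit_radial[OF that assms(2) r]
      has_nontangential_limit_radial[OF assms r] LIMSEQ_unique by blast
  then have "(THE L. has_nontangential_limit f \<zeta> L) = L" using assms by blast
  then show ?thesis unfolding boundary_fun_def using assms by auto
qed

lemma stolz_region_rotate: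
  assumes "cmod \<zeta> = 1"
  shows "\<zeta> * w \<in> stolz_region \<alpha> \<zeta> \<longleftrightarrow> w \<in> stolz_region \<alpha> 1"
proof -
  have "\<zeta> * w - \<zeta> = \<zeta> * (w - 1)" by (simp add: algebra_simps)
  then show ?thesis using assms by (simp add: stolz_region_def norm_mult)
qed

text \<open>This expresses the existence of the limit with countable quantifiers: the apertures m +
  2 are cofinal, and the Cauchy criterion avoids naming the limit. Writing the points near \<zeta>
  as \<zeta> w makes the sets of w independent of \<zeta>, so for continuous f each single condition
  is closed in \<zeta>.\<close>

lemma has_nontangential_limit_iff_Cauchy:
  assumes "cmod \<zeta> = 1"
  shows "(\<exists>L. has_nontangential_limit f \<zeta> L) \<longleftrightarrow>
    (\<forall>m k. \<exists>n. \<forall>w\<in>stolz_region (real m + 2) 1 \<inter> ball 1 (inverse (real (Suc n))).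
       \<forall>w'\<in>stolz_region (real m + 2) 1 \<inter> ball 1 (inverse (real (Suc n))).
         dist (f (\<zeta> * w)) (f (\<zeta> * w')) \<le> inverse (real (Suc k)))"
    (is "_ \<longleftrightarrow> ?C")
proof
  have dz: "dist (\<zeta> * w) \<zeta> = dist w 1" for w
  proof -
    have "\<zeta> * w - \<zeta> = \<zeta> * (w - 1)" by (simp add: algebra_simps)
    then show ?thesis using assms by (simp add: dist_norm norm_mult)
  qed
  {
    assume "\<exists>L. has_nontangential_limit f \<zeta> L"
    then obtain L where L: "has_nontangential_limit f \<zeta> L" by blast
    show ?C
    proof (intro allI)
      fix m k
      have "(f \<longlongrightarrow> L) (at \<zeta> within stolz_region (real m + 2) \<zeta>)"
        using L by (simp add: has_nontangential_limit_def)
      then have "\<forall>\<^sub>F x in at \<zeta> within stolz_region (real m + 2) \<zeta>. dist (f x) L < inverse (real (Suc k)) / 2"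
        by (rule tendstoD) simp
      then obtain d where d: "d > 0" "\<And>x. x \<in> stolz_region (real m + 2) \<zeta> \<Longrightarrow> x \<noteq> \<zeta> \<Longrightarrow> dist x \<zeta> < d
          \<Longrightarrow> dist (f x) L < inverse (real (Suc k)) / 2"
        unfolding eventually_at by blast
      obtain n where n: "inverse (real (Suc n)) < d" using reals_Archimedean[OF d(1)] by blast
      have *: "dist (f (\<zeta> * w)) L < inverse (real (Suc k)) / 2"
        if "w \<in> stolz_region (real m + 2) 1 \<inter> ball 1 (inverse (real (Suc n)))" for w
      proof (rule d(2))
        show "\<zeta> * w \<in> stolz_region (real m + 2) \<zeta>" using that stolz_region_rotate[OF assms] by simp
        show "\<zeta> * w \<noteq> \<zeta>" using that assms by (auto simp: stolz_region_def)
        show "dist (\<zeta> * w) \<zeta> < d" unfolding dz using that n by (simp add: dist_commute)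
      qed
      show "\<exists>n. \<forall>w\<in>stolz_region (real m + 2) 1 \<inter> ball 1 (inverse (real (Suc n))).
         \<forall>w'\<in>stolz_region (real m + 2) 1 \<inter> ball 1 (inverse (real (Suc n))).
         dist (f (\<zeta> * w)) (f (\<zeta> * w')) \<le> inverse (real (Suc k))"
        by (intro exI[of _ n] ballI less_imp_le) (rule dist_triangle_half_l[OF * *])
    qed
  }
  assume C: ?C
  \<comment> \<open>The radial points eventually lie in each of the sets of w, whatever the
    aperture, so the limit L along the radius serves all apertures at once.\<close>
  define r where "r j = 1 - inverse (real (Suc j))" for j
  have r: "r \<longlonglongrightarrow> 1" "\<And>j. 0 \<le> r j" "\<And>j. r j < 1"
    unfolding r_def using LIMSEQ_inverse_real_of_nat_add_minus[of 1] by (auto simp: field_simps)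
  have rs: "complex_of_real (r j) \<in> stolz_region (real m + 2) 1 \<inter> ball 1 (inverse (real (Suc n)))" if "j > n" for j m n
  proof -
    have d1: "cmod (of_real (r j) - 1) = inverse (real (Suc j))"
    proof -
      have "complex_of_real (r j) - 1 = of_real (r j - 1)" by simp
      then show ?thesis by (simp only: norm_of_real) (simp add: r_def)
    qed
    have "inverse (real (Suc j)) < (real m + 2) * inverse (real (Suc j))"
      by simp
    moreover have "1 - cmod (of_real (r j)) = inverse (real (Suc j))"
      unfolding norm_of_real using r(2)[of j] by (simp add: r_def)
    moreover have "inverse (real (Suc j)) < inverse (real (Suc n))" using that by simp
    ultimately show ?thesis using d1 r(2,3)[of j]
      by (simp add: stolz_region_def dist_norm norm_minus_commute)
  qed
  have "Cauchy (\<lambda>j. f (\<zeta> * of_real (r j)))"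
  proof (rule metric_CauchyI)
    fix e :: real assume "e > 0"
    obtain k where k: "inverse (real (Suc k)) < e" using reals_Archimedean[OF \<open>e > 0\<close>] by blast
    obtain n where n: "\<forall>w\<in>stolz_region (real 0 + 2) 1 \<inter> ball 1 (inverse (real (Suc n))).
       \<forall>w'\<in>stolz_region (real 0 + 2) 1 \<inter> ball 1 (inverse (real (Suc n))).
         dist (f (\<zeta> * w)) (f (\<zeta> * w')) \<le> inverse (real (Suc k))" using C by blast
    have "dist (f (\<zeta> * of_real (r i))) (f (\<zeta> * of_real (r j))) < e" if "i \<ge> Suc n" "j \<ge> Suc n" for i j
      using n[rule_format, OF rs rs, of i j] that k by simp
    then show "\<exists>M. \<forall>m\<ge>M. \<forall>n\<ge>M. dist (f (\<zeta> * of_real (r m))) (f (\<zeta> * of_real (r n))) < e" by blast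
  qed
  then obtain L where L: "(\<lambda>j. f (\<zeta> * of_real (r j))) \<longlonglongrightarrow> L" using Cauchy_convergent convergentD by blast
  have "has_nontangential_limit f \<zeta> L"
    unfolding has_nontangential_limit_def
  proof (intro allI impI)
    fix \<alpha> :: real assume "\<alpha> > 1"
    obtain m where m: "\<alpha> \<le> real m" using real_arch_simple by blast
    have sub: "stolz_region \<alpha> \<zeta> \<subseteq> stolz_region (real m + 2) \<zeta>"
      unfolding stolz_region_def using m by (auto elim!: less_le_trans intro!: mult_right_mono)
    have "(f \<longlongrightarrow> L) (at \<zeta> within stolz_region (real m + 2) \<zeta>)"
    proof (rule tendstoI)
      fix e :: real assume "e > 0"
      obtain k where k: "inverse (real (Suc k)) < e" using reals_Archimedean[OF \<open>e > 0\<close>] by blast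
      obtain n where n: "\<forall>w\<in>stolz_region (real m + 2) 1 \<inter> ball 1 (inverse (real (Suc n))).
         \<forall>w'\<in>stolz_region (real m + 2) 1 \<inter> ball 1 (inverse (real (Suc n))).
           dist (f (\<zeta> * w)) (f (\<zeta> * w')) \<le> inverse (real (Suc k))" using C by blast
      have "dist (f x) L < e" if x: "x \<in> stolz_region (real m + 2) \<zeta>" "dist x \<zeta> < inverse (real (Suc n))" for x
      proof -
        define w where "w = x / \<zeta>"
        have xw: "x = \<zeta> * w" using assms by (auto simp: w_def)
        have w: "w \<in> stolz_region (real m + 2) 1 \<inter> ball 1 (inverse (real (Suc n)))"
          using x unfolding xw dz stolz_region_rotate[OF assms] by (simp add: dist_commute)
        have "dist (f x) L \<le> inverse (real (Suc k))"
        proof (rule LIMSEQ_le_const2)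
          show "(\<lambda>j. dist (f x) (f (\<zeta> * of_real (r j)))) \<longlonglongrightarrow> dist (f x) L"
            by (intro tendsto_intros L)
          show "\<exists>N. \<forall>j\<ge>N. dist (f x) (f (\<zeta> * of_real (r j))) \<le> inverse (real (Suc k))"
            unfolding xw by (intro exI[of _ "Suc n"] allI impI n[rule_format, OF w rs]) simp
        qed
        then show ?thesis using k by simp
      qed
      then show "\<forall>\<^sub>F x in at \<zeta> within stolz_region (real m + 2) \<zeta>. dist (f x) L < e"
        unfolding eventually_at by (intro exI[of _ "inverse (real (Suc n))"]) auto
    qed
    then show "(f \<longlongrightarrow> L) (at \<zeta> within stolz_region \<alpha> \<zeta>)" using sub by (rule tendsto_within_subset)
  qed
  then show "\<exists>L. has_nontangential_limit f \<zeta> L" by blast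
qed

text \<open>The set E where the limit exists is a countable combination of closed sets. On E the
  boundary function is the limit of the dilates, off E it has the default value 0, so the dilates
  cut off by the indicator of E converge everywhere.\<close>

lemma boundary_fun_measurable:
  assumes f: "continuous_on (ball 0 1) f"
  shows "boundary_fun f \<in> borel_measurable circle_borel"
proof -
  define N where "N m n = stolz_region (real m + 2) 1 \<inter> ball 1 (inverse (real (Suc n)))" for m n
  define C where "C m k n = sphere 0 1 \<inter> (\<Inter>w\<in>N m n. \<Inter>w'\<in>N m n.
    {\<zeta>\<in>sphere 0 1. dist (f (\<zeta> * w)) (f (\<zeta> * w')) \<le> inverse (real (Suc k))})" for m k n
  define E where "E = (\<Inter>m. \<Inter>k. \<Union>n. C m k n)"
  have E: "(\<exists>L. has_nontangential_limit f \<zeta> L) \<longleftrightarrow> \<zeta> \<in> E" if "\<zeta> \<in> sphere 0 1" for \<zeta>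
    using that unfolding E_def C_def has_nontangential_limit_iff_Cauchy[of \<zeta> f, OF that[simplified]] N_def
    by auto
  have cf: "continuous_on (sphere 0 1) (\<lambda>\<zeta>. f (\<zeta> * w))" if "w \<in> N m n" for w m n
    using that by (intro continuous_on_compose2[OF f] continuous_intros)
      (auto simp: N_def stolz_region_def norm_mult)
  have "closed (C m k n)" for m k n
    unfolding C_def
    by (intro closed_Int closed_INT ballI closed_sphere continuous_on_closed_Collect_le continuous_intros)
       (auto intro!: cf)
  then have "E \<in> sets borel" unfolding E_def by auto
  moreover have "E \<subseteq> sphere 0 1" by (auto simp: E_def C_def)
  ultimately have [measurable]: "E \<in> sets circle_borel" 
    by (subst sets_restrict_space_iff) auto
  define r where "r j = 1 - inverse (real (Suc j))" for j
  have r: "r \<longlonglongrightarrow> 1" "\<And>j. 0 \<le> r j" "\<And>j. r j < 1"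
    unfolding r_def using LIMSEQ_inverse_real_of_nat_add_minus[of 1] by (auto simp: field_simps)
  have [measurable]: "(\<lambda>\<zeta>. f (of_real (r j) * \<zeta>)) \<in> borel_measurable circle_borel" for j
    using r(2,3)[of j] by (intro measurable_circle_continuous continuous_on_compose2[OF f] continuous_intros)
      (auto simp: norm_mult)
  show ?thesis
  proof (rule borel_measurable_LIMSEQ_metric)
    show "(\<lambda>\<zeta>. indicator E \<zeta> *\<^sub>R f (of_real (r j) * \<zeta>)) \<in> borel_measurable circle_borel" for j
      by measurable
    fix \<zeta> :: complex assume "\<zeta> \<in> space circle_borel"
    then have \<zeta>: "\<zeta> \<in> sphere 0 1" by (simp add: space_restrict_space)
    show "(\<lambda>j. indicator E \<zeta> *\<^sub>R f (of_real (r j) * \<zeta>)) \<longlonglongrightarrow> boundary_fun f \<zeta>"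
    proof (cases "\<zeta> \<in> E")
      case True
      then obtain L where L: "has_nontangential_limit f \<zeta> L" using E[OF \<zeta>] by blast
      then show ?thesis
        using has_nontangential_limit_radial[OF L _ r] boundary_fun_eqI[OF L] \<zeta> True by simp
    next
      case False
      then have "boundary_fun f \<zeta> = 0" unfolding boundary_fun_def E[OF \<zeta>] by (rule if_not_P)
      with False show ?thesis by simp
    qed
  qed
qed

section \<open>Power series in the disc and the Smirnov class\<close>

lemma analytic_disc_sums:
  assumes "a \<in> analytic_disc" "cmod z < 1"
  shows "(\<lambda>n. a n * z ^ n) sums disc_fun a z"
  using assms by (auto simp: analytic_disc_def disc_fun_def dest!: bspec[of _ _ z] intro: sums_summable summable_sums)

lemma analytic_disc_holomorphic:
  assumes "a \<in> analytic_disc"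
  shows "disc_fun a holomorphic_on ball 0 1"
proof -
  obtain f where f: "f holomorphic_on ball 0 1" "\<And>z. z \<in> ball 0 1 \<Longrightarrow> (\<lambda>n. a n * z ^ n) sums f z"
    using assms by (auto simp: analytic_disc_def)
  have "f z = disc_fun a z" if "z \<in> ball 0 1" for z
    using f(2)[OF that] by (simp add: disc_fun_def sums_iff)
  with f(1) show ?thesis by (rule holomorphic_transform)
qed

lemma disc_fun_dilate_continuous:
  assumes "a \<in> analytic_disc" "cmod r < 1"
  shows "continuous_on (cball 0 1) (\<lambda>z. disc_fun a (r * z))"
  by (rule continuous_on_compose2[OF holomorphic_on_imp_continuous_on[OF analytic_disc_holomorphic[OF assms(1)]]])
     (use assms(2) in \<open>auto simp: norm_mult intro!: continuous_intros mult_le_less_imp_less[of _ _ _ 1, simplified]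
       le_less_trans[OF mult_left_le]\<close>)

lemma disc_fun_dilate_holomorphic:
  assumes "a \<in> analytic_disc" "cmod r < 1"
  shows "(\<lambda>z. disc_fun a (r * z)) holomorphic_on ball 0 1"
proof -
  have "(disc_fun a \<circ> (\<lambda>z. r * z)) holomorphic_on ball 0 1"
    by (rule holomorphic_on_compose_gen[OF _ analytic_disc_holomorphic[OF assms(1)]])
       (use assms(2) in \<open>auto simp: norm_mult intro!: holomorphic_intros le_less_trans[OF mult_left_le]\<close>)
  then show ?thesis by (simp add: o_def)
qed

lemma ennreal_liminf_add_le:
  fixes f g :: "nat \<Rightarrow> ennreal"
  shows "liminf f + liminf g \<le> liminf (\<lambda>n. f n + g n)"
proof -
  have "(INF m\<in>{n..}. f m) + liminf g \<le> liminf (\<lambda>n. f n + g n)" for n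
  proof -
    have "(INF m\<in>{n..}. f m) + liminf g = liminf (\<lambda>k. (INF m\<in>{n..}. f m) + g k)"
      by (simp add: Liminf_const_add)
    also have "\<dots> \<le> liminf (\<lambda>n. f n + g n)"
      by (intro Liminf_mono eventually_sequentiallyI[of n] add_right_mono INF_lower) auto
    finally show ?thesis .
  qed
  then show ?thesis
    unfolding liminf_SUP_INF[of f] by (subst ennreal_SUP_add_left[symmetric]) (auto intro: SUP_least)
qed

lemma log_plus_nonneg: "0 \<le> log_plus x"
  by (simp add: log_plus_def)

text \<open>
  Where no nontangential limit exists the boundary function is 0, so \<open>log_plus \<bar>f\<^sub>r\<bar>\<close> has
  lower limit at least \<open>log_plus \<bar>f\<bar>\<close> everywhere. As the integrals converge, Fatou's lemma for
  \<open>(c - P) log_plus \<bar>f\<^sub>r\<bar>\<close>, where \<open>c\<close> bounds the Poisson kernel \<open>P\<close>, gives the inequality; the theorem of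
  Fatou on nontangential limits is not needed.
\<close>

lemma smirnov_log_plus_le_poisson:
  assumes a: "a \<in> smirnov_class"
  defines "v \<equiv> \<lambda>\<zeta>. log_plus (cmod (boundary_fun (disc_fun a) \<zeta>))"
  shows "integrable circle_measure v"
    and "cmod z < 1 \<Longrightarrow> log_plus (cmod (disc_fun a z)) \<le> (LINT \<zeta>|circle_measure. poisson z \<zeta> * v \<zeta>)"
proof -
  let ?f = "disc_fun a"
  have an: "a \<in> analytic_disc" using a by (simp add: smirnov_class_def nevanlinna_class_def)
  have cont: "continuous_on (ball 0 1) ?f"
    by (intro holomorphic_on_imp_continuous_on analytic_disc_holomorphic an)
  have [measurable]: "v \<in> borel_measurable circle_measure"
  proof -
    have "boundary_fun ?f \<in> borel_measurable circle_measure"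
      by (intro measurable_circle boundary_fun_measurable cont)
    then show ?thesis unfolding v_def log_plus_def by measurable
  qed
  define r where "r j = 1 - inverse (real (Suc (Suc j)))" for j
  have r: "r \<longlonglongrightarrow> 1" "\<And>j. 0 < r j" "\<And>j. r j < 1"
    unfolding r_def using LIMSEQ_Suc[OF LIMSEQ_inverse_real_of_nat_add_minus[of 1]]
    by (auto simp: field_simps)
  define u where "u j \<zeta> = log_plus (cmod (?f (of_real (r j) * \<zeta>)))" for j \<zeta>
  have cu: "continuous_on (sphere 0 1) (u j)" for j
    unfolding u_def log_plus_def
    by (intro continuous_intros continuous_on_subset[OF disc_fun_dilate_continuous[OF an]])
       (use r[of ] in \<open>auto simp: less_imp_le\<close>)
  have [measurable]: "u j \<in> borel_measurable circle_measure" for j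
    by (intro measurable_circle measurable_circle_continuous cu)
  define I where "I = (\<integral>\<^sup>+\<zeta>. ennreal (v \<zeta>) \<partial>circle_measure)"
  have "filterlim r (at_left 1) sequentially"
    using r(1) by (auto simp: filterlim_at r(3) intro!: always_eventually less_imp_neq)
  then have Ilim: "(\<lambda>j. \<integral>\<^sup>+\<zeta>. ennreal (u j \<zeta>) \<partial>circle_measure) \<longlonglongrightarrow> I"
    using a unfolding smirnov_class_def I_def u_def v_def by (auto intro: filterlim_compose)
  have "I \<le> (SUP r\<in>{0<..<1}. \<integral>\<^sup>+z. ennreal (log_plus (cmod (?f (of_real r * z)))) \<partial>circle_measure)"
    by (rule LIMSEQ_le_const2[OF Ilim]) (use r in \<open>auto simp: u_def intro!: exI[of _ 0] SUP_upper\<close>)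
  then have Ifin: "I < \<infinity>"
    using a by (auto simp: smirnov_class_def nevanlinna_class_def)
  show int: "integrable circle_measure v"
    by (rule integrableI_nonneg[OF \<open>v \<in> _\<close>]) (use Ifin in \<open>auto simp: v_def log_plus_nonneg I_def\<close>)
  have liminf: "ennreal (v \<zeta>) \<le> liminf (\<lambda>j. ennreal (u j \<zeta>))" if "\<zeta> \<in> sphere 0 1" for \<zeta>
  proof (cases "\<exists>L. has_nontangential_limit ?f \<zeta> L")
    case True
    then obtain L where L: "has_nontangential_limit ?f \<zeta> L" by blast
    have \<zeta>: "cmod \<zeta> = 1" using that by simp
    have "(\<lambda>j. ?f (of_real (r j) * \<zeta>)) \<longlonglongrightarrow> boundary_fun ?f \<zeta>"
      using has_nontangential_limit_radial[OF L \<zeta> r(1)] boundary_fun_eqI[OF L \<zeta>] r(2,3) by (simp add: less_imp_le)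
    then have "(\<lambda>j. ennreal (u j \<zeta>)) \<longlonglongrightarrow> ennreal (v \<zeta>)"
      unfolding u_def v_def log_plus_def by (intro tendsto_intros) auto
    then show ?thesis by (simp add: lim_imp_Liminf)
  next
    case False
    then have "boundary_fun ?f \<zeta> = 0" unfolding boundary_fun_def by (rule if_not_P)
    then show ?thesis by (simp add: v_def log_plus_def)
  qed
  assume z: "cmod z < 1"
  define c where "c = 4 / (1 - (cmod z)\<^sup>2)"
  have c: "poisson z \<zeta> \<le> c" if "\<zeta> \<in> sphere 0 1" for \<zeta> using poisson_le[OF z] that by (simp add: c_def)
  have pn: "0 \<le> poisson z \<zeta>" for \<zeta> by (rule poisson_nonneg[OF z])
  have c0: "0 \<le> c" using c[of 1] pn[of 1] by simp
  have [measurable]: "poisson z \<in> borel_measurable circle_measure"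
    by (intro measurable_circle measurable_circle_continuous continuous_on_poisson z)
  have v0: "0 \<le> v \<zeta>" and u0: "0 \<le> u j \<zeta>" for \<zeta> j by (simp_all add: v_def u_def log_plus_nonneg)
  \<comment> \<open>\<open>J\<close> and \<open>K\<close> integrate against P and c - P. Their sum
    is c times the plain integral, the quantity whose convergence the Smirnov condition
    provides.\<close>
  define J where "J g = (\<integral>\<^sup>+\<zeta>. ennreal (poisson z \<zeta>) * ennreal (g \<zeta>) \<partial>circle_measure)" for g :: "complex \<Rightarrow> real"
  define K where "K g = (\<integral>\<^sup>+\<zeta>. ennreal (c - poisson z \<zeta>) * ennreal (g \<zeta>) \<partial>circle_measure)" for g :: "complex \<Rightarrow> real"
  have JK: "J g + K g = ennreal c * (\<integral>\<^sup>+\<zeta>. ennreal (g \<zeta>) \<partial>circle_measure)"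
    if [measurable]: "g \<in> borel_measurable circle_measure" for g
  proof -
    have "J g + K g = (\<integral>\<^sup>+\<zeta>. ennreal (poisson z \<zeta>) * ennreal (g \<zeta>) + ennreal (c - poisson z \<zeta>) * ennreal (g \<zeta>) \<partial>circle_measure)"
      unfolding J_def K_def by (rule nn_integral_add[symmetric]) auto
    also have "\<dots> = (\<integral>\<^sup>+\<zeta>. ennreal c * ennreal (g \<zeta>) \<partial>circle_measure)"
      by (intro nn_integral_cong) (use c pn in \<open>auto simp flip: distrib_right ennreal_plus\<close>)
    finally show ?thesis by (simp add: nn_integral_cmult)
  qed
  have Kfin: "K v < \<infinity>"
  proof -
    have "K v \<le> J v + K v" by simp
    also have "\<dots> < \<infinity>" unfolding JK[OF \<open>v \<in> _\<close>] using Ifin by (simp add: I_def ennreal_mult_less_top)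
    finally show ?thesis .
  qed
  define x where "x j = ennreal (log_plus (cmod (?f (of_real (r j) * z))))" for j
  have xJ: "x j \<le> J (u j)" for j
  proof -
    have rj: "cmod (of_real (r j)) < 1" using r(2,3)[of j] by simp
    have "integrable circle_measure (\<lambda>\<zeta>. poisson z \<zeta> * u j \<zeta>)"
      by (intro integral_circle continuous_intros continuous_on_poisson z cu)
    then have eq: "ennreal (LINT \<zeta>|circle_measure. poisson z \<zeta> * u j \<zeta>) = J (u j)"
      unfolding J_def by (subst nn_integral_eq_integral[symmetric]) (use pn u0 in \<open>auto simp: ennreal_mult\<close>)
    have "log_plus (cmod (?f (of_real (r j) * z))) \<le> (LINT \<zeta>|circle_measure. poisson z \<zeta> * u j \<zeta>)"
      using ln_max_le_poisson[OF disc_fun_dilate_continuous[OF an rj] disc_fun_dilate_holomorphic[OF an rj] z]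
      unfolding u_def log_plus_def .
    then show ?thesis unfolding x_def eq[symmetric] by (rule ennreal_leI)
  qed
  have "(\<lambda>j. of_real (r j) * z) \<longlonglongrightarrow> of_real 1 * z" by (intro tendsto_intros r(1))
  then have "(\<lambda>j. ?f (of_real (r j) * z)) \<longlonglongrightarrow> ?f (of_real 1 * z)"
    by (rule continuous_on_tendsto_compose[OF cont])
       (use r z in \<open>auto intro!: eventuallyI simp: norm_mult less_imp_le intro: le_less_trans[OF mult_left_le_one_le]\<close>)
  then have xlim: "x \<longlonglongrightarrow> ennreal (log_plus (cmod (?f z)))"
    unfolding x_def log_plus_def by (intro tendsto_intros) auto
  have iv: "integrable circle_measure (\<lambda>\<zeta>. poisson z \<zeta> * v \<zeta>)"
    by (rule Bochner_Integration.integrable_bound[of _ "\<lambda>\<zeta>. c * v \<zeta>"])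
       (use int c c0 pn v0 in \<open>auto simp: abs_mult abs_of_nonneg intro!: AE_I2 mult_right_mono\<close>)
  \<comment> \<open>Adding the finite number \<open>K v\<close> converts Fatou's lower bound for c -
    P into the wanted upper bound by the integral against P; it is cancelled at the end.\<close>
  have "ennreal (log_plus (cmod (?f z))) + K v \<le> liminf x + liminf (\<lambda>j. K (u j))"
  proof (rule add_mono)
    show "ennreal (log_plus (cmod (?f z))) \<le> liminf x" using xlim by (simp add: lim_imp_Liminf)
    have "K v \<le> (\<integral>\<^sup>+\<zeta>. liminf (\<lambda>j. ennreal (c - poisson z \<zeta>) * ennreal (u j \<zeta>)) \<partial>circle_measure)"
      unfolding K_def
    proof (rule nn_integral_mono)
      fix \<zeta> assume "\<zeta> \<in> space circle_measure"
      then have "ennreal (c - poisson z \<zeta>) * ennreal (v \<zeta>) \<le> ennreal (c - poisson z \<zeta>) * liminf (\<lambda>j. ennreal (u j \<zeta>))"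
        by (intro mult_left_mono liminf) auto
      also have "\<dots> = liminf (\<lambda>j. ennreal (c - poisson z \<zeta>) * ennreal (u j \<zeta>))"
        by (rule Liminf_compose_continuous_mono[symmetric])
           (auto intro!: continuous_intros monoI mult_left_mono ennreal_continuous_on_cmult)
      finally show "ennreal (c - poisson z \<zeta>) * ennreal (v \<zeta>) \<le> \<dots>" .
    qed
    also have "\<dots> \<le> liminf (\<lambda>j. K (u j))"
      unfolding K_def by (rule nn_integral_liminf) auto
    finally show "K v \<le> liminf (\<lambda>j. K (u j))" .
  qed
  also have "\<dots> \<le> liminf (\<lambda>j. x j + K (u j))"
    by (rule ennreal_liminf_add_le)
  also have "\<dots> \<le> liminf (\<lambda>j. J (u j) + K (u j))"
    by (intro Liminf_mono eventuallyI add_right_mono xJ)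
  also have "\<dots> = ennreal c * I"
    unfolding JK[OF \<open>u _ \<in> _\<close>]
    by (intro lim_imp_Liminf ennreal_tendsto_cmult Ilim) auto
  also have "\<dots> = J v + K v" unfolding I_def JK[OF \<open>v \<in> _\<close>] ..
  finally have "ennreal (log_plus (cmod (?f z))) \<le> J v"
    using Kfin by (auto simp: ennreal_add_left_cancel_le add.commute[of _ "K v"])
  also have "J v = ennreal (LINT \<zeta>|circle_measure. poisson z \<zeta> * v \<zeta>)"
    unfolding J_def by (subst nn_integral_eq_integral[OF iv, symmetric]) (use pn v0 in \<open>auto simp: ennreal_mult\<close>)
  finally show "log_plus (cmod (?f z)) \<le> (LINT \<zeta>|circle_measure. poisson z \<zeta> * v \<zeta>)"
    by (subst (asm) ennreal_le_iff) (auto intro!: integral_nonneg_AE simp: pn v0)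
qed

section \<open>Integral means of Poisson majorants\<close>

lemma nn_integral_powr_Icc:
  fixes e :: real
  assumes "e > -1" "b \<ge> 0"
  shows "(\<integral>\<^sup>+t\<in>{0..b}. ennreal (t powr e) \<partial>lborel) = ennreal (b powr (e + 1) / (e + 1))"
proof -
  have "(\<integral>\<^sup>+t. ennreal (t powr e * indicator {0..b} t) \<partial>lborel) = ennreal (b powr (e + 1) / (e + 1))"
  proof (rule nn_integral_has_integral_lborel)
    have "((\<lambda>t. if t \<in> {0..b} then t powr e else 0) has_integral b powr (e + 1) / (e + 1)) UNIV"
      using has_integral_powr_from_0[OF assms] by (subst has_integral_restrict_UNIV)
    then show "((\<lambda>t. t powr e * indicator {0..b} t) has_integral b powr (e + 1) / (e + 1)) UNIV"
      by (rule has_integral_eq[rotated]) auto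
  qed auto
  then show ?thesis by (simp add: nn_integral_set_ennreal)
qed

lemma nn_integral_powr_Ici:
  fixes e :: real
  assumes "e < -1" "b > 0"
  shows "(\<integral>\<^sup>+t\<in>{b..}. ennreal (t powr e) \<partial>lborel) = ennreal (b powr (e + 1) / - (e + 1))"
proof -
  have "(\<integral>\<^sup>+t. ennreal (t powr e * indicator {b..} t) \<partial>lborel) = ennreal (- (b powr (e + 1)) / (e + 1))"
  proof (rule nn_integral_has_integral_lborel)
    have "((\<lambda>t. if t \<in> {b..} then t powr e else 0) has_integral - (b powr (e + 1)) / (e + 1)) UNIV"
      using has_integral_powr_to_inf[OF assms] by (subst has_integral_restrict_UNIV)
    then show "((\<lambda>t. t powr e * indicator {b..} t) has_integral - (b powr (e + 1)) / (e + 1)) UNIV"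
      by (rule has_integral_eq[rotated]) auto
  qed auto
  moreover have "- (b powr (e + 1)) / (e + 1) = b powr (e + 1) / - (e + 1)" using assms by (simp add: field_simps)
  ultimately show ?thesis by (simp only: nn_integral_set_ennreal)
qed

interpretation circle_line: pair_sigma_finite circle_measure "lborel :: real measure"
  by unfold_locales

interpretation circle_circle: pair_sigma_finite circle_measure circle_measure
  by unfold_locales

lemma nn_integral_layer_cake:
  assumes [measurable]: "w \<in> borel_measurable circle_measure" "k \<in> borel_measurable borel"
  shows "(\<integral>\<^sup>+\<zeta>. (\<integral>\<^sup>+s. k s * indicator {..<w \<zeta>} s \<partial>lborel) \<partial>circle_measure) =
    (\<integral>\<^sup>+(s::real). k s * emeasure circle_measure {\<zeta>\<in>sphere 0 1. s < w \<zeta>} \<partial>lborel)"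
proof -
  have "(\<integral>\<^sup>+\<zeta>. (\<integral>\<^sup>+s. k s * indicator {..<w \<zeta>} s \<partial>lborel) \<partial>circle_measure) =
      (\<integral>\<^sup>+\<zeta>. (\<integral>\<^sup>+s. k s * (if s < w \<zeta> then 1 else 0) \<partial>lborel) \<partial>circle_measure)"
    by (simp add: indicator_def of_bool_def lessThan_def)
  also have "\<dots> = (\<integral>\<^sup>+s. (\<integral>\<^sup>+\<zeta>. k s * (if s < w \<zeta> then 1 else 0) \<partial>circle_measure) \<partial>lborel)"
    by (rule circle_line.Fubini'[symmetric]) measurable
  also have "\<dots> = (\<integral>\<^sup>+s. k s * emeasure circle_measure {\<zeta>\<in>sphere 0 1. s < w \<zeta>} \<partial>lborel)"
  proof (rule nn_integral_cong)
    fix s :: real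
    have "(\<integral>\<^sup>+\<zeta>. k s * (if s < w \<zeta> then 1 else 0) \<partial>circle_measure) =
        k s * (\<integral>\<^sup>+\<zeta>. (if s < w \<zeta> then 1 else 0) \<partial>circle_measure)"
      by (rule nn_integral_cmult) measurable
    also have "(\<integral>\<^sup>+\<zeta>. (if s < w \<zeta> then 1 else 0) \<partial>circle_measure) =
        (\<integral>\<^sup>+\<zeta>. indicator {\<zeta>\<in>sphere 0 1. s < w \<zeta>} \<zeta> \<partial>circle_measure)"
      by (intro nn_integral_cong) (auto simp: indicator_def)
    also have "\<dots> = emeasure circle_measure {\<zeta>\<in>sphere 0 1. s < w \<zeta>}"
    proof (rule nn_integral_indicator)
      have "{\<zeta>\<in>space circle_measure. s < w \<zeta>} \<in> sets circle_measure" by measurable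
      then show "{\<zeta>\<in>sphere 0 1. s < w \<zeta>} \<in> sets circle_measure" by simp
    qed
    finally show "(\<integral>\<^sup>+\<zeta>. k s * (if s < w \<zeta> then 1 else 0) \<partial>circle_measure) =
        k s * emeasure circle_measure {\<zeta>\<in>sphere 0 1. s < w \<zeta>}" .
  qed
  finally show ?thesis .
qed

lemma poisson_measurable [measurable]: "cmod z < 1 \<Longrightarrow> poisson z \<in> borel_measurable circle_measure"
  by (intro measurable_circle measurable_circle_continuous continuous_on_poisson)

lemma integrable_poisson_mult:
  fixes X :: "complex \<Rightarrow> real"
  assumes z: "cmod z < 1" and X: "integrable circle_measure X"
  shows "integrable circle_measure (\<lambda>\<zeta>. poisson z \<zeta> * X \<zeta>)"
proof (rule Bochner_Integration.integrable_bound)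
  show "integrable circle_measure (\<lambda>\<zeta>. 4 / (1 - (cmod z)\<^sup>2) * X \<zeta>)" using X by simp
  show "AE \<zeta> in circle_measure. norm (poisson z \<zeta> * X \<zeta>) \<le> norm (4 / (1 - (cmod z)\<^sup>2) * X \<zeta>)"
  proof (rule AE_I2)
    fix \<zeta> assume "\<zeta> \<in> space circle_measure"
    then have "poisson z \<zeta> \<le> 4 / (1 - (cmod z)\<^sup>2)" using poisson_le[OF z] by simp
    with poisson_nonneg[OF z, of \<zeta>] have "\<bar>poisson z \<zeta>\<bar> \<le> \<bar>4 / (1 - (cmod z)\<^sup>2)\<bar>" by linarith
    then show "norm (poisson z \<zeta> * X \<zeta>) \<le> norm (4 / (1 - (cmod z)\<^sup>2) * X \<zeta>)"
      unfolding real_norm_def abs_mult by (rule mult_right_mono) simp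
  qed
qed (use z X in measurable)

lemma poisson_Jensen:
  fixes X q :: "_ \<Rightarrow> real"
  assumes z: "cmod z < 1" and X: "integrable circle_measure X" "\<And>\<zeta>. X \<zeta> \<in> I"
    and I: "I = {0<..} \<or> I = UNIV"
    and q: "integrable circle_measure (\<lambda>\<zeta>. q (X \<zeta>))" "convex_on I q"
  shows "q (LINT \<zeta>|circle_measure. poisson z \<zeta> * X \<zeta>) \<le> (LINT \<zeta>|circle_measure. poisson z \<zeta> * q (X \<zeta>))"
proof -
  define D where "D = density circle_measure (\<lambda>\<zeta>. ennreal (poisson z \<zeta>))"
  have [measurable]: "poisson z \<in> borel_measurable circle_measure" using z by measurable
  have nn: "AE \<zeta> in circle_measure. 0 \<le> poisson z \<zeta>" using poisson_nonneg[OF z] by simp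
  have intD: "integrable D f \<longleftrightarrow> integrable circle_measure (\<lambda>\<zeta>. poisson z \<zeta> * f \<zeta>)"
      "(LINT \<zeta>|D. f \<zeta>) = (LINT \<zeta>|circle_measure. poisson z \<zeta> * f \<zeta>)"
    if [measurable]: "f \<in> borel_measurable circle_measure" for f :: "complex \<Rightarrow> real"
    using integrable_density[OF that _ nn] integral_density[OF that _ nn] by (simp_all add: D_def)
  interpret D: prob_space D
  proof (rule prob_spaceI)
    have "emeasure D (space D) = (\<integral>\<^sup>+\<zeta>. ennreal (poisson z \<zeta>) \<partial>circle_measure)"
      unfolding D_def using sets.top[of circle_measure]
      by (subst emeasure_density) (auto intro!: nn_integral_cong simp: indicator_def)
    also have "\<dots> = 1"
      using nn_integral_eq_integral[OF integrable_poisson[OF z] nn] integral_poisson_1[OF z] by simp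
    finally show "emeasure D (space D) = 1" .
  qed
  have m: "X \<in> borel_measurable circle_measure" "(\<lambda>\<zeta>. q (X \<zeta>)) \<in> borel_measurable circle_measure"
    using X(1) q(1) by auto
  have "q (D.expectation X) \<le> D.expectation (\<lambda>\<zeta>. q (X \<zeta>))"
  proof (rule D.jensens_inequality[where I = I and a = 0])
    show "I = {0 <..< 0} \<or> I = {0 <..} \<or> I = {..< 0} \<or> I = UNIV" using I by auto
  qed (use X q z m in \<open>auto simp: intD integrable_poisson_mult\<close>)
  then show ?thesis by (simp add: intD m)
qed

text \<open>After Fubini, \<open>poisson_symmetric\<close> makes the inner integral the mass of a
  Poisson kernel, which is 1. Averaging a Poisson majorant over a circle thus costs nothing.\<close>

lemma nn_integral_poisson_circle:
  assumes r: "0 \<le> r" "r < 1" and [measurable]: "g \<in> borel_measurable circle_measure"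
  shows "(\<integral>\<^sup>+\<zeta>. (\<integral>\<^sup>+\<eta>. ennreal (poisson (of_real r * \<zeta>) \<eta>) * g \<eta> \<partial>circle_measure) \<partial>circle_measure) =
    (\<integral>\<^sup>+\<eta>. g \<eta> \<partial>circle_measure)"
proof -
  have [measurable]: "(\<lambda>z. z) \<in> circle_measure \<rightarrow>\<^sub>M borel"
    using measurable_circle_id by (simp add: measurable_restrict_space2_iff)
  have "(\<integral>\<^sup>+\<zeta>. (\<integral>\<^sup>+\<eta>. ennreal (poisson (of_real r * \<zeta>) \<eta>) * g \<eta> \<partial>circle_measure) \<partial>circle_measure) =
      (\<integral>\<^sup>+\<eta>. (\<integral>\<^sup>+\<zeta>. ennreal (poisson (of_real r * \<zeta>) \<eta>) * g \<eta> \<partial>circle_measure) \<partial>circle_measure)"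
    unfolding poisson_def by (rule circle_circle.Fubini'[symmetric]) measurable
  also have "\<dots> = (\<integral>\<^sup>+\<eta>. g \<eta> \<partial>circle_measure)"
  proof (rule nn_integral_cong)
    fix \<eta> assume "\<eta> \<in> space circle_measure"
    then have \<eta>: "cmod \<eta> = 1" by simp
    then have z: "cmod (of_real r * \<eta>) < 1" using r by (simp add: norm_mult)
    then have [measurable]: "poisson (of_real r * \<eta>) \<in> borel_measurable circle_measure" by measurable
    have "(\<integral>\<^sup>+\<zeta>. ennreal (poisson (of_real r * \<zeta>) \<eta>) * g \<eta> \<partial>circle_measure) =
        (\<integral>\<^sup>+\<zeta>. ennreal (poisson (of_real r * \<eta>) \<zeta>) * g \<eta> \<partial>circle_measure)"
      by (rule nn_integral_cong) (use \<eta> in \<open>simp add: poisson_symmetric\<close>)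
    also have "\<dots> = (\<integral>\<^sup>+\<zeta>. ennreal (poisson (of_real r * \<eta>) \<zeta>) \<partial>circle_measure) * g \<eta>"
      by (rule nn_integral_multc) measurable
    also have "(\<integral>\<^sup>+\<zeta>. ennreal (poisson (of_real r * \<eta>) \<zeta>) \<partial>circle_measure) = 1"
      using nn_integral_eq_integral[OF integrable_poisson[OF z]] integral_poisson_1[OF z] poisson_nonneg[OF z]
      by simp
    finally show "(\<integral>\<^sup>+\<zeta>. ennreal (poisson (of_real r * \<zeta>) \<eta>) * g \<eta> \<partial>circle_measure) = g \<eta>" by simp
  qed
  finally show ?thesis .
qed

definition mean1 :: "real \<Rightarrow> (complex \<Rightarrow> complex) \<Rightarrow> ennreal" where
  "mean1 r f = (\<integral>\<^sup>+\<zeta>. ennreal (cmod (f (of_real r * \<zeta>))) \<partial>circle_measure)"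

lemma powr_add_le:
  fixes x y a :: real
  assumes "0 \<le> x" "0 \<le> y" "0 \<le> a"
  shows "(x + y) powr a \<le> 2 powr a * (x powr a + y powr a)"
proof -
  have "(x + y) powr a \<le> (2 * max x y) powr a" using assms by (intro powr_mono2) auto
  also have "\<dots> = 2 powr a * (max x y) powr a" using assms by (simp add: powr_mult)
  also have "\<dots> \<le> 2 powr a * (x powr a + y powr a)" by (intro mult_left_mono) (auto simp: max_def)
  finally show ?thesis .
qed

text \<open>
  Write \<open>w = exp (p v / 2)\<close> and \<open>\<alpha> = 2 / p\<close>. By Jensen \<open>\<bar>f\<bar> \<le> (P w)\<^sup>\<alpha>\<close>; the truncation \<open>min w T\<close>
  is treated by Jensen again, the excess over \<open>T\<close> by the supremum bound \<open>A\<close> for its Poisson integral.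
\<close>

lemma mean1_le_truncation:
  fixes v :: "complex \<Rightarrow> real" and p T A r :: real
  defines "w \<equiv> \<lambda>\<zeta>. exp (p / 2 * v \<zeta>)" and "\<alpha> \<equiv> 2 / p"
  assumes p: "0 < p" "p < 1" and v: "integrable circle_measure v" "\<And>\<zeta>. 0 \<le> v \<zeta>"
    and f: "\<And>z. cmod z < 1 \<Longrightarrow> log_plus (cmod (f z)) \<le> (LINT \<zeta>|circle_measure. poisson z \<zeta> * v \<zeta>)"
    and r: "0 \<le> r" "r < 1" and T: "1 \<le> T"
    and A: "0 \<le> A" "ennreal (4 / (1 - r\<^sup>2)) * (\<integral>\<^sup>+\<zeta>. ennreal (max 0 (w \<zeta> - T)) \<partial>circle_measure) \<le> ennreal A"
  shows "mean1 r f \<le> ennreal (2 powr \<alpha>) * ((\<integral>\<^sup>+\<zeta>. ennreal (min (w \<zeta>) T powr \<alpha>) \<partial>circle_measure) +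
    ennreal (A powr (\<alpha> - 1)) * (\<integral>\<^sup>+\<zeta>. ennreal (max 0 (w \<zeta> - T)) \<partial>circle_measure))"
proof -
  have \<alpha>: "\<alpha> > 2" using p by (simp add: \<alpha>_def field_simps)
  have r2: "0 < 1 - r\<^sup>2" using r by (simp add: abs_square_less_1)
  have [measurable]: "v \<in> borel_measurable circle_measure" using v by auto
  have [measurable]: "w \<in> borel_measurable circle_measure" unfolding w_def by measurable
  have w1: "1 \<le> w \<zeta>" for \<zeta> unfolding w_def using p v(2)[of \<zeta>] by simp
  define x where "x \<zeta> = min (w \<zeta>) T" for \<zeta>
  define y where "y \<zeta> = max 0 (w \<zeta> - T)" for \<zeta>
  have [measurable]: "x \<in> borel_measurable circle_measure" "y \<in> borel_measurable circle_measure"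
    unfolding x_def y_def by measurable
  have wxy: "w \<zeta> = x \<zeta> + y \<zeta>" for \<zeta> by (simp add: x_def y_def)
  have x0: "0 < x \<zeta>" "x \<zeta> \<le> T" and y0: "0 \<le> y \<zeta>" for \<zeta> using w1[of \<zeta>] T by (auto simp: x_def y_def)
  \<comment> \<open>The hypothesis on A forces integrability of the excess, because its factor 4 /
    (1 - r^2) is positive.\<close>
  have "(\<integral>\<^sup>+\<zeta>. ennreal (y \<zeta>) \<partial>circle_measure) < \<infinity>"
  proof (rule ccontr)
    assume "\<not> ?thesis"
    then have "(\<integral>\<^sup>+\<zeta>. ennreal (y \<zeta>) \<partial>circle_measure) = \<infinity>" by (simp add: less_top[symmetric])
    with A(2) r2 show False by (simp add: y_def ennreal_mult_top top_unique)
  qed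
  then have iy: "integrable circle_measure y" by (intro integrableI_nonneg) (auto simp: y0)
  have ix: "integrable circle_measure x"
    by (rule circle.integrable_const_bound[of _ T]) (use x0 in \<open>auto simp: less_imp_le\<close>)
  have ixa: "integrable circle_measure (\<lambda>\<zeta>. x \<zeta> powr \<alpha>)"
    by (rule circle.integrable_const_bound[of _ "T powr \<alpha>"])
       (use x0 \<alpha> in \<open>auto intro!: powr_mono2 simp: less_imp_le\<close>)
  have iw: "integrable circle_measure w" unfolding wxy using ix iy by simp
  have A': "4 / (1 - r\<^sup>2) * (LINT \<zeta>|circle_measure. y \<zeta>) \<le> A"
  proof -
    have "ennreal (4 / (1 - r\<^sup>2)) * ennreal (LINT \<zeta>|circle_measure. y \<zeta>) \<le> ennreal A"
      using A(2)[folded y_def] unfolding nn_integral_eq_integral[OF iy AE_I2[OF y0]] .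
    then have "ennreal (4 / (1 - r\<^sup>2) * (LINT \<zeta>|circle_measure. y \<zeta>)) \<le> ennreal A"
      by (subst ennreal_mult) (use r2 y0 in auto)
    then show ?thesis using A(1) by simp
  qed
  \<comment> \<open>On the circle of radius r, |f| will be at most the Poisson integral of
    \<open>\<Theta>\<close>; averaging then leaves the integral of \<open>\<Theta>\<close>, which is
    the right-hand side of the claim.\<close>
  define \<Theta> where "\<Theta> \<zeta> = 2 powr \<alpha> * (x \<zeta> powr \<alpha> + A powr (\<alpha> - 1) * y \<zeta>)" for \<zeta>
  have [measurable]: "\<Theta> \<in> borel_measurable circle_measure" unfolding \<Theta>_def by measurable
  have i\<Theta>: "integrable circle_measure \<Theta>" unfolding \<Theta>_def using ixa iy by simp
  have \<Theta>0: "0 \<le> \<Theta> \<zeta>" for \<zeta> unfolding \<Theta>_def using y0[of \<zeta>] by simp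
  have key: "ennreal (cmod (f (of_real r * \<eta>))) \<le> (\<integral>\<^sup>+\<zeta>. ennreal (poisson (of_real r * \<eta>) \<zeta>) * ennreal (\<Theta> \<zeta>) \<partial>circle_measure)"
    if \<eta>: "cmod \<eta> = 1" for \<eta>
  proof -
    define z where "z = of_real r * \<eta>"
    have z: "cmod z < 1" "cmod z = r" using r \<eta> by (auto simp: z_def norm_mult)
    let ?P = "\<lambda>g. LINT \<zeta>|circle_measure. poisson z \<zeta> * g \<zeta>"
    have pn: "0 \<le> poisson z \<zeta>" for \<zeta> by (rule poisson_nonneg[OF z(1)])
    have 1: "exp (p / 2 * ?P v) \<le> ?P w"
      using poisson_Jensen[OF z(1) v(1), of UNIV "\<lambda>t. exp (p / 2 * t)"] iw
        convex_on_exp[of "p / 2"] p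
      by (simp add: w_def)
    have 2: "?P x powr \<alpha> \<le> ?P (\<lambda>\<zeta>. x \<zeta> powr \<alpha>)"
      by (rule poisson_Jensen[OF z(1) ix, of "{0<..}" "\<lambda>t. t powr \<alpha>"]) (use x0 \<alpha> ixa in \<open>auto intro: powr_convex\<close>)
    have Py0: "0 \<le> ?P y" by (intro integral_nonneg_AE AE_I2 mult_nonneg_nonneg pn y0)
    have Px0: "0 \<le> ?P x" by (intro integral_nonneg_AE AE_I2 mult_nonneg_nonneg pn less_imp_le[OF x0(1)])
    have "?P y \<le> (LINT \<zeta>|circle_measure. 4 / (1 - r\<^sup>2) * y \<zeta>)"
      by (intro integral_mono_AE AE_I2 mult_right_mono y0 integrable_poisson_mult z iy integrable_mult_right)
         (use poisson_le[OF z(1)] z in auto)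
    also have "\<dots> \<le> A" using A' by simp
    finally have PyA: "?P y \<le> A" .
    \<comment> \<open>All but one power of the excess are paid by the supremum bound A, so that only
      the first moment of the excess appears.\<close>
    have 3: "?P y powr \<alpha> \<le> A powr (\<alpha> - 1) * ?P y"
    proof -
      have "?P y powr \<alpha> = ?P y powr (\<alpha> - 1) * ?P y"
        using Py0 by (cases "?P y = 0") (auto simp: powr_diff)
      also have "\<dots> \<le> A powr (\<alpha> - 1) * ?P y"
        using Py0 PyA \<alpha> by (intro mult_right_mono powr_mono2) auto
      finally show ?thesis .
    qed
    have "cmod (f z) \<le> max 1 (cmod (f z))" by simp
    also have "\<dots> = exp (log_plus (cmod (f z)))" by (simp add: log_plus_def)
    also have "\<dots> \<le> exp (?P v)" using f[OF z(1)] by simp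
    also have "\<dots> = exp (p / 2 * ?P v) powr \<alpha>" using p by (simp add: \<alpha>_def powr_def)
    also have "\<dots> \<le> ?P w powr \<alpha>" using 1 \<alpha> by (intro powr_mono2) auto
    also have "?P w = ?P x + ?P y" unfolding wxy distrib_left
      by (intro Bochner_Integration.integral_add integrable_poisson_mult z ix iy)
    also have "(?P x + ?P y) powr \<alpha> \<le> 2 powr \<alpha> * (?P x powr \<alpha> + ?P y powr \<alpha>)"
      using Px0 Py0 \<alpha> by (intro powr_add_le) auto
    also have "\<dots> \<le> 2 powr \<alpha> * (?P (\<lambda>\<zeta>. x \<zeta> powr \<alpha>) + A powr (\<alpha> - 1) * ?P y)"
      using 2 3 by (intro mult_left_mono add_mono) auto
    also have "\<dots> = 2 powr \<alpha> * (?P (\<lambda>\<zeta>. x \<zeta> powr \<alpha>) + ?P (\<lambda>\<zeta>. A powr (\<alpha> - 1) * y \<zeta>))"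
      by (simp add: mult.left_commute[of _ "A powr (\<alpha> - 1)"])
    also have "\<dots> = 2 powr \<alpha> * ?P (\<lambda>\<zeta>. x \<zeta> powr \<alpha> + A powr (\<alpha> - 1) * y \<zeta>)"
      unfolding distrib_left by (subst Bochner_Integration.integral_add)
        (auto intro!: integrable_poisson_mult z ixa iy integrable_mult_right simp: distrib_left)
    also have "\<dots> = ?P \<Theta>" unfolding \<Theta>_def by (simp add: mult.left_commute[of _ "2 powr \<alpha>"])
    finally have "ennreal (cmod (f z)) \<le> ennreal (?P \<Theta>)" by (rule ennreal_leI)
    also have "\<dots> = (\<integral>\<^sup>+\<zeta>. ennreal (poisson z \<zeta> * \<Theta> \<zeta>) \<partial>circle_measure)"
      by (rule nn_integral_eq_integral[symmetric]) (use z i\<Theta> pn \<Theta>0 in \<open>auto intro!: integrable_poisson_mult\<close>)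
    finally show ?thesis unfolding z_def[symmetric] using pn \<Theta>0 by (simp add: ennreal_mult)
  qed
  have "mean1 r f \<le> (\<integral>\<^sup>+\<eta>. (\<integral>\<^sup>+\<zeta>. ennreal (poisson (of_real r * \<eta>) \<zeta>) * ennreal (\<Theta> \<zeta>) \<partial>circle_measure) \<partial>circle_measure)"
    unfolding mean1_def by (rule nn_integral_mono) (use key in auto)
  also have "\<dots> = (\<integral>\<^sup>+\<zeta>. ennreal (\<Theta> \<zeta>) \<partial>circle_measure)"
    by (rule nn_integral_poisson_circle[OF r]) measurable
  also have "\<dots> = (\<integral>\<^sup>+\<zeta>. ennreal (2 powr \<alpha>) * (ennreal (x \<zeta> powr \<alpha>) + ennreal (A powr (\<alpha> - 1)) * ennreal (y \<zeta>)) \<partial>circle_measure)"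
    unfolding \<Theta>_def by (intro nn_integral_cong) (use y0 in \<open>simp add: ennreal_mult ennreal_plus\<close>)
  also have "\<dots> = ennreal (2 powr \<alpha>) * ((\<integral>\<^sup>+\<zeta>. ennreal (x \<zeta> powr \<alpha>) \<partial>circle_measure) +
      ennreal (A powr (\<alpha> - 1)) * (\<integral>\<^sup>+\<zeta>. ennreal (y \<zeta>) \<partial>circle_measure))"
    by (simp add: nn_integral_cmult nn_integral_add)
  finally show ?thesis by (simp add: x_def y_def)
qed

text \<open>Layer cake: the tail bound \<epsilon> s^(-2), integrated from T on, gives \<epsilon> /
  T.\<close>

lemma nn_integral_excess_le:
  assumes [measurable]: "w \<in> borel_measurable circle_measure" and T: "0 < T" and \<epsilon>: "0 \<le> \<epsilon>"
    and d: "\<And>s. T \<le> s \<Longrightarrow> measure circle_measure {\<zeta>\<in>sphere 0 1. s < w \<zeta>} \<le> \<epsilon> * s powr - 2"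
  shows "(\<integral>\<^sup>+\<zeta>. ennreal (max 0 (w \<zeta> - T)) \<partial>circle_measure) \<le> ennreal (\<epsilon> / T)"
proof -
  have "ennreal (max 0 (w \<zeta> - T)) = (\<integral>\<^sup>+s. indicator {T..} s * indicator {..<w \<zeta>} s \<partial>lborel)" for \<zeta>
  proof -
    have "(\<integral>\<^sup>+s. indicator {T..} s * indicator {..<w \<zeta>} s \<partial>lborel) = (\<integral>\<^sup>+s. indicator {T..<w \<zeta>} s \<partial>lborel)"
      by (intro nn_integral_cong) (auto simp: indicator_def)
    then show ?thesis by (cases "T \<le> w \<zeta>") auto
  qed
  then have "(\<integral>\<^sup>+\<zeta>. ennreal (max 0 (w \<zeta> - T)) \<partial>circle_measure) =
      (\<integral>\<^sup>+s. indicator {T..} s * emeasure circle_measure {\<zeta>\<in>sphere 0 1. s < w \<zeta>} \<partial>lborel)"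
    by (simp add: nn_integral_layer_cake)
  also have "\<dots> \<le> (\<integral>\<^sup>+s. ennreal \<epsilon> * (ennreal (s powr - 2) * indicator {T..} s) \<partial>lborel)"
    by (intro nn_integral_mono)
       (use d \<epsilon> in \<open>auto simp: indicator_def circle.emeasure_eq_measure simp flip: ennreal_mult intro!: ennreal_leI\<close>)
  also have "\<dots> = ennreal \<epsilon> * (\<integral>\<^sup>+s\<in>{T..}. ennreal (s powr - 2) \<partial>lborel)"
    by (rule nn_integral_cmult) measurable
  also have "\<dots> = ennreal (\<epsilon> / T)"
    using T \<epsilon> by (subst nn_integral_powr_Ici) (auto simp: powr_minus divide_simps simp flip: ennreal_mult)
  finally show ?thesis .
qed

text \<open>Layer cake with density \<alpha> s^(\<alpha> - 1) up to T. Below S the measure is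
  estimated by 1; above S the tail bound leaves s^(\<alpha> - 3), which is integrable at 0 because
  \<alpha> > 2.\<close>

lemma nn_integral_truncation_le:
  fixes \<alpha> S T \<epsilon> :: real
  assumes [measurable]: "w \<in> borel_measurable circle_measure" and w: "\<And>\<zeta>. 0 \<le> w \<zeta>"
    and \<alpha>: "2 < \<alpha>" and S: "0 \<le> S" "S \<le> T" and \<epsilon>: "0 \<le> \<epsilon>"
    and d: "\<And>s. S \<le> s \<Longrightarrow> measure circle_measure {\<zeta>\<in>sphere 0 1. s < w \<zeta>} \<le> \<epsilon> * s powr - 2"
  shows "(\<integral>\<^sup>+\<zeta>. ennreal (min (w \<zeta>) T powr \<alpha>) \<partial>circle_measure) \<le>
    ennreal (S powr \<alpha> + \<epsilon> * (\<alpha> / (\<alpha> - 2)) * T powr (\<alpha> - 2))"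
proof -
  define k where "k s = ennreal \<alpha> * (ennreal (s powr (\<alpha> - 1)) * indicator {0..T} s)" for s
  have [measurable]: "k \<in> borel_measurable borel" unfolding k_def by measurable
  have "ennreal (min (w \<zeta>) T powr \<alpha>) \<le> (\<integral>\<^sup>+s. k s * indicator {..<w \<zeta>} s \<partial>lborel)" for \<zeta>
  proof -
    let ?m = "min (w \<zeta>) T"
    have "ennreal (?m powr \<alpha>) = ennreal \<alpha> * ennreal (?m powr \<alpha> / \<alpha>)"
      using \<alpha> by (simp flip: ennreal_mult)
    also have "\<dots> = ennreal \<alpha> * (\<integral>\<^sup>+s\<in>{0..?m}. ennreal (s powr (\<alpha> - 1)) \<partial>lborel)"
      using \<alpha> w[of \<zeta>] S by (subst nn_integral_powr_Icc) auto
    also have "\<dots> = (\<integral>\<^sup>+s. ennreal \<alpha> * (ennreal (s powr (\<alpha> - 1)) * indicator {0..?m} s) \<partial>lborel)"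
      by (rule nn_integral_cmult[symmetric]) measurable
    also have "\<dots> \<le> (\<integral>\<^sup>+s. k s * indicator {..<w \<zeta>} s \<partial>lborel)"
    proof (rule nn_integral_mono_AE)
      show "AE s in lborel. ennreal \<alpha> * (ennreal (s powr (\<alpha> - 1)) * indicator {0..?m} s) \<le> k s * indicator {..<w \<zeta>} s"
        using AE_lborel_singleton[of "w \<zeta>"] by eventually_elim (auto simp: k_def indicator_def)
    qed
    finally show ?thesis .
  qed
  then have "(\<integral>\<^sup>+\<zeta>. ennreal (min (w \<zeta>) T powr \<alpha>) \<partial>circle_measure) \<le>
      (\<integral>\<^sup>+\<zeta>. (\<integral>\<^sup>+s. k s * indicator {..<w \<zeta>} s \<partial>lborel) \<partial>circle_measure)"
    by (intro nn_integral_mono)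
  also have "\<dots> = (\<integral>\<^sup>+s. k s * emeasure circle_measure {\<zeta>\<in>sphere 0 1. s < w \<zeta>} \<partial>lborel)"
    by (rule nn_integral_layer_cake) measurable
  also have "\<dots> \<le> (\<integral>\<^sup>+s. ennreal \<alpha> * (ennreal (s powr (\<alpha> - 1)) * indicator {0..S} s) +
      ennreal (\<alpha> * \<epsilon>) * (ennreal (s powr (\<alpha> - 3)) * indicator {0..T} s) \<partial>lborel)"
  proof (rule nn_integral_mono)
    fix s :: real
    consider "s < 0 \<or> T < s" | "0 \<le> s" "s \<le> S" | "0 \<le> s" "S \<le> s" "s \<le> T" by linarith
    then show "k s * emeasure circle_measure {\<zeta>\<in>sphere 0 1. s < w \<zeta>} \<le>
        ennreal \<alpha> * (ennreal (s powr (\<alpha> - 1)) * indicator {0..S} s) +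
        ennreal (\<alpha> * \<epsilon>) * (ennreal (s powr (\<alpha> - 3)) * indicator {0..T} s)"
    proof cases
      case 2
      have "k s * emeasure circle_measure {\<zeta>\<in>sphere 0 1. s < w \<zeta>} \<le> k s * 1"
        by (intro mult_left_mono) (auto simp: circle.emeasure_eq_measure)
      also have "k s * 1 = ennreal \<alpha> * (ennreal (s powr (\<alpha> - 1)) * indicator {0..S} s)"
        using 2 S by (simp add: k_def)
      finally show ?thesis by (simp add: add_increasing2)
    next
      case 3
      have "k s * emeasure circle_measure {\<zeta>\<in>sphere 0 1. s < w \<zeta>} \<le> k s * ennreal (\<epsilon> * s powr - 2)"
        using d[OF 3(2)] by (intro mult_left_mono) (auto simp: circle.emeasure_eq_measure intro!: ennreal_leI)
      also have "\<dots> = ennreal (\<alpha> * s powr (\<alpha> - 1) * (\<epsilon> * s powr - 2))"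
        using 3 \<alpha> \<epsilon> by (simp add: k_def flip: ennreal_mult)
      also have "\<alpha> * s powr (\<alpha> - 1) * (\<epsilon> * s powr - 2) = (\<alpha> * \<epsilon>) * (s powr (\<alpha> - 1) * s powr - 2)" by simp
      also have "s powr (\<alpha> - 1) * s powr - 2 = s powr (\<alpha> - 3)" by (simp flip: powr_add)
      finally have "k s * emeasure circle_measure {\<zeta>\<in>sphere 0 1. s < w \<zeta>} \<le>
          ennreal (\<alpha> * \<epsilon>) * (ennreal (s powr (\<alpha> - 3)) * indicator {0..T} s)"
        using 3 \<alpha> \<epsilon> by (simp add: ennreal_mult)
      then show ?thesis by (simp add: add_increasing)
    qed (auto simp: k_def)
  qed
  also have "\<dots> = ennreal \<alpha> * (\<integral>\<^sup>+s\<in>{0..S}. ennreal (s powr (\<alpha> - 1)) \<partial>lborel) +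
      ennreal (\<alpha> * \<epsilon>) * (\<integral>\<^sup>+s\<in>{0..T}. ennreal (s powr (\<alpha> - 3)) \<partial>lborel)"
    by (simp add: nn_integral_add nn_integral_cmult)
  also have "\<dots> = ennreal \<alpha> * ennreal (S powr \<alpha> / \<alpha>) + ennreal (\<alpha> * \<epsilon>) * ennreal (T powr (\<alpha> - 2) / (\<alpha> - 2))"
    using nn_integral_powr_Icc[of "\<alpha> - 1" S] nn_integral_powr_Icc[of "\<alpha> - 3" T] \<alpha> S by simp
  also have "\<dots> = ennreal (S powr \<alpha> + \<epsilon> * (\<alpha> / (\<alpha> - 2)) * T powr (\<alpha> - 2))"
    using \<alpha> \<epsilon> by (simp add: mult_ac flip: ennreal_mult ennreal_plus)
  finally show ?thesis .
qed

text \<open>The truncation level T is about (1 - r^2)^(-1/2). Then both parts of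
  \<open>mean1_le_truncation\<close> contribute multiples of T^(\<alpha> - 2), and this is of order
  (1 - r^2)^(1 - 1/p). K collects what depends on the threshold S but not on r. The factor
  \<epsilon> (1 + \<epsilon>^(\<alpha> - 1)) is kept explicit because it tends to 0 with \<epsilon>,
  which later turns O into o.\<close>

lemma mean1_le_of_weak_type:
  fixes p S \<epsilon> :: real and v :: "complex \<Rightarrow> real"
  defines "\<alpha> \<equiv> 2 / p"
  assumes p: "0 < p" "p < 1" and v: "integrable circle_measure v" "\<And>\<zeta>. 0 \<le> v \<zeta>"
    and f: "\<And>z. cmod z < 1 \<Longrightarrow> log_plus (cmod (f z)) \<le> (LINT \<zeta>|circle_measure. poisson z \<zeta> * v \<zeta>)"
    and S: "1 \<le> S" and \<epsilon>: "0 \<le> \<epsilon>"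
    and d: "\<And>s. S \<le> s \<Longrightarrow> measure circle_measure {\<zeta>\<in>sphere 0 1. s < exp (p / 2 * v \<zeta>)} \<le> \<epsilon> * s powr - 2"
  shows "\<exists>K\<ge>0. \<forall>r. 0 \<le> r \<longrightarrow> r < 1 \<longrightarrow> mean1 r f \<le> ennreal (K +
    2 powr \<alpha> * 2 powr (\<alpha> - 2) * (\<alpha> / (\<alpha> - 2) + 4 powr (\<alpha> - 1)) * (\<epsilon> * (1 + \<epsilon> powr (\<alpha> - 1))) * (1 - r\<^sup>2) powr (1 - 1 / p))"
proof -
  have \<alpha>: "\<alpha> > 2" using p by (simp add: \<alpha>_def field_simps)
  define w where "w \<zeta> = exp (p / 2 * v \<zeta>)" for \<zeta>
  have [measurable]: "v \<in> borel_measurable circle_measure" using v by auto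
  have [measurable]: "w \<in> borel_measurable circle_measure" unfolding w_def by measurable
  define Q where "Q = (\<alpha> / (\<alpha> - 2) + 4 powr (\<alpha> - 1)) * (\<epsilon> * (1 + \<epsilon> powr (\<alpha> - 1)))"
  have Q0: "0 \<le> Q" unfolding Q_def using \<alpha> \<epsilon> by (intro mult_nonneg_nonneg add_nonneg_nonneg) auto
  define K where "K = 2 powr \<alpha> * S powr \<alpha> + 2 powr \<alpha> * Q * 2 powr (\<alpha> - 2) * S powr (\<alpha> - 2)"
  have K0: "0 \<le> K" unfolding K_def using Q0 by simp
  have "mean1 r f \<le> ennreal (K + 2 powr \<alpha> * 2 powr (\<alpha> - 2) * Q * (1 - r\<^sup>2) powr (1 - 1 / p))"
    if r: "0 \<le> r" "r < 1" for r
  proof -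
    define \<tau> where "\<tau> = 1 - r\<^sup>2"
    have \<tau>: "0 < \<tau>" using r by (simp add: \<tau>_def abs_square_less_1)
    \<comment> \<open>The summand S makes the tail bound available from T on; the other one gives
      \<tau> T^2 >= 1.\<close>
    define T where "T = S + \<tau> powr (- 1 / 2)"
    have T: "1 \<le> T" "S \<le> T" "0 < T" "\<tau> powr (- 1 / 2) \<le> T" using S by (auto simp: T_def intro: add_increasing2 add_pos_nonneg)
    \<comment> \<open>From 4 / \<tau> times the excess bound \<epsilon> / T, using 1 / \<tau> <=
      T^2.\<close>
    define A where "A = 4 * \<epsilon> * T"
    have A0: "0 \<le> A" using \<epsilon> T by (simp add: A_def)
    have ex: "(\<integral>\<^sup>+\<zeta>. ennreal (max 0 (w \<zeta> - T)) \<partial>circle_measure) \<le> ennreal (\<epsilon> / T)"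
      by (rule nn_integral_excess_le) (use T \<epsilon> d in \<open>auto simp: w_def\<close>)
    have tr: "(\<integral>\<^sup>+\<zeta>. ennreal (min (w \<zeta>) T powr \<alpha>) \<partial>circle_measure) \<le>
        ennreal (S powr \<alpha> + \<epsilon> * (\<alpha> / (\<alpha> - 2)) * T powr (\<alpha> - 2))"
      by (rule nn_integral_truncation_le) (use T S \<epsilon> d \<alpha> in \<open>auto simp: w_def\<close>)
    have "1 = \<tau> * (\<tau> powr (- 1 / 2) * \<tau> powr (- 1 / 2))"
      using \<tau> by (simp add: powr_minus divide_simps flip: powr_add)
    also have "\<dots> \<le> \<tau> * (T * T)" using \<tau> T by (intro mult_left_mono mult_mono) auto
    finally have \<tau>T: "1 \<le> \<tau> * T * T" by (simp add: mult_ac)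
    have A: "ennreal (4 / (1 - r\<^sup>2)) * (\<integral>\<^sup>+\<zeta>. ennreal (max 0 (w \<zeta> - T)) \<partial>circle_measure) \<le> ennreal A"
    proof -
      have "ennreal (4 / \<tau>) * (\<integral>\<^sup>+\<zeta>. ennreal (max 0 (w \<zeta> - T)) \<partial>circle_measure) \<le> ennreal (4 / \<tau>) * ennreal (\<epsilon> / T)"
        by (intro mult_left_mono ex) auto
      also have "\<dots> = ennreal (4 * \<epsilon> / (\<tau> * T))" using \<tau> T \<epsilon> by (simp flip: ennreal_mult)
      also have "\<dots> \<le> ennreal A"
      proof (rule ennreal_leI)
        have "4 * \<epsilon> * 1 \<le> 4 * \<epsilon> * (\<tau> * T * T)" using \<tau>T \<epsilon> by (intro mult_left_mono) auto
        then show "4 * \<epsilon> / (\<tau> * T) \<le> A" using \<tau> T by (simp add: A_def field_simps)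
      qed
      finally show ?thesis by (simp add: \<tau>_def)
    qed
    have "mean1 r f \<le> ennreal (2 powr \<alpha>) * ((\<integral>\<^sup>+\<zeta>. ennreal (min (w \<zeta>) T powr \<alpha>) \<partial>circle_measure) +
        ennreal (A powr (\<alpha> - 1)) * (\<integral>\<^sup>+\<zeta>. ennreal (max 0 (w \<zeta> - T)) \<partial>circle_measure))"
      using mean1_le_truncation[OF p v f r T(1) A0] A unfolding w_def \<alpha>_def by blast
    also have "\<dots> \<le> ennreal (2 powr \<alpha>) * (ennreal (S powr \<alpha> + \<epsilon> * (\<alpha> / (\<alpha> - 2)) * T powr (\<alpha> - 2)) +
        ennreal (A powr (\<alpha> - 1)) * ennreal (\<epsilon> / T))"
      by (intro mult_left_mono add_mono ex tr) auto
    also have "\<dots> = ennreal (2 powr \<alpha> * (S powr \<alpha> + \<epsilon> * (\<alpha> / (\<alpha> - 2)) * T powr (\<alpha> - 2) + A powr (\<alpha> - 1) * (\<epsilon> / T)))"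
      using \<alpha> \<epsilon> T by (simp flip: ennreal_mult ennreal_plus)
    also have "\<dots> \<le> ennreal (K + 2 powr \<alpha> * 2 powr (\<alpha> - 2) * Q * \<tau> powr (1 - 1 / p))"
    proof (rule ennreal_leI)
      have "A powr (\<alpha> - 1) * (\<epsilon> / T) = 4 powr (\<alpha> - 1) * (\<epsilon> * \<epsilon> powr (\<alpha> - 1)) * (T powr (\<alpha> - 1) / T)"
        using \<epsilon> T by (simp add: A_def powr_mult)
      also have "T powr (\<alpha> - 1) / T = T powr (\<alpha> - 2)"
        using T powr_diff[of T "\<alpha> - 1" 1] by simp
      finally have 1: "\<epsilon> * (\<alpha> / (\<alpha> - 2)) * T powr (\<alpha> - 2) + A powr (\<alpha> - 1) * (\<epsilon> / T) =
          (\<epsilon> * (\<alpha> / (\<alpha> - 2)) + 4 powr (\<alpha> - 1) * (\<epsilon> * \<epsilon> powr (\<alpha> - 1))) * T powr (\<alpha> - 2)"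
        by (simp add: distrib_right)
      have "\<epsilon> * (\<alpha> / (\<alpha> - 2)) + 4 powr (\<alpha> - 1) * (\<epsilon> * \<epsilon> powr (\<alpha> - 1)) \<le> Q"
      proof -
        have "Q = \<epsilon> * (\<alpha> / (\<alpha> - 2)) + 4 powr (\<alpha> - 1) * (\<epsilon> * \<epsilon> powr (\<alpha> - 1)) +
            (\<epsilon> * (\<epsilon> powr (\<alpha> - 1)) * (\<alpha> / (\<alpha> - 2)) + 4 powr (\<alpha> - 1) * \<epsilon>)"
          unfolding Q_def by (simp add: algebra_simps)
        moreover have "0 \<le> \<epsilon> * (\<epsilon> powr (\<alpha> - 1)) * (\<alpha> / (\<alpha> - 2)) + 4 powr (\<alpha> - 1) * \<epsilon>" using \<epsilon> \<alpha> by simp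
        ultimately show ?thesis by linarith
      qed
      then have 2: "(\<epsilon> * (\<alpha> / (\<alpha> - 2)) + 4 powr (\<alpha> - 1) * (\<epsilon> * \<epsilon> powr (\<alpha> - 1))) * T powr (\<alpha> - 2) \<le> Q * T powr (\<alpha> - 2)"
        by (rule mult_right_mono) simp
      have "T powr (\<alpha> - 2) \<le> 2 powr (\<alpha> - 2) * (S powr (\<alpha> - 2) + (\<tau> powr (- 1 / 2)) powr (\<alpha> - 2))"
        unfolding T_def using S \<alpha> by (intro powr_add_le) auto
      also have "(\<tau> powr (- 1 / 2)) powr (\<alpha> - 2) = \<tau> powr (1 - 1 / p)"
      proof -
        have "(- 1 / 2) * (\<alpha> - 2) = 1 - 1 / p" using p by (simp add: \<alpha>_def field_simps)
        then show ?thesis unfolding powr_powr by simp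
      qed
      finally have "Q * T powr (\<alpha> - 2) \<le> Q * (2 powr (\<alpha> - 2) * (S powr (\<alpha> - 2) + \<tau> powr (1 - 1 / p)))"
        using Q0 by (rule mult_left_mono)
      with 1 2 have "S powr \<alpha> + \<epsilon> * (\<alpha> / (\<alpha> - 2)) * T powr (\<alpha> - 2) + A powr (\<alpha> - 1) * (\<epsilon> / T) \<le>
          S powr \<alpha> + Q * (2 powr (\<alpha> - 2) * (S powr (\<alpha> - 2) + \<tau> powr (1 - 1 / p)))" by linarith
      then have "2 powr \<alpha> * (S powr \<alpha> + \<epsilon> * (\<alpha> / (\<alpha> - 2)) * T powr (\<alpha> - 2) + A powr (\<alpha> - 1) * (\<epsilon> / T)) \<le>
          2 powr \<alpha> * (S powr \<alpha> + Q * (2 powr (\<alpha> - 2) * (S powr (\<alpha> - 2) + \<tau> powr (1 - 1 / p))))"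
        by (rule mult_left_mono) simp
      also have "\<dots> = K + 2 powr \<alpha> * 2 powr (\<alpha> - 2) * Q * \<tau> powr (1 - 1 / p)"
        unfolding K_def by (simp add: algebra_simps)
      finally show "2 powr \<alpha> * (S powr \<alpha> + \<epsilon> * (\<alpha> / (\<alpha> - 2)) * T powr (\<alpha> - 2) + A powr (\<alpha> - 1) * (\<epsilon> / T)) \<le>
          K + 2 powr \<alpha> * 2 powr (\<alpha> - 2) * Q * \<tau> powr (1 - 1 / p)" .
    qed
    finally show ?thesis by (simp add: \<tau>_def)
  qed
  then show ?thesis using K0 unfolding Q_def by (auto simp: mult.assoc)
qed

text \<open>The theorem of Hardy and Littlewood on integral means, in terms of \<open>\<tau> = 1 - r\<^sup>2\<close>.\<close>

lemma nn_integral_mean1_le: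
  fixes p :: real and v :: "complex \<Rightarrow> real"
  defines "\<alpha> \<equiv> 2 / p" and "\<beta> \<equiv> 1 / p"
  assumes p: "0 < p" "p < 1" and v: "integrable circle_measure v" "\<And>\<zeta>. 0 \<le> v \<zeta>"
    and f: "\<And>z. cmod z < 1 \<Longrightarrow> log_plus (cmod (f z)) \<le> (LINT \<zeta>|circle_measure. poisson z \<zeta> * v \<zeta>)"
    and v2: "(\<integral>\<^sup>+\<zeta>. ennreal (exp (p * v \<zeta>)) \<partial>circle_measure) \<le> 2"
  shows "(\<integral>\<^sup>+\<tau>\<in>{0<..<1}. ennreal (\<tau> powr (\<beta> - 2)) * mean1 (sqrt (1 - \<tau>)) f \<partial>lborel) \<le>
    ennreal (2 * 2 powr \<alpha> * (1 / (\<beta> - 1) + 1 + 2 * 8 powr (\<alpha> - 1)))"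
proof -
  have \<beta>: "1 < \<beta>" "\<alpha> = 2 * \<beta>" using p by (simp_all add: \<beta>_def \<alpha>_def)
  define w where "w \<zeta> = exp (p / 2 * v \<zeta>)" for \<zeta>
  have [measurable]: "v \<in> borel_measurable circle_measure" using v by auto
  have [measurable]: "w \<in> borel_measurable circle_measure" unfolding w_def by measurable
  have w1: "1 \<le> w \<zeta>" for \<zeta> unfolding w_def using p v(2)[of \<zeta>] by simp
  have wsq: "exp (p * v \<zeta>) = (w \<zeta>)\<^sup>2" for \<zeta> unfolding w_def by (simp flip: exp_double)
  \<comment> \<open>Here the truncation level \<tau>^(-1/2) moves with \<tau>. After exchanging the
    integrals, an elementary integral in \<tau> remains for each \<zeta>.\<close>
  define G where "G \<tau> \<zeta> = 2 powr \<alpha> * (\<tau> powr (\<beta> - 2) * (min (w \<zeta>) (\<tau> powr (- 1 / 2)) powr \<alpha> +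
    (8 * \<tau> powr (- 1 / 2)) powr (\<alpha> - 1) * max 0 (w \<zeta> - \<tau> powr (- 1 / 2))))" for \<tau> \<zeta>
  have G0: "0 \<le> G \<tau> \<zeta>" for \<tau> \<zeta> by (simp add: G_def)
  define D where "D = 1 / (\<beta> - 1) + 1 + 2 * 8 powr (\<alpha> - 1)"
  have D0: "0 \<le> D" using \<beta> by (simp add: D_def)
  have mean: "ennreal (\<tau> powr (\<beta> - 2)) * mean1 (sqrt (1 - \<tau>)) f \<le> (\<integral>\<^sup>+\<zeta>. ennreal (G \<tau> \<zeta>) \<partial>circle_measure)"
    if \<tau>: "0 < \<tau>" "\<tau> < 1" for \<tau>
  proof -
    define T where "T = \<tau> powr (- 1 / 2)"
    have T1: "1 \<le> T"
      using powr_mono'[of "- 1 / 2" 0 \<tau>] \<tau> by (simp add: T_def)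
    have \<tau>T: "\<tau> * T * T = 1" unfolding T_def
      using \<tau> by (simp add: powr_minus divide_simps mult.assoc flip: powr_add)
    have r2: "1 - (sqrt (1 - \<tau>))\<^sup>2 = \<tau>" using \<tau> by simp
    have ex: "(\<integral>\<^sup>+\<zeta>. ennreal (max 0 (w \<zeta> - T)) \<partial>circle_measure) \<le> ennreal (2 / T)"
    proof -
      have "max 0 (w \<zeta> - T) \<le> (w \<zeta>)\<^sup>2 / T" for \<zeta>
      proof (cases "w \<zeta> \<le> T")
        case False
        then have "w \<zeta> * T \<le> w \<zeta> * w \<zeta>" using w1[of \<zeta>] by (intro mult_left_mono) auto
        then have "w \<zeta> \<le> (w \<zeta>)\<^sup>2 / T" using T1 by (simp add: field_simps power2_eq_square)
        then show ?thesis using T1 False by linarith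
      qed (use T1 in auto)
      then have "(\<integral>\<^sup>+\<zeta>. ennreal (max 0 (w \<zeta> - T)) \<partial>circle_measure) \<le> (\<integral>\<^sup>+\<zeta>. ennreal (1 / T) * ennreal ((w \<zeta>)\<^sup>2) \<partial>circle_measure)"
        using T1 by (intro nn_integral_mono) (auto simp flip: ennreal_mult intro!: ennreal_leI)
      also have "\<dots> = ennreal (1 / T) * (\<integral>\<^sup>+\<zeta>. ennreal ((w \<zeta>)\<^sup>2) \<partial>circle_measure)"
        by (rule nn_integral_cmult) measurable
      also have "\<dots> \<le> ennreal (1 / T) * 2" using v2 unfolding wsq by (rule mult_left_mono) simp
      also have "\<dots> = ennreal (2 / T)"
        using T1 by (simp flip: ennreal_numeral ennreal_mult)
      finally show ?thesis .
    qed
    \<comment> \<open>8 T is 4 / \<tau> times the excess bound 2 / T, since 1 / \<tau> =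
      T^2.\<close>
    have A: "ennreal (4 / (1 - (sqrt (1 - \<tau>))\<^sup>2)) * (\<integral>\<^sup>+\<zeta>. ennreal (max 0 (w \<zeta> - T)) \<partial>circle_measure) \<le> ennreal (8 * T)"
    proof -
      have "ennreal (4 / \<tau>) * (\<integral>\<^sup>+\<zeta>. ennreal (max 0 (w \<zeta> - T)) \<partial>circle_measure) \<le> ennreal (4 / \<tau>) * ennreal (2 / T)"
        by (intro mult_left_mono ex) simp
      also have "\<dots> = ennreal (8 / (\<tau> * T))" using \<tau> T1 by (simp flip: ennreal_mult)
      also have "8 / (\<tau> * T) = 8 * T" using \<tau>T \<tau> T1 by (simp add: field_simps)
      finally show ?thesis unfolding r2 .
    qed
    have "mean1 (sqrt (1 - \<tau>)) f \<le> ennreal (2 powr \<alpha>) * ((\<integral>\<^sup>+\<zeta>. ennreal (min (w \<zeta>) T powr \<alpha>) \<partial>circle_measure) +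
        ennreal ((8 * T) powr (\<alpha> - 1)) * (\<integral>\<^sup>+\<zeta>. ennreal (max 0 (w \<zeta> - T)) \<partial>circle_measure))"
      using mean1_le_truncation[OF p v f _ _ T1, of "sqrt (1 - \<tau>)" "8 * T"] A \<tau> T1 unfolding w_def \<alpha>_def by simp
    also have "\<dots> = (\<integral>\<^sup>+\<zeta>. ennreal (2 powr \<alpha>) * (ennreal (min (w \<zeta>) T powr \<alpha>) +
        ennreal ((8 * T) powr (\<alpha> - 1)) * ennreal (max 0 (w \<zeta> - T))) \<partial>circle_measure)"
      by (simp add: nn_integral_cmult nn_integral_add)
    finally have "ennreal (\<tau> powr (\<beta> - 2)) * mean1 (sqrt (1 - \<tau>)) f \<le> ennreal (\<tau> powr (\<beta> - 2)) * \<dots>"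
      by (rule mult_left_mono) simp
    also have "\<dots> = (\<integral>\<^sup>+\<zeta>. ennreal (\<tau> powr (\<beta> - 2)) * (ennreal (2 powr \<alpha>) * (ennreal (min (w \<zeta>) T powr \<alpha>) +
        ennreal ((8 * T) powr (\<alpha> - 1)) * ennreal (max 0 (w \<zeta> - T)))) \<partial>circle_measure)"
      by (rule nn_integral_cmult[symmetric]) measurable
    also have "\<dots> = (\<integral>\<^sup>+\<zeta>. ennreal (G \<tau> \<zeta>) \<partial>circle_measure)"
      unfolding G_def T_def[symmetric]
    proof (rule nn_integral_cong)
      have e: "ennreal b * (ennreal a * (ennreal c + ennreal d * ennreal e)) = ennreal (a * (b * (c + d * e)))"
        if "0 \<le> a" "0 \<le> b" "0 \<le> c" "0 \<le> d" "0 \<le> e" for a b c d e :: real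
        using that by (simp add: mult_ac flip: ennreal_mult ennreal_plus)
      show "ennreal (\<tau> powr (\<beta> - 2)) * (ennreal (2 powr \<alpha>) * (ennreal (min (w \<zeta>) T powr \<alpha>) +
          ennreal ((8 * T) powr (\<alpha> - 1)) * ennreal (max 0 (w \<zeta> - T)))) =
          ennreal (2 powr \<alpha> * (\<tau> powr (\<beta> - 2) * (min (w \<zeta>) T powr \<alpha> + (8 * T) powr (\<alpha> - 1) * max 0 (w \<zeta> - T))))" for \<zeta>
        by (rule e) auto
    qed
    finally show ?thesis .
  qed
  have inner: "(\<integral>\<^sup>+\<tau>\<in>{0<..<1}. ennreal (G \<tau> \<zeta>) \<partial>lborel) \<le> ennreal (2 powr \<alpha> * D) * ennreal ((w \<zeta>)\<^sup>2)" for \<zeta>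
  proof -
    define x where "x = w \<zeta>"
    have x: "1 \<le> x" using w1 by (simp add: x_def)
    \<comment> \<open>At \<tau> = b the level \<tau>^(-1/2) equals x. For \<tau> up to b nothing is
      cut off; beyond b the truncated part and the excess leave \<tau>^(-2) and x \<tau>^(-3/2).
      Each of the three integrals is a multiple of x^2, and these multiples are the three summands
      of \<open>D\<close>.\<close>
    define b where "b = x powr - 2"
    have b: "0 < b" using x by (simp add: b_def)
    have bT: "\<tau> powr (- 1 / 2) \<ge> x" if "0 < \<tau>" "\<tau> \<le> b" for \<tau>
      using powr_mono2'[of "- 1 / 2" \<tau> b] that x by (simp add: b_def powr_powr)
    have "ennreal (G \<tau> \<zeta>) * indicator {0<..<1} \<tau> \<le>
        ennreal (2 powr \<alpha> * x powr \<alpha>) * (ennreal (\<tau> powr (\<beta> - 2)) * indicator {0..b} \<tau>) +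
        (ennreal (2 powr \<alpha>) * (ennreal (\<tau> powr - 2) * indicator {b..} \<tau>) +
         ennreal (2 powr \<alpha> * 8 powr (\<alpha> - 1) * x) * (ennreal (\<tau> powr (- 3 / 2)) * indicator {b..} \<tau>))"
      (is "_ \<le> ?R1 + (?R2 + ?R3)") for \<tau>
    proof -
      consider "\<tau> \<le> 0 \<or> 1 \<le> \<tau>" | "0 < \<tau>" "\<tau> < 1" "\<tau> \<le> b" | "0 < \<tau>" "\<tau> < 1" "b < \<tau>" by linarith
      then show ?thesis
      proof cases
        case 2
        have "G \<tau> \<zeta> = 2 powr \<alpha> * x powr \<alpha> * \<tau> powr (\<beta> - 2)"
          unfolding G_def x_def[symmetric] using bT[OF 2(1,3)] by (simp add: min_def max_def)
        then have "ennreal (G \<tau> \<zeta>) * indicator {0<..<1} \<tau> = ?R1"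
          using 2 by (simp add: ennreal_mult)
        then show ?thesis by (simp add: add_increasing2)
      next
        case 3
        have "min x (\<tau> powr (- 1 / 2)) powr \<alpha> \<le> (\<tau> powr (- 1 / 2)) powr \<alpha>"
          using x \<beta> by (intro powr_mono2) auto
        also have "\<dots> = \<tau> powr - \<beta>" by (simp add: powr_powr \<beta>(2))
        finally have m1: "min x (\<tau> powr (- 1 / 2)) powr \<alpha> \<le> \<tau> powr - \<beta>" .
        have "(8 * \<tau> powr (- 1 / 2)) powr (\<alpha> - 1) * max 0 (x - \<tau> powr (- 1 / 2)) \<le> (8 * \<tau> powr (- 1 / 2)) powr (\<alpha> - 1) * x"
          using x by (intro mult_left_mono) auto
        also have "\<dots> = 8 powr (\<alpha> - 1) * x * \<tau> powr (1 / 2 - \<beta>)"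
        proof -
          have "(- 1 / 2) * (\<alpha> - 1) = 1 / 2 - \<beta>" unfolding \<beta>(2) by (simp add: field_simps)
          then show ?thesis by (simp add: powr_mult powr_powr mult_ac)
        qed
        finally have m2: "(8 * \<tau> powr (- 1 / 2)) powr (\<alpha> - 1) * max 0 (x - \<tau> powr (- 1 / 2)) \<le> 8 powr (\<alpha> - 1) * x * \<tau> powr (1 / 2 - \<beta>)" .
        have "G \<tau> \<zeta> \<le> 2 powr \<alpha> * (\<tau> powr (\<beta> - 2) * (\<tau> powr - \<beta> + 8 powr (\<alpha> - 1) * x * \<tau> powr (1 / 2 - \<beta>)))"
          unfolding G_def x_def[symmetric] using m1 m2 by (intro mult_left_mono add_mono) auto
        also have "\<dots> = 2 powr \<alpha> * (\<tau> powr (\<beta> - 2) * \<tau> powr - \<beta>) +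
            2 powr \<alpha> * 8 powr (\<alpha> - 1) * x * (\<tau> powr (\<beta> - 2) * \<tau> powr (1 / 2 - \<beta>))"
          by (simp add: algebra_simps)
        also have "\<dots> = 2 powr \<alpha> * \<tau> powr - 2 + 2 powr \<alpha> * 8 powr (\<alpha> - 1) * x * \<tau> powr (- 3 / 2)"
          by (simp flip: powr_add)
        finally have "ennreal (G \<tau> \<zeta>) \<le> ?R2 + ?R3"
          using 3 x by (simp add: ennreal_leI flip: ennreal_mult ennreal_plus)
        then show ?thesis using 3 by (simp add: add_increasing)
      qed auto
    qed
    then have "(\<integral>\<^sup>+\<tau>\<in>{0<..<1}. ennreal (G \<tau> \<zeta>) \<partial>lborel) \<le> (\<integral>\<^sup>+\<tau>. ennreal (2 powr \<alpha> * x powr \<alpha>) * (ennreal (\<tau> powr (\<beta> - 2)) * indicator {0..b} \<tau>) +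
        (ennreal (2 powr \<alpha>) * (ennreal (\<tau> powr - 2) * indicator {b..} \<tau>) +
         ennreal (2 powr \<alpha> * 8 powr (\<alpha> - 1) * x) * (ennreal (\<tau> powr (- 3 / 2)) * indicator {b..} \<tau>)) \<partial>lborel)"
      by (intro nn_integral_mono)
    also have "\<dots> = ennreal (2 powr \<alpha> * x powr \<alpha>) * (\<integral>\<^sup>+\<tau>\<in>{0..b}. ennreal (\<tau> powr (\<beta> - 2)) \<partial>lborel) +
        (ennreal (2 powr \<alpha>) * (\<integral>\<^sup>+\<tau>\<in>{b..}. ennreal (\<tau> powr - 2) \<partial>lborel) +
         ennreal (2 powr \<alpha> * 8 powr (\<alpha> - 1) * x) * (\<integral>\<^sup>+\<tau>\<in>{b..}. ennreal (\<tau> powr (- 3 / 2)) \<partial>lborel))"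
      by (simp add: nn_integral_add nn_integral_cmult)
    also have "\<dots> = ennreal (2 powr \<alpha> * x powr \<alpha>) * ennreal (b powr (\<beta> - 1) / (\<beta> - 1)) +
        (ennreal (2 powr \<alpha>) * ennreal (b powr - 1) +
         ennreal (2 powr \<alpha> * 8 powr (\<alpha> - 1) * x) * ennreal (2 * b powr (- 1 / 2)))"
    proof -
      have "(\<integral>\<^sup>+\<tau>\<in>{0..b}. ennreal (\<tau> powr (\<beta> - 2)) \<partial>lborel) = ennreal (b powr (\<beta> - 1) / (\<beta> - 1))"
        using nn_integral_powr_Icc[of "\<beta> - 2" b] \<beta> b by simp
      moreover have "(\<integral>\<^sup>+\<tau>\<in>{b..}. ennreal (\<tau> powr - 2) \<partial>lborel) = ennreal (b powr - 1)"
        using nn_integral_powr_Ici[of "- 2" b] b by simp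
      moreover have "(\<integral>\<^sup>+\<tau>\<in>{b..}. ennreal (\<tau> powr (- 3 / 2)) \<partial>lborel) = ennreal (2 * b powr (- 1 / 2))"
        using nn_integral_powr_Ici[of "- 3 / 2" b] b by (simp add: mult.commute)
      ultimately show ?thesis by (simp only:)
    qed
    also have "\<dots> = ennreal (2 powr \<alpha> * x powr \<alpha> * (b powr (\<beta> - 1) / (\<beta> - 1)) +
        (2 powr \<alpha> * b powr - 1 + 2 powr \<alpha> * 8 powr (\<alpha> - 1) * x * (2 * b powr (- 1 / 2))))"
      using x \<beta> by (simp flip: ennreal_mult ennreal_plus)
    also have "2 powr \<alpha> * x powr \<alpha> * (b powr (\<beta> - 1) / (\<beta> - 1)) +
        (2 powr \<alpha> * b powr - 1 + 2 powr \<alpha> * 8 powr (\<alpha> - 1) * x * (2 * b powr (- 1 / 2))) = 2 powr \<alpha> * D * x\<^sup>2"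
    proof -
      have e1: "x powr \<alpha> * b powr (\<beta> - 1) = x\<^sup>2"
        using x unfolding b_def powr_powr by (simp add: \<beta>(2) flip: powr_add powr_numeral)
      have e2: "b powr - 1 = x\<^sup>2" using x unfolding b_def powr_powr by (simp flip: powr_numeral)
      have e3: "x * b powr (- 1 / 2) = x\<^sup>2" using x unfolding b_def powr_powr by (simp add: power2_eq_square)
      have "2 powr \<alpha> * x powr \<alpha> * (b powr (\<beta> - 1) / (\<beta> - 1)) +
          (2 powr \<alpha> * b powr - 1 + 2 powr \<alpha> * 8 powr (\<alpha> - 1) * x * (2 * b powr (- 1 / 2))) =
          2 powr \<alpha> * ((x powr \<alpha> * b powr (\<beta> - 1)) / (\<beta> - 1) + b powr - 1 + 2 * 8 powr (\<alpha> - 1) * (x * b powr (- 1 / 2)))"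
        by (simp add: algebra_simps)
      also have "\<dots> = 2 powr \<alpha> * (D * x\<^sup>2)"
        unfolding e1 e2 e3 D_def by (simp add: algebra_simps)
      finally show ?thesis by simp
    qed
    finally show ?thesis using D0 by (simp add: x_def ennreal_mult)
  qed
  have "(\<integral>\<^sup>+\<tau>\<in>{0<..<1}. ennreal (\<tau> powr (\<beta> - 2)) * mean1 (sqrt (1 - \<tau>)) f \<partial>lborel) \<le>
      (\<integral>\<^sup>+\<tau>. (\<integral>\<^sup>+\<zeta>. ennreal (G \<tau> \<zeta>) * indicator {0<..<1} \<tau> \<partial>circle_measure) \<partial>lborel)"
    by (intro nn_integral_mono) (use mean in \<open>auto simp: indicator_def\<close>)
  also have "\<dots> = (\<integral>\<^sup>+\<zeta>. (\<integral>\<^sup>+\<tau>\<in>{0<..<1}. ennreal (G \<tau> \<zeta>) \<partial>lborel) \<partial>circle_measure)"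
    unfolding G_def by (rule circle_line.Fubini') measurable
  also have "\<dots> \<le> (\<integral>\<^sup>+\<zeta>. ennreal (2 powr \<alpha> * D) * ennreal ((w \<zeta>)\<^sup>2) \<partial>circle_measure)"
    by (intro nn_integral_mono inner)
  also have "\<dots> = ennreal (2 powr \<alpha> * D) * (\<integral>\<^sup>+\<zeta>. ennreal ((w \<zeta>)\<^sup>2) \<partial>circle_measure)"
    by (rule nn_integral_cmult) measurable
  also have "\<dots> \<le> ennreal (2 powr \<alpha> * D) * 2"
    using v2 unfolding wsq by (rule mult_left_mono) simp
  also have "\<dots> = ennreal (2 * 2 powr \<alpha> * D)"
    using D0 by (simp add: mult_ac flip: ennreal_numeral ennreal_mult)
  finally show ?thesis unfolding D_def .
qed

section \<open>Fractional derivatives and Bloch type spaces\<close>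

lemma analytic_disc_bounded:
  assumes "a \<in> analytic_disc" "0 \<le> r" "r < 1"
  shows "\<exists>B. \<forall>n. cmod (a n) * r ^ n \<le> B"
proof -
  have "summable (\<lambda>n. a n * of_real r ^ n)"
    using analytic_disc_sums[OF assms(1), of "of_real r"] assms by (auto simp: sums_iff)
  then have "Bseq (\<lambda>n. a n * of_real r ^ n)"
    by (intro convergent_imp_Bseq) (auto dest: summable_LIMSEQ_zero simp: convergent_def)
  then obtain B where "\<forall>n. norm (a n * of_real r ^ n) \<le> B" by (auto simp: Bseq_def)
  then show ?thesis using assms by (auto simp: norm_mult norm_power)
qed

lemma analytic_discI:
  assumes "\<And>r. 0 < r \<Longrightarrow> r < 1 \<Longrightarrow> \<exists>B. \<forall>n. cmod (a n) * r ^ n \<le> B"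
  shows "a \<in> analytic_disc"
proof -
  have "summable (\<lambda>n. a n * z ^ n)" if z: "z \<in> ball 0 1" for z
  proof -
    obtain r where r: "cmod z < r" "r < 1" using z dense by auto
    then obtain B where "\<forall>n. cmod (a n) * r ^ n \<le> B" using assms[of r] norm_ge_zero[of z] by auto
    then have "summable (\<lambda>n. norm (a n) * cmod z ^ n)" using r by (intro Abel_lemma[of _ r]) auto
    then show ?thesis by (intro summable_norm_cancel[of "\<lambda>n. a n * z ^ n"]) (simp add: norm_mult norm_power)
  qed
  then have sums: "(\<lambda>n. a n * z ^ n) sums disc_fun a z" if "z \<in> ball 0 1" for z
    unfolding disc_fun_def using that by (blast intro: summable_sums)
  then have "disc_fun a holomorphic_on ball 0 1"
    by (intro power_series_holomorphic[of 0 1 a]) simp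
  with sums show ?thesis unfolding analytic_disc_def by blast
qed

lemma analytic_disc_norm_summable:
  assumes "a \<in> analytic_disc" "0 \<le> r" "r < 1"
  shows "summable (\<lambda>n. cmod (a n) * r ^ n)"
proof -
  obtain s where s: "r < s" "s < 1" using assms dense by blast
  obtain B where "\<forall>n. cmod (a n) * s ^ n \<le> B" using analytic_disc_bounded[OF assms(1)] s assms by fastforce
  then show ?thesis using s assms by (intro Abel_lemma[of _ s]) auto
qed

lemma analytic_disc_mult:
  assumes "a \<in> analytic_disc" "b \<in> analytic_disc"
  shows "(\<lambda>n. a n * b n) \<in> analytic_disc"
proof (rule analytic_discI)
  fix r :: real assume r: "0 < r" "r < 1"
  have sr: "0 \<le> sqrt r" "sqrt r < 1" using r by auto
  obtain A where A: "\<And>n. cmod (a n) * sqrt r ^ n \<le> A" using analytic_disc_bounded[OF assms(1) sr] by blast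
  obtain B where B: "\<And>n. cmod (b n) * sqrt r ^ n \<le> B" using analytic_disc_bounded[OF assms(2) sr] by blast
  have "0 \<le> A" using order_trans[OF _ A[of 0]] by simp
  then have "(cmod (a n) * sqrt r ^ n) * (cmod (b n) * sqrt r ^ n) \<le> A * B" for n
    using r by (intro mult_mono A B) auto
  moreover have "sqrt r ^ n * sqrt r ^ n = r ^ n" for n using r by (simp flip: power_mult_distrib)
  moreover have "cmod (a n * b n) * r ^ n = (cmod (a n) * sqrt r ^ n) * (cmod (b n) * sqrt r ^ n)" for n
    using \<open>sqrt r ^ n * sqrt r ^ n = r ^ n\<close> by (simp add: norm_mult mult_ac)
  ultimately have "cmod (a n * b n) * r ^ n \<le> A * B" for n by simp
  then show "\<exists>B. \<forall>n. cmod (a n * b n) * r ^ n \<le> B" by blast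
qed

lemma binomial_kernel_sums:
  fixes s :: real and z :: complex
  assumes "0 < s" "cmod z < 1"
  shows "(\<lambda>n. of_real (Gamma (real n + s) / fact n) * z ^ n) sums
    (of_real (Gamma s) * (1 - z) powr (- of_real s))"
proof -
  have G: "Gamma s > 0" using assms by simp
  have s: "complex_of_real s \<notin> \<int>\<^sub>\<le>\<^sub>0"
    using assms nonpos_Ints_nonpos[of s] by (auto simp: of_real_in_nonpos_Ints_iff)
  have "(\<lambda>n. ((- of_real s) gchoose n) * (- z) ^ n) sums (1 + (- z)) powr (- of_real s)"
    by (rule gen_binomial_complex) (use assms in simp)
  then have "(\<lambda>n. of_real (Gamma s) * (((- of_real s) gchoose n) * (- z) ^ n)) sums
      (of_real (Gamma s) * (1 - z) powr (- of_real s))"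
    by (intro sums_mult) simp
  also have "(\<lambda>n. of_real (Gamma s) * (((- of_real s) gchoose n) * (- z) ^ n)) =
      (\<lambda>n. of_real (Gamma (real n + s) / fact n) * z ^ n)"
  proof
    fix n
    have "((- of_real s) gchoose n) * (- z) ^ n = ((- 1) ^ n * (- 1) ^ n) * (pochhammer (of_real s) n / fact n * z ^ n)"
      unfolding gbinomial_pochhammer power_minus[of z] minus_minus times_divide_eq_right times_divide_eq_left
      by (simp only: mult_ac)
    also have "(- 1) ^ n * (- 1) ^ n = (1 :: complex)" by (simp flip: power_mult_distrib)
    finally have "((- of_real s) gchoose n) * (- z) ^ n = pochhammer (of_real s) n / fact n * z ^ n" by (simp only: mult_1)
    moreover have "pochhammer (complex_of_real s) n = of_real (Gamma (real n + s)) / of_real (Gamma s)"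
    proof -
      have "complex_of_real s + of_nat n = of_real (real n + s)" by simp
      then show ?thesis unfolding pochhammer_Gamma[OF s] by (simp only: Gamma_complex_of_real)
    qed
    ultimately show "of_real (Gamma s) * (((- of_real s) gchoose n) * (- z) ^ n) =
        of_real (Gamma (real n + s) / fact n) * z ^ n"
      using G by simp
  qed
  finally show ?thesis .
qed

lemma Gamma_coeff_analytic:
  assumes "0 \<le> \<beta>"
  shows "(\<lambda>n. complex_of_real (Gamma (real n + \<beta> + 1) / fact n)) \<in> analytic_disc"
proof (rule analytic_discI)
  fix r :: real assume r: "0 < r" "r < 1"
  let ?c = "\<lambda>n. complex_of_real (Gamma (real n + (\<beta> + 1)) / fact n)"
  have "summable (\<lambda>n. ?c n * of_real r ^ n)"
    using binomial_kernel_sums[of "\<beta> + 1" "of_real r"] assms r by (auto simp: sums_iff)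
  then have "Bseq (\<lambda>n. ?c n * of_real r ^ n)"
    by (intro convergent_imp_Bseq) (auto dest: summable_LIMSEQ_zero simp: convergent_def)
  then obtain B where "\<forall>n. norm (?c n * of_real r ^ n) \<le> B" unfolding Bseq_def by blast
  then show "\<exists>B. \<forall>n. cmod (complex_of_real (Gamma (real n + \<beta> + 1) / fact n)) * r ^ n \<le> B"
    using r unfolding norm_mult norm_power norm_of_real add.assoc by auto
qed

lemma frac_deriv_analytic: "0 \<le> \<beta> \<Longrightarrow> a \<in> analytic_disc \<Longrightarrow> frac_deriv \<beta> a \<in> analytic_disc"
  unfolding frac_deriv_def[abs_def] by (intro analytic_disc_mult Gamma_coeff_analytic)

lemma set_integral_Beta:
  fixes a b :: real
  assumes "0 < a" "0 < b"
  shows "set_integrable lborel {0<..<1} (\<lambda>\<tau>. \<tau> powr (a - 1) * (1 - \<tau>) powr (b - 1))"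
    and "(LINT \<tau>:{0<..<1}|lborel. \<tau> powr (a - 1) * (1 - \<tau>) powr (b - 1)) = Beta a b"
proof -
  show i: "set_integrable lborel {0<..<1} (\<lambda>\<tau>. \<tau> powr (a - 1) * (1 - \<tau>) powr (b - 1))"
    by (rule set_integrable_subset[OF integrable_Beta[OF assms]]) auto
  have "((\<lambda>\<tau>. \<tau> powr (a - 1) * (1 - \<tau>) powr (b - 1)) has_integral Beta a b) {0<..<1}"
    using has_integral_Beta_real[of a b] assms by (simp add: has_integral_Icc_iff_Ioo)
  then show "(LINT \<tau>:{0<..<1}|lborel. \<tau> powr (a - 1) * (1 - \<tau>) powr (b - 1)) = Beta a b"
    using set_borel_integral_eq_integral(2)[OF i] by (simp add: integral_unique)
qed

text \<open>By the Beta integral, Gamma(\<eta>) times the derivative of order \<gamma> at z is the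
  integral over 0 < \<tau> < 1 of \<tau>^(\<eta> - 1) (1 - \<tau>)^\<gamma> times the derivative of
  order \<gamma> + \<eta> at w = (1 - \<tau>) z. Here 1 - |w| is at least 1 - |z| and at least
  \<tau>; with the first bound for \<tau> <= 1 - |z| and the second beyond, the growth exponent
  drops by \<eta>. The summand K lets one estimate serve for O and for o.\<close>

lemma frac_deriv_integral_bound:
  fixes a :: "nat \<Rightarrow> complex" and \<gamma> \<eta> \<epsilon> K :: real
  assumes a: "a \<in> analytic_disc" and \<gamma>: "0 \<le> \<gamma>" and \<eta>: "0 < \<eta>" and \<epsilon>: "0 \<le> \<epsilon>" and K: "0 \<le> K"
    and bd: "\<And>z. cmod z < 1 \<Longrightarrow> cmod (disc_fun (frac_deriv (\<gamma> + \<eta>) a) z) \<le> \<epsilon> * (1 - cmod z) powr - (\<eta> + 1) + K"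
    and z: "cmod z < 1"
  shows "cmod (disc_fun (frac_deriv \<gamma> a) z) \<le> (1 / \<eta> + 1) / Gamma \<eta> * (\<epsilon> / (1 - cmod z) + K)"
proof -
  define b where "b = frac_deriv (\<gamma> + \<eta>) a"
  have b: "b \<in> analytic_disc" unfolding b_def by (intro frac_deriv_analytic a) (use \<gamma> \<eta> in auto)
  define \<delta> where "\<delta> = 1 - cmod z"
  have \<delta>: "0 < \<delta>" "\<delta> \<le> 1" using z by (auto simp: \<delta>_def)
  have G: "Gamma \<eta> > 0" using \<eta> by simp
  define k where "k \<tau> = indicator {0<..<1} \<tau> * (\<tau> powr (\<eta> - 1) * (1 - \<tau>) powr \<gamma>)" for \<tau> :: real
  have [measurable]: "k \<in> borel_measurable lborel" unfolding k_def by measurable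
  have k0: "0 \<le> k \<tau>" for \<tau> by (simp add: k_def)
  define F where "F n \<tau> = of_real (k \<tau>) * (b n * (of_real (1 - \<tau>) * z) ^ n)" for n \<tau>
  have F: "integrable lborel (F n)" "(LINT \<tau>|lborel. F n \<tau>) = of_real (Gamma \<eta>) * (frac_deriv \<gamma> a n * z ^ n)" for n
  proof -
    have pw: "(1 - \<tau>) ^ n * (1 - \<tau>) powr \<gamma> = (1 - \<tau>) powr (real n + \<gamma> + 1 - 1)" if "\<tau> \<in> {0<..<1}" for \<tau> :: real
      using that by (simp add: powr_add powr_realpow)
    have eq: "F n \<tau> = of_real (indicator {0<..<1} \<tau> *\<^sub>R (\<tau> powr (\<eta> - 1) * (1 - \<tau>) powr (real n + \<gamma> + 1 - 1))) * (b n * z ^ n)" for \<tau>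
    proof (cases "\<tau> \<in> {0<..<1}")
      case True
      show ?thesis unfolding pw[OF True, symmetric] F_def k_def by (simp add: power_mult_distrib mult_ac)
    qed (simp add: F_def k_def)
    have i: "integrable lborel (\<lambda>\<tau>. indicator {0<..<1} \<tau> *\<^sub>R (\<tau> powr (\<eta> - 1) * (1 - \<tau>) powr (real n + \<gamma> + 1 - 1)))"
      using set_integral_Beta(1)[of \<eta> "real n + \<gamma> + 1"] \<eta> \<gamma> unfolding set_integrable_def by simp
    show "integrable lborel (F n)" unfolding eq
      by (intro integrable_mult_left integrable_of_real i)
    have "(LINT \<tau>|lborel. F n \<tau>) = of_real (Beta \<eta> (real n + \<gamma> + 1)) * (b n * z ^ n)"
      unfolding eq integral_mult_left_zero integral_complex_of_real
      using set_integral_Beta(2)[of \<eta> "real n + \<gamma> + 1"] \<eta> \<gamma> unfolding set_lebesgue_integral_def by simp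
    also have "\<dots> = of_real (Gamma \<eta>) * (frac_deriv \<gamma> a n * z ^ n)"
    proof -
      have "Gamma (real n + \<gamma> + \<eta> + 1) > 0" using \<gamma> \<eta> by simp
      then have "Beta \<eta> (real n + \<gamma> + 1) * (Gamma (real n + (\<gamma> + \<eta>) + 1) / fact n) =
          Gamma \<eta> * (Gamma (real n + \<gamma> + 1) / fact n)"
        by (simp add: Beta_def add_ac)
      then have "complex_of_real (Beta \<eta> (real n + \<gamma> + 1)) * of_real (Gamma (real n + (\<gamma> + \<eta>) + 1) / fact n) =
          of_real (Gamma \<eta>) * of_real (Gamma (real n + \<gamma> + 1) / fact n)"
        by (metis of_real_mult)
      then show ?thesis unfolding b_def frac_deriv_def by (metis mult.assoc)
    qed
    finally show "(LINT \<tau>|lborel. F n \<tau>) = of_real (Gamma \<eta>) * (frac_deriv \<gamma> a n * z ^ n)" .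
  qed
  have sb: "summable (\<lambda>n. cmod (b n) * cmod z ^ n)"
    by (rule analytic_disc_norm_summable[OF b]) (use z in auto)
  have Fle: "norm (F n \<tau>) \<le> k \<tau> * (cmod (b n) * cmod z ^ n)" for n \<tau>
  proof (cases "\<tau> \<in> {0<..<1}")
    case True
    have "norm (F n \<tau>) = k \<tau> * (cmod (b n) * ((1 - \<tau>) * cmod z) ^ n)"
      unfolding F_def norm_mult norm_power norm_of_real using k0[of \<tau>] True by simp
    also have "\<dots> \<le> k \<tau> * (cmod (b n) * cmod z ^ n)"
      using True k0[of \<tau>] by (intro mult_left_mono power_mono mult_left_le_one_le) auto
    finally show ?thesis .
  qed (simp add: F_def k_def)
  have ik: "integrable lborel k"
    using set_integral_Beta(1)[of \<eta> "\<gamma> + 1"] \<eta> \<gamma> unfolding set_integrable_def k_def by simp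
  have 1: "AE \<tau> in lborel. summable (\<lambda>n. norm (F n \<tau>))"
    by (intro AE_I2 summable_comparison_test'[OF summable_mult[OF sb]]) (use Fle in auto)
  have 2: "summable (\<lambda>n. LINT \<tau>|lborel. norm (F n \<tau>))"
  proof (rule summable_comparison_test'[OF summable_mult[OF sb]])
    fix n
    have "(LINT \<tau>|lborel. norm (F n \<tau>)) \<le> (LINT \<tau>|lborel. k \<tau> * (cmod (b n) * cmod z ^ n))"
      by (intro integral_mono integrable_norm F integrable_mult_left ik Fle)
    then show "norm (LINT \<tau>|lborel. norm (F n \<tau>)) \<le> (LINT \<tau>|lborel. k \<tau>) * (cmod (b n) * cmod z ^ n)"
      by (simp add: integral_nonneg_AE)
  qed
  have int: "integrable lborel (\<lambda>\<tau>. \<Sum>n. F n \<tau>)" by (rule integrable_suminf[OF F(1) 1 2])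
  have "(\<lambda>n. of_real (Gamma \<eta>) * (frac_deriv \<gamma> a n * z ^ n)) sums (LINT \<tau>|lborel. (\<Sum>n. F n \<tau>))"
    using sums_integral[OF F(1) 1 2] unfolding F(2) .
  moreover have "(\<lambda>n. of_real (Gamma \<eta>) * (frac_deriv \<gamma> a n * z ^ n)) sums (of_real (Gamma \<eta>) * disc_fun (frac_deriv \<gamma> a) z)"
    by (intro sums_mult analytic_disc_sums frac_deriv_analytic a \<gamma> z)
  ultimately have eq: "of_real (Gamma \<eta>) * disc_fun (frac_deriv \<gamma> a) z = (LINT \<tau>|lborel. (\<Sum>n. F n \<tau>))"
    by (rule sums_unique2[symmetric])
  have "ennreal (Gamma \<eta> * cmod (disc_fun (frac_deriv \<gamma> a) z)) = ennreal (norm (LINT \<tau>|lborel. (\<Sum>n. F n \<tau>)))"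
    unfolding eq[symmetric] norm_mult norm_of_real using G by simp
  also have "\<dots> \<le> (\<integral>\<^sup>+\<tau>. ennreal (norm (\<Sum>n. F n \<tau>)) \<partial>lborel)"
    by (rule integral_norm_bound_ennreal[OF int])
  also have "\<dots> \<le> (\<integral>\<^sup>+\<tau>. ennreal (\<epsilon> * \<delta> powr - (\<eta> + 1)) * (ennreal (\<tau> powr (\<eta> - 1)) * indicator {0..\<delta>} \<tau>) +
      (ennreal \<epsilon> * (ennreal (\<tau> powr - 2) * indicator {\<delta>..} \<tau>) +
       ennreal K * (ennreal (\<tau> powr (\<eta> - 1)) * indicator {0..1} \<tau>)) \<partial>lborel)"
  proof (rule nn_integral_mono)
    fix \<tau> :: real
    show "ennreal (norm (\<Sum>n. F n \<tau>)) \<le> ennreal (\<epsilon> * \<delta> powr - (\<eta> + 1)) * (ennreal (\<tau> powr (\<eta> - 1)) * indicator {0..\<delta>} \<tau>) +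
      (ennreal \<epsilon> * (ennreal (\<tau> powr - 2) * indicator {\<delta>..} \<tau>) +
       ennreal K * (ennreal (\<tau> powr (\<eta> - 1)) * indicator {0..1} \<tau>))" (is "_ \<le> ?R1 + (?R2 + ?R3)")
    proof (cases "\<tau> \<in> {0<..<1}")
      case True
      define w where "w = of_real (1 - \<tau>) * z"
      have w: "cmod w = (1 - \<tau>) * cmod z" using True by (simp add: w_def norm_mult del: of_real_diff)
      have "cmod w \<le> cmod z" using True unfolding w by (simp add: mult_left_le_one_le)
      moreover have "cmod w \<le> 1 - \<tau>" using True z unfolding w by (simp add: mult_left_le)
      ultimately have w1: "cmod w < 1" "\<delta> \<le> 1 - cmod w" "\<tau> \<le> 1 - cmod w" using z by (auto simp: \<delta>_def)
      have "(\<Sum>n. F n \<tau>) = of_real (k \<tau>) * disc_fun b w"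
        unfolding F_def w_def[symmetric]
        using sums_mult[OF analytic_disc_sums[OF b w1(1)]] by (simp add: sums_iff)
      then have "norm (\<Sum>n. F n \<tau>) = k \<tau> * cmod (disc_fun b w)"
        using k0[of \<tau>] by (simp add: norm_mult)
      also have "\<dots> \<le> \<tau> powr (\<eta> - 1) * (\<epsilon> * (1 - cmod w) powr - (\<eta> + 1) + K)"
      proof (rule mult_mono)
        have "(1 - \<tau>) powr \<gamma> \<le> 1" using True \<gamma> by (intro powr_le1) auto
        then show "k \<tau> \<le> \<tau> powr (\<eta> - 1)" using True by (simp add: k_def mult_left_le)
        show "cmod (disc_fun b w) \<le> \<epsilon> * (1 - cmod w) powr - (\<eta> + 1) + K"
          unfolding b_def by (rule bd[OF w1(1)])
      qed auto
      finally have m: "norm (\<Sum>n. F n \<tau>) \<le> \<tau> powr (\<eta> - 1) * (\<epsilon> * (1 - cmod w) powr - (\<eta> + 1)) + K * \<tau> powr (\<eta> - 1)"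
        by (simp add: algebra_simps)
      show ?thesis
      proof (cases "\<tau> \<le> \<delta>")
        case t: True
        have "(1 - cmod w) powr - (\<eta> + 1) \<le> \<delta> powr - (\<eta> + 1)"
          using w1 \<delta> \<eta> by (intro powr_mono2') auto
        then have "\<tau> powr (\<eta> - 1) * (\<epsilon> * (1 - cmod w) powr - (\<eta> + 1)) \<le> \<epsilon> * \<delta> powr - (\<eta> + 1) * \<tau> powr (\<eta> - 1)"
          using \<epsilon> by (simp add: mult.commute mult_left_mono)
        with m have "ennreal (norm (\<Sum>n. F n \<tau>)) \<le> ennreal (\<epsilon> * \<delta> powr - (\<eta> + 1) * \<tau> powr (\<eta> - 1) + K * \<tau> powr (\<eta> - 1))"
          by (intro ennreal_leI) simp
        also have "\<dots> = ?R1 + ?R3" using True t \<epsilon> K by (simp add: ennreal_plus ennreal_mult)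
        also have "\<dots> \<le> ?R1 + (?R2 + ?R3)" by (intro add_left_mono) (simp add: add_increasing)
        finally show ?thesis .
      next
        case t: False
        have "\<tau> powr (\<eta> - 1) * (1 - cmod w) powr - (\<eta> + 1) \<le> \<tau> powr (\<eta> - 1) * \<tau> powr - (\<eta> + 1)"
          using w1 True \<eta> by (intro mult_left_mono powr_mono2') auto
        also have "\<dots> = \<tau> powr - 2" by (simp flip: powr_add)
        finally have "\<epsilon> * (\<tau> powr (\<eta> - 1) * (1 - cmod w) powr - (\<eta> + 1)) \<le> \<epsilon> * \<tau> powr - 2"
          using \<epsilon> by (rule mult_left_mono)
        with m have "ennreal (norm (\<Sum>n. F n \<tau>)) \<le> ennreal (\<epsilon> * \<tau> powr - 2 + K * \<tau> powr (\<eta> - 1))"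
          by (intro ennreal_leI) (simp add: mult.left_commute)
        also have "\<dots> = ?R2 + ?R3" using True t \<epsilon> K \<delta> by (simp add: ennreal_plus ennreal_mult)
        also have "\<dots> \<le> ?R1 + (?R2 + ?R3)" by (simp add: add_increasing)
        finally show ?thesis .
      qed
    qed (simp add: F_def k_def)
  qed
  also have "\<dots> = ennreal (\<epsilon> * \<delta> powr - (\<eta> + 1)) * (\<integral>\<^sup>+\<tau>\<in>{0..\<delta>}. ennreal (\<tau> powr (\<eta> - 1)) \<partial>lborel) +
      (ennreal \<epsilon> * (\<integral>\<^sup>+\<tau>\<in>{\<delta>..}. ennreal (\<tau> powr - 2) \<partial>lborel) +
       ennreal K * (\<integral>\<^sup>+\<tau>\<in>{0..1}. ennreal (\<tau> powr (\<eta> - 1)) \<partial>lborel))"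
    by (simp add: nn_integral_add nn_integral_cmult)
  also have "\<dots> = ennreal (\<epsilon> * \<delta> powr - (\<eta> + 1)) * ennreal (\<delta> powr \<eta> / \<eta>) + (ennreal \<epsilon> * ennreal (\<delta> powr - 1) + ennreal K * ennreal (1 / \<eta>))"
  proof -
    have "(\<integral>\<^sup>+\<tau>\<in>{0..\<delta>}. ennreal (\<tau> powr (\<eta> - 1)) \<partial>lborel) = ennreal (\<delta> powr \<eta> / \<eta>)"
      using nn_integral_powr_Icc[of "\<eta> - 1" \<delta>] \<eta> \<delta> by simp
    moreover have "(\<integral>\<^sup>+\<tau>\<in>{\<delta>..}. ennreal (\<tau> powr - 2) \<partial>lborel) = ennreal (\<delta> powr - 1)"
      using nn_integral_powr_Ici[of "- 2" \<delta>] \<delta> by simp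
    moreover have "(\<integral>\<^sup>+\<tau>\<in>{0..1}. ennreal (\<tau> powr (\<eta> - 1)) \<partial>lborel) = ennreal (1 / \<eta>)"
      using nn_integral_powr_Icc[of "\<eta> - 1" 1] \<eta> by simp
    ultimately show ?thesis by (simp only:)
  qed
  also have "\<dots> = ennreal (\<epsilon> * \<delta> powr - (\<eta> + 1) * (\<delta> powr \<eta> / \<eta>) + (\<epsilon> * \<delta> powr - 1 + K * (1 / \<eta>)))"
    using \<epsilon> K \<eta> by (simp flip: ennreal_mult ennreal_plus)
  also have "\<epsilon> * \<delta> powr - (\<eta> + 1) * (\<delta> powr \<eta> / \<eta>) + (\<epsilon> * \<delta> powr - 1 + K * (1 / \<eta>)) =
      \<epsilon> / \<delta> * (1 / \<eta> + 1) + K / \<eta>"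
  proof -
    have "\<delta> powr - (\<eta> + 1) * \<delta> powr \<eta> = 1 / \<delta>" "\<delta> powr - 1 = 1 / \<delta>"
      using \<delta> by (simp_all add: powr_minus_divide flip: powr_add)
    then have "\<epsilon> * \<delta> powr - (\<eta> + 1) * (\<delta> powr \<eta> / \<eta>) = \<epsilon> * (1 / \<delta>) / \<eta>" by (metis mult.assoc times_divide_eq_right)
    then show ?thesis using \<open>\<delta> powr - 1 = 1 / \<delta>\<close> by (simp add: algebra_simps)
  qed
  finally have "Gamma \<eta> * cmod (disc_fun (frac_deriv \<gamma> a) z) \<le> \<epsilon> / \<delta> * (1 / \<eta> + 1) + K / \<eta>"
    using \<epsilon> K \<delta> \<eta> by (subst (asm) ennreal_le_iff) auto
  also have "\<dots> \<le> (1 / \<eta> + 1) * (\<epsilon> / \<delta> + K)" using K by (simp add: algebra_simps)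
  finally have "cmod (disc_fun (frac_deriv \<gamma> a) z) \<le> (1 / \<eta> + 1) * (\<epsilon> / \<delta> + K) / Gamma \<eta>"
    using G by (simp add: pos_le_divide_eq mult.commute)
  then show ?thesis by (simp add: \<delta>_def)
qed

section \<open>Fourier coefficients and convolution on the circle\<close>

lemma sums_integral_circle:
  fixes g :: "nat \<Rightarrow> complex \<Rightarrow> complex"
  assumes c: "\<And>n. continuous_on (sphere 0 1) (g n)" and s: "summable B"
    and B: "\<And>n \<zeta>. cmod \<zeta> = 1 \<Longrightarrow> cmod (g n \<zeta>) \<le> B n"
  shows "(\<lambda>n. LINT \<zeta>|circle_measure. g n \<zeta>) sums (LINT \<zeta>|circle_measure. (\<Sum>n. g n \<zeta>))"
proof (rule sums_integral)
  show i: "integrable circle_measure (g n)" for n by (rule integral_circle(1)[OF c])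
  show "AE \<zeta> in circle_measure. summable (\<lambda>n. norm (g n \<zeta>))"
    by (intro AE_I2 summable_comparison_test'[OF s]) (use B in auto)
  show "summable (\<lambda>n. LINT \<zeta>|circle_measure. norm (g n \<zeta>))"
  proof (rule summable_comparison_test'[OF s])
    fix n
    have "(LINT \<zeta>|circle_measure. norm (g n \<zeta>)) \<le> (LINT \<zeta>|circle_measure. B n)"
      by (rule integral_mono) (use i B in auto)
    then show "norm (LINT \<zeta>|circle_measure. norm (g n \<zeta>)) \<le> B n"
      using circle.prob_space by (simp add: integral_nonneg_AE)
  qed
qed

lemma integral_circle_cnj_power:
  "(LINT \<zeta>|circle_measure. cnj \<zeta> ^ n * \<zeta> ^ m) = (if m = n then 1 else 0)"
proof -
  have pos: "(LINT \<zeta>|circle_measure. \<zeta> ^ k) = 0 ^ k" for k :: nat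
  proof -
    have "(LINT \<zeta>|circle_measure. \<zeta> ^ k) = (LINT \<zeta>|circle_measure. \<zeta> ^ k * \<zeta> / (\<zeta> - 0))"
      by (intro Bochner_Integration.integral_cong) auto
    also have "\<dots> = 0 ^ k"
      by (rule circle_Cauchy) (auto intro!: continuous_intros holomorphic_intros)
    finally show ?thesis .
  qed
  have neg: "(LINT \<zeta>|circle_measure. cnj \<zeta> ^ k) = 0 ^ k" for k :: nat
    using integral_bounded_linear[OF bounded_linear_cnj integral_circle(1)[of "\<lambda>\<zeta>. \<zeta> ^ k"]] pos[of k]
    by (simp add: continuous_intros)
  have 1: "\<zeta> ^ j * cnj \<zeta> ^ j = 1" if "\<zeta> \<in> space circle_measure" for \<zeta> j
    using that complex_norm_square[of \<zeta>] by (simp flip: power_mult_distrib)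
  show ?thesis
  proof (cases "n \<le> m")
    case True
    then have "(LINT \<zeta>|circle_measure. cnj \<zeta> ^ n * \<zeta> ^ m) = (LINT \<zeta>|circle_measure. \<zeta> ^ (m - n))"
    proof (intro Bochner_Integration.integral_cong)
      fix \<zeta> :: complex assume "\<zeta> \<in> space circle_measure"
      have "cnj \<zeta> ^ n * \<zeta> ^ m = (\<zeta> ^ n * cnj \<zeta> ^ n) * \<zeta> ^ (m - n)"
        using True power_add[of \<zeta> "m - n" n] by (simp add: mult_ac)
      with 1[OF \<open>\<zeta> \<in> _\<close>] show "cnj \<zeta> ^ n * \<zeta> ^ m = \<zeta> ^ (m - n)" by simp
    qed auto
    then show ?thesis using True by (auto simp: pos)
  next
    case False
    then have "(LINT \<zeta>|circle_measure. cnj \<zeta> ^ n * \<zeta> ^ m) = (LINT \<zeta>|circle_measure. cnj \<zeta> ^ (n - m))"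
    proof (intro Bochner_Integration.integral_cong)
      fix \<zeta> :: complex assume "\<zeta> \<in> space circle_measure"
      have "cnj \<zeta> ^ n * \<zeta> ^ m = (\<zeta> ^ m * cnj \<zeta> ^ m) * cnj \<zeta> ^ (n - m)"
        using False power_add[of "cnj \<zeta>" "n - m" m] by (simp add: mult_ac)
      with 1[OF \<open>\<zeta> \<in> _\<close>] show "cnj \<zeta> ^ n * \<zeta> ^ m = cnj \<zeta> ^ (n - m)" by simp
    qed auto
    then show ?thesis using False by (auto simp: neg)
  qed
qed

lemma disc_fun_continuous_dilate_circle:
  assumes "a \<in> analytic_disc" "0 \<le> r" "r < 1"
  shows "continuous_on (sphere 0 1) (\<lambda>z. disc_fun a (of_real r * z))"
  by (rule continuous_on_subset[OF disc_fun_dilate_continuous[OF assms(1)]]) (use assms in auto)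

lemma integral_cnj_power_disc_fun:
  assumes a: "a \<in> analytic_disc" and r: "0 \<le> r" "r < 1"
  shows "(LINT \<zeta>|circle_measure. cnj \<zeta> ^ n * disc_fun a (of_real r * \<zeta>)) = a n * of_real r ^ n"
proof -
  let ?g = "\<lambda>m \<zeta>. a m * of_real r ^ m * (cnj \<zeta> ^ n * \<zeta> ^ m)"
  have s: "(\<lambda>m. LINT \<zeta>|circle_measure. ?g m \<zeta>) sums (LINT \<zeta>|circle_measure. (\<Sum>m. ?g m \<zeta>))"
    by (rule sums_integral_circle[OF _ analytic_disc_norm_summable[OF a r]])
       (use r in \<open>auto intro!: continuous_intros simp: norm_mult norm_power\<close>)
  have "(LINT \<zeta>|circle_measure. ?g m \<zeta>) = (if m = n then a n * of_real r ^ n else 0)" for m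
    by (simp add: integral_circle_cnj_power)
  then have "(\<lambda>m. LINT \<zeta>|circle_measure. ?g m \<zeta>) sums (a n * of_real r ^ n)"
    using sums_If_finite_set[of "{n}" "\<lambda>m. a m * of_real r ^ m"] by (simp cong: if_cong)
  with s have "(LINT \<zeta>|circle_measure. (\<Sum>m. ?g m \<zeta>)) = a n * of_real r ^ n" by (rule sums_unique2)
  moreover have "(LINT \<zeta>|circle_measure. (\<Sum>m. ?g m \<zeta>)) = (LINT \<zeta>|circle_measure. cnj \<zeta> ^ n * disc_fun a (of_real r * \<zeta>))"
  proof (intro Bochner_Integration.integral_cong refl)
    fix \<zeta> :: complex assume "\<zeta> \<in> space circle_measure"
    then have "cmod (of_real r * \<zeta>) < 1" using r by (simp add: norm_mult)
    have geq: "?g m \<zeta> = cnj \<zeta> ^ n * (a m * (of_real r * \<zeta>) ^ m)" for m by (simp add: power_mult_distrib mult_ac)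
    show "(\<Sum>m. ?g m \<zeta>) = cnj \<zeta> ^ n * disc_fun a (of_real r * \<zeta>)"
      unfolding geq
      by (rule sums_unique[OF sums_mult[OF analytic_disc_sums[OF a \<open>cmod (of_real r * \<zeta>) < 1\<close>]], symmetric])
  qed
  ultimately show ?thesis by simp
qed

text \<open>At r^2 \<omega> the product series is the convolution of the two functions on the circle
  of radius r; one factor is estimated by its supremum, the other one leaves its mean.\<close>

lemma disc_fun_Hadamard_product_bound:
  assumes a: "a \<in> analytic_disc" and b: "b \<in> analytic_disc" and r: "0 \<le> r" "r < 1" and \<omega>: "cmod \<omega> = 1"
    and C: "\<And>z. cmod z = r \<Longrightarrow> cmod (disc_fun b z) \<le> C"
  shows "ennreal (cmod (disc_fun (\<lambda>n. b n * a n) (of_real (r\<^sup>2) * \<omega>))) \<le> ennreal C * mean1 r (disc_fun a)"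
proof -
  let ?f = "\<lambda>\<zeta>. disc_fun a (of_real r * \<zeta>)"
  let ?h = "\<lambda>\<zeta>. disc_fun b (of_real r * (\<omega> * cnj \<zeta>)) * ?f \<zeta>"
  let ?g = "\<lambda>n \<zeta>. b n * (of_real r * \<omega>) ^ n * (cnj \<zeta> ^ n * ?f \<zeta>)"
  have cf: "continuous_on (sphere 0 1) ?f" by (rule disc_fun_continuous_dilate_circle[OF a r])
  have "bounded (?f ` sphere 0 1)" by (intro compact_imp_bounded compact_continuous_image cf compact_sphere)
  then obtain B where B: "\<And>\<zeta>. cmod \<zeta> = 1 \<Longrightarrow> cmod (?f \<zeta>) \<le> B" unfolding bounded_iff by force
  have s: "(\<lambda>n. LINT \<zeta>|circle_measure. ?g n \<zeta>) sums (LINT \<zeta>|circle_measure. (\<Sum>n. ?g n \<zeta>))"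
    by (rule sums_integral_circle[OF _ summable_mult2[OF analytic_disc_norm_summable[OF b r], of B]])
       (use r B \<omega> in \<open>auto intro!: continuous_intros cf mult_left_mono simp: norm_mult norm_power\<close>)
  have sum_h: "(\<Sum>n. ?g n \<zeta>) = ?h \<zeta>" if "cmod \<zeta> = 1" for \<zeta>
  proof -
    have "cmod (of_real r * (\<omega> * cnj \<zeta>)) < 1" using r \<omega> that by (simp add: norm_mult)
    from sums_mult2[OF analytic_disc_sums[OF b this], of "?f \<zeta>"]
    show ?thesis by (simp add: sums_iff power_mult_distrib mult_ac)
  qed
  have gi: "(LINT \<zeta>|circle_measure. ?g n \<zeta>) = b n * a n * (of_real (r\<^sup>2) * \<omega>) ^ n" for n
    unfolding integral_mult_right_zero integral_cnj_power_disc_fun[OF a r]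
    by (simp add: power_mult_distrib power2_eq_square mult_ac)
  have "(\<lambda>n. b n * a n * (of_real (r\<^sup>2) * \<omega>) ^ n) sums (LINT \<zeta>|circle_measure. (\<Sum>n. ?g n \<zeta>))"
    using s unfolding gi .
  then have "disc_fun (\<lambda>n. b n * a n) (of_real (r\<^sup>2) * \<omega>) = (LINT \<zeta>|circle_measure. (\<Sum>n. ?g n \<zeta>))"
    by (simp add: disc_fun_def sums_iff)
  also have "\<dots> = (LINT \<zeta>|circle_measure. ?h \<zeta>)"
    by (intro Bochner_Integration.integral_cong) (use sum_h in auto)
  finally have eq: "disc_fun (\<lambda>n. b n * a n) (of_real (r\<^sup>2) * \<omega>) = (LINT \<zeta>|circle_measure. ?h \<zeta>)" .
  have ch: "continuous_on (sphere 0 1) ?h"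
    by (intro continuous_on_mult cf continuous_on_compose2[OF disc_fun_continuous_dilate_circle[OF b r]] continuous_intros)
       (use \<omega> in \<open>auto simp: norm_mult\<close>)
  have "ennreal (cmod (LINT \<zeta>|circle_measure. ?h \<zeta>)) \<le> (\<integral>\<^sup>+\<zeta>. ennreal (cmod (?h \<zeta>)) \<partial>circle_measure)"
    by (rule integral_norm_bound_ennreal[OF integral_circle(1)[OF ch]])
  also have "\<dots> \<le> (\<integral>\<^sup>+\<zeta>. ennreal C * ennreal (cmod (?f \<zeta>)) \<partial>circle_measure)"
  proof (rule nn_integral_mono)
    fix \<zeta> :: complex assume "\<zeta> \<in> space circle_measure"
    then have "cmod (disc_fun b (of_real r * (\<omega> * cnj \<zeta>))) \<le> C"
      using r \<omega> by (intro C) (simp add: norm_mult)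
    then show "ennreal (cmod (?h \<zeta>)) \<le> ennreal C * ennreal (cmod (?f \<zeta>))"
      by (simp add: norm_mult ennreal_mult'' mult_right_mono ennreal_leI)
  qed
  also have "\<dots> = ennreal C * mean1 r (disc_fun a)"
    unfolding mean1_def by (rule nn_integral_cmult)
      (intro measurable_compose[OF _ measurable_ennreal] measurable_circle measurable_circle_continuous continuous_intros cf)
  finally show ?thesis unfolding eq .
qed

section \<open>Growth characterizations of the Bloch type spaces\<close>

lemma max_modulus_le_iff:
  assumes "0 \<le> C" "0 < r"
  shows "max_modulus r f \<le> ennreal C \<longleftrightarrow> (\<forall>z. cmod z = r \<longrightarrow> cmod (f z) \<le> C)"
proof
  assume m: "max_modulus r f \<le> ennreal C"
  show "\<forall>z. cmod z = r \<longrightarrow> cmod (f z) \<le> C"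
  proof (intro allI impI)
    fix z assume "cmod z = r"
    then have "z / of_real r \<in> sphere 0 1" "of_real r * (z / of_real r) = z" using assms by (auto simp: norm_divide)
    then have "ennreal (cmod (f z)) \<le> max_modulus r f"
      unfolding max_modulus_def by (metis (no_types, lifting) SUP_upper)
    with m have "ennreal (cmod (f z)) \<le> ennreal C" by (rule order_trans[rotated])
    then show "cmod (f z) \<le> C" using assms by simp
  qed
next
  assume "\<forall>z. cmod z = r \<longrightarrow> cmod (f z) \<le> C"
  then show "max_modulus r f \<le> ennreal C"
    unfolding max_modulus_def using assms by (intro SUP_least ennreal_leI) (auto simp: norm_mult)
qed

lemma weighted_max_modulus_le_iff:
  assumes "0 \<le> C" "0 < r" "r < 1"
  shows "ennreal (1 - r) * max_modulus r f \<le> ennreal C \<longleftrightarrow> (\<forall>z. cmod z = r \<longrightarrow> (1 - r) * cmod (f z) \<le> C)"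
proof -
  have "ennreal (1 - r) * max_modulus r f \<le> ennreal C \<longleftrightarrow> max_modulus r f \<le> ennreal (C / (1 - r))"
  proof
    assume "ennreal (1 - r) * max_modulus r f \<le> ennreal C"
    then have "ennreal (1 / (1 - r)) * (ennreal (1 - r) * max_modulus r f) \<le> ennreal (1 / (1 - r)) * ennreal C"
      by (rule mult_left_mono) simp
    then show "max_modulus r f \<le> ennreal (C / (1 - r))"
      using assms by (simp add: mult.assoc[symmetric] flip: ennreal_mult)
  next
    assume "max_modulus r f \<le> ennreal (C / (1 - r))"
    then have "ennreal (1 - r) * max_modulus r f \<le> ennreal (1 - r) * ennreal (C / (1 - r))"
      by (rule mult_left_mono) simp
    then show "ennreal (1 - r) * max_modulus r f \<le> ennreal C"
      using assms by (simp flip: ennreal_mult)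
  qed
  also have "\<dots> \<longleftrightarrow> (\<forall>z. cmod z = r \<longrightarrow> cmod (f z) \<le> C / (1 - r))"
    using assms by (intro max_modulus_le_iff) auto
  finally show ?thesis using assms by (simp add: pos_le_divide_eq mult.commute)
qed

lemma bloch_type_iff:
  assumes "0 \<le> \<beta>"
  shows "a \<in> bloch_type \<beta> \<longleftrightarrow> a \<in> analytic_disc \<and>
    (\<exists>C\<ge>0. \<forall>z. cmod z < 1 \<longrightarrow> cmod (disc_fun (frac_deriv \<beta> a) z) \<le> C / (1 - cmod z))"
proof (intro iffI conjI)
  let ?D = "disc_fun (frac_deriv \<beta> a)"
  assume a: "a \<in> bloch_type \<beta>"
  then show "a \<in> analytic_disc" by (simp add: bloch_type_def)
  from a obtain C where C: "0 \<le> C" "(SUP r\<in>{0<..<1}. ennreal (1 - r) * max_modulus r ?D) = ennreal C"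
    unfolding bloch_type_def by (auto simp: less_top_ennreal)
  \<comment> \<open>The supremum runs over 0 < r < 1 and misses the center, whose value therefore
    enters the constant.\<close>
  have "cmod (?D z) \<le> max C (cmod (?D 0)) / (1 - cmod z)" if z: "cmod z < 1" for z
  proof (cases "z = 0")
    case False
    then have "ennreal (1 - cmod z) * max_modulus (cmod z) ?D \<le> ennreal C"
      unfolding C(2)[symmetric] using z by (intro SUP_upper) auto
    then have "(1 - cmod z) * cmod (?D z) \<le> C"
      using weighted_max_modulus_le_iff[OF C(1), of "cmod z" ?D] z False by simp
    then have "(1 - cmod z) * cmod (?D z) \<le> max C (cmod (?D 0))" by simp
    then show ?thesis using z by (simp add: pos_le_divide_eq mult.commute)
  qed simp
  then show "\<exists>C\<ge>0. \<forall>z. cmod z < 1 \<longrightarrow> cmod (?D z) \<le> C / (1 - cmod z)"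
    using C(1) by (intro exI[of _ "max C (cmod (?D 0))"]) auto
next
  let ?D = "disc_fun (frac_deriv \<beta> a)"
  assume "a \<in> analytic_disc \<and> (\<exists>C\<ge>0. \<forall>z. cmod z < 1 \<longrightarrow> cmod (?D z) \<le> C / (1 - cmod z))"
  then obtain C where a: "a \<in> analytic_disc" and C: "0 \<le> C" "\<And>z. cmod z < 1 \<Longrightarrow> cmod (?D z) \<le> C / (1 - cmod z)" by blast
  have "(SUP r\<in>{0<..<1}. ennreal (1 - r) * max_modulus r ?D) \<le> ennreal C"
    using C by (intro SUP_least) (auto simp: weighted_max_modulus_le_iff pos_le_divide_eq mult.commute)
  then show "a \<in> bloch_type \<beta>" using a unfolding bloch_type_def by (auto simp: le_less_trans)
qed

text \<open>The limit is encoded by bounds \<epsilon> / (1 - |z|) + K with K depending on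
  \<epsilon>. In this form smallness passes through products and fractional integration as a plain
  estimate.\<close>

lemma bloch_type0_iff:
  assumes "0 \<le> \<beta>"
  shows "a \<in> bloch_type0 \<beta> \<longleftrightarrow> a \<in> analytic_disc \<and>
    (\<forall>\<epsilon>>0. \<exists>K\<ge>0. \<forall>z. cmod z < 1 \<longrightarrow> cmod (disc_fun (frac_deriv \<beta> a) z) \<le> \<epsilon> / (1 - cmod z) + K)"
proof (intro iffI conjI)
  let ?D = "disc_fun (frac_deriv \<beta> a)"
  let ?m = "\<lambda>r. ennreal (1 - r) * max_modulus r ?D"
  assume "a \<in> bloch_type0 \<beta>"
  then have a: "a \<in> analytic_disc" and lim: "(?m \<longlongrightarrow> 0) (at_left 1)"
    by (simp_all add: bloch_type0_def bloch_type_def)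
  show "a \<in> analytic_disc" by (fact a)
  show "\<forall>\<epsilon>>0. \<exists>K\<ge>0. \<forall>z. cmod z < 1 \<longrightarrow> cmod (?D z) \<le> \<epsilon> / (1 - cmod z) + K"
  proof (intro allI impI)
    fix \<epsilon> :: real assume "0 < \<epsilon>"
    then have "\<forall>\<^sub>F r in at_left 1. ?m r < ennreal \<epsilon>" using lim by (intro order_tendstoD) auto
    then obtain s where s: "s < 1" "\<And>r. s < r \<Longrightarrow> r < 1 \<Longrightarrow> ?m r < ennreal \<epsilon>"
      unfolding eventually_at_left_field by blast
    have "continuous_on (cball 0 (max s 0)) ?D"
      by (rule continuous_on_subset[OF holomorphic_on_imp_continuous_on[OF analytic_disc_holomorphic[OF frac_deriv_analytic[OF assms a]]]])
         (use s in auto)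
    then have "bounded (?D ` cball 0 (max s 0))" by (intro compact_imp_bounded compact_continuous_image compact_cball)
    then obtain K where K: "\<And>z. cmod z \<le> max s 0 \<Longrightarrow> cmod (?D z) \<le> K" unfolding bounded_iff by force
    have "0 \<le> K" using order_trans[OF norm_ge_zero K[of 0]] by simp
    have "cmod (?D z) \<le> \<epsilon> / (1 - cmod z) + K" if z: "cmod z < 1" for z
    proof (cases "cmod z \<le> max s 0")
      case True
      then show ?thesis using K[OF True] z \<open>0 < \<epsilon>\<close> by (simp add: add_increasing)
    next
      case False
      then have "?m (cmod z) \<le> ennreal \<epsilon>" using s z by (intro less_imp_le) auto
      moreover have "z \<noteq> 0" using False by auto
      ultimately have "(1 - cmod z) * cmod (?D z) \<le> \<epsilon>"
        using weighted_max_modulus_le_iff[of \<epsilon> "cmod z" ?D] \<open>0 < \<epsilon>\<close> z by simp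
      then have "cmod (?D z) \<le> \<epsilon> / (1 - cmod z)" using z by (simp add: pos_le_divide_eq mult.commute)
      then show ?thesis using \<open>0 \<le> K\<close> by simp
    qed
    then show "\<exists>K\<ge>0. \<forall>z. cmod z < 1 \<longrightarrow> cmod (?D z) \<le> \<epsilon> / (1 - cmod z) + K" using \<open>0 \<le> K\<close> by blast
  qed
next
  let ?D = "disc_fun (frac_deriv \<beta> a)"
  let ?m = "\<lambda>r. ennreal (1 - r) * max_modulus r ?D"
  assume "a \<in> analytic_disc \<and> (\<forall>\<epsilon>>0. \<exists>K\<ge>0. \<forall>z. cmod z < 1 \<longrightarrow> cmod (?D z) \<le> \<epsilon> / (1 - cmod z) + K)"
  then have a: "a \<in> analytic_disc"
    and D: "\<And>\<epsilon>. 0 < \<epsilon> \<Longrightarrow> \<exists>K\<ge>0. \<forall>z. cmod z < 1 \<longrightarrow> cmod (?D z) \<le> \<epsilon> / (1 - cmod z) + K" by blast+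
  have "a \<in> bloch_type \<beta>"
  proof -
    obtain K where K: "0 \<le> K" "\<And>z. cmod z < 1 \<Longrightarrow> cmod (?D z) \<le> 1 / (1 - cmod z) + K" using D[of 1] by auto
    have "cmod (?D z) \<le> (1 + K) / (1 - cmod z)" if "cmod z < 1" for z
    proof -
      have "K \<le> K / (1 - cmod z)" using that K(1) by (simp add: pos_le_divide_eq mult_left_le)
      then show ?thesis using K(2)[OF that] by (simp add: add_divide_distrib)
    qed
    then show ?thesis unfolding bloch_type_iff[OF assms] using a K(1) by (intro conjI exI[of _ "1 + K"]) auto
  qed
  moreover have "(?m \<longlongrightarrow> 0) (at_left 1)"
  proof (rule order_tendstoI)
    fix e :: ennreal assume "0 < e"
    then obtain x where x: "0 < x" "x < e" using dense by blast
    then have "x \<noteq> \<top>" by auto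
    then obtain \<epsilon> where "x = ennreal \<epsilon>" by (cases x) auto
    with x have \<epsilon>: "0 < ennreal \<epsilon>" "ennreal \<epsilon> < e" by auto
    then have e0: "0 < \<epsilon>" by simp
    obtain K where K: "0 \<le> K" "\<And>z. cmod z < 1 \<Longrightarrow> cmod (?D z) \<le> \<epsilon> / 2 / (1 - cmod z) + K" using D[of "\<epsilon> / 2"] e0 by auto
    \<comment> \<open>For r > s the term (1 - r) K is at most \<epsilon> / 2.\<close>
    define s where "s = max 0 (1 - \<epsilon> / (2 * (K + 1)))"
    have s: "s < 1" using e0 K by (simp add: s_def)
    have "?m r < e" if "s < r" "r < 1" for r
    proof -
      have r: "0 < r" "r < 1" using that by (auto simp: s_def)
      have "1 - r \<le> \<epsilon> / (2 * (K + 1))" using that by (auto simp: s_def)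
      then have "(1 - r) * (2 * (K + 1)) \<le> \<epsilon>" using K by (simp add: pos_le_divide_eq)
      moreover have "(1 - r) * K \<le> (1 - r) * (K + 1)" using r by (intro mult_left_mono) auto
      moreover have "(1 - r) * (2 * (K + 1)) = 2 * ((1 - r) * (K + 1))" by simp
      ultimately have rK: "(1 - r) * K \<le> \<epsilon> / 2" by linarith
      have "(1 - r) * cmod (?D z) \<le> \<epsilon>" if z: "cmod z = r" for z
      proof -
        have "(1 - r) * cmod (?D z) \<le> (1 - r) * (\<epsilon> / 2 / (1 - r) + K)"
          using K(2)[of z] r z by (intro mult_left_mono) auto
        also have "\<dots> = \<epsilon> / 2 + (1 - r) * K" using r by (simp add: field_simps)
        finally show ?thesis using rK by simp
      qed
      then have "?m r \<le> ennreal \<epsilon>" using weighted_max_modulus_le_iff[of \<epsilon> r ?D] r e0 by simp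
      then show ?thesis using \<epsilon>(2) by (rule le_less_trans)
    qed
    then show "\<forall>\<^sub>F r in at_left 1. ?m r < e" unfolding eventually_at_left_field using s by blast
  qed auto
  ultimately show "a \<in> bloch_type0 \<beta>" by (simp add: bloch_type0_def)
qed

section \<open>Decreasing rearrangements and Lorentz norms\<close>

lemma distribution_fun_le_1: "distribution_fun g t \<le> 1"
  by (simp add: distribution_fun_def)

lemma circle_set_measurable:
  assumes "g \<in> borel_measurable circle_measure"
  shows "{\<zeta>\<in>sphere 0 1. t < cmod (g \<zeta>)} \<in> sets circle_measure"
proof -
  have "{\<zeta>\<in>space circle_measure. t < cmod (g \<zeta>)} \<in> sets circle_measure"
    using assms by measurable
  then show ?thesis by simp
qed

lemma distribution_fun_antimono:
  assumes "g \<in> borel_measurable circle_measure" "s \<le> t"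
  shows "distribution_fun g t \<le> distribution_fun g s"
  unfolding distribution_fun_def
  by (intro circle.finite_measure_mono circle_set_measurable assms) (use assms in auto)

lemma ex_distribution_fun_le:
  assumes g: "g \<in> borel_measurable circle_measure" and s: "0 < s"
  shows "\<exists>t\<ge>0. distribution_fun g t \<le> s"
proof -
  let ?A = "\<lambda>n::nat. {\<zeta>\<in>sphere 0 1. real n < cmod (g \<zeta>)}"
  have "(\<lambda>n. measure circle_measure (?A n)) \<longlonglongrightarrow> measure circle_measure (\<Inter>n. ?A n)"
    by (intro circle.finite_Lim_measure_decseq) (use circle_set_measurable[OF g] in \<open>auto simp: decseq_def\<close>)
  moreover have "(\<Inter>n. ?A n) = {}"
  proof -
    have "\<exists>n. \<not> real n < cmod (g \<zeta>)" for \<zeta>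
      using real_arch_simple[of "cmod (g \<zeta>)"] by (auto simp: not_less)
    then show ?thesis by auto
  qed
  ultimately have "(\<lambda>n. measure circle_measure (?A n)) \<longlonglongrightarrow> 0" by simp
  then have "\<forall>\<^sub>F n in sequentially. measure circle_measure (?A n) < s"
    using s by (rule order_tendstoD)
  then obtain n where "measure circle_measure (?A n) < s" by (auto simp: eventually_sequentially)
  then show ?thesis unfolding distribution_fun_def by (intro exI[of _ "real n"]) auto
qed

lemma decr_rearr_le: "0 \<le> t \<Longrightarrow> distribution_fun g t \<le> s \<Longrightarrow> decr_rearr g s \<le> t"
  unfolding decr_rearr_def by (intro cInf_lower) (auto simp: bdd_below_def)

lemma decr_rearr_nonneg:
  assumes "g \<in> borel_measurable circle_measure" "0 < s"
  shows "0 \<le> decr_rearr g s"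
  unfolding decr_rearr_def using ex_distribution_fun_le[OF assms] by (intro cInf_greatest) auto

lemma decr_rearr_antimono:
  assumes "g \<in> borel_measurable circle_measure" "0 < s" "s \<le> t"
  shows "decr_rearr g t \<le> decr_rearr g s"
  unfolding decr_rearr_def
  by (intro cInf_superset_mono) (use ex_distribution_fun_le[OF assms(1,2)] assms(3) in \<open>auto simp: bdd_below_def\<close>)

lemma decr_rearr_eq_0:
  assumes "g \<in> borel_measurable circle_measure" "1 \<le> s"
  shows "decr_rearr g s = 0"
proof (rule antisym)
  show "decr_rearr g s \<le> 0" using distribution_fun_le_1[of g 0] assms by (intro decr_rearr_le) auto
  show "0 \<le> decr_rearr g s" using assms by (intro decr_rearr_nonneg) auto
qed

text \<open>The strict inequality provides a level below t that already belongs to the set under the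
  infimum; monotonicity of the distribution function does the rest.\<close>

lemma distribution_fun_le_of_decr_rearr:
  assumes g: "g \<in> borel_measurable circle_measure" and "0 < s" "decr_rearr g s < t"
  shows "distribution_fun g t \<le> s"
proof -
  obtain t' where "0 \<le> t'" "distribution_fun g t' \<le> s" "t' < t"
    using cInf_lessD[of "{t. 0 \<le> t \<and> distribution_fun g t \<le> s}" t] ex_distribution_fun_le[OF assms(1,2)] assms(3)
    unfolding decr_rearr_def by auto
  then show ?thesis using distribution_fun_antimono[OF g, of t' t] by simp
qed

lemma smirnov_boundary_measurable:
  assumes "a \<in> smirnov_class"
  shows "boundary_fun (disc_fun a) \<in> borel_measurable circle_measure"
  using assms
  by (intro measurable_circle boundary_fun_measurable holomorphic_on_imp_continuous_on analytic_disc_holomorphic)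
     (simp add: smirnov_class_def nevanlinna_class_def)

text \<open>The rearrangement is monotone on the positive axis only, hence the cutoff by the
  indicator.\<close>

lemma decr_rearr_measurable:
  assumes "g \<in> borel_measurable circle_measure"
  shows "(\<lambda>s. decr_rearr g s * indicator {0<..} s) \<in> borel_measurable borel"
proof -
  have "(\<lambda>s. - decr_rearr g s) \<in> borel_measurable (restrict_space borel {0<..})"
    by (rule borel_measurable_mono_on_fnc) (auto simp: mono_on_def intro!: decr_rearr_antimono assms)
  then have "(\<lambda>s. - (- decr_rearr g s)) \<in> borel_measurable (restrict_space borel {0<..})"
    by (rule borel_measurable_uminus)
  then have "(\<lambda>s. indicator {0<..} s *\<^sub>R decr_rearr g s) \<in> borel_measurable borel"
    by (subst (asm) borel_measurable_restrict_space_iff) auto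
  then show ?thesis by (simp add: mult.commute)
qed

lemma ennreal_powr_less_top: "x < \<top> \<Longrightarrow> ennreal_powr x e < \<top>"
  by (simp add: ennreal_powr_def)

lemma less_top_of_ennreal_powr: "ennreal_powr x e < \<infinity> \<Longrightarrow> x < \<infinity>"
  by (cases "x = \<infinity>") (simp_all add: ennreal_powr_def top.not_eq_extremum)

text \<open>As the rearrangement R decreases, the part of the Lorentz integral over (0, s) is at
  least (R(s) s^\<beta>)^Q / (\<beta> Q). These partial integrals tend to 0 with s, which gives the
  smallness, and are bounded by the whole integral, which gives the weak norm.\<close>

lemma hardy_lorentz_subset_lorentz0:
  fixes p :: real and q :: ennreal
  assumes p: "0 < p" and q: "0 < q" "q \<noteq> \<infinity>"
  shows "hardy_lorentz p q \<subseteq> hardy_lorentz0 p"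
proof
  fix a assume a: "a \<in> hardy_lorentz p q"
  let ?g = "boundary_fun (disc_fun a)"
  define Q where "Q = enn2real q"
  have Q: "0 < Q" using q by (simp add: Q_def enn2real_positive_iff less_top)
  define \<beta> where "\<beta> = 1 / p"
  have \<beta>: "0 < \<beta>" using p by (simp add: \<beta>_def)
  have g: "?g \<in> borel_measurable circle_measure"
    using a by (intro smirnov_boundary_measurable) (simp add: hardy_lorentz_def)
  define R where "R s = decr_rearr ?g s" for s
  have R0: "0 \<le> R s" if "0 < s" for s unfolding R_def by (intro decr_rearr_nonneg g that)
  define \<Phi> where "\<Phi> s = ennreal ((R s * s powr \<beta>) powr Q / s) * indicator {0<..<1} s" for s
  have \<Phi>m[measurable]: "\<Phi> \<in> borel_measurable lborel"
  proof -
    have [measurable]: "(\<lambda>s. R s * indicator {0<..} s) \<in> borel_measurable borel"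
      unfolding R_def by (rule decr_rearr_measurable[OF g])
    have "\<Phi> = (\<lambda>s. ennreal ((R s * indicator {0<..} s * s powr \<beta>) powr Q / s) * indicator {0<..<1} s)"
      by (auto simp: \<Phi>_def fun_eq_iff indicator_def)
    also have "\<dots> \<in> borel_measurable lborel" by measurable
    finally show ?thesis .
  qed
  have I: "(\<integral>\<^sup>+s. \<Phi> s \<partial>lborel) < \<infinity>"
  proof (rule less_top_of_ennreal_powr)
    show "ennreal_powr (\<integral>\<^sup>+s. \<Phi> s \<partial>lborel) (1 / Q) < \<infinity>"
      using a q by (simp add: hardy_lorentz_def lorentz_norm_def \<Phi>_def R_def Q_def \<beta>_def)
  qed
  have lower: "ennreal ((R s * s powr \<beta>) powr Q / (\<beta> * Q)) \<le> (\<integral>\<^sup>+t. \<Phi> t * indicator {0..s} t \<partial>lborel)"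
    if s: "0 < s" "s < 1" for s
  proof -
    have "ennreal ((R s * s powr \<beta>) powr Q / (\<beta> * Q)) = ennreal (R s powr Q) * ennreal (s powr (\<beta> * Q - 1 + 1) / (\<beta> * Q - 1 + 1))"
      using s Q \<beta> R0[of s] by (simp add: powr_mult powr_powr flip: ennreal_mult)
    also have "\<dots> = ennreal (R s powr Q) * (\<integral>\<^sup>+t\<in>{0..s}. ennreal (t powr (\<beta> * Q - 1)) \<partial>lborel)"
      using s Q \<beta> by (subst nn_integral_powr_Icc) auto
    also have "\<dots> = (\<integral>\<^sup>+t. ennreal (R s powr Q) * (ennreal (t powr (\<beta> * Q - 1)) * indicator {0..s} t) \<partial>lborel)"
      by (rule nn_integral_cmult[symmetric]) measurable
    also have "\<dots> \<le> (\<integral>\<^sup>+t. \<Phi> t * indicator {0..s} t \<partial>lborel)"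
    proof (rule nn_integral_mono)
      fix t :: real
      show "ennreal (R s powr Q) * (ennreal (t powr (\<beta> * Q - 1)) * indicator {0..s} t) \<le> \<Phi> t * indicator {0..s} t"
      proof (cases "0 < t \<and> t \<le> s")
        case True
        then have "R s \<le> R t" unfolding R_def by (intro decr_rearr_antimono g) auto
        then have "R s powr Q * t powr (\<beta> * Q - 1) \<le> R t powr Q * t powr (\<beta> * Q - 1)"
          using R0[OF s(1)] Q by (intro mult_right_mono powr_mono2) auto
        also have "\<dots> = (R t * t powr \<beta>) powr Q / t"
          using True R0[of t] by (simp add: powr_mult powr_powr powr_diff)
        finally show ?thesis using True s by (simp add: \<Phi>_def ennreal_leI flip: ennreal_mult)
      qed (auto simp: indicator_def)
    qed
    finally show ?thesis .
  qed
  have lim: "((\<lambda>s. R s * s powr \<beta>) \<longlongrightarrow> 0) (at_right 0)"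
  proof (rule order_tendstoI)
    fix \<epsilon> :: real assume \<epsilon>: "0 < \<epsilon>"
    define e where "e = \<epsilon> powr Q / (\<beta> * Q)"
    have e: "0 < e" using \<epsilon> Q \<beta> by (simp add: e_def)
    have "(\<lambda>n. \<integral>\<^sup>+t. \<Phi> t * indicator {0..inverse (real (Suc n))} t \<partial>lborel) \<longlonglongrightarrow> (\<integral>\<^sup>+t. 0 \<partial>(lborel :: real measure))"
    proof (rule nn_integral_dominated_convergence[where w = \<Phi>])
      show "AE t in lborel. \<Phi> t * indicator {0..inverse (real (Suc n))} t \<le> \<Phi> t" for n
        by (auto simp: indicator_def)
      show "AE t in lborel. (\<lambda>n. \<Phi> t * indicator {0..inverse (real (Suc n))} t) \<longlonglongrightarrow> 0"
      proof (rule AE_I2, rule tendsto_eventually)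
        fix t :: real
        show "\<forall>\<^sub>F n in sequentially. \<Phi> t * indicator {0..inverse (real (Suc n))} t = 0"
        proof (cases "0 < t")
          case True
          then obtain N where N: "inverse (real (Suc N)) < t" using reals_Archimedean by blast
          have "\<not> t \<le> inverse (real (Suc n))" if "n \<ge> N" for n
            using N that by (smt (verit) inverse_le_iff_le of_nat_0_less_iff of_nat_le_iff Suc_le_mono zero_less_Suc)
          then show ?thesis by (intro eventually_sequentiallyI[of N]) (auto simp: indicator_def)
        qed (auto simp: \<Phi>_def)
      qed
    qed (use I in auto)
    then have "\<forall>\<^sub>F n in sequentially. (\<integral>\<^sup>+t. \<Phi> t * indicator {0..inverse (real (Suc n))} t \<partial>lborel) < ennreal e"
      using e by (intro order_tendstoD) auto
    then obtain n where n: "(\<integral>\<^sup>+t. \<Phi> t * indicator {0..inverse (real (Suc n))} t \<partial>lborel) < ennreal e"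
      by (auto simp: eventually_sequentially)
    have "R s * s powr \<beta> < \<epsilon>" if s: "0 < s" "s < min 1 (inverse (real (Suc n)))" for s
    proof -
      have "ennreal ((R s * s powr \<beta>) powr Q / (\<beta> * Q)) \<le> (\<integral>\<^sup>+t. \<Phi> t * indicator {0..s} t \<partial>lborel)"
        using s by (intro lower) auto
      also have "\<dots> \<le> (\<integral>\<^sup>+t. \<Phi> t * indicator {0..inverse (real (Suc n))} t \<partial>lborel)"
        using s by (intro nn_integral_mono mult_left_mono) (auto simp: indicator_def)
      also note n
      finally have "(R s * s powr \<beta>) powr Q / (\<beta> * Q) < e"
        using e by (simp add: ennreal_less_iff Q \<beta> less_imp_le)
      then have "(R s * s powr \<beta>) powr Q < \<epsilon> powr Q"
        unfolding e_def using Q \<beta> by (simp add: divide_less_cancel)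
      then show ?thesis using powr_mono2[of Q \<epsilon> "R s * s powr \<beta>"] Q \<epsilon> by force
    qed
    then show "\<forall>\<^sub>F s in at_right 0. R s * s powr \<beta> < \<epsilon>"
      unfolding eventually_at_right_field by (intro exI[of _ "min 1 (inverse (real (Suc n)))"]) auto
  next
    fix e :: real assume "e < 0"
    then show "\<forall>\<^sub>F s in at_right 0. e < R s * s powr \<beta>"
      unfolding eventually_at_right_field using R0
      by (intro exI[of _ 1]) (auto intro!: less_le_trans[of e 0] mult_nonneg_nonneg)
  qed
  have "lorentz_norm p \<infinity> ?g < \<infinity>"
  proof -
    obtain V where V: "0 \<le> V" "(\<integral>\<^sup>+s. \<Phi> s \<partial>lborel) = ennreal V" using I by (auto simp: less_top_ennreal)
    have "R s * s powr \<beta> \<le> (V * (\<beta> * Q)) powr (1 / Q)" if s: "0 < s" for s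
    proof (cases "s < 1")
      case True
      have "ennreal ((R s * s powr \<beta>) powr Q / (\<beta> * Q)) \<le> (\<integral>\<^sup>+t. \<Phi> t * indicator {0..s} t \<partial>lborel)"
        using s True by (intro lower) auto
      also have "\<dots> \<le> (\<integral>\<^sup>+t. \<Phi> t \<partial>lborel)" by (intro nn_integral_mono) (auto simp: indicator_def)
      also have "\<dots> = ennreal V" by (fact V)
      finally have "(R s * s powr \<beta>) powr Q \<le> V * (\<beta> * Q)" using V Q \<beta> by (simp add: divide_le_eq)
      then have "((R s * s powr \<beta>) powr Q) powr (1 / Q) \<le> (V * (\<beta> * Q)) powr (1 / Q)"
        using Q by (intro powr_mono2) auto
      then show ?thesis using Q R0[OF s] by (simp add: powr_powr)
    next
      case False
      then have "R s = 0" unfolding R_def using g by (intro decr_rearr_eq_0) auto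
      then show ?thesis by simp
    qed
    then have "lorentz_norm p \<infinity> ?g \<le> ennreal ((V * (\<beta> * Q)) powr (1 / Q))"
      unfolding lorentz_norm_def R_def \<beta>_def by (auto intro!: SUP_least ennreal_leI)
    then show ?thesis by (simp add: le_less_trans)
  qed
  then show "a \<in> hardy_lorentz0 p"
    using a lim by (simp add: hardy_lorentz0_def hardy_lorentz_def R_def \<beta>_def)
qed

section \<open>Functions with a radial majorant around the point 1\<close>

lemma half_le_sin:
  fixes x :: real
  assumes "0 \<le> x" "x \<le> pi / 2"
  shows "x / 2 \<le> sin x"
proof (cases "x \<le> pi / 3")
  \<comment> \<open>sin x - x / 2 increases while cos x >= 1 / 2, that is up to pi / 3, and
    decreases afterwards. It is nonnegative at both ends, at pi / 2 because pi < 4.\<close>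
  case True
  have "sin 0 - 0 / 2 \<le> sin x - x / 2"
  proof (rule DERIV_nonneg_imp_nondecreasing[OF assms(1)])
    fix y assume "0 \<le> y" "y \<le> x"
    then have "cos (pi / 3) \<le> cos y" using True by (intro cos_monotone_0_pi_le) auto
    then show "\<exists>d. ((\<lambda>x. sin x - x / 2) has_real_derivative d) (at y) \<and> 0 \<le> d"
      by (intro exI[of _ "cos y - 1 / 2"] conjI) (auto intro!: derivative_eq_intros simp: cos_60)
  qed
  then show ?thesis by simp
next
  case False
  have "sin (pi / 2) - (pi / 2) / 2 \<le> sin x - x / 2"
  proof (rule DERIV_nonpos_imp_nonincreasing[OF assms(2)])
    fix y assume "x \<le> y" "y \<le> pi / 2"
    then have "cos y \<le> cos (pi / 3)" using False by (intro cos_monotone_0_pi_le) auto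
    then show "\<exists>d. ((\<lambda>x. sin x - x / 2) has_real_derivative d) (at y) \<and> d \<le> 0"
      by (intro exI[of _ "cos y - 1 / 2"] conjI) (auto intro!: derivative_eq_intros simp: cos_60)
  qed
  then show ?thesis using pi_less_4 by simp
qed

text \<open>The chord is 2 |sin(pi t)|, at least three times the distance of t to 0 or 1, so the arc
  has measure at most 2 s / 3. The bound s, with constant 1, is what \<open>decr_rearr_le\<close>
  asks for at the argument s.\<close>

lemma measure_circle_arc_le:
  assumes "0 < s"
  shows "measure circle_measure {\<zeta>\<in>sphere 0 1. cmod (1 - \<zeta>) < s} \<le> s"
proof -
  let ?A = "{\<zeta>. cmod (1 - \<zeta>) < s}"
  have [measurable]: "?A \<in> sets borel"
    by (intro borel_open open_Collect_less continuous_intros)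
  have iA: "(\<lambda>\<zeta>. indicator ?A \<zeta> :: ennreal) \<in> borel_measurable circle_borel"
    by (intro measurable_restrict_space1) measurable
  have chord: "cmod (1 - cis (2 * pi * t)) = 2 * \<bar>sin (pi * t)\<bar>" for t
  proof -
    have "(cmod (1 - cis (2 * pi * t)))\<^sup>2 = (1 - cos (2 * (pi * t)))\<^sup>2 + (sin (2 * (pi * t)))\<^sup>2"
      by (simp add: cmod_power2 mult.assoc)
    also have "\<dots> = 2 - 2 * cos (2 * (pi * t))"
      using sin_cos_squared_add[of "2 * (pi * t)"] by (simp add: power2_eq_square algebra_simps)
    also have "\<dots> = (2 * \<bar>sin (pi * t)\<bar>)\<^sup>2" unfolding cos_double_sin by (simp add: power_mult_distrib)
    finally show ?thesis by (rule power2_eq_imp_eq) auto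
  qed
  have lb: "3 * u \<le> 2 * sin (pi * u)" if "0 \<le> u" "u \<le> 1 / 2" for u
  proof -
    have "3 * u \<le> pi * u" using that pi_gt3 by (intro mult_right_mono) auto
    also have "\<dots> \<le> 2 * sin (pi * u)" using half_le_sin[of "pi * u"] that by simp
    finally show ?thesis .
  qed
  have sub: "t \<in> {0..s / 3} \<union> {1 - s / 3..1}" if t: "0 \<le> t" "t < 1" and c: "cmod (1 - cis (2 * pi * t)) < s" for t
  proof (cases "t \<le> 1 / 2")
    case True
    then show ?thesis using lb[of t] t c unfolding chord by auto
  next
    case False
    have "sin (pi * t) = sin (pi * (1 - t))" by (simp add: right_diff_distrib)
    then show ?thesis using lb[of "1 - t"] False t c unfolding chord by auto
  qed
  have "emeasure circle_measure {\<zeta>\<in>sphere 0 1. cmod (1 - \<zeta>) < s} = (\<integral>\<^sup>+\<zeta>. indicator {\<zeta>\<in>sphere 0 1. cmod (1 - \<zeta>) < s} \<zeta> \<partial>circle_measure)"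
  proof (rule nn_integral_indicator[symmetric])
    have "(\<lambda>\<zeta>. cmod (1 - \<zeta>)) \<in> borel_measurable circle_measure"
      by (intro measurable_circle measurable_circle_continuous continuous_intros)
    then have "{\<zeta>\<in>space circle_measure. cmod (1 - \<zeta>) < s} \<in> sets circle_measure" by measurable
    then show "{\<zeta>\<in>sphere 0 1. cmod (1 - \<zeta>) < s} \<in> sets circle_measure" by simp
  qed
  also have "\<dots> = (\<integral>\<^sup>+\<zeta>. indicator ?A \<zeta> \<partial>circle_measure)"
    by (intro nn_integral_cong) (auto simp: indicator_def)
  also have "\<dots> = (\<integral>\<^sup>+t\<in>{0..<1}. indicator ?A (cis (2 * pi * t)) \<partial>lborel)"
    by (rule nn_integral_circle[OF iA])
  also have "\<dots> \<le> (\<integral>\<^sup>+t. indicator ({0..s / 3} \<union> {1 - s / 3..1}) t \<partial>lborel)"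
    by (intro nn_integral_mono) (use sub in \<open>auto simp: indicator_def\<close>)
  also have "\<dots> = emeasure lborel ({0..s / 3} \<union> {1 - s / 3..1})" by simp
  also have "\<dots> \<le> emeasure lborel {0..s / 3} + emeasure lborel {1 - s / 3..1}"
    by (rule emeasure_subadditive) auto
  also have "\<dots> = ennreal (s / 3 + s / 3)" using assms by (simp flip: ennreal_plus)
  also have "\<dots> \<le> ennreal s" using assms by (intro ennreal_leI) auto
  finally show ?thesis using assms by (simp add: circle.emeasure_eq_measure)
qed

text \<open>By \<open>measure_circle_arc_le\<close> the function |1 - \<zeta>|^(-1/2) is of weak
  type 2, hence integrable. It serves to dominate log+ |f| for functions with a power singularity at
  1.\<close>

lemma nn_integral_circle_singularity_le:
  "(\<integral>\<^sup>+\<zeta>. ennreal (cmod (1 - \<zeta>) powr (- 1 / 2)) \<partial>circle_measure) \<le> 2"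
proof -
  define w where "w \<zeta> = cmod (1 - \<zeta>) powr (- 1 / 2)" for \<zeta>
  have [measurable]: "w \<in> borel_measurable circle_measure"
    unfolding w_def by (intro measurable_circle measurable_restrict_space1) measurable
  have d: "measure circle_measure {\<zeta>\<in>sphere 0 1. s < w \<zeta>} \<le> 1 * s powr - 2" if s: "1 \<le> s" for s
  proof -
    have "cmod (1 - \<zeta>) < s powr - 2" if "s < w \<zeta>" for \<zeta>
    proof -
      have "0 < cmod (1 - \<zeta>)" using that s by (cases "\<zeta> = 1") (auto simp: w_def)
      then show ?thesis
        using powr_less_mono2_neg[of "- 2" s "w \<zeta>"] that s by (simp add: w_def powr_powr)
    qed
    then have "{\<zeta>\<in>sphere 0 1. s < w \<zeta>} \<subseteq> {\<zeta>\<in>sphere 0 1. cmod (1 - \<zeta>) < s powr - 2}" by auto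
    moreover have "{\<zeta>\<in>sphere 0 1. cmod (1 - \<zeta>) < s powr - 2} \<in> sets circle_measure"
    proof -
      have "(\<lambda>\<zeta>. cmod (1 - \<zeta>)) \<in> borel_measurable circle_measure"
        by (intro measurable_circle measurable_circle_continuous continuous_intros)
      then have "{\<zeta>\<in>space circle_measure. cmod (1 - \<zeta>) < s powr - 2} \<in> sets circle_measure" by measurable
      then show ?thesis by simp
    qed
    ultimately have "measure circle_measure {\<zeta>\<in>sphere 0 1. s < w \<zeta>} \<le>
        measure circle_measure {\<zeta>\<in>sphere 0 1. cmod (1 - \<zeta>) < s powr - 2}"
      by (rule circle.finite_measure_mono)
    also have "\<dots> \<le> s powr - 2" using s by (intro measure_circle_arc_le) auto
    finally show ?thesis by simp
  qed
  have "(\<integral>\<^sup>+\<zeta>. ennreal (w \<zeta>) \<partial>circle_measure) \<le> (\<integral>\<^sup>+\<zeta>. 1 + ennreal (max 0 (w \<zeta> - 1)) \<partial>circle_measure)"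
    by (intro nn_integral_mono) (auto simp: max_def simp flip: ennreal_1 ennreal_plus intro!: ennreal_leI)
  also have "\<dots> = 1 + (\<integral>\<^sup>+\<zeta>. ennreal (max 0 (w \<zeta> - 1)) \<partial>circle_measure)"
    by (subst nn_integral_add) (use circle.emeasure_space_1 in auto)
  also have "\<dots> \<le> 1 + ennreal (1 / 1)"
    by (intro add_left_mono nn_integral_excess_le d) auto
  finally show ?thesis by (simp add: w_def)
qed

text \<open>This is ln y <= y - 1 at y = max(1, x)^(1/k). With k = 2 b it reduces a power
  singularity of order b to order 1 / 2.\<close>

lemma ln_max_le_powr:
  fixes k x :: real
  assumes k: "0 < k"
  shows "ln (max 1 x) \<le> k * (1 + x powr (1 / k))"
proof -
  have "0 < max 1 x" by simp
  then have "ln (max 1 x) = k * ln (max 1 x powr (1 / k))" using k ln_powr[of "max 1 x" "1 / k"] by simp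
  also have "\<dots> \<le> k * max 1 x powr (1 / k)"
    using k ln_le_minus_one[of "max 1 x powr (1 / k)"] \<open>0 < max 1 x\<close> by (intro mult_left_mono) auto
  also have "max 1 x powr (1 / k) \<le> 1 + x powr (1 / k)" by (auto simp: max_def)
  finally show ?thesis using k by simp
qed

lemma cmod_1_minus_le:
  assumes "cmod z \<le> 1" "0 \<le> r" "r \<le> 1"
  shows "cmod (1 - z) \<le> 2 * cmod (1 - of_real r * z)" and "1 - r \<le> cmod (1 - of_real r * z)"
proof -
  have "cmod (of_real r * z) \<le> r" using assms by (simp add: norm_mult mult_left_le)
  then show 1: "1 - r \<le> cmod (1 - of_real r * z)"
    using norm_triangle_ineq2[of 1 "of_real r * z"] by simp
  have "1 - z = (1 - of_real r * z) - of_real (1 - r) * z" by (simp add: algebra_simps)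
  then have "cmod (1 - z) \<le> cmod (1 - of_real r * z) + cmod (of_real (1 - r) * z)"
    by (metis norm_triangle_ineq4)
  also have "cmod (of_real (1 - r) * z) \<le> 1 - r"
    using assms by (simp add: norm_mult mult_left_le del: of_real_diff)
  finally show "cmod (1 - z) \<le> 2 * cmod (1 - of_real r * z)" using 1 by simp
qed

text \<open>Away from 1 the boundary function is F. It can exceed \<Psi>(s) only at distance less
  than s from 1, on an arc of measure at most s, which bounds the rearrangement by \<Psi>. The power
  growth of \<Psi> yields one integrable majorant of log+ |f| on all circles, so dominated
  convergence gives the Smirnov condition.\<close>

lemma radial_majorant:
  fixes a :: "nat \<Rightarrow> complex" and \<Psi> :: "real \<Rightarrow> real" and b C :: real
  assumes a: "a \<in> analytic_disc" and cF: "continuous_on (cball 0 1 - {1}) F"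
    and eq: "\<And>z. z \<in> ball 0 1 \<Longrightarrow> F z = disc_fun a z"
    and bd: "\<And>z. z \<in> cball 0 1 - {1} \<Longrightarrow> cmod (F z) \<le> \<Psi> (cmod (1 - z))"
    and anti: "\<And>s t. 0 < s \<Longrightarrow> s \<le> t \<Longrightarrow> \<Psi> t \<le> \<Psi> s" and \<Psi>0: "\<And>t. 0 < t \<Longrightarrow> 0 \<le> \<Psi> t"
    and gr: "\<And>t. 0 < t \<Longrightarrow> \<Psi> t \<le> C * t powr - b" and b: "0 < b" and C: "0 \<le> C"
  shows "a \<in> smirnov_class" and "\<And>s. 0 < s \<Longrightarrow> decr_rearr (boundary_fun (disc_fun a)) s \<le> \<Psi> s"
proof -
  let ?f = "disc_fun a" and ?g = "boundary_fun (disc_fun a)"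
  have bf: "?g \<zeta> = F \<zeta>" if \<zeta>: "\<zeta> \<in> sphere 0 1" "\<zeta> \<noteq> 1" for \<zeta>
  proof (rule boundary_fun_eqI)
    show "has_nontangential_limit ?f \<zeta> (F \<zeta>)"
      unfolding has_nontangential_limit_def
    proof (intro allI impI)
      fix \<alpha> :: real
      have "(F \<longlongrightarrow> F \<zeta>) (at \<zeta> within cball 0 1 - {1})"
        using cF \<zeta> by (auto simp: continuous_on_def)
      then have "(F \<longlongrightarrow> F \<zeta>) (at \<zeta> within stolz_region \<alpha> \<zeta>)"
        by (rule tendsto_within_subset) (auto simp: stolz_region_def)
      moreover have "\<forall>\<^sub>F z in at \<zeta> within stolz_region \<alpha> \<zeta>. F z = ?f z"
        unfolding eventually_at by (intro exI[of _ 1]) (auto simp: stolz_region_def intro!: eq)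
      ultimately show "(?f \<longlongrightarrow> F \<zeta>) (at \<zeta> within stolz_region \<alpha> \<zeta>)"
        by (rule Lim_transform_eventually)
    qed
  qed (use \<zeta> in simp)
  have gm: "?g \<in> borel_measurable circle_measure"
    by (intro measurable_circle boundary_fun_measurable holomorphic_on_imp_continuous_on analytic_disc_holomorphic a)
  show "decr_rearr ?g s \<le> \<Psi> s" if s: "0 < s" for s
  proof (rule decr_rearr_le[OF \<Psi>0[OF s]])
    have "distribution_fun ?g (\<Psi> s) \<le> measure circle_measure {\<zeta>\<in>sphere 0 1. cmod (1 - \<zeta>) < s}"
      unfolding distribution_fun_def
    proof (rule circle.finite_measure_mono)
      show "{\<zeta>\<in>sphere 0 1. \<Psi> s < cmod (?g \<zeta>)} \<subseteq> {\<zeta>\<in>sphere 0 1. cmod (1 - \<zeta>) < s}"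
      proof safe
        fix \<zeta> :: complex assume \<zeta>: "\<zeta> \<in> sphere 0 1" "\<Psi> s < cmod (?g \<zeta>)"
        show "cmod (1 - \<zeta>) < s"
        proof (rule ccontr)
          assume "\<not> ?thesis"
          then have "s \<le> cmod (1 - \<zeta>)" "\<zeta> \<noteq> 1" using s by auto
          then have "cmod (?g \<zeta>) \<le> \<Psi> s"
            using bf[OF \<zeta>(1)] bd[of \<zeta>] anti[OF s, of "cmod (1 - \<zeta>)"] \<zeta>(1) by auto
          then show False using \<zeta>(2) by simp
        qed
      qed
      have "(\<lambda>\<zeta>. cmod (1 - \<zeta>)) \<in> borel_measurable circle_measure"
        by (intro measurable_circle measurable_circle_continuous continuous_intros)
      then have "{\<zeta>\<in>space circle_measure. cmod (1 - \<zeta>) < s} \<in> sets circle_measure" by measurable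
      then show "{\<zeta>\<in>sphere 0 1. cmod (1 - \<zeta>) < s} \<in> sets circle_measure" by simp
    qed
    also have "\<dots> \<le> s" by (rule measure_circle_arc_le[OF s])
    finally show "distribution_fun ?g (\<Psi> s) \<le> s" .
  qed
  \<comment> \<open>The factor 2^b comes from |1 - \<zeta>| <= 2 |1 - r \<zeta>|; the exponent 1 /
    (2 b) gives \<open>D\<close> a singularity of order 1 / 2 for every b.\<close>
  define M where "M = (C * 2 powr b) powr (1 / (2 * b))"
  define D where "D \<zeta> = 2 * b * (1 + M * cmod (1 - \<zeta>) powr (- 1 / 2))" for \<zeta>
  have M: "0 \<le> M" by (simp add: M_def)
  have [measurable]: "D \<in> borel_measurable circle_measure"
    unfolding D_def by (intro measurable_circle measurable_restrict_space1) measurable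
  have D: "log_plus (cmod (?f (of_real r * \<zeta>))) \<le> D \<zeta>" if \<zeta>: "cmod \<zeta> = 1" "\<zeta> \<noteq> 1" and r: "0 < r" "r < 1" for \<zeta> r
  proof -
    let ?z = "of_real r * \<zeta>"
    have z: "?z \<in> ball 0 1" using \<zeta> r by (simp add: norm_mult)
    have d: "0 < cmod (1 - \<zeta>)" "cmod (1 - \<zeta>) / 2 \<le> cmod (1 - ?z)" using cmod_1_minus_le(1)[of \<zeta> r] \<zeta> r by auto
    have d1: "0 < cmod (1 - ?z)" using d by linarith
    have "cmod (?f ?z) \<le> \<Psi> (cmod (1 - ?z))" using bd[of ?z] eq[OF z] z d1 by auto
    also have "\<dots> \<le> C * cmod (1 - ?z) powr - b" by (rule gr[OF d1])
    also have "\<dots> \<le> C * (cmod (1 - \<zeta>) / 2) powr - b"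
      using d b C by (intro mult_left_mono powr_mono2') auto
    also have "\<dots> = C * 2 powr b * cmod (1 - \<zeta>) powr - b"
      by (simp add: powr_divide powr_minus divide_simps)
    finally have "cmod (?f ?z) \<le> C * 2 powr b * cmod (1 - \<zeta>) powr - b" .
    then have "log_plus (cmod (?f ?z)) \<le> ln (max 1 (C * 2 powr b * cmod (1 - \<zeta>) powr - b))"
      unfolding log_plus_def by (subst ln_le_cancel_iff) auto
    also have "\<dots> \<le> 2 * b * (1 + (C * 2 powr b * cmod (1 - \<zeta>) powr - b) powr (1 / (2 * b)))"
      using b by (intro ln_max_le_powr) auto
    also have "(C * 2 powr b * cmod (1 - \<zeta>) powr - b) powr (1 / (2 * b)) = M * cmod (1 - \<zeta>) powr (- 1 / 2)"
      using C b unfolding M_def by (subst powr_mult) (auto simp: powr_powr)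
    finally show ?thesis unfolding D_def .
  qed
  have D0: "0 \<le> D \<zeta>" for \<zeta> using b M by (simp add: D_def)
  define k where "k \<zeta> = cmod (1 - \<zeta>) powr (- 1 / 2)" for \<zeta>
  have [measurable]: "k \<in> borel_measurable circle_measure"
    unfolding k_def by (intro measurable_circle measurable_restrict_space1) measurable
  have k0: "0 \<le> k \<zeta>" for \<zeta> by (simp add: k_def)
  have "(\<integral>\<^sup>+\<zeta>. ennreal (D \<zeta>) \<partial>circle_measure) =
      (\<integral>\<^sup>+\<zeta>. ennreal (2 * b) + ennreal (2 * b * M) * ennreal (k \<zeta>) \<partial>circle_measure)"
    unfolding D_def k_def[symmetric] using k0 b M by (intro nn_integral_cong) (simp add: distrib_left mult.assoc flip: ennreal_mult ennreal_plus)
  also have "\<dots> = ennreal (2 * b) + ennreal (2 * b * M) * (\<integral>\<^sup>+\<zeta>. ennreal (k \<zeta>) \<partial>circle_measure)"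
    using circle.emeasure_space_1 by (simp add: nn_integral_add nn_integral_cmult)
  also have "\<dots> \<le> ennreal (2 * b) + ennreal (2 * b * M) * 2"
    unfolding k_def by (intro add_left_mono mult_left_mono nn_integral_circle_singularity_le) simp
  also have "\<dots> < \<infinity>" by (simp add: ennreal_mult_less_top)
  finally have DI: "(\<integral>\<^sup>+\<zeta>. ennreal (D \<zeta>) \<partial>circle_measure) < \<infinity>" .
  have DAE: "AE \<zeta> in circle_measure. ennreal (log_plus (cmod (?f (of_real r * \<zeta>)))) \<le> ennreal (D \<zeta>)"
    if "0 < r" "r < 1" for r
    using circle_singleton_null[of 1] AE_space
    by eventually_elim (use D that in \<open>auto intro!: ennreal_leI\<close>)
  have "(SUP r\<in>{0<..<1}. \<integral>\<^sup>+z. ennreal (log_plus (cmod (?f (of_real r * z)))) \<partial>circle_measure) \<le>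
      (\<integral>\<^sup>+\<zeta>. ennreal (D \<zeta>) \<partial>circle_measure)"
    by (intro SUP_least nn_integral_mono_AE DAE) auto
  then have nev: "a \<in> nevanlinna_class"
    using a DI unfolding nevanlinna_class_def by (auto intro: le_less_trans)
  have "((\<lambda>r. \<integral>\<^sup>+z. ennreal (log_plus (cmod (?f (of_real r * z)))) \<partial>circle_measure)
       \<longlongrightarrow> (\<integral>\<^sup>+z. ennreal (log_plus (cmod (?g z))) \<partial>circle_measure)) (at_left 1)"
  proof (rule tendsto_at_left_sequentially[of 0])
    fix S :: "nat \<Rightarrow> real" assume S: "\<And>n. S n < 1" "\<And>n. 0 < S n" "S \<longlonglongrightarrow> 1"
    show "(\<lambda>n. \<integral>\<^sup>+z. ennreal (log_plus (cmod (?f (of_real (S n) * z)))) \<partial>circle_measure)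
       \<longlonglongrightarrow> (\<integral>\<^sup>+z. ennreal (log_plus (cmod (?g z))) \<partial>circle_measure)"
    proof (rule nn_integral_dominated_convergence[where w = "\<lambda>\<zeta>. ennreal (D \<zeta>)"])
      have "(\<lambda>z. ?f (of_real (S n) * z)) \<in> borel_measurable circle_measure" for n
        by (intro measurable_circle measurable_circle_continuous disc_fun_continuous_dilate_circle a)
           (use S in \<open>auto simp: less_imp_le\<close>)
      then show "(\<lambda>z. ennreal (log_plus (cmod (?f (of_real (S n) * z))))) \<in> borel_measurable circle_measure" for n
        unfolding log_plus_def by measurable
      show "(\<lambda>z. ennreal (log_plus (cmod (?g z)))) \<in> borel_measurable circle_measure"
        using gm unfolding log_plus_def by measurable
      show "AE z in circle_measure. ennreal (log_plus (cmod (?f (of_real (S n) * z)))) \<le> ennreal (D z)" for n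
        by (intro DAE S)
      show "AE z in circle_measure. (\<lambda>n. ennreal (log_plus (cmod (?f (of_real (S n) * z)))))
          \<longlonglongrightarrow> ennreal (log_plus (cmod (?g z)))"
        using circle_singleton_null[of 1] AE_space
      proof eventually_elim
        case (elim z)
        then have z: "cmod z = 1" "z \<noteq> 1" by auto
        have "(\<lambda>n. of_real (S n) * z) \<longlonglongrightarrow> of_real 1 * z" by (intro tendsto_intros S)
        then have lim: "(\<lambda>n. F (of_real (S n) * z)) \<longlonglongrightarrow> F (of_real 1 * z)"
        proof (rule continuous_on_tendsto_compose[OF cF])
          have lt: "cmod (of_real (S n) * z) < 1" for n
            using z S(1,2)[of n] by (simp add: norm_mult)
          have "of_real (S n) * z \<in> cball 0 1 - {1}" for n
          proof -
            have "of_real (S n) * z \<noteq> 1" using lt[of n] by (metis norm_one less_irrefl)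
            then show ?thesis using less_imp_le[OF lt[of n]] by simp
          qed
          then show "\<forall>\<^sub>F n in sequentially. of_real (S n) * z \<in> cball 0 1 - {1}" by simp
        qed (use z in auto)
        have "F (of_real (S n) * z) = ?f (of_real (S n) * z)" for n
          using z S(1,2)[of n] by (intro eq) (simp add: norm_mult)
        with lim bf[of z] z have "(\<lambda>n. ?f (of_real (S n) * z)) \<longlonglongrightarrow> ?g z" by simp
        then show ?case unfolding log_plus_def by (intro tendsto_intros) auto
      qed
    qed (use DI in auto)
  qed auto
  then show "a \<in> smirnov_class" using nev by (simp add: smirnov_class_def)
qed

section \<open>Test functions\<close>

text \<open>The factorial of \<open>n + 1\<close>, not \<open>n\<close>, makes the first derivative of a product a fractional derivative.\<close>

definition kernel_seq :: "real \<Rightarrow> nat \<Rightarrow> complex" where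
  "kernel_seq s n = of_real (Gamma (real n + s + 1) / fact (Suc n))"

text \<open>Closed form of the power series with coefficients \<open>kernel_seq s\<close>;
  subtracting 1 and dividing by z reflect the shifted index. Unlike the series it also makes sense
  on the circle away from 1.\<close>

definition kernel_fun :: "real \<Rightarrow> complex \<Rightarrow> complex" where
  "kernel_fun s z = (if z = 0 then of_real (Gamma (s + 1))
     else of_real (Gamma s) * ((1 - z) powr (- of_real s) - 1) / z)"

lemma frac_deriv_1_kernel_seq:
  "frac_deriv 1 (\<lambda>n. l n * (kernel_seq s n * c n)) n = frac_deriv s l n * c n"
proof -
  have "Gamma (real n + 1 + 1) = fact (Suc n)"
    using Gamma_fact[of "Suc n", where ?'a = real] by (simp add: add_ac)
  then have "Gamma (real n + 1 + 1) / fact n * (Gamma (real n + s + 1) / fact (Suc n)) = Gamma (real n + s + 1) / fact n"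
    by simp
  then have "complex_of_real (Gamma (real n + 1 + 1) / fact n) * of_real (Gamma (real n + s + 1) / fact (Suc n)) =
      of_real (Gamma (real n + s + 1) / fact n)"
    by (metis of_real_mult)
  then show ?thesis unfolding frac_deriv_def kernel_seq_def by (metis mult.assoc mult.left_commute)
qed

lemma kernel_seq_1: "kernel_seq 1 n = 1"
proof -
  have "Gamma (real n + 1 + 1) = fact (Suc n)"
    using Gamma_fact[of "Suc n", where ?'a = real] by (simp add: add_ac)
  then show ?thesis by (simp add: kernel_seq_def del: fact_Suc)
qed

lemma kernel_seq_analytic:
  assumes "0 < s"
  shows "kernel_seq s \<in> analytic_disc"
proof (rule analytic_discI)
  fix r :: real assume r: "0 < r" "r < 1"
  obtain B where B: "\<And>n. cmod (complex_of_real (Gamma (real n + s + 1) / fact n)) * r ^ n \<le> B"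
    using analytic_disc_bounded[OF Gamma_coeff_analytic[of s], of r] assms r by auto
  have "cmod (kernel_seq s n) * r ^ n \<le> B" for n
  proof -
    have G: "0 < Gamma (real n + s + 1)" using assms by simp
    have f: "(fact n :: real) \<le> fact (Suc n)" by (intro fact_mono) auto
    have "cmod (kernel_seq s n) \<le> cmod (complex_of_real (Gamma (real n + s + 1) / fact n))"
      unfolding kernel_seq_def norm_of_real using G f by (simp add: divide_left_mono del: fact_Suc)
    then have "cmod (kernel_seq s n) * r ^ n \<le> cmod (complex_of_real (Gamma (real n + s + 1) / fact n)) * r ^ n"
      using r by (intro mult_right_mono) auto
    with B[of n] show ?thesis by linarith
  qed
  then show "\<exists>B. \<forall>n. cmod (kernel_seq s n) * r ^ n \<le> B" by blast
qed

lemma kernel_fun_eq: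
  assumes s: "0 < s" and z: "z \<in> ball 0 1"
  shows "kernel_fun s z = disc_fun (kernel_seq s) z"
proof (cases "z = 0")
  case True
  then have "(\<lambda>n. kernel_seq s n * z ^ n) sums kernel_seq s 0"
    using powser_sums_zero[of "kernel_seq s"] by simp
  then show ?thesis using True by (simp add: disc_fun_def sums_iff kernel_fun_def kernel_seq_def)
next
  case False
  let ?c = "\<lambda>n. complex_of_real (Gamma (real n + s) / fact n) * z ^ n"
  have "?c sums (of_real (Gamma s) * (1 - z) powr (- of_real s))"
    using binomial_kernel_sums[OF s] z by simp
  then have "(\<lambda>n. ?c (Suc n)) sums (of_real (Gamma s) * (1 - z) powr (- of_real s) - ?c 0)"
    by (subst sums_Suc_iff) simp
  then have "(\<lambda>n. ?c (Suc n) / z) sums ((of_real (Gamma s) * (1 - z) powr (- of_real s) - ?c 0) / z)"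
    by (rule sums_divide)
  also have "(\<lambda>n. ?c (Suc n) / z) = (\<lambda>n. kernel_seq s n * z ^ n)"
    using False by (auto simp: kernel_seq_def fun_eq_iff add_ac)
  also have "(of_real (Gamma s) * (1 - z) powr (- of_real s) - ?c 0) / z = kernel_fun s z"
    using False by (simp add: kernel_fun_def algebra_simps)
  finally show ?thesis by (simp add: disc_fun_def sums_iff)
qed

lemma Re_1_minus_pos:
  assumes "z \<in> cball 0 1 - {1}"
  shows "0 < Re (1 - z)"
proof (rule ccontr)
  assume "\<not> ?thesis"
  then have "1 \<le> Re z" by simp
  have "(cmod z)\<^sup>2 \<le> 1\<^sup>2" using assms by (intro power_mono) auto
  then have sum: "(Re z)\<^sup>2 + (Im z)\<^sup>2 \<le> 1" by (simp add: cmod_power2)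
  have "1 \<le> (Re z)\<^sup>2" using \<open>1 \<le> Re z\<close> by (rule one_le_power)
  with sum have "(Im z)\<^sup>2 \<le> 0" by linarith
  then have "Im z = 0" by simp
  with sum have "\<bar>Re z\<bar> \<le> 1" by (simp add: abs_square_le_1)
  with \<open>1 \<le> Re z\<close> \<open>Im z = 0\<close> have "z = 1" by (simp add: complex_eq_iff)
  then show False using assms by simp
qed

lemma kernel_fun_continuous:
  assumes s: "0 < s"
  shows "continuous_on (cball 0 1 - {1}) (kernel_fun s)"
  unfolding continuous_on_def
proof
  fix z :: complex assume z: "z \<in> cball 0 1 - {1}"
  show "(kernel_fun s \<longlongrightarrow> kernel_fun s z) (at z within cball 0 1 - {1})"
  proof (cases "z = 0")
    case True
    have "continuous_on (ball 0 1) (kernel_fun s)"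
      using holomorphic_on_imp_continuous_on[OF analytic_disc_holomorphic[OF kernel_seq_analytic[OF s]]]
      by (rule continuous_on_eq) (simp add: kernel_fun_eq[OF s])
    then have "isCont (kernel_fun s) z" using True by (simp add: continuous_on_eq_continuous_at)
    then show ?thesis unfolding isCont_def by (rule tendsto_within_subset) auto
  next
    case False
    have "1 - z \<notin> \<real>\<^sub>\<le>\<^sub>0" using Re_1_minus_pos[OF z] by (auto simp: complex_nonpos_Reals_iff)
    then have "((\<lambda>w. of_real (Gamma s) * ((1 - w) powr (- of_real s) - 1) / w) \<longlongrightarrow>
        of_real (Gamma s) * ((1 - z) powr (- of_real s) - 1) / z) (at z within cball 0 1 - {1})"
      using False by (intro tendsto_intros) auto
    moreover have "\<forall>\<^sub>F w in at z within cball 0 1 - {1}. of_real (Gamma s) * ((1 - w) powr (- of_real s) - 1) / w = kernel_fun s w"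
      unfolding eventually_at using False
      by (intro exI[of _ "cmod z"]) (auto simp: kernel_fun_def dist_norm)
    ultimately have "(kernel_fun s \<longlongrightarrow> of_real (Gamma s) * ((1 - z) powr (- of_real s) - 1) / z) (at z within cball 0 1 - {1})"
      by (rule Lim_transform_eventually)
    then show ?thesis using False by (simp add: kernel_fun_def)
  qed
qed

text \<open>Near 0 compactness bounds the quotient, for |z| > 1/2 the formula is estimated directly.
  Constants are absorbed by 1 <= 2^s |1 - z|^(-s), which holds because |1 - z| <= 2.\<close>

lemma kernel_fun_bound:
  assumes s: "0 < s"
  obtains C where "0 < C" "\<And>z. z \<in> cball 0 1 - {1} \<Longrightarrow> cmod (kernel_fun s z) \<le> C * cmod (1 - z) powr - s"
proof -
  have "continuous_on (cball 0 (1 / 2)) (kernel_fun s)"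
    by (rule continuous_on_subset[OF kernel_fun_continuous[OF s]]) auto
  then have "bounded (kernel_fun s ` cball 0 (1 / 2))"
    by (intro compact_imp_bounded compact_continuous_image compact_cball)
  then obtain B where B: "0 < B" "\<And>z. cmod z \<le> 1 / 2 \<Longrightarrow> cmod (kernel_fun s z) \<le> B"
    unfolding bounded_pos by force
  have G: "0 < Gamma s" using s by simp
  define C where "C = B * 2 powr s + 2 * Gamma s * (1 + 2 powr s)"
  have "cmod (kernel_fun s z) \<le> C * cmod (1 - z) powr - s" if z: "z \<in> cball 0 1 - {1}" for z
  proof -
    define t where "t = cmod (1 - z)"
    have "t \<le> 2" using norm_triangle_ineq4[of 1 z] z by (simp add: t_def)
    moreover have t0: "0 < t" using z by (auto simp: t_def)
    ultimately have "2 powr - s \<le> t powr - s" using s by (intro powr_mono2') auto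
    then have "2 powr s * 2 powr - s \<le> 2 powr s * t powr - s" by (intro mult_left_mono) auto
    then have 1: "1 \<le> 2 powr s * t powr - s" by (simp flip: powr_add)
    show ?thesis
    proof (cases "cmod z \<le> 1 / 2")
      case True
      have "cmod (kernel_fun s z) \<le> B * 1" using B(2)[OF True] by simp
      also have "\<dots> \<le> B * (2 powr s * t powr - s)" using B(1) 1 by (intro mult_left_mono) auto
      also have "\<dots> \<le> C * t powr - s" unfolding C_def using G by (simp add: distrib_right mult.assoc)
      finally show ?thesis by (simp add: t_def)
    next
      case False
      then have z0: "z \<noteq> 0" by auto
      have n: "cmod ((1 - z) powr (- of_real s)) = t powr - s"
        using t0 z by (simp add: powr_def t_def norm_exp_eq_Re)
      have "cmod (kernel_fun s z) = Gamma s * cmod ((1 - z) powr (- of_real s) - 1) / cmod z"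
        using z0 G by (simp add: kernel_fun_def norm_mult norm_divide)
      also have "\<dots> \<le> Gamma s * (t powr - s + 1) / cmod z"
        using G norm_triangle_ineq4[of "(1 - z) powr (- of_real s)" 1] unfolding n
        by (intro divide_right_mono mult_left_mono) auto
      also have "\<dots> \<le> Gamma s * (t powr - s + 1) / (1 / 2)"
        using G False z0 by (intro divide_left_mono mult_nonneg_nonneg mult_pos_pos) auto
      also have "\<dots> \<le> 2 * Gamma s * (t powr - s + 2 powr s * t powr - s)"
        using G 1 by simp
      also have "\<dots> \<le> C * t powr - s" unfolding C_def using B(1) by (simp add: algebra_simps)
      finally show ?thesis by (simp add: t_def)
    qed
  qed
  moreover have "0 < C" unfolding C_def using B(1) G by (intro add_pos_nonneg) auto
  ultimately show ?thesis using that by blast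
qed

lemma hardy_lorentz_finiteI:
  fixes p :: real and q :: ennreal
  assumes q: "0 < q" "q \<noteq> \<infinity>" and a: "a \<in> smirnov_class"
    and R: "\<And>s. 0 < s \<Longrightarrow> decr_rearr (boundary_fun (disc_fun a)) s \<le> \<Psi> s"
    and I: "(\<integral>\<^sup>+s\<in>{0<..<1}. ennreal ((\<Psi> s * s powr (1 / p)) powr enn2real q / s) \<partial>lborel) < \<infinity>"
  shows "a \<in> hardy_lorentz p q"
proof -
  let ?R = "decr_rearr (boundary_fun (disc_fun a))"
  have "(\<integral>\<^sup>+s\<in>{0<..<1}. ennreal ((?R s * s powr (1 / p)) powr enn2real q / s) \<partial>lborel) \<le>
      (\<integral>\<^sup>+s\<in>{0<..<1}. ennreal ((\<Psi> s * s powr (1 / p)) powr enn2real q / s) \<partial>lborel)"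
  proof (rule nn_integral_mono)
    fix s :: real
    have "(?R s * s powr (1 / p)) powr enn2real q / s \<le> (\<Psi> s * s powr (1 / p)) powr enn2real q / s" if "0 < s"
      using R[OF that] decr_rearr_nonneg[OF smirnov_boundary_measurable[OF a] that] that
      by (intro divide_right_mono powr_mono2 mult_right_mono) auto
    then show "ennreal ((?R s * s powr (1 / p)) powr enn2real q / s) * indicator {0<..<1} s \<le>
        ennreal ((\<Psi> s * s powr (1 / p)) powr enn2real q / s) * indicator {0<..<1} s"
      by (auto simp: indicator_def intro!: ennreal_leI)
  qed
  also note I
  finally have "lorentz_norm p q (boundary_fun (disc_fun a)) < \<infinity>"
    using q by (simp add: lorentz_norm_def ennreal_powr_less_top)
  then show ?thesis using a by (simp add: hardy_lorentz_def)
qed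

lemma kernel_seq_radial:
  assumes s: "0 < s"
  obtains C where "0 < C" "kernel_seq s \<in> smirnov_class"
    "\<And>t. 0 < t \<Longrightarrow> decr_rearr (boundary_fun (disc_fun (kernel_seq s))) t \<le> C * t powr - s"
proof -
  obtain C where C: "0 < C" "\<And>z. z \<in> cball 0 1 - {1} \<Longrightarrow> cmod (kernel_fun s z) \<le> C * cmod (1 - z) powr - s"
    using kernel_fun_bound[OF s] by blast
  note rm = radial_majorant[OF kernel_seq_analytic[OF s] kernel_fun_continuous[OF s] kernel_fun_eq[OF s] C(2), of C s]
  show ?thesis
  proof (rule that[OF C(1)])
    show "kernel_seq s \<in> smirnov_class"
      by (rule rm(1)) (use C s in \<open>auto intro!: mult_left_mono powr_mono2'\<close>)
    show "decr_rearr (boundary_fun (disc_fun (kernel_seq s))) t \<le> C * t powr - s" if "0 < t" for t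
      by (rule rm(2)) (use C s that in \<open>auto intro!: mult_left_mono powr_mono2'\<close>)
  qed
qed

text \<open>This is the function 1 / (1 - z), the kernel of order 1, and its product with l is l
  itself; so a multiplier into the Bloch space has to be analytic. Its rearrangement is O(1 / t),
  and the Lorentz integral converges because 1 / p > 1.\<close>

lemma one_in_hardy_lorentz:
  fixes p :: real and q :: ennreal
  assumes p: "0 < p" "p < 1" and q: "0 < q" "q \<noteq> \<infinity>"
  shows "(\<lambda>n. 1) \<in> hardy_lorentz p q"
proof -
  define Q where "Q = enn2real q"
  have Q: "0 < Q" using q by (simp add: Q_def enn2real_positive_iff less_top)
  have p1: "0 < 1 / p - 1" using p by (simp add: field_simps)
  obtain C where C: "0 < C" "kernel_seq 1 \<in> smirnov_class"
    "\<And>t. 0 < t \<Longrightarrow> decr_rearr (boundary_fun (disc_fun (kernel_seq 1))) t \<le> C * t powr - 1"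
    using kernel_seq_radial[of 1] by auto
  have "kernel_seq 1 \<in> hardy_lorentz p q"
  proof (rule hardy_lorentz_finiteI[OF q C(2,3)])
    have "(\<integral>\<^sup>+s\<in>{0<..<1}. ennreal ((C * s powr - 1 * s powr (1 / p)) powr enn2real q / s) \<partial>lborel) \<le>
        (\<integral>\<^sup>+s. ennreal (C powr Q) * (ennreal (s powr ((1 / p - 1) * Q - 1)) * indicator {0..1} s) \<partial>lborel)"
    proof (rule nn_integral_mono)
      fix s :: real
      have "(C * s powr - 1 * s powr (1 / p)) powr Q / s = C powr Q * s powr ((1 / p - 1) * Q - 1)" if "0 < s"
      proof -
        have "s powr - 1 * s powr (1 / p) = s powr (- 1 + 1 / p)" by (rule powr_add[symmetric])
        then have e: "C * s powr - 1 * s powr (1 / p) = C * s powr (1 / p - 1)"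
          by (simp only: mult.assoc) (simp add: add.commute)
        show ?thesis unfolding e
          using C(1) that powr_diff[of s "(1 / p - 1) * Q" 1] by (simp add: powr_mult powr_powr)
      qed
      then show "ennreal ((C * s powr - 1 * s powr (1 / p)) powr enn2real q / s) * indicator {0<..<1} s \<le>
          ennreal (C powr Q) * (ennreal (s powr ((1 / p - 1) * Q - 1)) * indicator {0..1} s)"
        by (auto simp: indicator_def Q_def ennreal_mult simp del: powr_minus_divide)
    qed
    also have "\<dots> = ennreal (C powr Q) * (\<integral>\<^sup>+s\<in>{0..1}. ennreal (s powr ((1 / p - 1) * Q - 1)) \<partial>lborel)"
      by (rule nn_integral_cmult) measurable
    also have "\<dots> < \<infinity>"
      using p1 Q by (subst nn_integral_powr_Icc) (auto simp: ennreal_mult_less_top)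
    finally show "(\<integral>\<^sup>+s\<in>{0<..<1}. ennreal ((C * s powr - 1 * s powr (1 / p)) powr enn2real q / s) \<partial>lborel) < \<infinity>" .
  qed
  then show ?thesis by (simp add: kernel_seq_1[abs_def])
qed

text \<open>Multiplying the n-th coefficient by the sum of the d_k \<alpha>_k^n superposes the
  dilates b(\<alpha>_k z) with weights d_k. The double series is dominated by d_k |b_n| |z|^n, and
  the interchange is \<open>sums_integral\<close> for the counting measure.\<close>

lemma disc_fun_superposition:
  fixes d \<alpha> :: "nat \<Rightarrow> real"
  assumes b: "b \<in> analytic_disc" and d: "summable d" "\<And>k. 0 \<le> d k" and \<alpha>: "\<And>k. 0 \<le> \<alpha> k" "\<And>k. \<alpha> k \<le> 1"
  shows "(\<lambda>n. b n * of_real (\<Sum>k. d k * \<alpha> k ^ n)) \<in> analytic_disc"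
    and "cmod z < 1 \<Longrightarrow> (\<lambda>k. of_real (d k) * disc_fun b (of_real (\<alpha> k) * z)) sums
      disc_fun (\<lambda>n. b n * of_real (\<Sum>k. d k * \<alpha> k ^ n)) z"
proof -
  have le: "d k * \<alpha> k ^ n \<le> d k" for k n
    using d(2) \<alpha> by (intro mult_left_le) (auto intro: power_le_one)
  have sm: "summable (\<lambda>k. d k * \<alpha> k ^ n)" for n
    by (rule summable_comparison_test'[OF d(1)]) (use le d(2) \<alpha>(1) in auto)
  have c0: "0 \<le> (\<Sum>k. d k * \<alpha> k ^ n)" for n by (intro suminf_nonneg sm) (use d(2) \<alpha>(1) in auto)
  have cle: "(\<Sum>k. d k * \<alpha> k ^ n) \<le> (\<Sum>k. d k)" for n by (intro suminf_le sm d le)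
  show A: "(\<lambda>n. b n * of_real (\<Sum>k. d k * \<alpha> k ^ n)) \<in> analytic_disc"
  proof (rule analytic_discI)
    fix r :: real assume r: "0 < r" "r < 1"
    obtain B where B: "\<And>n. cmod (b n) * r ^ n \<le> B" using analytic_disc_bounded[OF b, of r] r by auto
    have "cmod (b n * of_real (\<Sum>k. d k * \<alpha> k ^ n)) * r ^ n \<le> B * (\<Sum>k. d k)" for n
    proof -
      have "cmod (b n * of_real (\<Sum>k. d k * \<alpha> k ^ n)) * r ^ n = (cmod (b n) * r ^ n) * (\<Sum>k. d k * \<alpha> k ^ n)"
        using c0[of n] by (simp add: norm_mult)
      also have "\<dots> \<le> B * (\<Sum>k. d k)"
        using r by (intro mult_mono B cle c0 order_trans[OF _ B[of n]]) auto
      finally show ?thesis .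
    qed
    then show "\<exists>B. \<forall>n. cmod (b n * of_real (\<Sum>k. d k * \<alpha> k ^ n)) * r ^ n \<le> B" by blast
  qed
  assume z: "cmod z < 1"
  define f where "f k n = of_real (d k * \<alpha> k ^ n) * (b n * z ^ n)" for k n
  have sb: "summable (\<lambda>n. cmod (b n) * cmod z ^ n)" by (rule analytic_disc_norm_summable[OF b]) (use z in auto)
  have fle: "norm (f k n) \<le> d k * (cmod (b n) * cmod z ^ n)" for k n
    unfolding f_def norm_mult norm_of_real norm_power using le[of k n] d(2)[of k] \<alpha>(1)[of k]
    by (intro mult_right_mono) auto
  have sfn: "summable (\<lambda>n. norm (f k n))" for k
    by (rule summable_comparison_test'[OF summable_mult[OF sb, of "d k"]]) (use fle in auto)
  have 1: "integrable (count_space UNIV) (f k)" for k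
    using sfn by (simp add: integrable_count_space_nat_iff)
  have 2: "AE n in count_space UNIV. summable (\<lambda>k. norm (f k n))"
    by (intro AE_I2 summable_comparison_test'[OF summable_mult2[OF d(1)]]) (use fle in auto)
  have 3: "summable (\<lambda>k. LINT n|count_space UNIV. norm (f k n))"
  proof (rule summable_comparison_test'[OF summable_mult2[OF d(1)]])
    fix k
    have "(LINT n|count_space UNIV. norm (f k n)) = (\<Sum>n. norm (f k n))"
      using sfn by (intro integral_count_space_nat) (simp add: integrable_count_space_nat_iff)
    also have "\<dots> \<le> (\<Sum>n. d k * (cmod (b n) * cmod z ^ n))"
      by (intro suminf_le fle sfn summable_mult sb)
    also have "\<dots> = d k * (\<Sum>n. cmod (b n) * cmod z ^ n)" by (rule suminf_mult[OF sb])
    finally show "norm (LINT n|count_space UNIV. norm (f k n)) \<le> d k * (\<Sum>n. cmod (b n) * cmod z ^ n)"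
      by (simp add: integral_nonneg_AE)
  qed
  have s1: "(\<lambda>k. LINT n|count_space UNIV. f k n) sums (LINT n|count_space UNIV. (\<Sum>k. f k n))"
    by (rule sums_integral[OF 1 2 3])
  have s2: "(LINT n|count_space UNIV. (\<Sum>k. f k n)) = (\<Sum>n. \<Sum>k. f k n)"
    by (rule integral_count_space_nat[OF integrable_suminf[OF 1 2 3]])
  have s3: "(\<Sum>k. f k n) = b n * of_real (\<Sum>k. d k * \<alpha> k ^ n) * z ^ n" for n
  proof -
    have "(\<lambda>k. of_real (d k * \<alpha> k ^ n) * (b n * z ^ n)) sums (of_real (\<Sum>k. d k * \<alpha> k ^ n) * (b n * z ^ n))"
      by (intro sums_mult2 sums_of_real summable_sums sm)
    then have "(\<Sum>k. f k n) = of_real (\<Sum>k. d k * \<alpha> k ^ n) * (b n * z ^ n)"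
      unfolding f_def by (rule sums_unique[symmetric])
    then show ?thesis by (simp only: mult_ac)
  qed
  have s4: "(LINT n|count_space UNIV. f k n) = of_real (d k) * disc_fun b (of_real (\<alpha> k) * z)" for k
  proof -
    have z': "cmod (of_real (\<alpha> k) * z) < 1"
      using z \<alpha>[of k] by (simp add: norm_mult le_less_trans[OF mult_left_le_one_le])
    have "(\<lambda>n. of_real (d k) * (b n * (of_real (\<alpha> k) * z) ^ n)) sums (of_real (d k) * disc_fun b (of_real (\<alpha> k) * z))"
      by (intro sums_mult analytic_disc_sums b z')
    also have "(\<lambda>n. of_real (d k) * (b n * (of_real (\<alpha> k) * z) ^ n)) = f k"
      by (simp add: f_def fun_eq_iff power_mult_distrib mult_ac)
    finally show ?thesis
      using integral_count_space_nat[OF 1] by (simp add: sums_iff)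
  qed
  show "(\<lambda>k. of_real (d k) * disc_fun b (of_real (\<alpha> k) * z)) sums
      disc_fun (\<lambda>n. b n * of_real (\<Sum>k. d k * \<alpha> k ^ n)) z"
    using s1 unfolding s2 unfolding s3 s4 by (simp only: disc_fun_def)
qed

text \<open>A replacement for the triangle inequality that works for every Q > 0. If all 2^(-k) x_k
  were below a quarter of the sum X, splitting 4^(-k) into 2^(-k) 2^(-k) would give X <= X / 2. So a
  single term dominates X up to the factor 4, and its power is at most the sum of all
  powers.\<close>

lemma suminf_geometric_powr_le:
  fixes x :: "nat \<Rightarrow> real"
  assumes x: "\<And>k. 0 \<le> x k" "\<And>k. x k \<le> 1" and Q: "0 < Q"
  shows "ennreal ((\<Sum>k. (1 / 4) ^ k * x k) powr Q) \<le> (\<Sum>k. ennreal (4 powr Q * (((1 / 2) ^ k) powr Q * x k powr Q)))"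
proof -
  let ?X = "\<Sum>k. (1 / 4) ^ k * x k"
  have sm: "summable (\<lambda>k. (1 / 4 :: real) ^ k * x k)"
    by (rule summable_comparison_test'[OF summable_geometric[of "1 / 4 :: real"]]) (use x in \<open>auto simp: mult_left_le\<close>)
  have X0: "0 \<le> ?X" by (intro suminf_nonneg sm) (use x in auto)
  show ?thesis
  proof (cases "?X = 0")
    case False
    have "\<exists>k. ?X \<le> 4 * ((1 / 2) ^ k * x k)"
    proof (rule ccontr)
      assume "\<not> ?thesis"
      then have lt: "(1 / 2) ^ k * x k \<le> ?X / 4" for k by (simp add: not_le less_imp_le field_simps)
      have "(1 / 4) ^ k * x k \<le> (1 / 2) ^ k * (?X / 4)" for k
      proof -
        have "(1 / 4 :: real) ^ k = (1 / 2) ^ k * (1 / 2) ^ k" by (simp flip: power_mult_distrib)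
        then have "(1 / 4) ^ k * x k = (1 / 2) ^ k * ((1 / 2) ^ k * x k)" by simp
        also have "\<dots> \<le> (1 / 2) ^ k * (?X / 4)" by (intro mult_left_mono lt) simp
        finally show ?thesis .
      qed
      then have "?X \<le> (\<Sum>k. (1 / 2) ^ k * (?X / 4))"
        by (intro suminf_le sm summable_mult2 summable_geometric) auto
      also have "\<dots> = (\<Sum>k. (1 / 2) ^ k) * (?X / 4)" by (rule suminf_mult2[symmetric]) (intro summable_geometric, simp)
      also have "\<dots> = ?X / 2" by (simp add: suminf_geometric)
      finally show False using X0 False by simp
    qed
    then obtain k where k: "?X \<le> 4 * ((1 / 2) ^ k * x k)" by blast
    have "?X powr Q \<le> (4 * ((1 / 2) ^ k * x k)) powr Q" using k X0 Q by (intro powr_mono2) auto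
    also have "\<dots> = 4 powr Q * (((1 / 2) ^ k) powr Q * x k powr Q)" using x by (simp add: powr_mult)
    finally have "ennreal (?X powr Q) \<le> ennreal (4 powr Q * (((1 / 2) ^ k) powr Q * x k powr Q))" by (rule ennreal_leI)
    also have "\<dots> = (\<Sum>j\<in>{k}. ennreal (4 powr Q * (((1 / 2) ^ j) powr Q * x j powr Q)))" by simp
    also have "\<dots> \<le> (\<Sum>k. ennreal (4 powr Q * (((1 / 2) ^ k) powr Q * x k powr Q)))"
      by (rule sum_le_suminf) auto
    finally show ?thesis .
  qed (use Q in simp)
qed

text \<open>The dilated kernel (1 - \<alpha>_k z)^(-2 \<beta>) times (1 - \<alpha>_k)^\<beta> has
  Lorentz norm bounded independently of k, so the weights 4^(-k) suffice for convergence. The radial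
  majorant \<Psi> of the whole sum is the sum of the radial majorants of the terms.\<close>

lemma kernel_superposition_in_hardy_lorentz:
  fixes p :: real and q :: ennreal and \<alpha> :: "nat \<Rightarrow> real"
  defines "\<beta> \<equiv> 1 / p"
  defines "d \<equiv> \<lambda>k. (1 / 4) ^ k * (1 - \<alpha> k) powr \<beta>"
  assumes p: "0 < p" and q: "0 < q" "q \<noteq> \<infinity>" and \<alpha>: "\<And>k. 0 \<le> \<alpha> k" "\<And>k. \<alpha> k < 1"
  shows "(\<lambda>n. kernel_seq (2 * \<beta>) n * of_real (\<Sum>k. d k * \<alpha> k ^ n)) \<in> hardy_lorentz p q"
proof -
  have \<beta>: "0 < \<beta>" "0 < 2 * \<beta>" using p by (simp_all add: \<beta>_def)
  define Q where "Q = enn2real q"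
  have Q: "0 < Q" using q by (simp add: Q_def enn2real_positive_iff less_top)
  define \<delta> where "\<delta> k = 1 - \<alpha> k" for k
  have \<delta>: "0 < \<delta> k" "\<delta> k \<le> 1" for k using \<alpha>[of k] by (auto simp: \<delta>_def)
  have d: "0 \<le> d k" "d k \<le> (1 / 4) ^ k" for k
  proof -
    have "\<delta> k powr \<beta> \<le> 1" using \<delta>[of k] \<beta> by (intro powr_le1) auto
    then show "0 \<le> d k" "d k \<le> (1 / 4) ^ k" by (auto simp: d_def \<delta>_def[symmetric] mult_left_le)
  qed
  have sd: "summable d"
    by (rule summable_comparison_test'[OF summable_geometric[of "1 / 4 :: real"]]) (use d in auto)
  let ?a = "\<lambda>n. kernel_seq (2 * \<beta>) n * of_real (\<Sum>k. d k * \<alpha> k ^ n)"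
  let ?K = "kernel_fun (2 * \<beta>)"
  note sup = disc_fun_superposition[OF kernel_seq_analytic[OF \<beta>(2)] sd d(1) \<alpha>(1) less_imp_le[OF \<alpha>(2)]]
  obtain C where C: "0 < C" "\<And>z. z \<in> cball 0 1 - {1} \<Longrightarrow> cmod (?K z) \<le> C * cmod (1 - z) powr - (2 * \<beta>)"
    using kernel_fun_bound[OF \<beta>(2)] by blast
  define D where "D = C * 3 powr (2 * \<beta>)"
  have D: "0 < D" using C by (simp add: D_def)
  define \<phi> where "\<phi> k t = d k * (\<delta> k + t) powr - (2 * \<beta>)" for k t
  define \<Psi> where "\<Psi> t = D * (\<Sum>k. \<phi> k t)" for t
  have \<phi>0: "0 \<le> \<phi> k t" for k t using d by (simp add: \<phi>_def)
  have \<phi>le: "\<phi> k t \<le> (1 / 4) ^ k * t powr - \<beta>" if t: "0 < t" for k t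
  proof -
    have "(\<delta> k + t) powr - (2 * \<beta>) = (\<delta> k + t) powr - \<beta> * (\<delta> k + t) powr - \<beta>" by (simp flip: powr_add)
    also have "\<dots> \<le> \<delta> k powr - \<beta> * t powr - \<beta>"
      using \<delta>[of k] t \<beta> by (intro mult_mono powr_mono2') auto
    finally have "\<phi> k t \<le> d k * (\<delta> k powr - \<beta> * t powr - \<beta>)"
      unfolding \<phi>_def using d by (intro mult_left_mono) auto
    also have "\<dots> = (1 / 4) ^ k * t powr - \<beta> * (\<delta> k powr \<beta> * \<delta> k powr - \<beta>)"
      unfolding d_def \<delta>_def[symmetric] by simp
    also have "\<delta> k powr \<beta> * \<delta> k powr - \<beta> = 1" using \<delta>[of k] by (simp flip: powr_add)
    finally show ?thesis by simp
  qed
  have s\<phi>: "summable (\<lambda>k. \<phi> k t)" if "0 < t" for t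
    by (rule summable_comparison_test'[OF summable_mult2[OF summable_geometric[of "1 / 4 :: real"]]])
       (use \<phi>le[OF that] \<phi>0 in auto)
  have mem: "of_real (\<alpha> k) * z \<in> cball 0 1 - {1}" if "z \<in> cball 0 1 - {1}" for k and z :: complex
  proof -
    have "cmod (of_real (\<alpha> k) * z) \<le> \<alpha> k" using that \<alpha>(1)[of k] by (simp add: norm_mult mult_left_le)
    then have "cmod (of_real (\<alpha> k) * z) < 1" using \<alpha>(2)[of k] by simp
    moreover from this have "of_real (\<alpha> k) * z \<noteq> 1" by (metis norm_one less_irrefl)
    ultimately show ?thesis using less_imp_le by simp
  qed
  have Kle: "cmod (of_real (d k) * ?K (of_real (\<alpha> k) * z)) \<le> D * \<phi> k (cmod (1 - z))" if z: "z \<in> cball 0 1 - {1}" for k z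
  proof -
    have t: "0 < cmod (1 - z)" using z by auto
    \<comment> \<open>Sum of 1 - \<alpha> <= |1 - \<alpha> z| and |1 - z| <= 2 |1 - \<alpha> z|;
      this is the origin of the 3 in \<open>D\<close>.\<close>
    have 3: "(\<delta> k + cmod (1 - z)) / 3 \<le> cmod (1 - of_real (\<alpha> k) * z)"
      using cmod_1_minus_le[of z "\<alpha> k"] z \<alpha>[of k] by (simp add: \<delta>_def)
    have "cmod (?K (of_real (\<alpha> k) * z)) \<le> C * cmod (1 - of_real (\<alpha> k) * z) powr - (2 * \<beta>)"
      by (rule C(2)[OF mem[OF z]])
    also have "\<dots> \<le> C * ((\<delta> k + cmod (1 - z)) / 3) powr - (2 * \<beta>)"
      using C(1) 3 \<beta> t \<delta>(1)[of k] by (intro mult_left_mono powr_mono2') (auto intro: add_pos_pos)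
    also have "\<dots> = D * (\<delta> k + cmod (1 - z)) powr - (2 * \<beta>)"
      using \<delta>[of k] by (simp add: D_def powr_divide powr_minus divide_simps)
    finally have "d k * cmod (?K (of_real (\<alpha> k) * z)) \<le> d k * (D * (\<delta> k + cmod (1 - z)) powr - (2 * \<beta>))"
      using d by (intro mult_left_mono) auto
    then show ?thesis using d(1)[of k] by (simp add: norm_mult \<phi>_def mult_ac)
  qed
  define F where "F z = (\<Sum>k. of_real (d k) * ?K (of_real (\<alpha> k) * z))" for z
  have sF: "summable (\<lambda>k. cmod (of_real (d k) * ?K (of_real (\<alpha> k) * z)))" if z: "z \<in> cball 0 1 - {1}" for z
    by (rule summable_comparison_test'[OF summable_mult[OF s\<phi>[of "cmod (1 - z)"], of D]]) (use Kle[OF z] z in auto)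
  have F\<Psi>: "cmod (F z) \<le> \<Psi> (cmod (1 - z))" if z: "z \<in> cball 0 1 - {1}" for z
  proof -
    have t: "0 < cmod (1 - z)" using z by auto
    have "cmod (F z) \<le> (\<Sum>k. cmod (of_real (d k) * ?K (of_real (\<alpha> k) * z)))"
      unfolding F_def by (rule summable_norm[OF sF[OF z]])
    also have "\<dots> \<le> (\<Sum>k. D * \<phi> k (cmod (1 - z)))"
      by (intro suminf_le Kle z sF summable_mult s\<phi> t)
    finally show ?thesis unfolding \<Psi>_def by (simp only: suminf_mult[OF s\<phi>[OF t]])
  qed
  have contF: "continuous_on (cball 0 1 - {1}) F"
    unfolding continuous_on_def
  proof
    fix z :: complex assume z: "z \<in> cball 0 1 - {1}"
    define \<eta> where "\<eta> = cmod (1 - z) / 2"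
    have \<eta>: "0 < \<eta>" "\<eta> < cmod (1 - z)" using z by (auto simp: \<eta>_def)
    \<comment> \<open>Continuity is local: at distance more than \<eta> from 1 the terms have the
      uniform majorants of the Weierstrass test.\<close>
    define T where "T = {w. \<eta> < cmod (1 - w)}"
    have "open T" unfolding T_def by (intro open_Collect_less continuous_intros)
    have "z \<in> T" using \<eta> by (simp add: T_def)
    let ?S = "(cball 0 1 - {1}) \<inter> T"
    have "continuous_on ?S F"
    proof (rule uniform_limit_theorem)
      show "uniform_limit ?S (\<lambda>n w. \<Sum>k<n. of_real (d k) * ?K (of_real (\<alpha> k) * w)) F sequentially"
        unfolding F_def
      proof (rule Weierstrass_m_test[where M = "\<lambda>k. D * ((1 / 4) ^ k * \<eta> powr - \<beta>)"])
        fix k w assume w: "w \<in> ?S"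
        have w': "\<eta> < cmod (1 - w)" using w by (simp add: T_def)
        have "cmod (of_real (d k) * ?K (of_real (\<alpha> k) * w)) \<le> D * \<phi> k (cmod (1 - w))" using w by (intro Kle) auto
        also have "\<dots> \<le> D * ((1 / 4) ^ k * cmod (1 - w) powr - \<beta>)"
          using D w' \<eta> by (intro mult_left_mono \<phi>le) auto
        also have "\<dots> \<le> D * ((1 / 4) ^ k * \<eta> powr - \<beta>)"
          using D w' \<eta> \<beta> by (intro mult_left_mono powr_mono2') auto
        finally show "cmod (of_real (d k) * ?K (of_real (\<alpha> k) * w)) \<le> D * ((1 / 4) ^ k * \<eta> powr - \<beta>)" .
      qed (intro summable_mult summable_mult2 summable_geometric, simp)
      show "\<forall>\<^sub>F n in sequentially. continuous_on ?S (\<lambda>w. \<Sum>k<n. of_real (d k) * ?K (of_real (\<alpha> k) * w))"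
      proof (intro always_eventually allI continuous_on_sum continuous_on_mult continuous_on_const)
        fix k
        show "continuous_on ?S (\<lambda>w. ?K (of_real (\<alpha> k) * w))"
          by (rule continuous_on_compose2[OF kernel_fun_continuous[OF \<beta>(2)]]) (use mem in \<open>auto intro!: continuous_intros\<close>)
      qed
    qed simp
    then have "(F \<longlongrightarrow> F z) (at z within ?S)" using z \<open>z \<in> T\<close> by (auto simp: continuous_on_def)
    also have "at z within ?S = at z within cball 0 1 - {1}"
      by (rule at_within_nhd[OF \<open>z \<in> T\<close> \<open>open T\<close>]) auto
    finally show "(F \<longlongrightarrow> F z) (at z within cball 0 1 - {1})" .
  qed
  have Feq: "F z = disc_fun ?a z" if z: "z \<in> ball 0 1" for z
  proof -
    have "?K (of_real (\<alpha> k) * z) = disc_fun (kernel_seq (2 * \<beta>)) (of_real (\<alpha> k) * z)" for k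
      by (rule kernel_fun_eq[OF \<beta>(2)])
         (use z \<alpha>[of k] in \<open>simp add: norm_mult le_less_trans[OF mult_left_le_one_le] less_imp_le\<close>)
    then show ?thesis unfolding F_def using sup(2)[of z] z by (simp add: sums_iff)
  qed
  have \<Psi>anti: "\<Psi> t \<le> \<Psi> s" if "0 < s" "s \<le> t" for s t
    unfolding \<Psi>_def using that D \<beta> d \<delta>
    by (intro mult_left_mono suminf_le s\<phi>) (auto simp: \<phi>_def intro!: mult_left_mono powr_mono2' add_pos_pos)
  have \<Psi>0: "0 \<le> \<Psi> t" if "0 < t" for t
    unfolding \<Psi>_def using D \<phi>0 s\<phi>[OF that] by (intro mult_nonneg_nonneg suminf_nonneg) auto
  have \<Psi>gr: "\<Psi> t \<le> (D * (4 / 3)) * t powr - \<beta>" if t: "0 < t" for t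
  proof -
    have "(\<Sum>k. \<phi> k t) \<le> (\<Sum>k. (1 / 4) ^ k * t powr - \<beta>)"
      by (intro suminf_le \<phi>le s\<phi> t summable_mult2 summable_geometric) auto
    also have "\<dots> = (\<Sum>k. (1 / 4) ^ k) * t powr - \<beta>" by (rule suminf_mult2[symmetric]) (intro summable_geometric, simp)
    also have "(\<Sum>k. (1 / 4 :: real) ^ k) = 4 / 3" by (simp add: suminf_geometric)
    finally show ?thesis unfolding \<Psi>_def using D by (simp add: mult.assoc)
  qed
  note rm = radial_majorant[OF sup(1) contF Feq F\<Psi> \<Psi>anti \<Psi>0 \<Psi>gr \<beta>(1)]
  have sm: "?a \<in> smirnov_class" by (rule rm(1)) (use D in auto)
  have R: "decr_rearr (boundary_fun (disc_fun ?a)) t \<le> \<Psi> t" if "0 < t" for t by (rule rm(2)) (use D that in auto)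
  \<comment> \<open>Up to 4^(-k), \<open>x k t\<close> is t^\<beta> times the k-th majorant. It is
    symmetric in \<delta>_k and t and behaves like (t / \<delta>_k)^\<beta> or its inverse on the
    two sides of t = \<delta>_k. Hence it is at most 1, and the integral of its power Q against dt /
    t is bounded uniformly in k.\<close>
  define x where "x k t = \<delta> k powr \<beta> * t powr \<beta> * (\<delta> k + t) powr - (2 * \<beta>)" for k t
  have x0: "0 \<le> x k t" for k t by (simp add: x_def)
  have x_le1: "x k t \<le> t powr \<beta> * \<delta> k powr - \<beta>" if "0 < t" for k t
  proof -
    have "x k t \<le> \<delta> k powr \<beta> * t powr \<beta> * \<delta> k powr - (2 * \<beta>)"
      unfolding x_def using that \<delta>[of k] \<beta> by (intro mult_left_mono powr_mono2') auto
    also have "\<dots> = t powr \<beta> * (\<delta> k powr \<beta> * \<delta> k powr - (2 * \<beta>))" by simp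
    also have "\<delta> k powr \<beta> * \<delta> k powr - (2 * \<beta>) = \<delta> k powr - \<beta>" by (simp flip: powr_add)
    finally show ?thesis .
  qed
  have x_le2: "x k t \<le> \<delta> k powr \<beta> * t powr - \<beta>" if "0 < t" for k t
  proof -
    have "x k t \<le> \<delta> k powr \<beta> * t powr \<beta> * t powr - (2 * \<beta>)"
      unfolding x_def using that \<delta>[of k] \<beta> by (intro mult_left_mono powr_mono2') auto
    also have "\<dots> = \<delta> k powr \<beta> * (t powr \<beta> * t powr - (2 * \<beta>))" by simp
    also have "t powr \<beta> * t powr - (2 * \<beta>) = t powr - \<beta>" by (simp flip: powr_add)
    finally show ?thesis .
  qed
  have x1: "x k t \<le> 1" if t: "0 < t" for k t
  proof -
    have 1: "u powr \<beta> * u powr - \<beta> = 1" if "0 < u" for u using that by (simp flip: powr_add)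
    show ?thesis
    proof (cases "t \<le> \<delta> k")
      case True
      have "x k t \<le> t powr \<beta> * \<delta> k powr - \<beta>" by (rule x_le1[OF t])
      also have "\<dots> \<le> \<delta> k powr \<beta> * \<delta> k powr - \<beta>" using True t \<beta> by (intro mult_right_mono powr_mono2) auto
      finally show ?thesis using 1[OF \<delta>(1)] by simp
    next
      case False
      have "x k t \<le> \<delta> k powr \<beta> * t powr - \<beta>" by (rule x_le2[OF t])
      also have "\<dots> \<le> t powr \<beta> * t powr - \<beta>" using False \<delta>(1)[of k] \<beta> by (intro mult_right_mono powr_mono2) auto
      finally show ?thesis using 1[OF t] by simp
    qed
  qed
  have xI: "(\<integral>\<^sup>+t\<in>{0<..<1}. ennreal (x k t powr Q / t) \<partial>lborel) \<le> ennreal (2 / (\<beta> * Q))" for k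
  proof -
    have "(\<integral>\<^sup>+t\<in>{0<..<1}. ennreal (x k t powr Q / t) \<partial>lborel) \<le>
        (\<integral>\<^sup>+t. ennreal (\<delta> k powr - (\<beta> * Q)) * (ennreal (t powr (\<beta> * Q - 1)) * indicator {0..\<delta> k} t) +
          ennreal (\<delta> k powr (\<beta> * Q)) * (ennreal (t powr (- (\<beta> * Q) - 1)) * indicator {\<delta> k..} t) \<partial>lborel)"
    proof (rule nn_integral_mono)
      fix t :: real
      show "ennreal (x k t powr Q / t) * indicator {0<..<1} t \<le>
          ennreal (\<delta> k powr - (\<beta> * Q)) * (ennreal (t powr (\<beta> * Q - 1)) * indicator {0..\<delta> k} t) +
          ennreal (\<delta> k powr (\<beta> * Q)) * (ennreal (t powr (- (\<beta> * Q) - 1)) * indicator {\<delta> k..} t)"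
      proof (cases "t \<in> {0<..<1}")
        case True
        show ?thesis
        proof (cases "t \<le> \<delta> k")
          case t: True
          have "x k t powr Q / t \<le> (t powr \<beta> * \<delta> k powr - \<beta>) powr Q / t"
            using True Q x0 by (intro divide_right_mono powr_mono2 x_le1) auto
          also have "\<dots> = \<delta> k powr - (\<beta> * Q) * t powr (\<beta> * Q - 1)"
            using True by (simp add: powr_mult powr_powr powr_diff)
          finally have "ennreal (x k t powr Q / t) \<le> ennreal (\<delta> k powr - (\<beta> * Q)) * ennreal (t powr (\<beta> * Q - 1))"
            by (simp add: ennreal_leI flip: ennreal_mult)
          then show ?thesis using True t by (simp add: add_increasing2)
        next
          case t: False
          have "x k t powr Q / t \<le> (\<delta> k powr \<beta> * t powr - \<beta>) powr Q / t"
            using True Q x0 by (intro divide_right_mono powr_mono2 x_le2) auto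
          also have "\<dots> = \<delta> k powr (\<beta> * Q) * t powr (- (\<beta> * Q) - 1)"
            using True by (simp add: powr_mult powr_powr powr_diff)
          finally have "ennreal (x k t powr Q / t) \<le> ennreal (\<delta> k powr (\<beta> * Q)) * ennreal (t powr (- (\<beta> * Q) - 1))"
            by (simp add: ennreal_leI flip: ennreal_mult)
          then show ?thesis using True t by (simp add: add_increasing)
        qed
      qed simp
    qed
    also have "\<dots> = ennreal (\<delta> k powr - (\<beta> * Q)) * (\<integral>\<^sup>+t\<in>{0..\<delta> k}. ennreal (t powr (\<beta> * Q - 1)) \<partial>lborel) +
        ennreal (\<delta> k powr (\<beta> * Q)) * (\<integral>\<^sup>+t\<in>{\<delta> k..}. ennreal (t powr (- (\<beta> * Q) - 1)) \<partial>lborel)"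
      by (simp add: nn_integral_add nn_integral_cmult)
    also have "\<dots> = ennreal (\<delta> k powr - (\<beta> * Q)) * ennreal (\<delta> k powr (\<beta> * Q) / (\<beta> * Q)) +
        ennreal (\<delta> k powr (\<beta> * Q)) * ennreal (\<delta> k powr - (\<beta> * Q) / (\<beta> * Q))"
    proof -
      have "0 < \<beta> * Q" using \<beta> Q by simp
      then have "(\<integral>\<^sup>+t\<in>{0..\<delta> k}. ennreal (t powr (\<beta> * Q - 1)) \<partial>lborel) = ennreal (\<delta> k powr (\<beta> * Q) / (\<beta> * Q))"
        "(\<integral>\<^sup>+t\<in>{\<delta> k..}. ennreal (t powr (- (\<beta> * Q) - 1)) \<partial>lborel) = ennreal (\<delta> k powr - (\<beta> * Q) / (\<beta> * Q))"
        using nn_integral_powr_Icc[of "\<beta> * Q - 1" "\<delta> k"] nn_integral_powr_Ici[of "- (\<beta> * Q) - 1" "\<delta> k"] \<delta>[of k] by simp_all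
      then show ?thesis by (simp only:)
    qed
    also have "\<dots> = ennreal (\<delta> k powr - (\<beta> * Q) * (\<delta> k powr (\<beta> * Q) / (\<beta> * Q)) + \<delta> k powr (\<beta> * Q) * (\<delta> k powr - (\<beta> * Q) / (\<beta> * Q)))"
      using \<beta> Q by (simp flip: ennreal_mult ennreal_plus)
    also have "\<delta> k powr - (\<beta> * Q) * (\<delta> k powr (\<beta> * Q) / (\<beta> * Q)) + \<delta> k powr (\<beta> * Q) * (\<delta> k powr - (\<beta> * Q) / (\<beta> * Q)) = 2 / (\<beta> * Q)"
    proof -
      have "\<delta> k powr - (\<beta> * Q) * \<delta> k powr (\<beta> * Q) = 1" using \<delta>[of k] by (simp flip: powr_add)
      then show ?thesis by (simp add: mult.commute)
    qed
    finally show ?thesis by simp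
  qed
  have "(\<integral>\<^sup>+t\<in>{0<..<1}. ennreal ((\<Psi> t * t powr (1 / p)) powr enn2real q / t) \<partial>lborel) \<le>
      (\<integral>\<^sup>+t. (\<Sum>k. ennreal (D powr Q * 4 powr Q * ((1 / 2) ^ k) powr Q) * (ennreal (x k t powr Q / t) * indicator {0<..<1} t)) \<partial>lborel)"
  proof (rule nn_integral_mono)
    fix t :: real
    show "ennreal ((\<Psi> t * t powr (1 / p)) powr enn2real q / t) * indicator {0<..<1} t \<le>
        (\<Sum>k. ennreal (D powr Q * 4 powr Q * ((1 / 2) ^ k) powr Q) * (ennreal (x k t powr Q / t) * indicator {0<..<1} t))"
    proof (cases "t \<in> {0<..<1}")
      case True
      then have t: "0 < t" by simp
      have "(\<Sum>k. \<phi> k t) * t powr \<beta> = (\<Sum>k. \<phi> k t * t powr \<beta>)" by (rule suminf_mult2[OF s\<phi>[OF t]])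
      also have "(\<lambda>k. \<phi> k t * t powr \<beta>) = (\<lambda>k. (1 / 4) ^ k * x k t)"
        unfolding \<phi>_def x_def d_def \<delta>_def[symmetric] by (simp add: fun_eq_iff mult_ac)
      finally have "(\<Psi> t * t powr \<beta>) powr Q / t = D powr Q / t * ((\<Sum>k. (1 / 4) ^ k * x k t) powr Q)"
        using D by (simp add: \<Psi>_def mult.assoc powr_mult)
      then have "ennreal ((\<Psi> t * t powr \<beta>) powr Q / t) = ennreal (D powr Q / t) * ennreal ((\<Sum>k. (1 / 4) ^ k * x k t) powr Q)"
        using t by (simp flip: ennreal_mult)
      also have "\<dots> \<le> ennreal (D powr Q / t) * (\<Sum>k. ennreal (4 powr Q * (((1 / 2) ^ k) powr Q * x k t powr Q)))"
        by (intro mult_left_mono suminf_geometric_powr_le x0 x1 t Q) simp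
      also have "\<dots> = (\<Sum>k. ennreal (D powr Q / t) * ennreal (4 powr Q * (((1 / 2) ^ k) powr Q * x k t powr Q)))"
        by simp
      also have "\<dots> = (\<Sum>k. ennreal (D powr Q * 4 powr Q * ((1 / 2) ^ k) powr Q) * ennreal (x k t powr Q / t))"
        using t by (intro suminf_cong) (simp add: mult_ac flip: ennreal_mult)
      finally show ?thesis using True by (simp add: \<beta>_def Q_def)
    qed simp
  qed
  also have "\<dots> = (\<Sum>k. \<integral>\<^sup>+t. ennreal (D powr Q * 4 powr Q * ((1 / 2) ^ k) powr Q) * (ennreal (x k t powr Q / t) * indicator {0<..<1} t) \<partial>lborel)"
    unfolding x_def by (rule nn_integral_suminf) measurable
  also have "\<dots> = (\<Sum>k. ennreal (D powr Q * 4 powr Q * ((1 / 2) ^ k) powr Q) * (\<integral>\<^sup>+t\<in>{0<..<1}. ennreal (x k t powr Q / t) \<partial>lborel))"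
    unfolding x_def by (intro suminf_cong nn_integral_cmult) measurable
  also have "\<dots> \<le> (\<Sum>k. ennreal (D powr Q * 4 powr Q * ((1 / 2) ^ k) powr Q) * ennreal (2 / (\<beta> * Q)))"
    by (intro suminf_le mult_left_mono xI) auto
  also have "\<dots> = (\<Sum>k. ennreal ((D powr Q * 4 powr Q * (2 / (\<beta> * Q))) * ((1 / 2) powr Q) ^ k))"
  proof (intro suminf_cong)
    fix k
    have "((1 / 2 :: real) ^ k) powr Q = ((1 / 2) powr Q) ^ k"
      by (simp add: powr_powr mult.commute flip: powr_realpow)
    then show "ennreal (D powr Q * 4 powr Q * ((1 / 2) ^ k) powr Q) * ennreal (2 / (\<beta> * Q)) =
        ennreal ((D powr Q * 4 powr Q * (2 / (\<beta> * Q))) * ((1 / 2) powr Q) ^ k)"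
      using \<beta> Q by (simp add: mult_ac flip: ennreal_mult)
  qed
  also have "\<dots> < \<infinity>"
  proof -
    have "(1 / 2 :: real) powr Q < 1" using powr_less_mono2[of Q "1 / 2" 1] Q by simp
    then have "summable (\<lambda>k. (D powr Q * 4 powr Q * (2 / (\<beta> * Q))) * ((1 / 2) powr Q) ^ k)"
      by (intro summable_mult summable_geometric) simp
    then show ?thesis using \<beta> Q
      by (subst suminf_ennreal2) (auto intro!: mult_nonneg_nonneg)
  qed
  finally have I: "(\<integral>\<^sup>+t\<in>{0<..<1}. ennreal ((\<Psi> t * t powr (1 / p)) powr enn2real q / t) \<partial>lborel) < \<infinity>" .
  show ?thesis by (rule hardy_lorentz_finiteI[OF q sm R I])
qed

section \<open>Coefficient multipliers of Hardy-Lorentz spaces\<close>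

lemma analytic_disc_bounded_on_cball:
  assumes "a \<in> analytic_disc" "r < 1"
  shows "\<exists>S\<ge>0. \<forall>z. cmod z \<le> r \<longrightarrow> cmod (disc_fun a z) \<le> S"
proof -
  have "continuous_on (cball 0 r) (disc_fun a)"
    by (rule continuous_on_subset[OF holomorphic_on_imp_continuous_on[OF analytic_disc_holomorphic[OF assms(1)]]])
       (use assms(2) in auto)
  then have "bounded (disc_fun a ` cball 0 r)"
    by (intro compact_imp_bounded compact_continuous_image compact_cball)
  then obtain S where "0 < S" "\<And>z. cmod z \<le> r \<Longrightarrow> cmod (disc_fun a z) \<le> S"
    unfolding bounded_pos by force
  then show ?thesis by (intro exI[of _ S]) auto
qed

text \<open>
  Gliding hump. If \<open>(1 - \<bar>z\<bar>)\<^sup>\<beta>\<^sup>+\<^sup>1 \<bar>\<Lambda>(z)\<bar>\<close> is unbounded, sparse points \<open>w\<^sub>k\<close> are chosen where it is large,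
  and the sum of the kernels adapted to the radii \<open>\<bar>w\<^sub>k\<bar>\<close> violates the Bloch condition near each \<open>w\<^sub>k\<close>.
\<close>

lemma multipliers_bloch_growth:
  fixes p :: real and q :: ennreal
  defines "\<beta> \<equiv> 1 / p"
  assumes p: "0 < p" "p < 1" and q: "0 < q" "q \<noteq> \<infinity>"
    and l: "l \<in> multipliers (hardy_lorentz p q) bloch" and lA: "l \<in> analytic_disc"
  defines "\<Lambda> \<equiv> disc_fun (frac_deriv (2 * \<beta>) l)"
  shows "\<exists>C\<ge>0. \<forall>z. cmod z < 1 \<longrightarrow> (1 - cmod z) powr (\<beta> + 1) * cmod (\<Lambda> z) \<le> C"
proof (rule ccontr)
  assume neg: "\<not> ?thesis"
  have \<beta>: "1 < \<beta>" using p by (simp add: \<beta>_def)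
  define b where "b = frac_deriv (2 * \<beta>) l"
  have b: "b \<in> analytic_disc" unfolding b_def using \<beta> lA by (intro frac_deriv_analytic) auto
  have \<Lambda>: "\<Lambda> = disc_fun b" by (simp add: \<Lambda>_def b_def)
  obtain S where S: "\<And>r. r < 1 \<Longrightarrow> 0 \<le> S r" "\<And>r z. r < 1 \<Longrightarrow> cmod z \<le> r \<Longrightarrow> cmod (\<Lambda> z) \<le> S r"
    using analytic_disc_bounded_on_cball[OF b] unfolding \<Lambda> by metis
  define \<Phi> where "\<Phi> z = (1 - cmod z) powr (\<beta> + 1) * cmod (\<Lambda> z)" for z
  \<comment> \<open>Exceeding \<open>S r\<close> as well pushes the point beyond radius r, because
    inside that radius \<Phi> <= |\<Lambda>| <= \<open>S r\<close>.\<close>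
  have large: "\<exists>z. cmod z < 1 \<and> r < cmod z \<and> B < \<Phi> z" if r: "0 \<le> r" "r < 1" for r B
  proof -
    have "\<exists>z. cmod z < 1 \<and> max \<bar>B\<bar> (S r) < \<Phi> z"
    proof (rule ccontr)
      assume "\<not> ?thesis"
      then have "\<forall>z. cmod z < 1 \<longrightarrow> \<Phi> z \<le> max \<bar>B\<bar> (S r)" by (meson not_less)
      then have "\<exists>C\<ge>0. \<forall>z. cmod z < 1 \<longrightarrow> \<Phi> z \<le> C" by (intro exI[of _ "max \<bar>B\<bar> (S r)"]) auto
      with neg show False unfolding \<Phi>_def by blast
    qed
    then obtain z where z: "cmod z < 1" "max \<bar>B\<bar> (S r) < \<Phi> z" by blast
    have "r < cmod z"
    proof (rule ccontr)
      assume "\<not> ?thesis"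
      then have "cmod (\<Lambda> z) \<le> S r" using S(2)[OF r(2), of z] by simp
      moreover have "\<Phi> z \<le> cmod (\<Lambda> z)"
        unfolding \<Phi>_def using z \<beta> by (intro mult_left_le_one_le powr_le1) auto
      ultimately show False using z(2) by simp
    qed
    then show ?thesis using z by auto
  qed
  \<comment> \<open>The square root splits w as \<alpha> z with \<alpha> = |z|, so that one radius
    serves both for the kernel and for the point of evaluation.\<close>
  define A where "A w = sqrt (cmod w)" for w :: complex
  \<comment> \<open>The second condition makes the new weight tame \<Lambda> on the earlier disc, so
    a later term is small at earlier points. The third one outweighs the factor 4^(-(n + 1)), the
    loss 1 - |w'| <= 2 (1 - \<open>A w'\<close>) and the other terms, which are controlled by
    \<open>S (A w)\<close>.\<close>
  define step where "step n w w' \<longleftrightarrow> A w \<le> A w' \<and> (1 - A w') powr \<beta> * S (A w) \<le> 1 \<and>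
    4 ^ Suc n * 2 powr (\<beta> + 1) * (real (Suc n) + 2 * S (A w)) \<le> \<Phi> w'" for n :: nat and w w'
  have A1: "A w < 1" if "cmod w < 1" for w using that by (simp add: A_def)
  have A0: "0 \<le> A w" for w by (simp add: A_def)
  have ex: "\<exists>w'. (cmod w' < 1 \<and> w' \<noteq> 0) \<and> step n w w'" if w: "cmod w < 1 \<and> w \<noteq> 0" for n w
  proof -
    have S0: "0 \<le> S (A w)" using S(1) A1 w by auto
    define x where "x = (1 / (1 + S (A w))) powr (1 / \<beta>)"
    have x: "0 < x" "x \<le> 1" using S0 \<beta> by (auto simp: x_def intro!: powr_le1)
    \<comment> \<open>Squared because \<open>A\<close> takes a square root; |w'| > r then gives
      \<open>A w'\<close> at least both \<open>A w\<close> and 1 - x.\<close>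
    define r where "r = (max (A w) (1 - x))\<^sup>2"
    have r: "0 \<le> r" "r < 1" using A1[of w] A0[of w] w x by (auto simp: r_def abs_square_less_1)
    obtain w' where w': "cmod w' < 1" "r < cmod w'" "4 ^ Suc n * 2 powr (\<beta> + 1) * (real (Suc n) + 2 * S (A w)) < \<Phi> w'"
      using large[OF r] by blast
    have "max (A w) (1 - x) \<le> A w'"
      unfolding A_def using w'(2) by (intro real_le_rsqrt) (simp add: r_def A_def)
    then have Aw: "A w \<le> A w'" "1 - A w' \<le> x" by auto
    have "(1 - A w') powr \<beta> \<le> x powr \<beta>" using Aw A1[OF w'(1)] \<beta> by (intro powr_mono2) auto
    also have "\<dots> = 1 / (1 + S (A w))" using S0 \<beta> by (simp add: x_def powr_powr)
    finally have "(1 - A w') powr \<beta> * S (A w) \<le> 1 / (1 + S (A w)) * S (A w)" using S0 by (rule mult_right_mono)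
    also have "\<dots> \<le> 1" using S0 by simp
    finally have "step n w w'" using Aw w'(3) by (simp add: step_def)
    moreover have "w' \<noteq> 0" using w'(2) r by auto
    ultimately show ?thesis using w'(1) by blast
  qed
  have "\<exists>w. \<forall>n. (cmod (w n) < 1 \<and> w n \<noteq> 0) \<and> step n (w n) (w (Suc n))"
  proof (rule dependent_nat_choice)
    show "\<exists>w::complex. cmod w < 1 \<and> w \<noteq> 0" by (intro exI[of _ "of_real (1 / 2)"]) simp
  qed (use ex in blast)
  then obtain w where w: "\<And>n. cmod (w n) < 1 \<and> w n \<noteq> 0" "\<And>n. step n (w n) (w (Suc n))" by blast
  define \<alpha> where "\<alpha> k = A (w k)" for k
  have \<alpha>: "0 \<le> \<alpha> k" "\<alpha> k < 1" "0 < \<alpha> k" for k using w(1)[of k] by (auto simp: \<alpha>_def A_def)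
  have mono: "\<alpha> i \<le> \<alpha> j" if "i \<le> j" for i j
    using that by (rule lift_Suc_mono_le[rotated]) (use w(2) in \<open>auto simp: step_def \<alpha>_def\<close>)
  define d where "d k = (1 / 4) ^ k * (1 - \<alpha> k) powr \<beta>" for k
  have d: "0 \<le> d k" "d k \<le> (1 / 4) ^ k" for k
  proof -
    have "(1 - \<alpha> k) powr \<beta> \<le> 1" using \<alpha>[of k] \<beta> by (intro powr_le1) auto
    then show "0 \<le> d k" "d k \<le> (1 / 4) ^ k" by (auto simp: d_def mult_left_le)
  qed
  have sd: "summable d"
    by (rule summable_comparison_test'[OF summable_geometric[of "1 / 4 :: real"]]) (use d in auto)
  define c where "c n = complex_of_real (\<Sum>k. d k * \<alpha> k ^ n)" for n
  have "(\<lambda>n. kernel_seq (2 * \<beta>) n * c n) \<in> hardy_lorentz p q"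
    unfolding c_def d_def \<beta>_def by (rule kernel_superposition_in_hardy_lorentz) (use p q \<alpha> in auto)
  then have "(\<lambda>n. l n * (kernel_seq (2 * \<beta>) n * c n)) \<in> bloch_type 1"
    using l by (auto simp: multipliers_def bloch_def)
  moreover have "frac_deriv 1 (\<lambda>n. l n * (kernel_seq (2 * \<beta>) n * c n)) = (\<lambda>n. b n * c n)"
    by (simp add: fun_eq_iff frac_deriv_1_kernel_seq b_def)
  ultimately obtain C where C: "0 \<le> C" "\<And>z. cmod z < 1 \<Longrightarrow> cmod (disc_fun (\<lambda>n. b n * c n) z) \<le> C / (1 - cmod z)"
    unfolding bloch_type_iff[OF zero_le_one] by auto
  have "real k \<le> C + 2" if k: "k = Suc m" for k m
  proof -
    \<comment> \<open>|z| = \<alpha>_k and \<alpha>_k z = w_k: the k-th term of the superposition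
      samples \<Lambda> at w_k.\<close>
    define z where "z = w k / of_real (\<alpha> k)"
    have cz: "cmod z = \<alpha> k" using \<alpha>[of k] by (simp add: z_def norm_divide \<alpha>_def A_def real_div_sqrt)
    have wz: "of_real (\<alpha> k) * z = w k" using \<alpha>[of k] by (simp add: z_def)
    define t where "t j = of_real (d j) * \<Lambda> (of_real (\<alpha> j) * z)" for j
    have t: "t sums disc_fun (\<lambda>n. b n * c n) z"
      unfolding t_def \<Lambda> c_def
      by (rule disc_fun_superposition(2)) (use b sd d \<alpha> cz in \<open>auto simp: less_imp_le\<close>)
    define s where "s = S (\<alpha> m)"
    have s0: "0 \<le> s" unfolding s_def using S(1) \<alpha> by auto
    \<comment> \<open>For j < k the point \<alpha>_j z lies in the disc of radius \<alpha>_m, where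
      |\<Lambda>| <= s. For j > k it lies in the disc of radius \<alpha>_(j-1), where the weight (1
      - \<alpha>_j)^\<beta> brings |\<Lambda>| down to 1.\<close>
    have tj: "cmod (t j) \<le> (1 / 4) ^ j * (s + 1)" if "j \<noteq> k" for j
    proof (cases "j < k")
      case True
      have "cmod (of_real (\<alpha> j) * z) \<le> \<alpha> j * 1" unfolding norm_mult cz
        using \<alpha>[of j] \<alpha>[of k] by (intro mult_mono) auto
      also have "\<dots> \<le> \<alpha> m" using True k mono[of j m] by simp
      finally have "cmod (\<Lambda> (of_real (\<alpha> j) * z)) \<le> s" unfolding s_def using S(2) \<alpha>(2) by blast
      then have "d j * cmod (\<Lambda> (of_real (\<alpha> j) * z)) \<le> (1 / 4) ^ j * (s + 1)"
        using d[of j] by (intro mult_mono) auto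
      then show ?thesis using d(1)[of j] by (simp add: t_def norm_mult)
    next
      case False
      with that obtain i where i: "j = Suc i" "k \<le> i" by (cases j) auto
      have "cmod (of_real (\<alpha> j) * z) \<le> 1 * \<alpha> k" unfolding norm_mult cz
        using \<alpha>[of j] \<alpha>(1)[of k] by (intro mult_mono) auto
      also have "\<dots> \<le> \<alpha> i" using mono[OF i(2)] by simp
      finally have "cmod (\<Lambda> (of_real (\<alpha> j) * z)) \<le> S (\<alpha> i)" using S(2) \<alpha>(2) by blast
      then have "(1 - \<alpha> j) powr \<beta> * cmod (\<Lambda> (of_real (\<alpha> j) * z)) \<le> (1 - \<alpha> j) powr \<beta> * S (\<alpha> i)"
        by (rule mult_left_mono) simp
      also have "\<dots> \<le> 1" using w(2)[of i] by (simp add: step_def \<alpha>_def i(1))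
      finally have "(1 / 4) ^ j * ((1 - \<alpha> j) powr \<beta> * cmod (\<Lambda> (of_real (\<alpha> j) * z))) \<le> (1 / 4) ^ j * (s + 1)"
        using s0 by (intro mult_left_mono) auto
      moreover have "cmod (t j) = d j * cmod (\<Lambda> (of_real (\<alpha> j) * z))"
        using d(1)[of j] by (simp add: t_def norm_mult)
      ultimately show ?thesis by (simp only: d_def mult.assoc)
    qed
    define t' where "t' j = (if j = k then 0 else t j)" for j
    have t'le: "cmod (t' j) \<le> (1 / 4) ^ j * (s + 1)" for j using tj[of j] s0 by (simp add: t'_def)
    have sg: "summable (\<lambda>j. (1 / 4 :: real) ^ j * (s + 1))" by (intro summable_mult2 summable_geometric) simp
    have st': "summable (\<lambda>j. cmod (t' j))" by (rule summable_comparison_test'[OF sg]) (use t'le in auto)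
    have "cmod (\<Sum>j. t' j) \<le> (\<Sum>j. cmod (t' j))" by (rule summable_norm[OF st'])
    also have "\<dots> \<le> (\<Sum>j. (1 / 4) ^ j * (s + 1))" by (intro suminf_le t'le st' sg)
    also have "\<dots> = (\<Sum>j. (1 / 4) ^ j) * (s + 1)" by (rule suminf_mult2[symmetric]) (intro summable_geometric, simp)
    also have "\<dots> = 4 / 3 * (s + 1)" by (simp add: suminf_geometric)
    finally have t'sum: "cmod (\<Sum>j. t' j) \<le> 2 * (s + 1)" using s0 by simp
    have "(\<lambda>j. (if j = k then t j else 0) + t' j) sums (t k + (\<Sum>j. t' j))"
      by (intro sums_add sums_single summable_sums summable_norm_cancel[OF st'])
    then have "t sums (t k + (\<Sum>j. t' j))" by (rule sums_cong[THEN iffD1, rotated]) (simp add: t'_def)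
    with t have eq: "disc_fun (\<lambda>n. b n * c n) z = t k + (\<Sum>j. t' j)" by (rule sums_unique2)
    have "cmod (t k) \<le> C / (1 - \<alpha> k) + 2 * (s + 1)"
      using norm_triangle_ineq4[of "t k + (\<Sum>j. t' j)" "\<Sum>j. t' j"] C(2)[of z] t'sum \<alpha>(2)[of k]
      unfolding eq[symmetric] cz by (simp add: eq)
    then have "(1 - \<alpha> k) * cmod (t k) \<le> (1 - \<alpha> k) * (C / (1 - \<alpha> k) + 2 * (s + 1))"
      using \<alpha>(2)[of k] by (intro mult_left_mono) auto
    also have "\<dots> = C + (1 - \<alpha> k) * (2 * (s + 1))" using \<alpha>(2)[of k] by (simp add: distrib_left)
    also have "\<dots> \<le> C + 2 * (s + 1)" using \<alpha>[of k] s0 by (intro add_left_mono mult_left_le_one_le) auto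
    finally have up: "(1 - \<alpha> k) * cmod (t k) \<le> C + 2 * (s + 1)" .
    have tk: "(1 - \<alpha> k) * cmod (t k) = (1 / 4) ^ k * ((1 - \<alpha> k) powr (\<beta> + 1) * cmod (\<Lambda> (w k)))"
    proof -
      have "cmod (t k) = d k * cmod (\<Lambda> (w k))" using d(1)[of k] by (simp add: t_def wz norm_mult)
      then show ?thesis using \<alpha>(2)[of k] by (simp add: d_def powr_add)
    qed
    have "1 - cmod (w k) \<le> 2 * (1 - \<alpha> k)"
    proof -
      have "cmod (w k) = \<alpha> k * \<alpha> k" by (simp add: \<alpha>_def A_def)
      moreover have "0 \<le> (1 - \<alpha> k) * (1 - \<alpha> k)" by simp
      ultimately show ?thesis by (simp add: algebra_simps)
    qed
    then have "(1 - cmod (w k)) powr (\<beta> + 1) \<le> (2 * (1 - \<alpha> k)) powr (\<beta> + 1)"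
      using w(1)[of k] \<beta> by (intro powr_mono2) auto
    also have "\<dots> = 2 powr (\<beta> + 1) * (1 - \<alpha> k) powr (\<beta> + 1)" by (rule powr_mult)
    finally have "\<Phi> (w k) \<le> 2 powr (\<beta> + 1) * ((1 - \<alpha> k) powr (\<beta> + 1) * cmod (\<Lambda> (w k)))"
      unfolding \<Phi>_def mult.assoc[symmetric] by (rule mult_right_mono) simp
    moreover have "4 ^ k * 2 powr (\<beta> + 1) * (real k + 2 * s) \<le> \<Phi> (w k)"
      using w(2)[of m] by (simp add: step_def k s_def \<alpha>_def)
    moreover have "4 ^ k * 2 powr (\<beta> + 1) * (real k + 2 * s) = 2 powr (\<beta> + 1) * (4 ^ k * (real k + 2 * s))"
      by (simp only: mult_ac)
    ultimately have "2 powr (\<beta> + 1) * (4 ^ k * (real k + 2 * s)) \<le> 2 powr (\<beta> + 1) * ((1 - \<alpha> k) powr (\<beta> + 1) * cmod (\<Lambda> (w k)))"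
      by linarith
    then have "4 ^ k * (real k + 2 * s) \<le> (1 - \<alpha> k) powr (\<beta> + 1) * cmod (\<Lambda> (w k))"
      by (rule mult_left_le_imp_le) simp
    then have "(1 / 4) ^ k * (4 ^ k * (real k + 2 * s)) \<le> (1 - \<alpha> k) * cmod (t k)"
      unfolding tk by (rule mult_left_mono) simp
    moreover have "(1 / 4 :: real) ^ k * 4 ^ k = 1" by (simp flip: power_mult_distrib)
    ultimately have "real k + 2 * s \<le> (1 - \<alpha> k) * cmod (t k)" by (simp add: mult.assoc[symmetric])
    with up show ?thesis by simp
  qed
  note bound = this
  obtain m where "C + 2 < real m" using reals_Archimedean2 by blast
  with bound[OF refl, of m] show False by simp
qed

lemma bloch_type_analytic: "l \<in> bloch_type \<beta> \<Longrightarrow> l \<in> analytic_disc"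
  by (simp add: bloch_type_def)

text \<open>Fractional integration of order \<beta> lowers the growth exponent from \<beta> + 1 to
  1. Both necessity proofs work with the order 2 \<beta> and return through this lemma.\<close>

lemma bloch_typeI_growth:
  assumes \<beta>: "0 < \<beta>" and l: "l \<in> analytic_disc" and C: "0 \<le> C"
    and bd: "\<And>z. cmod z < 1 \<Longrightarrow> cmod (disc_fun (frac_deriv (2 * \<beta>) l) z) \<le> C * (1 - cmod z) powr - (\<beta> + 1)"
  shows "l \<in> bloch_type \<beta>"
proof -
  have "cmod (disc_fun (frac_deriv \<beta> l) z) \<le> (1 / \<beta> + 1) / Gamma \<beta> * (C / (1 - cmod z) + 0)" if "cmod z < 1" for z
    by (rule frac_deriv_integral_bound[OF l _ _ C _ _ that])
       (use \<beta> bd in \<open>auto simp only: mult_2[symmetric] add_0_right less_imp_le order_refl\<close>)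
  then have "\<forall>z. cmod z < 1 \<longrightarrow> cmod (disc_fun (frac_deriv \<beta> l) z) \<le> ((1 / \<beta> + 1) / Gamma \<beta> * C) / (1 - cmod z)" by simp
  moreover have "0 \<le> (1 / \<beta> + 1) / Gamma \<beta> * C" using \<beta> C by simp
  ultimately show ?thesis using \<beta> l by (subst bloch_type_iff) auto
qed

lemma multipliers_hardy_lorentz_bloch_subset:
  fixes p :: real and q :: ennreal
  assumes p: "0 < p" "p < 1" and q: "0 < q" "q \<noteq> \<infinity>"
  shows "multipliers (hardy_lorentz p q) bloch \<subseteq> bloch_type (1 / p)"
proof
  fix l assume l: "l \<in> multipliers (hardy_lorentz p q) bloch"
  define \<beta> where "\<beta> = 1 / p"
  have \<beta>: "1 < \<beta>" using p by (simp add: \<beta>_def)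
  have "\<forall>w\<in>hardy_lorentz p q. (\<lambda>n. l n * w n) \<in> bloch" using l by (simp add: multipliers_def)
  from bspec[OF this one_in_hardy_lorentz[OF p q]] have "(\<lambda>n. l n * 1) \<in> bloch" .
  then have lA: "l \<in> analytic_disc" by (simp add: bloch_def bloch_type_analytic)
  obtain C where C: "0 \<le> C" "\<And>z. cmod z < 1 \<Longrightarrow> (1 - cmod z) powr (\<beta> + 1) * cmod (disc_fun (frac_deriv (2 * \<beta>) l) z) \<le> C"
    using multipliers_bloch_growth[OF p q l lA] unfolding \<beta>_def by blast
  have "l \<in> bloch_type \<beta>"
  proof (rule bloch_typeI_growth[OF _ lA C(1)])
    fix z :: complex assume z: "cmod z < 1"
    then have "0 < (1 - cmod z) powr (\<beta> + 1)" by simp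
    then have "cmod (disc_fun (frac_deriv (2 * \<beta>) l) z) \<le> C / (1 - cmod z) powr (\<beta> + 1)"
      using C(2)[OF z] by (simp add: pos_le_divide_eq mult.commute)
    also have "\<dots> = C * (1 - cmod z) powr - (\<beta> + 1)" by (simp only: powr_minus divide_inverse)
    finally show "cmod (disc_fun (frac_deriv (2 * \<beta>) l) z) \<le> C * (1 - cmod z) powr - (\<beta> + 1)" .
  qed (use \<beta> in auto)
  then show "l \<in> bloch_type (1 / p)" by (simp add: \<beta>_def)
qed

lemma little_bloch_subset_bloch: "little_bloch \<subseteq> bloch"
  by (auto simp: little_bloch_def bloch_def bloch_type0_def)

lemma multipliers_mono: "E' \<subseteq> E \<Longrightarrow> X \<subseteq> X' \<Longrightarrow> multipliers E X \<subseteq> multipliers E' X'"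
  by (auto simp: multipliers_def)

text \<open>A single function suffices here: its product with \<open>l\<close> has first derivative \<open>frac_deriv (1 / p) l\<close>.\<close>

lemma multipliers_weak_little_bloch_subset:
  fixes p :: real
  assumes p: "0 < p" "p < 1"
  shows "multipliers (hardy_lorentz p \<infinity>) little_bloch \<subseteq> bloch_type0 (1 / p)"
proof
  fix l assume l: "l \<in> multipliers (hardy_lorentz p \<infinity>) little_bloch"
  define \<beta> where "\<beta> = 1 / p"
  have \<beta>: "1 < \<beta>" using p by (simp add: \<beta>_def)
  \<comment> \<open>The finite index 1 gives access to the analyticity of l; the kernel of order
    \<beta> is tested afterwards.\<close>
  have "hardy_lorentz p 1 \<subseteq> hardy_lorentz p \<infinity>"
    using hardy_lorentz_subset_lorentz0[of p 1] p by (auto simp: hardy_lorentz0_def)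
  then have "l \<in> multipliers (hardy_lorentz p 1) bloch"
    using l multipliers_mono[OF _ little_bloch_subset_bloch] by blast
  then have "l \<in> bloch_type (1 / p)"
    using multipliers_hardy_lorentz_bloch_subset[OF p, of 1] by auto
  then have lA: "l \<in> analytic_disc" by (rule bloch_type_analytic)
  obtain C where C: "0 < C" "kernel_seq \<beta> \<in> smirnov_class"
    "\<And>t. 0 < t \<Longrightarrow> decr_rearr (boundary_fun (disc_fun (kernel_seq \<beta>))) t \<le> C * t powr - \<beta>"
    using kernel_seq_radial[of \<beta>] \<beta> by auto
  have "lorentz_norm p \<infinity> (boundary_fun (disc_fun (kernel_seq \<beta>))) \<le> ennreal C"
    unfolding lorentz_norm_def
  proof (simp, intro SUP_least ennreal_leI)
    fix t :: real assume "t \<in> {0<..}"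
    then have t: "0 < t" by simp
    have "decr_rearr (boundary_fun (disc_fun (kernel_seq \<beta>))) t * t powr (1 / p) \<le> C * t powr - \<beta> * t powr \<beta>"
      unfolding \<beta>_def[symmetric] using C(3)[OF t] by (rule mult_right_mono) simp
    also have "\<dots> = C" using t by (simp add: mult.assoc flip: powr_add)
    finally show "decr_rearr (boundary_fun (disc_fun (kernel_seq \<beta>))) t * t powr (1 / p) \<le> C" .
  qed
  then have "kernel_seq \<beta> \<in> hardy_lorentz p \<infinity>"
    using C(2) by (simp add: hardy_lorentz_def le_less_trans)
  then have "(\<lambda>n. l n * (kernel_seq \<beta> n * 1)) \<in> bloch_type0 1"
    using l by (auto simp: multipliers_def little_bloch_def)
  moreover have "frac_deriv 1 (\<lambda>n. l n * (kernel_seq \<beta> n * 1)) = frac_deriv \<beta> l"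
    using frac_deriv_1_kernel_seq[of l \<beta> "\<lambda>_. 1"] by (auto simp: fun_eq_iff)
  ultimately have "\<forall>\<epsilon>>0. \<exists>K\<ge>0. \<forall>z. cmod z < 1 \<longrightarrow> cmod (disc_fun (frac_deriv \<beta> l) z) \<le> \<epsilon> / (1 - cmod z) + K"
    unfolding bloch_type0_iff[OF zero_le_one] by simp
  then have "l \<in> bloch_type0 \<beta>" using lA \<beta> by (subst bloch_type0_iff) auto
  then show "l \<in> bloch_type0 (1 / p)" by (simp add: \<beta>_def)
qed

section \<open>Growth of the integral means and sufficiency of the Bloch type conditions\<close>

lemma mean1_le_of_decr_rearr:
  fixes p e t1 :: real
  defines "\<alpha> \<equiv> 2 / p" and "\<epsilon> \<equiv> (2 * e) powr p"
  assumes p: "0 < p" "p < 1" and e: "0 < e" and t1: "0 < t1" and a: "a \<in> smirnov_class"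
    and R: "\<And>t. 0 < t \<Longrightarrow> t < t1 \<Longrightarrow> decr_rearr (boundary_fun (disc_fun a)) t * t powr (1 / p) \<le> e"
  shows "\<exists>K\<ge>0. \<forall>r. 0 \<le> r \<longrightarrow> r < 1 \<longrightarrow> mean1 r (disc_fun a) \<le> ennreal (K +
    2 powr \<alpha> * 2 powr (\<alpha> - 2) * (\<alpha> / (\<alpha> - 2) + 4 powr (\<alpha> - 1)) * (\<epsilon> * (1 + \<epsilon> powr (\<alpha> - 1))) * (1 - r\<^sup>2) powr (1 - 1 / p))"
proof -
  let ?g = "boundary_fun (disc_fun a)"
  define v where "v \<zeta> = log_plus (cmod (?g \<zeta>))" for \<zeta>
  have gm: "?g \<in> borel_measurable circle_measure" by (rule smirnov_boundary_measurable[OF a])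
  have \<epsilon>: "0 < \<epsilon>" using e by (simp add: \<epsilon>_def)
  \<comment> \<open>Guarantees s > 1 and \<epsilon> s^(-2) < t1 for every s >= S.\<close>
  define S where "S = 1 + \<epsilon> / t1"
  have S: "1 < S" using \<epsilon> t1 by (simp add: S_def)
  \<comment> \<open>Since exp(p v / 2) = max(1, |g|)^(p/2), for s > 1 this is the set where |g| > T
    = s^(2/p). At t = \<epsilon> s^(-2) the hypothesis bounds the rearrangement by T / 2; the 2 in
    \<epsilon> = (2 e)^p leaves the room for the strict inequality.\<close>
  have d: "measure circle_measure {\<zeta>\<in>sphere 0 1. s < exp (p / 2 * v \<zeta>)} \<le> \<epsilon> * s powr - 2" if s: "S \<le> s" for s
  proof -
    have s1: "1 < s" using s S by simp
    define T where "T = s powr (2 / p)"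
    have T: "0 < T" using s1 by (simp add: T_def)
    have "{\<zeta>\<in>sphere 0 1. s < exp (p / 2 * v \<zeta>)} \<subseteq> {\<zeta>\<in>sphere 0 1. T < cmod (?g \<zeta>)}"
    proof safe
      fix \<zeta> assume "s < exp (p / 2 * v \<zeta>)"
      moreover have "max 1 (cmod (?g \<zeta>)) \<noteq> 0" by linarith
      ultimately have "s < max 1 (cmod (?g \<zeta>)) powr (p / 2)"
        by (simp add: v_def log_plus_def powr_def)
      then have "s powr (2 / p) < (max 1 (cmod (?g \<zeta>)) powr (p / 2)) powr (2 / p)"
        using s1 p by (intro powr_less_mono2) auto
      then have T1: "T < max 1 (cmod (?g \<zeta>))" using p by (simp add: T_def powr_powr)
      have "1 \<le> T" unfolding T_def using s1 p by (intro ge_one_powr_ge_zero) auto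
      then show "T < cmod (?g \<zeta>)" using T1 by (simp add: max_def split: if_splits)
    qed
    then have "measure circle_measure {\<zeta>\<in>sphere 0 1. s < exp (p / 2 * v \<zeta>)} \<le> distribution_fun ?g T"
      unfolding distribution_fun_def by (intro circle.finite_measure_mono circle_set_measurable gm)
    also have "\<dots> \<le> \<epsilon> * s powr - 2"
    proof (rule distribution_fun_le_of_decr_rearr[OF gm])
      let ?t = "\<epsilon> * s powr - 2"
      show t0: "0 < ?t" using \<epsilon> s1 by simp
      have "\<epsilon> / t1 < s" using s by (simp add: S_def)
      also have "s \<le> s * s" using s1 by simp
      finally have "\<epsilon> < s * s * t1" using t1 by (simp add: pos_divide_less_eq)
      then have "?t < t1" using s1 t1 by (simp add: powr_minus power2_eq_square field_simps)
      then have "decr_rearr ?g ?t * ?t powr (1 / p) \<le> e" by (rule R[OF t0])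
      also have "?t powr (1 / p) = 2 * e / T"
      proof -
        have "\<epsilon> powr (1 / p) = 2 * e" using e p by (simp add: \<epsilon>_def powr_powr)
        moreover have "(s powr - 2) powr (1 / p) = 1 / T"
          unfolding T_def powr_powr by (simp flip: powr_minus_divide)
        ultimately show ?thesis using \<epsilon> s1 by (simp only: powr_mult less_imp_le) simp
      qed
      finally have "decr_rearr ?g ?t * (2 * e / T) \<le> e" .
      then have "e * (2 * decr_rearr ?g ?t) \<le> e * T" using T by (simp add: field_simps)
      then have "2 * decr_rearr ?g ?t \<le> T" using e by simp
      then show "decr_rearr ?g ?t < T" using T by simp
    qed
    finally show ?thesis .
  qed
  show ?thesis
    unfolding \<alpha>_def
  proof (rule mean1_le_of_weak_type[OF p, where v = v and S = S])
    show "integrable circle_measure v" unfolding v_def by (rule smirnov_log_plus_le_poisson(1)[OF a])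
    show "log_plus (cmod (disc_fun a z)) \<le> (LINT \<zeta>|circle_measure. poisson z \<zeta> * v \<zeta>)" if "cmod z < 1" for z
      unfolding v_def by (rule smirnov_log_plus_le_poisson(2)[OF a that])
  qed (use S \<epsilon> d in \<open>auto simp: v_def log_plus_nonneg\<close>)
qed

lemma mean1_hardy_lorentz_weak:
  assumes p: "0 < p" "p < 1" and a: "a \<in> hardy_lorentz p \<infinity>"
  shows "\<exists>C\<ge>0. \<forall>r. 0 \<le> r \<longrightarrow> r < 1 \<longrightarrow> mean1 r (disc_fun a) \<le> ennreal (C * (1 - r\<^sup>2) powr (1 - 1 / p))"
proof -
  let ?g = "boundary_fun (disc_fun a)"
  define \<alpha> where "\<alpha> = 2 / p"
  have \<alpha>: "2 < \<alpha>" using p by (simp add: \<alpha>_def field_simps)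
  have sm: "a \<in> smirnov_class" and fin: "lorentz_norm p \<infinity> ?g < \<infinity>" using a by (auto simp: hardy_lorentz_def)
  then obtain V where V: "0 \<le> V" "(SUP s\<in>{0<..}. ennreal (decr_rearr ?g s * s powr (1 / p))) = ennreal V"
    unfolding lorentz_norm_def by (auto simp: less_top_ennreal)
  have R: "decr_rearr ?g t * t powr (1 / p) \<le> V + 1" if "0 < t" for t
  proof -
    have "ennreal (decr_rearr ?g t * t powr (1 / p)) \<le> ennreal V"
      unfolding V(2)[symmetric] using that by (intro SUP_upper) auto
    then show ?thesis using V(1) by simp
  qed
  define \<epsilon> where "\<epsilon> = (2 * (V + 1)) powr p"
  define M where "M = 2 powr \<alpha> * 2 powr (\<alpha> - 2) * (\<alpha> / (\<alpha> - 2) + 4 powr (\<alpha> - 1)) * (\<epsilon> * (1 + \<epsilon> powr (\<alpha> - 1)))"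
  have "0 \<le> \<epsilon>" by (simp add: \<epsilon>_def)
  then have M: "0 \<le> M" using \<alpha> unfolding M_def by (intro mult_nonneg_nonneg add_nonneg_nonneg) auto
  obtain K where K: "0 \<le> K" "\<And>r. 0 \<le> r \<Longrightarrow> r < 1 \<Longrightarrow> mean1 r (disc_fun a) \<le> ennreal (K + M * (1 - r\<^sup>2) powr (1 - 1 / p))"
    using mean1_le_of_decr_rearr[OF p, of "V + 1" 1 a] V(1) sm R unfolding M_def \<epsilon>_def \<alpha>_def by auto
  have "mean1 r (disc_fun a) \<le> ennreal ((K + M) * (1 - r\<^sup>2) powr (1 - 1 / p))" if r: "0 \<le> r" "r < 1" for r
  proof -
    have "0 < 1 - r\<^sup>2" using r by (simp add: abs_square_less_1)
    moreover have "1 - r\<^sup>2 \<le> 1" by simp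
    ultimately have "1 \<le> (1 - r\<^sup>2) powr (1 - 1 / p)"
      using powr_mono'[of "1 - 1 / p" 0 "1 - r\<^sup>2"] p by (simp add: field_simps)
    then have "K * 1 \<le> K * (1 - r\<^sup>2) powr (1 - 1 / p)" using K(1) by (rule mult_left_mono)
    then show ?thesis using K(2)[OF r] by (elim order_trans) (auto intro!: ennreal_leI simp: distrib_right)
  qed
  then show ?thesis using K(1) M by (intro exI[of _ "K + M"]) auto
qed

lemma mean1_hardy_lorentz0:
  assumes p: "0 < p" "p < 1" and a: "a \<in> hardy_lorentz0 p" and \<epsilon>: "0 < \<epsilon>"
  shows "\<exists>K\<ge>0. \<forall>r. 0 \<le> r \<longrightarrow> r < 1 \<longrightarrow> mean1 r (disc_fun a) \<le> ennreal (\<epsilon> * (1 - r\<^sup>2) powr (1 - 1 / p) + K)"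
proof -
  let ?g = "boundary_fun (disc_fun a)"
  define \<alpha> where "\<alpha> = 2 / p"
  have \<alpha>: "2 < \<alpha>" using p by (simp add: \<alpha>_def field_simps)
  define M where "M = 2 powr \<alpha> * 2 powr (\<alpha> - 2) * (\<alpha> / (\<alpha> - 2) + 4 powr (\<alpha> - 1))"
  have M: "0 < M" using \<alpha> unfolding M_def by (intro mult_pos_pos add_pos_pos) auto
  \<comment> \<open>\<eta> plays the role of (2 e)^p. Being at most 1 it makes the coefficient M
    \<eta> (1 + \<eta>^(\<alpha> - 1)) at most 2 M \<eta>, hence at most \<epsilon>.\<close>
  define \<eta> where "\<eta> = min 1 (\<epsilon> / (2 * M))"
  have \<eta>: "0 < \<eta>" "\<eta> \<le> 1" using \<epsilon> M by (auto simp: \<eta>_def)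
  define e where "e = \<eta> powr (1 / p) / 2"
  have e: "0 < e" "(2 * e) powr p = \<eta>" using \<eta> p by (auto simp: e_def powr_powr)
  have sm: "a \<in> smirnov_class" using a by (auto simp: hardy_lorentz0_def hardy_lorentz_def)
  have "((\<lambda>s. decr_rearr ?g s * s powr (1 / p)) \<longlongrightarrow> 0) (at_right 0)" using a by (simp add: hardy_lorentz0_def)
  then have "\<forall>\<^sub>F s in at_right 0. decr_rearr ?g s * s powr (1 / p) < e" using e(1) by (rule order_tendstoD)
  then obtain t1 where t1: "0 < t1" "\<And>s. 0 < s \<Longrightarrow> s < t1 \<Longrightarrow> decr_rearr ?g s * s powr (1 / p) < e"
    unfolding eventually_at_right_field by blast
  obtain K where K: "0 \<le> K" "\<And>r. 0 \<le> r \<Longrightarrow> r < 1 \<Longrightarrow> mean1 r (disc_fun a) \<le>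
      ennreal (K + M * (\<eta> * (1 + \<eta> powr (\<alpha> - 1))) * (1 - r\<^sup>2) powr (1 - 1 / p))"
    using mean1_le_of_decr_rearr[OF p e(1) t1(1) sm less_imp_le[OF t1(2)]] unfolding M_def e(2) \<alpha>_def by auto
  have "M * (\<eta> * (1 + \<eta> powr (\<alpha> - 1))) \<le> \<epsilon>"
  proof -
    have "\<eta> powr (\<alpha> - 1) \<le> 1" using \<eta> \<alpha> by (intro powr_le1) auto
    then have "\<eta> * (1 + \<eta> powr (\<alpha> - 1)) \<le> \<eta> * 2" using \<eta> by (intro mult_left_mono) auto
    also have "\<dots> \<le> \<epsilon> / (2 * M) * 2" by (intro mult_right_mono) (auto simp: \<eta>_def)
    finally have "M * (\<eta> * (1 + \<eta> powr (\<alpha> - 1))) \<le> M * (\<epsilon> / (2 * M) * 2)" using M by (intro mult_left_mono) auto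
    then show ?thesis using M by simp
  qed
  then have "M * (\<eta> * (1 + \<eta> powr (\<alpha> - 1))) * (1 - r\<^sup>2) powr (1 - 1 / p) \<le> \<epsilon> * (1 - r\<^sup>2) powr (1 - 1 / p)" for r
    by (rule mult_right_mono) simp
  then show ?thesis using K
    by (intro exI[of _ K] conjI allI impI order_trans[OF K(2)] ennreal_leI) (auto simp: add.commute)
qed

text \<open>A weaker singularity is absorbed by a small multiple of a stronger one: t0 is the point
  where \<tau>^(\<beta> - x) reaches \<theta>, and beyond it the left side is bounded.\<close>

lemma powr_interpolation:
  fixes x \<beta> \<theta> :: real
  assumes "0 \<le> x" "x < \<beta>" "0 < \<theta>"
  shows "\<exists>K\<ge>0. \<forall>\<tau>. 0 < \<tau> \<longrightarrow> \<tau> powr - x \<le> \<theta> * \<tau> powr - \<beta> + K"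
proof -
  define t0 where "t0 = \<theta> powr (1 / (\<beta> - x))"
  have t0: "0 < t0" using assms by (simp add: t0_def)
  have "\<tau> powr - x \<le> \<theta> * \<tau> powr - \<beta> + t0 powr - x" if \<tau>: "0 < \<tau>" for \<tau>
  proof (cases "\<tau> \<le> t0")
    case True
    have "\<tau> powr - x = \<tau> powr (\<beta> - x) * \<tau> powr - \<beta>" by (simp flip: powr_add)
    also have "\<dots> \<le> t0 powr (\<beta> - x) * \<tau> powr - \<beta>" using True \<tau> assms by (intro mult_right_mono powr_mono2) auto
    also have "t0 powr (\<beta> - x) = \<theta>" using assms by (simp add: t0_def powr_powr)
    finally show ?thesis by (simp add: add_increasing2)
  next
    case False
    then have "\<tau> powr - x \<le> t0 powr - x" using t0 assms by (intro powr_mono2') auto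
    then show ?thesis using assms by (simp add: add_increasing)
  qed
  then show ?thesis by (intro exI[of _ "t0 powr - x"]) auto
qed

lemma frac_deriv_mult: "frac_deriv \<beta> (\<lambda>n. l n * a n) = (\<lambda>n. frac_deriv \<beta> l n * a n)"
  by (simp add: frac_deriv_def fun_eq_iff)

text \<open>The derivative of order \<beta> of the product is the Hadamard product of that of l with
  f. Both factors are taken at radius r = sqrt |z|, and 1 - |z| <= 2 (1 - r) accounts for the factor
  2.\<close>

lemma product_frac_deriv_bound:
  assumes \<beta>: "1 < \<beta>" and l: "l \<in> analytic_disc" and a: "a \<in> analytic_disc"
    and nn: "0 \<le> \<epsilon>1" "0 \<le> \<epsilon>2" "0 \<le> K1" "0 \<le> K2" and z: "cmod z < 1"
    and L: "\<And>z. cmod z < 1 \<Longrightarrow> cmod (disc_fun (frac_deriv \<beta> l) z) \<le> \<epsilon>1 / (1 - cmod z) + K1"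
    and M: "\<And>r. 0 \<le> r \<Longrightarrow> r < 1 \<Longrightarrow> mean1 r (disc_fun a) \<le> ennreal (\<epsilon>2 * (1 - r\<^sup>2) powr (1 - \<beta>) + K2)"
  shows "cmod (disc_fun (frac_deriv \<beta> (\<lambda>n. l n * a n)) z) \<le>
    (2 * \<epsilon>1 / (1 - cmod z) + K1) * (\<epsilon>2 * (1 - cmod z) powr (1 - \<beta>) + K2)"
proof -
  define r where "r = sqrt (cmod z)"
  have r: "0 \<le> r" "r < 1" "r\<^sup>2 = cmod z" using z by (auto simp: r_def)
  obtain \<omega> where \<omega>: "cmod \<omega> = 1" "z = of_real (r\<^sup>2) * \<omega>"
  proof (cases "z = 0")
    case False
    then show ?thesis using that[of "z / of_real (cmod z)"] r(3) by (simp add: norm_divide)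
  qed (use that[of 1] r(3) in auto)
  have "(1 - r) * (1 + r) \<le> (1 - r) * 2" using r by (intro mult_left_mono) auto
  then have le: "1 - cmod z \<le> 2 * (1 - r)" unfolding r(3)[symmetric] by (simp add: power2_eq_square algebra_simps)
  have b: "cmod (disc_fun (frac_deriv \<beta> l) u) \<le> 2 * \<epsilon>1 / (1 - cmod z) + K1" if u: "cmod u = r" for u
  proof -
    have "\<epsilon>1 / (1 - r) = 2 * \<epsilon>1 / (2 * (1 - r))" by (rule mult_divide_mult_cancel_left[symmetric]) simp
    also have "\<dots> \<le> 2 * \<epsilon>1 / (1 - cmod z)" using le z nn r by (intro divide_left_mono mult_pos_pos) auto
    finally show ?thesis using L[of u] u r by simp
  qed
  have "ennreal (cmod (disc_fun (\<lambda>n. frac_deriv \<beta> l n * a n) (of_real (r\<^sup>2) * \<omega>))) \<le>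
      ennreal (2 * \<epsilon>1 / (1 - cmod z) + K1) * mean1 r (disc_fun a)"
    by (rule disc_fun_Hadamard_product_bound) (use \<beta> l a r(1,2) \<omega>(1) b in \<open>auto intro!: frac_deriv_analytic\<close>)
  then have "ennreal (cmod (disc_fun (\<lambda>n. frac_deriv \<beta> l n * a n) z)) \<le>
      ennreal (2 * \<epsilon>1 / (1 - cmod z) + K1) * mean1 r (disc_fun a)"
    by (simp only: \<omega>(2)[symmetric])
  also have "\<dots> \<le> ennreal (2 * \<epsilon>1 / (1 - cmod z) + K1) * ennreal (\<epsilon>2 * (1 - r\<^sup>2) powr (1 - \<beta>) + K2)"
    by (intro mult_left_mono M r) simp
  also have "\<dots> = ennreal ((2 * \<epsilon>1 / (1 - cmod z) + K1) * (\<epsilon>2 * (1 - cmod z) powr (1 - \<beta>) + K2))"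
    using nn z by (subst ennreal_mult) (auto simp: r(3))
  finally show ?thesis using nn z by (subst (asm) ennreal_le_iff) (auto simp: frac_deriv_mult)
qed

text \<open>The main term \<epsilon>1 \<epsilon>2 \<tau>^(-\<beta>) keeps both constants visible,
  while the weaker cross terms are interpolated into \<theta> \<tau>^(-\<beta>) + K. Fractional
  integration of order \<beta> - 1, positive because p < 1, then leads to the first derivative. One
  estimate covers the three uses: both constants fixed, \<epsilon>2 small, or \<epsilon>1
  small.\<close>

lemma product_bloch_bound:
  assumes \<beta>: "1 < \<beta>" and l: "l \<in> analytic_disc" and a: "a \<in> analytic_disc"
    and nn: "0 \<le> \<epsilon>1" "0 \<le> \<epsilon>2" "0 \<le> K1" "0 \<le> K2" and \<theta>: "0 < \<theta>"
    and L: "\<And>z. cmod z < 1 \<Longrightarrow> cmod (disc_fun (frac_deriv \<beta> l) z) \<le> \<epsilon>1 / (1 - cmod z) + K1"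
    and M: "\<And>r. 0 \<le> r \<Longrightarrow> r < 1 \<Longrightarrow> mean1 r (disc_fun a) \<le> ennreal (\<epsilon>2 * (1 - r\<^sup>2) powr (1 - \<beta>) + K2)"
  shows "\<exists>K\<ge>0. \<forall>z. cmod z < 1 \<longrightarrow> cmod (disc_fun (frac_deriv 1 (\<lambda>n. l n * a n)) z) \<le>
    (1 / (\<beta> - 1) + 1) / Gamma (\<beta> - 1) * (2 * \<epsilon>1 * \<epsilon>2 + \<theta>) / (1 - cmod z) + K"
proof -
  \<comment> \<open>The denominator is the total coefficient of the cross terms, increased by 1 to
    be positive.\<close>
  define \<theta>1 where "\<theta>1 = \<theta> / (2 * \<epsilon>1 * K2 + K1 * \<epsilon>2 + 1)"
  have den: "0 < 2 * \<epsilon>1 * K2 + K1 * \<epsilon>2 + 1" using nn by (intro add_nonneg_pos) auto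
  have \<theta>1: "0 < \<theta>1" using \<theta> den by (simp add: \<theta>1_def)
  obtain A where A: "0 \<le> A" "\<And>\<tau>. 0 < \<tau> \<Longrightarrow> \<tau> powr - 1 \<le> \<theta>1 * \<tau> powr - \<beta> + A"
    using powr_interpolation[of 1 \<beta> \<theta>1] \<beta> \<theta>1 by auto
  obtain B where B: "0 \<le> B" "\<And>\<tau>. 0 < \<tau> \<Longrightarrow> \<tau> powr - (\<beta> - 1) \<le> \<theta>1 * \<tau> powr - \<beta> + B"
    using powr_interpolation[of "\<beta> - 1" \<beta> \<theta>1] \<beta> \<theta>1 by auto
  define K where "K = 2 * \<epsilon>1 * K2 * A + K1 * \<epsilon>2 * B + K1 * K2"
  have K: "0 \<le> K" unfolding K_def using nn A(1) B(1) by simp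
  have hA: "(\<lambda>n. l n * a n) \<in> analytic_disc" by (rule analytic_disc_mult[OF l a])
  have bd: "cmod (disc_fun (frac_deriv (1 + (\<beta> - 1)) (\<lambda>n. l n * a n)) z) \<le> (2 * \<epsilon>1 * \<epsilon>2 + \<theta>) * (1 - cmod z) powr - ((\<beta> - 1) + 1) + K"
    if z: "cmod z < 1" for z
  proof -
    define \<tau> where "\<tau> = 1 - cmod z"
    have \<tau>: "0 < \<tau>" using z by (simp add: \<tau>_def)
    have "cmod (disc_fun (frac_deriv \<beta> (\<lambda>n. l n * a n)) z) \<le> (2 * \<epsilon>1 / \<tau> + K1) * (\<epsilon>2 * \<tau> powr (1 - \<beta>) + K2)"
      unfolding \<tau>_def by (rule product_frac_deriv_bound[OF \<beta> l a nn z L M])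
    also have "\<dots> = 2 * \<epsilon>1 * \<epsilon>2 * (\<tau> powr - 1 * \<tau> powr (1 - \<beta>)) + (2 * \<epsilon>1 * K2) * \<tau> powr - 1 + (K1 * \<epsilon>2) * \<tau> powr - (\<beta> - 1) + K1 * K2"
      using \<tau> by (simp add: powr_minus_divide field_simps)
    also have "\<tau> powr - 1 * \<tau> powr (1 - \<beta>) = \<tau> powr - \<beta>" by (simp only: powr_add[symmetric]) simp
    also have "2 * \<epsilon>1 * \<epsilon>2 * \<tau> powr - \<beta> + (2 * \<epsilon>1 * K2) * \<tau> powr - 1 + (K1 * \<epsilon>2) * \<tau> powr - (\<beta> - 1) + K1 * K2 \<le>
        2 * \<epsilon>1 * \<epsilon>2 * \<tau> powr - \<beta> + (2 * \<epsilon>1 * K2) * (\<theta>1 * \<tau> powr - \<beta> + A) + (K1 * \<epsilon>2) * (\<theta>1 * \<tau> powr - \<beta> + B) + K1 * K2"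
      using nn by (intro add_mono mult_left_mono A(2) B(2) \<tau>) auto
    also have "\<dots> = 2 * \<epsilon>1 * \<epsilon>2 * \<tau> powr - \<beta> + \<theta>1 * (2 * \<epsilon>1 * K2 + K1 * \<epsilon>2) * \<tau> powr - \<beta> + K"
      unfolding K_def by (simp add: algebra_simps)
    also have "\<dots> \<le> 2 * \<epsilon>1 * \<epsilon>2 * \<tau> powr - \<beta> + \<theta> * \<tau> powr - \<beta> + K"
    proof -
      have "\<theta>1 * (2 * \<epsilon>1 * K2 + K1 * \<epsilon>2) \<le> \<theta>1 * (2 * \<epsilon>1 * K2 + K1 * \<epsilon>2 + 1)" using \<theta>1 by simp
      also have "\<dots> = \<theta>" using den by (simp add: \<theta>1_def)
      finally have "\<theta>1 * (2 * \<epsilon>1 * K2 + K1 * \<epsilon>2) * \<tau> powr - \<beta> \<le> \<theta> * \<tau> powr - \<beta>" by (rule mult_right_mono) simp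
      then show ?thesis by simp
    qed
    finally show ?thesis by (simp add: \<tau>_def distrib_right)
  qed
  define G where "G = (1 / (\<beta> - 1) + 1) / Gamma (\<beta> - 1)"
  have G: "0 \<le> G" using \<beta> by (simp add: G_def)
  have "cmod (disc_fun (frac_deriv 1 (\<lambda>n. l n * a n)) z) \<le> G * (2 * \<epsilon>1 * \<epsilon>2 + \<theta>) / (1 - cmod z) + G * K" if z: "cmod z < 1" for z
  proof -
    have "cmod (disc_fun (frac_deriv 1 (\<lambda>n. l n * a n)) z) \<le> G * ((2 * \<epsilon>1 * \<epsilon>2 + \<theta>) / (1 - cmod z) + K)"
      unfolding G_def by (rule frac_deriv_integral_bound[OF hA _ _ _ K bd z]) (use \<beta> nn \<theta> in auto)
    then show ?thesis by (simp only: distrib_left[of G] times_divide_eq_right)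
  qed
  then show ?thesis using mult_nonneg_nonneg[OF G K] unfolding G_def by blast
qed

lemma hardy_lorentz_analytic: "a \<in> hardy_lorentz p q \<Longrightarrow> a \<in> analytic_disc"
  by (simp add: hardy_lorentz_def smirnov_class_def nevanlinna_class_def)

lemma bloch_type_subset_multipliers:
  fixes p :: real
  assumes p: "0 < p" "p < 1"
  shows "bloch_type (1 / p) \<subseteq> multipliers (hardy_lorentz p \<infinity>) bloch"
proof
  fix l assume l: "l \<in> bloch_type (1 / p)"
  define \<beta> where "\<beta> = 1 / p"
  have \<beta>: "1 < \<beta>" using p by (simp add: \<beta>_def)
  have "l \<in> bloch_type \<beta>" using l by (simp add: \<beta>_def)
  then have "l \<in> analytic_disc \<and> (\<exists>C\<ge>0. \<forall>z. cmod z < 1 \<longrightarrow> cmod (disc_fun (frac_deriv \<beta> l) z) \<le> C / (1 - cmod z) + 0)"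
    using bloch_type_iff[of \<beta> l] \<beta> by simp
  then obtain C where lA: "l \<in> analytic_disc" and C: "0 \<le> C"
    "\<And>z. cmod z < 1 \<Longrightarrow> cmod (disc_fun (frac_deriv \<beta> l) z) \<le> C / (1 - cmod z) + 0" by blast
  define G where "G = (1 / (\<beta> - 1) + 1) / Gamma (\<beta> - 1)"
  have G: "0 \<le> G" using \<beta> by (simp add: G_def)
  have "(\<lambda>n. l n * a n) \<in> bloch" if a: "a \<in> hardy_lorentz p \<infinity>" for a
  proof -
    have aA: "a \<in> analytic_disc" using a by (rule hardy_lorentz_analytic)
    obtain D where D: "0 \<le> D" "\<And>r. 0 \<le> r \<Longrightarrow> r < 1 \<Longrightarrow> mean1 r (disc_fun a) \<le> ennreal (D * (1 - r\<^sup>2) powr (1 - \<beta>) + 0)"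
      using mean1_hardy_lorentz_weak[OF p a] unfolding \<beta>_def by auto
    obtain K where K: "0 \<le> K" "\<And>z. cmod z < 1 \<Longrightarrow> cmod (disc_fun (frac_deriv 1 (\<lambda>n. l n * a n)) z) \<le>
        G * (2 * C * D + 1) / (1 - cmod z) + K"
      using product_bloch_bound[OF \<beta> lA aA C(1) D(1) order_refl order_refl zero_less_one C(2) D(2)] unfolding G_def by blast
    have "cmod (disc_fun (frac_deriv 1 (\<lambda>n. l n * a n)) z) \<le> (G * (2 * C * D + 1) + K) / (1 - cmod z)" if z: "cmod z < 1" for z
    proof -
      have "K \<le> K / (1 - cmod z)" using z K(1) by (simp add: pos_le_divide_eq mult_left_le)
      then show ?thesis using K(2)[OF z] by (simp add: add_divide_distrib)
    qed
    moreover have "0 \<le> G * (2 * C * D + 1) + K" using G C D K by simp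
    ultimately show ?thesis
      unfolding bloch_def bloch_type_iff[OF zero_le_one] using analytic_disc_mult[OF lA aA] by blast
  qed
  then show "l \<in> multipliers (hardy_lorentz p \<infinity>) bloch" by (simp add: multipliers_def)
qed

text \<open>Here the smallness comes from the integral means of f, that is from \<epsilon>2.\<close>

lemma bloch_type_subset_multipliers0:
  fixes p :: real
  assumes p: "0 < p" "p < 1"
  shows "bloch_type (1 / p) \<subseteq> multipliers (hardy_lorentz0 p) little_bloch"
proof
  fix l assume l: "l \<in> bloch_type (1 / p)"
  define \<beta> where "\<beta> = 1 / p"
  have \<beta>: "1 < \<beta>" using p by (simp add: \<beta>_def)
  have "l \<in> bloch_type \<beta>" using l by (simp add: \<beta>_def)
  then have "l \<in> analytic_disc \<and> (\<exists>C\<ge>0. \<forall>z. cmod z < 1 \<longrightarrow> cmod (disc_fun (frac_deriv \<beta> l) z) \<le> C / (1 - cmod z) + 0)"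
    using bloch_type_iff[of \<beta> l] \<beta> by simp
  then obtain C where lA: "l \<in> analytic_disc" and C: "0 \<le> C"
    "\<And>z. cmod z < 1 \<Longrightarrow> cmod (disc_fun (frac_deriv \<beta> l) z) \<le> C / (1 - cmod z) + 0" by blast
  define G where "G = (1 / (\<beta> - 1) + 1) / Gamma (\<beta> - 1)"
  have G: "0 < G" using \<beta> by (auto simp: G_def intro!: divide_pos_pos add_pos_pos)
  have "(\<lambda>n. l n * a n) \<in> little_bloch" if a: "a \<in> hardy_lorentz0 p" for a
  proof -
    have aA: "a \<in> analytic_disc" using a by (auto simp: hardy_lorentz0_def intro: hardy_lorentz_analytic)
    have "\<exists>K\<ge>0. \<forall>z. cmod z < 1 \<longrightarrow> cmod (disc_fun (frac_deriv 1 (\<lambda>n. l n * a n)) z) \<le> \<epsilon> / (1 - cmod z) + K"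
      if \<epsilon>: "0 < \<epsilon>" for \<epsilon>
    proof -
      define e where "e = \<epsilon> / (G * (2 * C + 1))"
      have e: "0 < e" using \<epsilon> G C by (auto simp: e_def intro!: divide_pos_pos mult_pos_pos add_nonneg_pos)
      obtain K2 where K2: "0 \<le> K2" "\<And>r. 0 \<le> r \<Longrightarrow> r < 1 \<Longrightarrow> mean1 r (disc_fun a) \<le> ennreal (e * (1 - r\<^sup>2) powr (1 - \<beta>) + K2)"
        using mean1_hardy_lorentz0[OF p a e] unfolding \<beta>_def by auto
      have "G * (2 * C * e + e) = \<epsilon>"
      proof -
        have "0 < 2 * C + 1" using C(1) by simp
        then have ne: "G * (2 * C + 1) \<noteq> 0" using G by simp
        have "G * (2 * C * e + e) = (G * (2 * C + 1)) * e" by (simp add: algebra_simps)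
        then show ?thesis unfolding e_def by (simp only: times_divide_eq_right nonzero_mult_div_cancel_left[OF ne])
      qed
      then show ?thesis
        using product_bloch_bound[OF \<beta> lA aA C(1) less_imp_le[OF e] order_refl K2(1) e C(2) K2(2), folded G_def] by simp
    qed
    then show ?thesis
      unfolding little_bloch_def bloch_type0_iff[OF zero_le_one] using analytic_disc_mult[OF lA aA] by blast
  qed
  then show "l \<in> multipliers (hardy_lorentz0 p) little_bloch" by (simp add: multipliers_def)
qed

text \<open>Here the smallness comes from l, that is from \<epsilon>1, while the means of f are only
  bounded.\<close>

lemma bloch_type0_subset_multipliers:
  fixes p :: real
  assumes p: "0 < p" "p < 1"
  shows "bloch_type0 (1 / p) \<subseteq> multipliers (hardy_lorentz p \<infinity>) little_bloch"
proof
  fix l assume l: "l \<in> bloch_type0 (1 / p)"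
  define \<beta> where "\<beta> = 1 / p"
  have \<beta>: "1 < \<beta>" using p by (simp add: \<beta>_def)
  have "l \<in> bloch_type0 \<beta>" using l by (simp add: \<beta>_def)
  then have lA: "l \<in> analytic_disc" and C: "\<And>\<epsilon>. 0 < \<epsilon> \<Longrightarrow> \<exists>K\<ge>0. \<forall>z. cmod z < 1 \<longrightarrow> cmod (disc_fun (frac_deriv \<beta> l) z) \<le> \<epsilon> / (1 - cmod z) + K"
    using bloch_type0_iff[of \<beta> l] \<beta> by simp_all
  define G where "G = (1 / (\<beta> - 1) + 1) / Gamma (\<beta> - 1)"
  have G: "0 < G" using \<beta> by (auto simp: G_def intro!: divide_pos_pos add_pos_pos)
  have "(\<lambda>n. l n * a n) \<in> little_bloch" if a: "a \<in> hardy_lorentz p \<infinity>" for a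
  proof -
    have aA: "a \<in> analytic_disc" using a by (rule hardy_lorentz_analytic)
    obtain D where D: "0 \<le> D" "\<And>r. 0 \<le> r \<Longrightarrow> r < 1 \<Longrightarrow> mean1 r (disc_fun a) \<le> ennreal (D * (1 - r\<^sup>2) powr (1 - \<beta>) + 0)"
      using mean1_hardy_lorentz_weak[OF p a] unfolding \<beta>_def by auto
    have "\<exists>K\<ge>0. \<forall>z. cmod z < 1 \<longrightarrow> cmod (disc_fun (frac_deriv 1 (\<lambda>n. l n * a n)) z) \<le> \<epsilon> / (1 - cmod z) + K"
      if \<epsilon>: "0 < \<epsilon>" for \<epsilon>
    proof -
      define e where "e = \<epsilon> / (G * (2 * D + 1))"
      have e: "0 < e" using \<epsilon> G D by (auto simp: e_def intro!: divide_pos_pos mult_pos_pos add_nonneg_pos)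
      obtain K1 where K1: "0 \<le> K1" "\<And>z. cmod z < 1 \<Longrightarrow> cmod (disc_fun (frac_deriv \<beta> l) z) \<le> e / (1 - cmod z) + K1"
        using C[OF e] by blast
      have "G * (2 * e * D + e) = \<epsilon>"
      proof -
        have "0 < 2 * D + 1" using D(1) by simp
        then have ne: "G * (2 * D + 1) \<noteq> 0" using G by simp
        have "G * (2 * e * D + e) = (G * (2 * D + 1)) * e" by (simp add: algebra_simps)
        then show ?thesis unfolding e_def by (simp only: times_divide_eq_right nonzero_mult_div_cancel_left[OF ne])
      qed
      then show ?thesis
        using product_bloch_bound[OF \<beta> lA aA less_imp_le[OF e] D(1) K1(1) order_refl e K1(2) D(2), folded G_def] by simp
    qed
    then show ?thesis
      unfolding little_bloch_def bloch_type0_iff[OF zero_le_one] using analytic_disc_mult[OF lA aA] by blast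
  qed
  then show "l \<in> multipliers (hardy_lorentz p \<infinity>) little_bloch" by (simp add: multipliers_def)
qed

section \<open>The dual of the Hardy space\<close>

lemma ennreal_powr_ennreal: "0 \<le> x \<Longrightarrow> ennreal_powr (ennreal x) e = ennreal (x powr e)"
  by (simp add: ennreal_powr_def)

lemma hardy_norm_le_iff:
  assumes p: "0 < p" and B: "0 \<le> B"
  shows "hardy_norm p f \<le> ennreal B \<longleftrightarrow>
    (\<forall>r. 0 < r \<longrightarrow> r < 1 \<longrightarrow> (\<integral>\<^sup>+\<zeta>. ennreal (cmod (f (of_real r * \<zeta>)) powr p) \<partial>circle_measure) \<le> ennreal (B powr p))"
proof -
  have "ennreal_powr X (1 / p) \<le> ennreal B \<longleftrightarrow> X \<le> ennreal (B powr p)" for X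
  proof (cases X)
    case (real x)
    have "x powr (1 / p) \<le> B \<longleftrightarrow> x \<le> B powr p"
    proof
      assume "x powr (1 / p) \<le> B"
      then have "(x powr (1 / p)) powr p \<le> B powr p" using p by (intro powr_mono2) auto
      then show "x \<le> B powr p" using p real by (simp add: powr_powr)
    next
      assume "x \<le> B powr p"
      then have "x powr (1 / p) \<le> (B powr p) powr (1 / p)" using p real by (intro powr_mono2) auto
      then show "x powr (1 / p) \<le> B" using p B by (simp add: powr_powr)
    qed
    then show ?thesis using real B by (simp add: ennreal_powr_ennreal)
  next
    case top
    then show ?thesis by (simp add: ennreal_powr_def top_unique)
  qed
  then show ?thesis unfolding hardy_norm_def SUP_le_iff by auto
qed

lemma disc_fun_cmult:
  assumes "a \<in> analytic_disc"
  shows "(\<lambda>n. c * a n) \<in> analytic_disc" and "cmod z < 1 \<Longrightarrow> disc_fun (\<lambda>n. c * a n) z = c * disc_fun a z"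
proof -
  show "(\<lambda>n. c * a n) \<in> analytic_disc"
  proof (rule analytic_discI)
    fix r :: real assume r: "0 < r" "r < 1"
    obtain B where B: "\<And>n. cmod (a n) * r ^ n \<le> B" using analytic_disc_bounded[OF assms, of r] r by auto
    have "cmod (c * a n) * r ^ n \<le> cmod c * B" for n
      using mult_left_mono[OF B[of n], of "cmod c"] by (simp add: norm_mult mult.assoc)
    then show "\<exists>B. \<forall>n. cmod (c * a n) * r ^ n \<le> B" by blast
  qed
  assume "cmod z < 1"
  from sums_mult[OF analytic_disc_sums[OF assms this], of c]
  show "disc_fun (\<lambda>n. c * a n) z = c * disc_fun a z" by (simp add: disc_fun_def sums_iff mult.assoc)
qed

lemma disc_fun_add:
  assumes "a \<in> analytic_disc" "b \<in> analytic_disc"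
  shows "(\<lambda>n. a n + b n) \<in> analytic_disc" and "cmod z < 1 \<Longrightarrow> disc_fun (\<lambda>n. a n + b n) z = disc_fun a z + disc_fun b z"
proof -
  show "(\<lambda>n. a n + b n) \<in> analytic_disc"
  proof (rule analytic_discI)
    fix r :: real assume r: "0 < r" "r < 1"
    obtain A where A: "\<And>n. cmod (a n) * r ^ n \<le> A" using analytic_disc_bounded[OF assms(1), of r] r by auto
    obtain B where B: "\<And>n. cmod (b n) * r ^ n \<le> B" using analytic_disc_bounded[OF assms(2), of r] r by auto
    have "cmod (a n + b n) * r ^ n \<le> A + B" for n
    proof -
      have "cmod (a n + b n) * r ^ n \<le> (cmod (a n) + cmod (b n)) * r ^ n"
        using r by (intro mult_right_mono norm_triangle_ineq) auto
      also have "\<dots> \<le> A + B" using A[of n] B[of n] by (simp add: distrib_right)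
      finally show ?thesis .
    qed
    then show "\<exists>B. \<forall>n. cmod (a n + b n) * r ^ n \<le> B" by blast
  qed
  assume z: "cmod z < 1"
  from sums_add[OF analytic_disc_sums[OF assms(1) z] analytic_disc_sums[OF assms(2) z]]
  show "disc_fun (\<lambda>n. a n + b n) z = disc_fun a z + disc_fun b z"
    by (simp add: disc_fun_def sums_iff algebra_simps)
qed

lemma hardy_norm_cmult_le:
  assumes p: "0 < p" and a: "a \<in> analytic_disc" and B: "0 \<le> B" "hardy_norm p (disc_fun a) \<le> ennreal B"
  shows "hardy_norm p (disc_fun (\<lambda>n. c * a n)) \<le> ennreal (cmod c * B)"
proof -
  have "(\<integral>\<^sup>+\<zeta>. ennreal (cmod (disc_fun (\<lambda>n. c * a n) (of_real r * \<zeta>)) powr p) \<partial>circle_measure) \<le> ennreal ((cmod c * B) powr p)"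
    if r: "0 < r" "r < 1" for r
  proof -
    have cont: "continuous_on (sphere 0 1) (\<lambda>\<zeta>. cmod (disc_fun a (of_real r * \<zeta>)) powr p)"
      using r p by (intro continuous_on_powr' continuous_intros disc_fun_continuous_dilate_circle[OF a]) auto
    have [measurable]: "(\<lambda>\<zeta>. cmod (disc_fun a (of_real r * \<zeta>)) powr p) \<in> borel_measurable circle_measure"
      by (intro measurable_circle measurable_circle_continuous cont)
    have "(\<integral>\<^sup>+\<zeta>. ennreal (cmod (disc_fun (\<lambda>n. c * a n) (of_real r * \<zeta>)) powr p) \<partial>circle_measure) =
        (\<integral>\<^sup>+\<zeta>. ennreal (cmod c powr p) * ennreal (cmod (disc_fun a (of_real r * \<zeta>)) powr p) \<partial>circle_measure)"
      using r by (intro nn_integral_cong) (simp add: disc_fun_cmult(2)[OF a] norm_mult powr_mult flip: ennreal_mult)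
    also have "\<dots> = ennreal (cmod c powr p) * (\<integral>\<^sup>+\<zeta>. ennreal (cmod (disc_fun a (of_real r * \<zeta>)) powr p) \<partial>circle_measure)"
      by (rule nn_integral_cmult) measurable
    also have "\<dots> \<le> ennreal (cmod c powr p) * ennreal (B powr p)"
      using B r hardy_norm_le_iff[OF p B(1)] by (intro mult_left_mono) auto
    also have "\<dots> = ennreal ((cmod c * B) powr p)" using B(1) by (simp add: powr_mult flip: ennreal_mult)
    finally show ?thesis .
  qed
  then show ?thesis using B(1) by (subst hardy_norm_le_iff[OF p]) auto
qed

lemma hardy_norm_le_suminf:
  assumes p: "0 < p" and s: "summable (\<lambda>n. cmod (a n))"
  shows "a \<in> hardy_space p" and "hardy_norm p (disc_fun a) \<le> ennreal (\<Sum>n. cmod (a n))"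
proof -
  have a: "a \<in> analytic_disc"
  proof (rule analytic_discI)
    fix r :: real assume r: "0 < r" "r < 1"
    have "cmod (a n) * r ^ n \<le> (\<Sum>n. cmod (a n))" for n
    proof -
      have "cmod (a n) * r ^ n \<le> cmod (a n)" using r by (intro mult_left_le power_le_one) auto
      also have "\<dots> \<le> (\<Sum>n. cmod (a n))" using sum_le_suminf[OF s, of "{n}"] by simp
      finally show ?thesis .
    qed
    then show "\<exists>B. \<forall>n. cmod (a n) * r ^ n \<le> B" by blast
  qed
  have S0: "0 \<le> (\<Sum>n. cmod (a n))" by (intro suminf_nonneg s) auto
  have bd: "cmod (disc_fun a z) \<le> (\<Sum>n. cmod (a n))" if z: "cmod z < 1" for z
  proof -
    have le: "cmod (a n * z ^ n) \<le> cmod (a n)" for n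
      unfolding norm_mult norm_power using z by (intro mult_left_le power_le_one) auto
    have sz: "summable (\<lambda>n. cmod (a n * z ^ n))" by (rule summable_comparison_test'[OF s]) (use le in auto)
    have "cmod (disc_fun a z) \<le> (\<Sum>n. cmod (a n * z ^ n))" unfolding disc_fun_def by (rule summable_norm[OF sz])
    also have "\<dots> \<le> (\<Sum>n. cmod (a n))" by (intro suminf_le le sz s)
    finally show ?thesis .
  qed
  have "(\<integral>\<^sup>+\<zeta>. ennreal (cmod (disc_fun a (of_real r * \<zeta>)) powr p) \<partial>circle_measure) \<le> ennreal ((\<Sum>n. cmod (a n)) powr p)"
    if r: "0 < r" "r < 1" for r
  proof -
    have "(\<integral>\<^sup>+\<zeta>. ennreal (cmod (disc_fun a (of_real r * \<zeta>)) powr p) \<partial>circle_measure) \<le>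
        (\<integral>\<^sup>+\<zeta>. ennreal ((\<Sum>n. cmod (a n)) powr p) \<partial>circle_measure)"
      using r p by (intro nn_integral_mono ennreal_leI powr_mono2 bd) (auto simp: norm_mult)
    then show ?thesis using circle.emeasure_space_1 by simp
  qed
  then show n: "hardy_norm p (disc_fun a) \<le> ennreal (\<Sum>n. cmod (a n))"
    using hardy_norm_le_iff[OF p S0] by blast
  then show "a \<in> hardy_space p" using a by (auto simp: hardy_space_def intro: le_less_trans)
qed

lemma linear_functional_sum_monomials:
  assumes p: "0 < p" and \<phi>: "linear_functional_on (hardy_space p) \<phi>"
  shows "\<phi> (\<lambda>n. if n < m then a n else 0) = (\<Sum>n<m. a n * \<phi> (monomial_seq n))"
proof -
  have fin: "(\<lambda>n. if n < k then b n else 0) \<in> hardy_space p" for k and b :: "nat \<Rightarrow> complex"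
    by (rule hardy_norm_le_suminf(1)[OF p]) (rule summable_finite[of "{..<k}"], auto)
  have mono: "monomial_seq k \<in> hardy_space p" for k
    by (rule hardy_norm_le_suminf(1)[OF p]) (rule summable_finite[of "{k}"], auto simp: monomial_seq_def)
  have smult: "\<phi> (\<lambda>n. c * b n) = c * \<phi> b" if "b \<in> hardy_space p" for c b
    using \<phi> that by (simp add: linear_functional_on_def)
  have add: "\<phi> (\<lambda>n. b n + c n) = \<phi> b + \<phi> c" if "b \<in> hardy_space p" "c \<in> hardy_space p" for b c
    using \<phi> that by (simp add: linear_functional_on_def)
  have mono': "(\<lambda>n. c * monomial_seq k n) \<in> hardy_space p" for c k
    by (rule hardy_norm_le_suminf(1)[OF p]) (rule summable_finite[of "{k}"], auto simp: monomial_seq_def)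
  show ?thesis
  proof (induction m)
    case 0
    show ?case using smult[OF mono, of 0 0] by simp
  next
    case (Suc m)
    have "(\<lambda>n. if n < Suc m then a n else 0) = (\<lambda>n. (if n < m then a n else 0) + a m * monomial_seq m n)"
      by (auto simp: fun_eq_iff monomial_seq_def less_Suc_eq)
    then show ?case using add[OF fin mono'] smult[OF mono] Suc.IH by simp
  qed
qed

text \<open>The sum of the moduli of the coefficients dominates the Hardy norm, so the Taylor
  polynomials converge in the space and the functional can be evaluated term by term.\<close>

lemma hardy_functional_sums:
  assumes p: "0 < p" and \<phi>: "linear_functional_on (hardy_space p) \<phi>" "hardy_continuous p \<phi>"
    and s: "summable (\<lambda>n. cmod (a n))"
  shows "(\<lambda>n. a n * \<phi> (monomial_seq n)) sums \<phi> a"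
proof -
  have aH: "a \<in> hardy_space p" by (rule hardy_norm_le_suminf(1)[OF p s])
  have "(\<lambda>m. \<Sum>n<m. a n * \<phi> (monomial_seq n)) \<longlonglongrightarrow> \<phi> a"
  proof (rule tendstoI)
    fix e :: real assume "0 < e"
    then obtain \<delta> where \<delta>: "0 < \<delta>" "\<And>b. b \<in> hardy_space p \<Longrightarrow> hardy_norm p (disc_fun (\<lambda>n. b n - a n)) < ennreal \<delta> \<Longrightarrow> cmod (\<phi> b - \<phi> a) < e"
      using \<phi>(2) aH unfolding hardy_continuous_def by blast
    have "(\<lambda>m. \<Sum>n. cmod (a (n + m))) \<longlonglongrightarrow> 0" by (rule suminf_exist_split2[OF s])
    then have "\<forall>\<^sub>F m in sequentially. (\<Sum>n. cmod (a (n + m))) < \<delta>" using \<delta>(1) by (rule order_tendstoD)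
    then show "\<forall>\<^sub>F m in sequentially. dist (\<Sum>n<m. a n * \<phi> (monomial_seq n)) (\<phi> a) < e"
    proof eventually_elim
      case (elim m)
      let ?b = "\<lambda>n. if n < m then a n else 0"
      let ?d = "\<lambda>n. ?b n - a n"
      have bH: "?b \<in> hardy_space p"
        by (rule hardy_norm_le_suminf(1)[OF p]) (rule summable_finite[of "{..<m}"], auto)
      have sd: "summable (\<lambda>n. cmod (?d n))" by (rule summable_comparison_test'[OF s]) auto
      have "(\<Sum>n. cmod (?d n)) = (\<Sum>n. cmod (?d (n + m))) + (\<Sum>n<m. cmod (?d n))"
        by (rule suminf_split_initial_segment[OF sd])
      also have "\<dots> = (\<Sum>n. cmod (a (n + m)))" by simp
      finally have "(\<Sum>n. cmod (?d n)) < \<delta>" using elim by simp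
      then have "ennreal (\<Sum>n. cmod (?d n)) < ennreal \<delta>"
        by (subst ennreal_less_iff) (auto intro!: suminf_nonneg sd)
      with hardy_norm_le_suminf(2)[OF p sd] have "hardy_norm p (disc_fun ?d) < ennreal \<delta>" by (rule le_less_trans)
      from \<delta>(2)[OF bH this] show ?case
        unfolding linear_functional_sum_monomials[OF p \<phi>(1)] by (simp add: dist_norm)
    qed
  qed
  then show ?thesis by (simp add: sums_def)
qed

lemma hardy_functional_bounded:
  assumes p: "0 < p" and \<phi>: "linear_functional_on (hardy_space p) \<phi>" "hardy_continuous p \<phi>"
  obtains M where "0 < M" "\<And>a B. a \<in> hardy_space p \<Longrightarrow> 0 < B \<Longrightarrow> hardy_norm p (disc_fun a) \<le> ennreal B \<Longrightarrow> cmod (\<phi> a) \<le> M * B"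
proof -
  have zH: "(\<lambda>n. 0) \<in> hardy_space p" by (rule hardy_norm_le_suminf(1)[OF p]) simp
  have smult: "\<phi> (\<lambda>n. c * b n) = c * \<phi> b" if "b \<in> hardy_space p" for c b
    using \<phi>(1) that by (simp add: linear_functional_on_def)
  have z: "\<phi> (\<lambda>n. 0) = 0" using smult[OF zH, of 0] by simp
  obtain \<delta> where \<delta>: "0 < \<delta>" "\<And>b. b \<in> hardy_space p \<Longrightarrow> hardy_norm p (disc_fun (\<lambda>n. b n - 0)) < ennreal \<delta> \<Longrightarrow> cmod (\<phi> b - \<phi> (\<lambda>n. 0)) < 1"
    using \<phi>(2)[unfolded hardy_continuous_def, rule_format, OF zH zero_less_one] by metis
  show ?thesis
  proof (rule that[of "2 / \<delta>"])
    fix a B assume a: "a \<in> hardy_space p" and B: "0 < B" "hardy_norm p (disc_fun a) \<le> ennreal B"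
    have aA: "a \<in> analytic_disc" using a by (simp add: hardy_space_def)
    \<comment> \<open>Rescales to norm at most \<delta> / 2, strictly below \<delta>; hence the
      constant 2 / \<delta>.\<close>
    define c where "c = complex_of_real (\<delta> / (2 * B))"
    have c: "cmod c = \<delta> / (2 * B)" unfolding c_def norm_of_real using \<delta>(1) B(1) by simp
    have "hardy_norm p (disc_fun (\<lambda>n. c * a n)) \<le> ennreal (cmod c * B)"
      by (rule hardy_norm_cmult_le[OF p aA less_imp_le[OF B(1)] B(2)])
    also have "cmod c * B = \<delta> / 2" unfolding c using B(1) by simp
    also have "ennreal (\<delta> / 2) < ennreal \<delta>" using \<delta>(1) by (simp add: ennreal_less_iff)
    finally have n: "hardy_norm p (disc_fun (\<lambda>n. c * a n)) < ennreal \<delta>" .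
    then have "(\<lambda>n. c * a n) \<in> hardy_space p"
      using disc_fun_cmult(1)[OF aA] by (auto simp: hardy_space_def intro: less_trans)
    then have "cmod (\<phi> (\<lambda>n. c * a n)) < 1" using \<delta>(2)[of "\<lambda>n. c * a n"] n z by simp
    then have "cmod c * cmod (\<phi> a) < 1" by (simp add: smult[OF a] norm_mult)
    then have "\<delta> * cmod (\<phi> a) \<le> 2 * B" unfolding c using B(1) by (simp add: field_simps)
    then show "cmod (\<phi> a) \<le> 2 / \<delta> * B" using \<delta>(1) by (simp add: field_simps)
  qed (use \<delta> in auto)
qed

text \<open>On the circle |1 - \<alpha> r \<zeta>| = |\<zeta> - z| with z the conjugate of \<alpha>
  r. Two of the 2 + p powers form a Poisson kernel up to 1 / (1 - |\<alpha>|), the other p are at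
  most (1 - |\<alpha>|)^(-p).\<close>

lemma nn_integral_kernel_le:
  assumes p: "0 < p" and \<alpha>: "cmod \<alpha> < 1" and r: "0 < r" "r < 1"
  shows "(\<integral>\<^sup>+\<zeta>. ennreal (cmod (1 - \<alpha> * (of_real r * \<zeta>)) powr - (2 + p)) \<partial>circle_measure) \<le> ennreal ((1 - cmod \<alpha>) powr - (1 + p))"
proof -
  define z where "z = cnj (\<alpha> * of_real r)"
  have cz: "cmod z \<le> cmod \<alpha>" using r by (simp add: z_def norm_mult mult_left_le)
  then have z1: "cmod z < 1" using \<alpha> by simp
  define \<delta> where "\<delta> = 1 - cmod \<alpha>"
  have \<delta>: "0 < \<delta>" using \<alpha> by (simp add: \<delta>_def)
  have sq: "\<delta> \<le> 1 - (cmod z)\<^sup>2"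
  proof -
    have "(cmod z)\<^sup>2 \<le> cmod z" using z1 by (simp add: power2_eq_square mult_left_le)
    then show ?thesis using cz by (simp add: \<delta>_def)
  qed
  have le: "cmod (1 - \<alpha> * (of_real r * \<zeta>)) powr - (2 + p) \<le> \<delta> powr - (1 + p) * poisson z \<zeta>" if \<zeta>: "cmod \<zeta> = 1" for \<zeta>
  proof -
    have "\<zeta> * cnj (1 - \<alpha> * (of_real r * \<zeta>)) = \<zeta> - z * (\<zeta> * cnj \<zeta>)" by (simp add: z_def algebra_simps)
    also have "\<zeta> * cnj \<zeta> = 1" using \<zeta> complex_norm_square[of \<zeta>] by simp
    finally have "cmod (\<zeta> - z) = cmod (1 - \<alpha> * (of_real r * \<zeta>))"
      by (metis \<zeta> complex_mod_cnj mult_1 mult_1_right norm_mult)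
    then have eq: "cmod (1 - \<alpha> * (of_real r * \<zeta>)) = cmod (\<zeta> - z)" by simp
    define u where "u = cmod (\<zeta> - z)"
    have "1 - cmod z \<le> u" using norm_triangle_ineq2[of \<zeta> z] \<zeta> by (simp add: u_def)
    then have u: "\<delta> \<le> u" using cz by (simp add: \<delta>_def)
    have "u powr - (2 + p) = u powr (- p + - 2)" by (rule arg_cong[of _ _ "(powr) u"]) simp
    also have "\<dots> = u powr - p * u powr - 2" by (rule powr_add)
    also have "u powr - 2 = 1 / u\<^sup>2" using u \<delta> by (simp add: powr_minus_divide)
    also have "u powr - p * (1 / u\<^sup>2) \<le> \<delta> powr - p * (1 / u\<^sup>2)"
      using u \<delta> p by (intro mult_right_mono powr_mono2') auto
    also have "1 / u\<^sup>2 \<le> poisson z \<zeta> / \<delta>"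
    proof -
      have "\<delta> / u\<^sup>2 \<le> poisson z \<zeta>" unfolding poisson_def u_def[symmetric] using sq by (intro divide_right_mono) auto
      then show ?thesis using \<delta> by (simp add: pos_le_divide_eq)
    qed
    then have "\<delta> powr - p * (1 / u\<^sup>2) \<le> \<delta> powr - p * (poisson z \<zeta> / \<delta>)" by (intro mult_left_mono) auto
    also have "\<dots> = \<delta> powr - (1 + p) * poisson z \<zeta>"
    proof -
      have "\<delta> powr - (1 + p) = \<delta> powr (- p - 1)" by (rule arg_cong[of _ _ "(powr) \<delta>"]) simp
      then show ?thesis using \<delta> powr_diff[of \<delta> "- p" 1] by simp
    qed
    finally show ?thesis unfolding eq u_def .
  qed
  have "(\<integral>\<^sup>+\<zeta>. ennreal (cmod (1 - \<alpha> * (of_real r * \<zeta>)) powr - (2 + p)) \<partial>circle_measure) \<le>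
      (\<integral>\<^sup>+\<zeta>. ennreal (\<delta> powr - (1 + p)) * ennreal (poisson z \<zeta>) \<partial>circle_measure)"
    using le poisson_nonneg[OF z1] by (intro nn_integral_mono) (simp add: ennreal_leI flip: ennreal_mult)
  also have "\<dots> = ennreal (\<delta> powr - (1 + p)) * (\<integral>\<^sup>+\<zeta>. ennreal (poisson z \<zeta>) \<partial>circle_measure)"
    by (rule nn_integral_cmult) (use poisson_measurable[OF z1] in measurable)
  also have "(\<integral>\<^sup>+\<zeta>. ennreal (poisson z \<zeta>) \<partial>circle_measure) = 1"
    using nn_integral_eq_integral[OF integrable_poisson[OF z1]] integral_poisson_1[OF z1] poisson_nonneg[OF z1] by simp
  finally show ?thesis by (simp add: \<delta>_def)
qed

text \<open>The functional applied to a kernel of parameter \<alpha> evaluates a fractional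
  derivative of l at \<alpha>, so the norm of the kernel bounds the growth of that
  derivative.\<close>

lemma hardy_dual_subset_bloch_type:
  assumes p: "0 < p" "p < 1"
  shows "hardy_dual p \<subseteq> bloch_type (1 / p)"
proof
  fix l assume "l \<in> hardy_dual p"
  then obtain \<phi> where \<phi>: "linear_functional_on (hardy_space p) \<phi>" "hardy_continuous p \<phi>"
    and l: "\<And>n. l n = \<phi> (monomial_seq n)" by (auto simp: hardy_dual_def)
  define \<beta> where "\<beta> = 1 / p"
  have \<beta>: "1 < \<beta>" using p by (simp add: \<beta>_def)
  obtain M where M: "0 < M" "\<And>a B. a \<in> hardy_space p \<Longrightarrow> 0 < B \<Longrightarrow> hardy_norm p (disc_fun a) \<le> ennreal B \<Longrightarrow> cmod (\<phi> a) \<le> M * B"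
    using hardy_functional_bounded[OF p(1) \<phi>] by blast
  have lM: "cmod (l n) \<le> M" for n
  proof -
    have s: "(\<lambda>k. cmod (monomial_seq n k)) sums 1"
      using sums_single[of n "\<lambda>_. 1 :: real"] by (rule sums_cong[THEN iffD1, rotated]) (auto simp: monomial_seq_def)
    then have "monomial_seq n \<in> hardy_space p" "hardy_norm p (disc_fun (monomial_seq n)) \<le> ennreal 1"
      using hardy_norm_le_suminf[OF p(1), of "monomial_seq n"] by (auto simp: sums_iff)
    then show ?thesis using M(2)[of "monomial_seq n" 1] by (simp add: l)
  qed
  have lA: "l \<in> analytic_disc"
  proof (rule analytic_discI)
    fix r :: real assume r: "0 < r" "r < 1"
    have "cmod (l n) * r ^ n \<le> M * 1" for n
      using r lM[of n] M(1) by (intro mult_mono power_le_one) auto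
    then show "\<exists>B. \<forall>n. cmod (l n) * r ^ n \<le> B" by blast
  qed
  \<comment> \<open>With this order the kernel has exponent s + 1 and (s + 1) p = 2 + p, as
    \<open>nn_integral_kernel_le\<close> expects.\<close>
  define s where "s = 2 * \<beta>"
  have G: "0 < Gamma (s + 1)" using \<beta> by (simp add: s_def)
  have bd: "cmod (disc_fun (frac_deriv s l) \<alpha>) \<le> M * Gamma (s + 1) * (1 - cmod \<alpha>) powr - (\<beta> + 1)" if \<alpha>: "cmod \<alpha> < 1" for \<alpha>
  proof -
    define g where "g n = complex_of_real (Gamma (real n + s + 1) / fact n)" for n
    define a where "a n = g n * \<alpha> ^ n" for n
    have gA: "g \<in> analytic_disc" unfolding g_def[abs_def] using \<beta> by (intro Gamma_coeff_analytic) (simp add: s_def)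
    have sa: "summable (\<lambda>n. cmod (a n))"
      unfolding a_def norm_mult norm_power by (rule analytic_disc_norm_summable[OF gA]) (use \<alpha> in auto)
    have aH: "a \<in> hardy_space p" by (rule hardy_norm_le_suminf(1)[OF p(1) sa])
    have "(\<lambda>n. a n * \<phi> (monomial_seq n)) sums \<phi> a" by (rule hardy_functional_sums[OF p(1) \<phi> sa])
    then have "\<phi> a = disc_fun (frac_deriv s l) \<alpha>"
      by (simp add: disc_fun_def frac_deriv_def sums_iff a_def g_def l mult_ac)
    moreover have "cmod (\<phi> a) \<le> M * (Gamma (s + 1) * (1 - cmod \<alpha>) powr - (\<beta> + 1))"
    proof (rule M(2)[OF aH])
      show B0: "0 < Gamma (s + 1) * (1 - cmod \<alpha>) powr - (\<beta> + 1)" using G \<alpha> by simp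
      have fz: "cmod (disc_fun a z) = Gamma (s + 1) * cmod (1 - \<alpha> * z) powr - (s + 1)" if z: "cmod z < 1" for z
      proof -
        have az: "cmod (\<alpha> * z) < 1" using \<alpha> z by (simp add: norm_mult le_less_trans[OF mult_left_le_one_le])
        then have "1 - \<alpha> * z \<noteq> 0" by auto
        have "(\<lambda>n. of_real (Gamma (real n + (s + 1)) / fact n) * (\<alpha> * z) ^ n) sums (of_real (Gamma (s + 1)) * (1 - \<alpha> * z) powr (- of_real (s + 1)))"
          by (rule binomial_kernel_sums) (use \<beta> az in \<open>auto simp: s_def\<close>)
        then have "disc_fun a z = of_real (Gamma (s + 1)) * (1 - \<alpha> * z) powr (- of_real (s + 1))"
          by (simp add: disc_fun_def sums_iff a_def g_def power_mult_distrib mult_ac add_ac)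
        moreover have "cmod ((1 - \<alpha> * z) powr (- of_real (s + 1))) = cmod (1 - \<alpha> * z) powr - (s + 1)"
          using \<open>1 - \<alpha> * z \<noteq> 0\<close> by (simp add: powr_def norm_exp_eq_Re algebra_simps del: of_real_add)
        ultimately show ?thesis using G by (simp add: norm_mult)
      qed
      show "hardy_norm p (disc_fun a) \<le> ennreal (Gamma (s + 1) * (1 - cmod \<alpha>) powr - (\<beta> + 1))"
      proof (subst hardy_norm_le_iff[OF p(1) less_imp_le[OF B0]], intro allI impI)
        fix r :: real assume r: "0 < r" "r < 1"
        have sp: "(s + 1) * p = 2 + p" using p by (simp add: s_def \<beta>_def field_simps)
        have cont: "continuous_on (sphere 0 1) (\<lambda>\<zeta>. cmod (1 - \<alpha> * (of_real r * \<zeta>)) powr - (2 + p))"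
        proof (intro continuous_on_powr continuous_intros ballI)
          fix \<zeta> :: complex assume "\<zeta> \<in> sphere 0 1"
          then have "cmod (\<alpha> * (of_real r * \<zeta>)) < 1"
            using \<alpha> r by (simp add: norm_mult le_less_trans[OF mult_right_le_one_le])
          then show "cmod (1 - \<alpha> * (of_real r * \<zeta>)) \<noteq> 0" by auto
        qed
        have [measurable]: "(\<lambda>\<zeta>. cmod (1 - \<alpha> * (of_real r * \<zeta>)) powr - (2 + p)) \<in> borel_measurable circle_measure"
          by (intro measurable_circle measurable_circle_continuous cont)
        have "(\<integral>\<^sup>+\<zeta>. ennreal (cmod (disc_fun a (of_real r * \<zeta>)) powr p) \<partial>circle_measure) =
            (\<integral>\<^sup>+\<zeta>. ennreal (Gamma (s + 1) powr p) * ennreal (cmod (1 - \<alpha> * (of_real r * \<zeta>)) powr - (2 + p)) \<partial>circle_measure)"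
        proof (rule nn_integral_cong)
          fix \<zeta> :: complex assume "\<zeta> \<in> space circle_measure"
          then have "cmod (of_real r * \<zeta>) < 1" using r by (simp add: norm_mult)
          then have "cmod (disc_fun a (of_real r * \<zeta>)) powr p = Gamma (s + 1) powr p * cmod (1 - \<alpha> * (of_real r * \<zeta>)) powr (- (s + 1) * p)"
            using G by (simp only: fz powr_mult powr_powr)
          also have "- (s + 1) * p = - (2 + p)" by (simp only: mult_minus_left sp)
          finally show "ennreal (cmod (disc_fun a (of_real r * \<zeta>)) powr p) =
              ennreal (Gamma (s + 1) powr p) * ennreal (cmod (1 - \<alpha> * (of_real r * \<zeta>)) powr - (2 + p))"
            by (simp only: ennreal_mult powr_ge_zero)
        qed
        also have "\<dots> = ennreal (Gamma (s + 1) powr p) * (\<integral>\<^sup>+\<zeta>. ennreal (cmod (1 - \<alpha> * (of_real r * \<zeta>)) powr - (2 + p)) \<partial>circle_measure)"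
          by (rule nn_integral_cmult) measurable
        also have "\<dots> \<le> ennreal (Gamma (s + 1) powr p) * ennreal ((1 - cmod \<alpha>) powr - (1 + p))"
          by (intro mult_left_mono nn_integral_kernel_le p \<alpha> r) simp
        also have "\<dots> = ennreal ((Gamma (s + 1) * (1 - cmod \<alpha>) powr - (\<beta> + 1)) powr p)"
        proof -
          have "- (\<beta> + 1) * p = - (1 + p)" using p by (simp add: \<beta>_def field_simps)
          then have "((1 - cmod \<alpha>) powr - (\<beta> + 1)) powr p = (1 - cmod \<alpha>) powr - (1 + p)"
            unfolding powr_powr by (simp only:)
          then show ?thesis using G by (simp only: powr_mult less_imp_le powr_ge_zero ennreal_mult)
        qed
        finally show "(\<integral>\<^sup>+\<zeta>. ennreal (cmod (disc_fun a (of_real r * \<zeta>)) powr p) \<partial>circle_measure) \<le>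
            ennreal ((Gamma (s + 1) * (1 - cmod \<alpha>) powr - (\<beta> + 1)) powr p)" .
      qed
    qed
    ultimately show ?thesis by (simp add: mult.assoc)
  qed
  have "l \<in> bloch_type \<beta>"
    by (rule bloch_typeI_growth[OF _ lA _ bd[unfolded s_def]]) (use \<beta> M(1) G in \<open>auto simp: s_def\<close>)
  then show "l \<in> bloch_type (1 / p)" by (simp add: \<beta>_def)
qed

text \<open>Integrand of an Euler integral: its integral over \<tau> stands for Gamma(\<beta>) times
  the formal sum of the l_n a_n, as \<open>integral_dual_integrand_monomial\<close> confirms on
  monomials.\<close>

definition dual_integrand :: "real \<Rightarrow> (nat \<Rightarrow> complex) \<Rightarrow> (nat \<Rightarrow> complex) \<Rightarrow> real \<Rightarrow> complex" where
  "dual_integrand \<beta> l a \<tau> = indicator {0<..<1} \<tau> *\<^sub>R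
     (of_real (\<tau> powr (\<beta> - 1)) * disc_fun (frac_deriv \<beta> (\<lambda>n. l n * a n)) (of_real (1 - \<tau>)))"

lemma disc_fun_dilate:
  assumes a: "a \<in> analytic_disc" and R: "0 \<le> R" "R \<le> 1"
  shows "(\<lambda>n. a n * of_real R ^ n) \<in> analytic_disc"
    and "disc_fun (\<lambda>n. a n * of_real R ^ n) z = disc_fun a (of_real R * z)"
proof -
  show "(\<lambda>n. a n * of_real R ^ n) \<in> analytic_disc"
  proof (rule analytic_discI)
    fix r :: real assume r: "0 < r" "r < 1"
    obtain B where B: "\<And>n. cmod (a n) * r ^ n \<le> B" using analytic_disc_bounded[OF a, of r] r by auto
    have "cmod (a n * of_real R ^ n) * r ^ n \<le> B" for n
    proof -
      have "cmod (a n * of_real R ^ n) \<le> cmod (a n)"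
        using R by (simp add: norm_mult norm_power mult_left_le power_le_one)
      then have "cmod (a n * of_real R ^ n) * r ^ n \<le> cmod (a n) * r ^ n" using r by (intro mult_right_mono) auto
      then show ?thesis using B[of n] by linarith
    qed
    then show "\<exists>B. \<forall>n. cmod (a n * of_real R ^ n) * r ^ n \<le> B" by blast
  qed
  show "disc_fun (\<lambda>n. a n * of_real R ^ n) z = disc_fun a (of_real R * z)"
    by (simp add: disc_fun_def power_mult_distrib mult.assoc)
qed

lemma disc_fun_ray_measurable:
  assumes a: "a \<in> analytic_disc" and R: "0 \<le> R" "R \<le> 1"
  shows "(\<lambda>\<tau>. indicator {0<..<1} \<tau> *\<^sub>R (of_real (\<tau> powr e) * disc_fun a (of_real R * of_real (1 - \<tau>)))) \<in> borel_measurable borel"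
proof -
  have lt: "cmod (of_real R * of_real (1 - \<tau>)) < 1" if "\<tau> \<in> {0<..<1}" for \<tau> :: real
  proof -
    have "cmod (of_real R * of_real (1 - \<tau>)) = R * (1 - \<tau>)"
      using that R by (simp add: norm_mult del: of_real_diff)
    also have "\<dots> \<le> 1 - \<tau>" using that R by (intro mult_left_le_one_le) auto
    finally show ?thesis using that by simp
  qed
  have "continuous_on {0<..<1} (\<lambda>\<tau>::real. disc_fun a (of_real R * of_real (1 - \<tau>)))"
    by (rule continuous_on_compose2[OF holomorphic_on_imp_continuous_on[OF analytic_disc_holomorphic[OF a]]])
       (use lt in \<open>auto intro!: continuous_intros simp del: of_real_diff\<close>)
  then have "continuous_on {0<..<1} (\<lambda>\<tau>::real. of_real (\<tau> powr e) * disc_fun a (of_real R * of_real (1 - \<tau>)))"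
    by (intro continuous_intros) auto
  then have "(\<lambda>\<tau>::real. of_real (\<tau> powr e) * disc_fun a (of_real R * of_real (1 - \<tau>))) \<in> borel_measurable (restrict_space borel {0<..<1})"
    by (rule borel_measurable_continuous_on_restrict)
  then show ?thesis by (subst (asm) borel_measurable_restrict_space_iff) auto
qed

text \<open>
  For \<open>\<parallel>f\<parallel>\<^sub>p \<le> 1\<close> the theorem of Hardy and Littlewood is applied to the dilates of \<open>f\<close>, which are
  continuous on the closed disc; Fatou's lemma removes the dilation.
\<close>

lemma nn_integral_dual_integrand_le_unit:
  fixes p C :: real
  defines "\<beta> \<equiv> 1 / p" and "\<alpha> \<equiv> 2 / p"
  assumes p: "0 < p" "p < 1" and l: "l \<in> analytic_disc" and C: "0 < C"
    and L: "\<And>z. cmod z < 1 \<Longrightarrow> cmod (disc_fun (frac_deriv \<beta> l) z) \<le> C / (1 - cmod z)"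
    and a: "a \<in> analytic_disc" and n: "hardy_norm p (disc_fun a) \<le> 1"
  shows "(\<integral>\<^sup>+\<tau>. ennreal (cmod (dual_integrand \<beta> l a \<tau>)) \<partial>lborel) \<le>
    ennreal (2 * C * (2 * 2 powr \<alpha> * (1 / (\<beta> - 1) + 1 + 2 * 8 powr (\<alpha> - 1))))"
proof -
  have \<beta>: "1 < \<beta>" using p by (simp add: \<beta>_def)
  define H where "H = 2 * 2 powr \<alpha> * (1 / (\<beta> - 1) + 1 + 2 * 8 powr (\<alpha> - 1))"
  define h where "h = frac_deriv \<beta> (\<lambda>n. l n * a n)"
  have h: "h \<in> analytic_disc" unfolding h_def using \<beta> by (intro frac_deriv_analytic analytic_disc_mult l a) simp
  define q where "q R \<tau> = indicator {0<..<1} \<tau> *\<^sub>R (of_real (\<tau> powr (\<beta> - 1)) * disc_fun h (of_real R * of_real (1 - \<tau>)))"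
    for R \<tau> :: real
  have bound: "(\<integral>\<^sup>+\<tau>. ennreal (cmod (q R \<tau>)) \<partial>lborel) \<le> ennreal (2 * C * H)" if R: "0 < R" "R < 1" for R
  proof -
    define b where "b n = a n * of_real R ^ n" for n
    have bA: "b \<in> analytic_disc" and bf: "\<And>z. disc_fun b z = disc_fun a (of_real R * z)"
      using disc_fun_dilate[OF a, of R] R by (simp_all add: b_def[abs_def])
    have cR: "cmod (of_real R) < 1" using R by simp
    have bc: "continuous_on (cball 0 1) (disc_fun b)" and bh: "disc_fun b holomorphic_on ball 0 1"
      using disc_fun_dilate_continuous[OF a cR] disc_fun_dilate_holomorphic[OF a cR] by (simp_all add: bf[abs_def])
    define v where "v \<zeta> = log_plus (cmod (disc_fun b \<zeta>))" for \<zeta>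
    have cv: "continuous_on (sphere 0 1) v" unfolding v_def log_plus_def
      by (intro continuous_intros continuous_on_subset[OF bc]) auto
    have "(\<integral>\<^sup>+\<zeta>. ennreal (cmod (disc_fun b \<zeta>) powr p) \<partial>circle_measure) \<le> ennreal (1 powr p)"
      unfolding bf using hardy_norm_le_iff[of p 1 "disc_fun a"] p n R by simp
    moreover have "(\<integral>\<^sup>+\<zeta>. ennreal (exp (p * v \<zeta>)) \<partial>circle_measure) \<le>
        (\<integral>\<^sup>+\<zeta>. 1 + ennreal (cmod (disc_fun b \<zeta>) powr p) \<partial>circle_measure)"
    proof (rule nn_integral_mono)
      fix \<zeta>
      have "max 1 (cmod (disc_fun b \<zeta>)) \<noteq> 0" by linarith
      then have "exp (p * v \<zeta>) = max 1 (cmod (disc_fun b \<zeta>)) powr p"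
        by (simp add: v_def log_plus_def powr_def)
      also have "\<dots> \<le> 1 + cmod (disc_fun b \<zeta>) powr p" by (auto simp: max_def)
      finally show "ennreal (exp (p * v \<zeta>)) \<le> 1 + ennreal (cmod (disc_fun b \<zeta>) powr p)"
        by (simp add: ennreal_leI flip: ennreal_1 ennreal_plus)
    qed
    moreover have "(\<integral>\<^sup>+\<zeta>. 1 + ennreal (cmod (disc_fun b \<zeta>) powr p) \<partial>circle_measure) =
        1 + (\<integral>\<^sup>+\<zeta>. ennreal (cmod (disc_fun b \<zeta>) powr p) \<partial>circle_measure)"
    proof -
      have "continuous_on (sphere 0 1) (\<lambda>\<zeta>. cmod (disc_fun b \<zeta>) powr p)"
        using p by (intro continuous_on_powr' continuous_intros continuous_on_subset[OF bc]) auto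
      then have [measurable]: "(\<lambda>\<zeta>. cmod (disc_fun b \<zeta>) powr p) \<in> borel_measurable circle_measure"
        by (intro measurable_circle measurable_circle_continuous)
      show ?thesis by (subst nn_integral_add) (use circle.emeasure_space_1 in auto)
    qed
    \<comment> \<open>2 = 1 + 1: the total mass of the circle, and the bound for the p-th power mean
      given by norm at most 1.\<close>
    ultimately have v2: "(\<integral>\<^sup>+\<zeta>. ennreal (exp (p * v \<zeta>)) \<partial>circle_measure) \<le> 2"
      by (metis add_left_mono ennreal_1 one_add_one order_trans powr_one_eq_one)
    have HL: "(\<integral>\<^sup>+\<tau>\<in>{0<..<1}. ennreal (\<tau> powr (\<beta> - 2)) * mean1 (sqrt (1 - \<tau>)) (disc_fun b) \<partial>lborel) \<le> ennreal H"
      unfolding H_def \<beta>_def \<alpha>_def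
    proof (rule nn_integral_mean1_le[OF p integral_circle(1)[OF cv] _ _ v2])
      show "0 \<le> v \<zeta>" for \<zeta> by (simp add: v_def log_plus_nonneg)
      show "log_plus (cmod (disc_fun b z)) \<le> (LINT \<zeta>|circle_measure. poisson z \<zeta> * v \<zeta>)" if "cmod z < 1" for z
        unfolding v_def log_plus_def by (rule ln_max_le_poisson[OF bc bh that])
    qed
    \<comment> \<open>With r = sqrt(1 - \<tau>) the Hadamard product is evaluated at r^2 = 1 -
      \<tau>, and \<tau> <= 2 (1 - r) turns C / (1 - r) into 2 C / \<tau>. This lowers the exponent
      of \<tau> to \<beta> - 2, as in the Hardy-Littlewood integral.\<close>
    have pw: "ennreal (cmod (q R \<tau>)) \<le> ennreal (2 * C) * (ennreal (\<tau> powr (\<beta> - 2)) * mean1 (sqrt (1 - \<tau>)) (disc_fun b) * indicator {0<..<1} \<tau>)" for \<tau>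
    proof (cases "\<tau> \<in> {0<..<1}")
      case True
      define r where "r = sqrt (1 - \<tau>)"
      have r: "0 \<le> r" "r < 1" "r\<^sup>2 = 1 - \<tau>" using True by (auto simp: r_def)
      have "(1 - r) * (1 + r) \<le> (1 - r) * 2" using r by (intro mult_left_mono) auto
      then have le: "\<tau> \<le> 2 * (1 - r)" using r(3) by (simp add: power2_eq_square algebra_simps)
      have "ennreal (cmod (disc_fun (\<lambda>n. frac_deriv \<beta> l n * b n) (of_real (r\<^sup>2) * 1))) \<le> ennreal (2 * C / \<tau>) * mean1 r (disc_fun b)"
      proof (rule disc_fun_Hadamard_product_bound[OF bA _ r(1,2)])
        show "frac_deriv \<beta> l \<in> analytic_disc" using \<beta> by (intro frac_deriv_analytic l) simp
        fix z :: complex assume z: "cmod z = r"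
        have "C / (1 - r) = 2 * C / (2 * (1 - r))" by (rule mult_divide_mult_cancel_left[symmetric]) simp
        also have "\<dots> \<le> 2 * C / \<tau>" using le C r True by (intro divide_left_mono mult_pos_pos) auto
        finally show "cmod (disc_fun (frac_deriv \<beta> l) z) \<le> 2 * C / \<tau>" using L[of z] z r by simp
      qed simp
      also have "disc_fun (\<lambda>n. frac_deriv \<beta> l n * b n) (of_real (r\<^sup>2) * 1) = disc_fun h (of_real R * of_real (1 - \<tau>))"
        unfolding r(3) mult_1_right b_def h_def frac_deriv_mult mult.assoc[symmetric]
        by (rule disc_fun_dilate(2)) (use \<beta> l a R in \<open>auto intro!: analytic_disc_mult frac_deriv_analytic\<close>)
      finally have "ennreal (\<tau> powr (\<beta> - 1)) * ennreal (cmod (disc_fun h (of_real R * of_real (1 - \<tau>)))) \<le>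
          ennreal (\<tau> powr (\<beta> - 1)) * (ennreal (2 * C / \<tau>) * mean1 r (disc_fun b))"
        by (rule mult_left_mono) simp
      also have "\<dots> = ennreal (2 * C) * (ennreal (\<tau> powr (\<beta> - 2)) * mean1 r (disc_fun b))"
      proof -
        have "\<tau> powr (\<beta> - 1) * (2 * C / \<tau>) = 2 * C * \<tau> powr (\<beta> - 2)"
          using True powr_diff[of \<tau> "\<beta> - 1" 1] by simp
        then have "ennreal (\<tau> powr (\<beta> - 1)) * ennreal (2 * C / \<tau>) = ennreal (2 * C) * ennreal (\<tau> powr (\<beta> - 2))"
          using C True by (simp flip: ennreal_mult)
        then show ?thesis by (simp add: mult.assoc[symmetric])
      qed
      finally show ?thesis using True
        by (simp add: q_def r_def norm_mult ennreal_mult del: of_real_diff)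
    qed (simp add: q_def)
    have qm: "(\<lambda>\<tau>. ennreal (cmod (q R \<tau>))) \<in> borel_measurable lborel"
    proof -
      have "q R \<in> borel_measurable borel"
        unfolding q_def[abs_def] by (rule disc_fun_ray_measurable[OF h]) (use R in auto)
      then show ?thesis by measurable
    qed
    \<comment> \<open>The constant 2 C is moved to the side of \<open>q\<close>, so that
      \<open>nn_integral_cmult\<close> is applied to the integrand whose measurability in \<tau> is
      at hand.\<close>
    have inv: "ennreal (1 / (2 * C)) * (ennreal (2 * C) * X) = X" for X
      using C by (simp add: mult.assoc[symmetric] flip: ennreal_mult)
    have "ennreal (1 / (2 * C)) * (\<integral>\<^sup>+\<tau>. ennreal (cmod (q R \<tau>)) \<partial>lborel) =
        (\<integral>\<^sup>+\<tau>. ennreal (1 / (2 * C)) * ennreal (cmod (q R \<tau>)) \<partial>lborel)"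
      by (rule nn_integral_cmult[symmetric, OF qm])
    also have "\<dots> \<le> (\<integral>\<^sup>+\<tau>\<in>{0<..<1}. ennreal (\<tau> powr (\<beta> - 2)) * mean1 (sqrt (1 - \<tau>)) (disc_fun b) \<partial>lborel)"
    proof (rule nn_integral_mono)
      fix \<tau>
      have "ennreal (1 / (2 * C)) * ennreal (cmod (q R \<tau>)) \<le> ennreal (1 / (2 * C)) *
          (ennreal (2 * C) * (ennreal (\<tau> powr (\<beta> - 2)) * mean1 (sqrt (1 - \<tau>)) (disc_fun b) * indicator {0<..<1} \<tau>))"
        by (rule mult_left_mono[OF pw]) simp
      then show "ennreal (1 / (2 * C)) * ennreal (cmod (q R \<tau>)) \<le>
          ennreal (\<tau> powr (\<beta> - 2)) * mean1 (sqrt (1 - \<tau>)) (disc_fun b) * indicator {0<..<1} \<tau>"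
        unfolding inv .
    qed
    also note HL
    finally have "ennreal (2 * C) * (ennreal (1 / (2 * C)) * (\<integral>\<^sup>+\<tau>. ennreal (cmod (q R \<tau>)) \<partial>lborel)) \<le> ennreal (2 * C) * ennreal H"
      by (rule mult_left_mono) simp
    also have "\<dots> = ennreal (2 * C * H)" using C by (intro ennreal_mult'[symmetric]) simp
    also have "ennreal (2 * C) * (ennreal (1 / (2 * C)) * (\<integral>\<^sup>+\<tau>. ennreal (cmod (q R \<tau>)) \<partial>lborel)) = (\<integral>\<^sup>+\<tau>. ennreal (cmod (q R \<tau>)) \<partial>lborel)"
      using inv[of "\<integral>\<^sup>+\<tau>. ennreal (cmod (q R \<tau>)) \<partial>lborel"] by (simp only: mult.left_commute)
    finally show ?thesis .
  qed
  define R where "R j = 1 - inverse (real (Suc (Suc j)))" for j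
  have R: "R \<longlonglongrightarrow> 1" "\<And>j. 0 < R j" "\<And>j. R j < 1"
    unfolding R_def using LIMSEQ_Suc[OF LIMSEQ_inverse_real_of_nat_add_minus[of 1]]
    by (auto simp: field_simps)
  have "(\<lambda>j. ennreal (cmod (q (R j) \<tau>))) \<longlonglongrightarrow> ennreal (cmod (dual_integrand \<beta> l a \<tau>))" for \<tau>
  proof (cases "\<tau> \<in> {0<..<1}")
    case True
    have "(\<lambda>j. of_real (R j) * of_real (1 - \<tau>)) \<longlonglongrightarrow> complex_of_real 1 * of_real (1 - \<tau>)"
      by (intro tendsto_intros R(1))
    then have "(\<lambda>j. disc_fun h (of_real (R j) * of_real (1 - \<tau>))) \<longlonglongrightarrow> disc_fun h (complex_of_real 1 * of_real (1 - \<tau>))"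
    proof (rule continuous_on_tendsto_compose[OF holomorphic_on_imp_continuous_on[OF analytic_disc_holomorphic[OF h]]])
      have "cmod (of_real (R j) * of_real (1 - \<tau>)) < 1" for j
        using True R(2,3)[of j] mult_strict_mono'[of "R j" 1 "1 - \<tau>" 1] by (simp add: norm_mult del: of_real_diff)
      then show "\<forall>\<^sub>F j in sequentially. of_real (R j) * complex_of_real (1 - \<tau>) \<in> ball 0 1" by simp
    qed (use True in \<open>simp add: norm_mult del: of_real_diff\<close>)
    then have "(\<lambda>j. cmod (q (R j) \<tau>)) \<longlonglongrightarrow> cmod (dual_integrand \<beta> l a \<tau>)"
      unfolding q_def dual_integrand_def h_def[symmetric] by (intro tendsto_intros) simp
    then show ?thesis by (rule tendsto_ennrealI)
  qed (simp add: q_def dual_integrand_def)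
  then have "(\<integral>\<^sup>+\<tau>. ennreal (cmod (dual_integrand \<beta> l a \<tau>)) \<partial>lborel) = (\<integral>\<^sup>+\<tau>. liminf (\<lambda>j. ennreal (cmod (q (R j) \<tau>))) \<partial>lborel)"
    by (intro nn_integral_cong lim_imp_Liminf[symmetric]) auto
  also have "\<dots> \<le> liminf (\<lambda>j. \<integral>\<^sup>+\<tau>. ennreal (cmod (q (R j) \<tau>)) \<partial>lborel)"
  proof (rule nn_integral_liminf)
    fix j
    have "q (R j) \<in> borel_measurable borel"
      unfolding q_def[abs_def] by (rule disc_fun_ray_measurable[OF h]) (use R in \<open>auto simp: less_imp_le\<close>)
    then show "(\<lambda>\<tau>. ennreal (cmod (q (R j) \<tau>))) \<in> borel_measurable lborel" by measurable
  qed
  also have "\<dots> \<le> ennreal (2 * C * H)"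
    by (rule order_trans[OF Liminf_le_Limsup Limsup_bounded]) (auto intro!: always_eventually bound R)
  finally show ?thesis by (simp add: H_def)
qed


text \<open>By homogeneity, dividing by B reduces the claim to norm at most 1.\<close>

lemma nn_integral_dual_integrand_le:
  fixes p C B :: real
  defines "\<beta> \<equiv> 1 / p" and "\<alpha> \<equiv> 2 / p"
  assumes p: "0 < p" "p < 1" and l: "l \<in> analytic_disc" and C: "0 < C"
    and L: "\<And>z. cmod z < 1 \<Longrightarrow> cmod (disc_fun (frac_deriv \<beta> l) z) \<le> C / (1 - cmod z)"
    and a: "a \<in> analytic_disc" and B: "0 < B" "hardy_norm p (disc_fun a) \<le> ennreal B"
  shows "integrable lborel (dual_integrand \<beta> l a)"
    and "cmod (LINT \<tau>|lborel. dual_integrand \<beta> l a \<tau>) \<le> 2 * C * (2 * 2 powr \<alpha> * (1 / (\<beta> - 1) + 1 + 2 * 8 powr (\<alpha> - 1))) * B"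
proof -
  define H where "H = 2 * C * (2 * 2 powr \<alpha> * (1 / (\<beta> - 1) + 1 + 2 * 8 powr (\<alpha> - 1)))"
  have \<beta>: "1 < \<beta>" using p by (simp add: \<beta>_def)
  have H: "0 \<le> H" using C \<beta> by (simp add: H_def)
  have la: "frac_deriv \<beta> (\<lambda>n. l n * a n) \<in> analytic_disc"
    using \<beta> by (intro frac_deriv_analytic analytic_disc_mult l a) simp
  have [measurable]: "dual_integrand \<beta> l a \<in> borel_measurable borel"
    using disc_fun_ray_measurable[OF la, of 1 "\<beta> - 1"] by (simp add: dual_integrand_def[abs_def])
  define c where "c = complex_of_real (1 / B)"
  have c: "cmod c = 1 / B" unfolding c_def norm_of_real using B by simp
  have "hardy_norm p (disc_fun (\<lambda>n. c * a n)) \<le> ennreal (cmod c * B)"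
    by (rule hardy_norm_cmult_le[OF p(1) a less_imp_le[OF B(1)] B(2)])
  then have n1: "hardy_norm p (disc_fun (\<lambda>n. c * a n)) \<le> 1" using B(1) by (simp add: c)
  have eq: "dual_integrand \<beta> l (\<lambda>n. c * a n) \<tau> = c * dual_integrand \<beta> l a \<tau>" for \<tau>
  proof (cases "\<tau> \<in> {0<..<1}")
    case True
    have "frac_deriv \<beta> (\<lambda>n. l n * (c * a n)) = (\<lambda>n. c * frac_deriv \<beta> (\<lambda>n. l n * a n) n)"
      by (simp add: frac_deriv_def fun_eq_iff)
    moreover have "cmod (complex_of_real (1 - \<tau>)) < 1" using True unfolding norm_of_real by simp
    ultimately show ?thesis
      unfolding dual_integrand_def using True by (simp only: disc_fun_cmult(2)[OF la]) (simp add: mult_ac)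
  qed (simp add: dual_integrand_def)
  have "ennreal (1 / B) * (\<integral>\<^sup>+\<tau>. ennreal (cmod (dual_integrand \<beta> l a \<tau>)) \<partial>lborel) =
      (\<integral>\<^sup>+\<tau>. ennreal (1 / B) * ennreal (cmod (dual_integrand \<beta> l a \<tau>)) \<partial>lborel)"
    by (rule nn_integral_cmult[symmetric]) measurable
  also have "\<dots> = (\<integral>\<^sup>+\<tau>. ennreal (cmod (dual_integrand \<beta> l (\<lambda>n. c * a n) \<tau>)) \<partial>lborel)"
    unfolding eq norm_mult c using B(1) by (intro nn_integral_cong ennreal_mult'[symmetric]) simp
  also have "\<dots> \<le> ennreal H"
    unfolding H_def \<beta>_def \<alpha>_def
    by (rule nn_integral_dual_integrand_le_unit[OF p l C _ disc_fun_cmult(1)[OF a] n1]) (use L in \<open>simp add: \<beta>_def\<close>)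
  finally have "ennreal B * (ennreal (1 / B) * (\<integral>\<^sup>+\<tau>. ennreal (cmod (dual_integrand \<beta> l a \<tau>)) \<partial>lborel)) \<le> ennreal B * ennreal H"
    by (rule mult_left_mono) simp
  then have I: "(\<integral>\<^sup>+\<tau>. ennreal (cmod (dual_integrand \<beta> l a \<tau>)) \<partial>lborel) \<le> ennreal (H * B)"
    using B(1) H by (simp add: mult.assoc[symmetric] mult.commute flip: ennreal_mult)
  show int: "integrable lborel (dual_integrand \<beta> l a)"
    by (rule integrableI_bounded) (use I in \<open>auto intro: le_less_trans\<close>)
  have "ennreal (cmod (LINT \<tau>|lborel. dual_integrand \<beta> l a \<tau>)) \<le> ennreal (H * B)"
    using integral_norm_bound_ennreal[OF int] I by (rule order_trans)
  then show "cmod (LINT \<tau>|lborel. dual_integrand \<beta> l a \<tau>) \<le> 2 * C * (2 * 2 powr \<alpha> * (1 / (\<beta> - 1) + 1 + 2 * 8 powr (\<alpha> - 1))) * B"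
    using H B(1) unfolding H_def[symmetric] by (subst (asm) ennreal_le_iff) auto
qed

lemma dual_integrand_add:
  assumes "0 \<le> \<beta>" "l \<in> analytic_disc" "a \<in> analytic_disc" "b \<in> analytic_disc"
  shows "dual_integrand \<beta> l (\<lambda>n. a n + b n) \<tau> = dual_integrand \<beta> l a \<tau> + dual_integrand \<beta> l b \<tau>"
proof (cases "\<tau> \<in> {0<..<1}")
  case True
  have A: "frac_deriv \<beta> (\<lambda>n. l n * a n) \<in> analytic_disc" "frac_deriv \<beta> (\<lambda>n. l n * b n) \<in> analytic_disc"
    using assms by (auto intro!: frac_deriv_analytic analytic_disc_mult)
  have "frac_deriv \<beta> (\<lambda>n. l n * (a n + b n)) = (\<lambda>n. frac_deriv \<beta> (\<lambda>n. l n * a n) n + frac_deriv \<beta> (\<lambda>n. l n * b n) n)"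
    by (simp add: frac_deriv_def fun_eq_iff distrib_left)
  moreover have "cmod (complex_of_real (1 - \<tau>)) < 1" using True unfolding norm_of_real by simp
  ultimately show ?thesis
    unfolding dual_integrand_def using True by (simp only: disc_fun_add(2)[OF A]) (simp add: distrib_left)
qed (simp add: dual_integrand_def)

lemma dual_integrand_cmult:
  assumes "0 \<le> \<beta>" "l \<in> analytic_disc" "a \<in> analytic_disc"
  shows "dual_integrand \<beta> l (\<lambda>n. c * a n) \<tau> = c * dual_integrand \<beta> l a \<tau>"
proof (cases "\<tau> \<in> {0<..<1}")
  case True
  have A: "frac_deriv \<beta> (\<lambda>n. l n * a n) \<in> analytic_disc"
    using assms by (auto intro!: frac_deriv_analytic analytic_disc_mult)
  have "frac_deriv \<beta> (\<lambda>n. l n * (c * a n)) = (\<lambda>n. c * frac_deriv \<beta> (\<lambda>n. l n * a n) n)"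
    by (simp add: frac_deriv_def fun_eq_iff)
  moreover have "cmod (complex_of_real (1 - \<tau>)) < 1" using True unfolding norm_of_real by simp
  ultimately show ?thesis
    unfolding dual_integrand_def using True by (simp only: disc_fun_cmult(2)[OF A]) (simp add: mult_ac)
qed (simp add: dual_integrand_def)

text \<open>The integral is Beta(\<beta>, n + 1), which cancels the factor Gamma(n + \<beta> + 1) /
  n! of the fractional derivative and leaves Gamma(\<beta>).\<close>

lemma integral_dual_integrand_monomial:
  assumes \<beta>: "0 < \<beta>"
  shows "(LINT \<tau>|lborel. dual_integrand \<beta> l (monomial_seq n) \<tau>) = of_real (Gamma \<beta>) * l n"
proof -
  define g where "g = complex_of_real (Gamma (real n + \<beta> + 1) / fact n) * l n"
  have f: "disc_fun (frac_deriv \<beta> (\<lambda>k. l k * monomial_seq n k)) z = g * z ^ n" for z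
  proof -
    have "(\<lambda>k. frac_deriv \<beta> (\<lambda>k. l k * monomial_seq n k) k * z ^ k) = (\<lambda>k. if k = n then g * z ^ k else 0)"
      by (auto simp: fun_eq_iff frac_deriv_def monomial_seq_def g_def)
    then show ?thesis unfolding disc_fun_def using sums_single[of n "\<lambda>k. g * z ^ k"] by (simp add: sums_iff)
  qed
  have pw: "(1 - \<tau>) ^ n = (1 - \<tau>) powr (real n + 1 - 1)" if "\<tau> \<in> {0<..<1}" for \<tau> :: real
    using that by (simp add: powr_realpow)
  have eq: "dual_integrand \<beta> l (monomial_seq n) \<tau> =
      of_real (indicator {0<..<1} \<tau> *\<^sub>R (\<tau> powr (\<beta> - 1) * (1 - \<tau>) powr (real n + 1 - 1))) * g" for \<tau>
  proof (cases "\<tau> \<in> {0<..<1}")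
    case True
    show ?thesis unfolding pw[OF True, symmetric] dual_integrand_def f using True by (simp add: mult_ac)
  qed (simp add: dual_integrand_def)
  have "(LINT \<tau>|lborel. dual_integrand \<beta> l (monomial_seq n) \<tau>) = of_real (Beta \<beta> (real n + 1)) * g"
    unfolding eq integral_mult_left_zero integral_complex_of_real
    using set_integral_Beta(2)[of \<beta> "real n + 1"] \<beta> unfolding set_lebesgue_integral_def by simp
  also have "\<dots> = of_real (Gamma \<beta>) * l n"
  proof -
    have "Gamma (real n + \<beta> + 1) > 0" using \<beta> by simp
    moreover have "Gamma (real n + 1) = fact n" using Gamma_fact[of n, where ?'a = real] by (simp add: add_ac)
    ultimately have "Beta \<beta> (real n + 1) * (Gamma (real n + \<beta> + 1) / fact n) = Gamma \<beta>"
      by (simp add: Beta_def add_ac)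
    then have "complex_of_real (Beta \<beta> (real n + 1)) * of_real (Gamma (real n + \<beta> + 1) / fact n) = of_real (Gamma \<beta>)"
      by (metis of_real_mult)
    then show ?thesis unfolding g_def by (metis mult.assoc)
  qed
  finally show ?thesis .
qed

text \<open>The functional is the integral of \<open>dual_integrand\<close> divided by
  Gamma(\<beta>). The integral converges absolutely on the whole of H^p, with a bound linear in the
  norm; applied to differences this gives continuity.\<close>

lemma bloch_type_subset_hardy_dual:
  assumes p: "0 < p" "p < 1"
  shows "bloch_type (1 / p) \<subseteq> hardy_dual p"
proof
  fix l assume l: "l \<in> bloch_type (1 / p)"
  define \<beta> where "\<beta> = 1 / p"
  have \<beta>: "1 < \<beta>" using p by (simp add: \<beta>_def)
  have "l \<in> bloch_type \<beta>" using l by (simp add: \<beta>_def)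
  then have "l \<in> analytic_disc \<and> (\<exists>C\<ge>0. \<forall>z. cmod z < 1 \<longrightarrow> cmod (disc_fun (frac_deriv \<beta> l) z) \<le> C / (1 - cmod z))"
    using bloch_type_iff[of \<beta> l] \<beta> by simp
  then obtain C0 where lA: "l \<in> analytic_disc" and C0: "0 \<le> C0"
    "\<And>z. cmod z < 1 \<Longrightarrow> cmod (disc_fun (frac_deriv \<beta> l) z) \<le> C0 / (1 - cmod z)" by blast
  define C where "C = C0 + 1"
  have C: "0 < C" using C0 by (simp add: C_def)
  have L: "cmod (disc_fun (frac_deriv \<beta> l) z) \<le> C / (1 - cmod z)" if z: "cmod z < 1" for z
  proof -
    have "C0 / (1 - cmod z) \<le> C / (1 - cmod z)" using z by (intro divide_right_mono) (auto simp: C_def)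
    then show ?thesis using C0(2)[OF z] by linarith
  qed
  define M where "M = 2 * C * (2 * 2 powr (2 / p) * (1 / (\<beta> - 1) + 1 + 2 * 8 powr (2 / p - 1)))"
  have M: "0 \<le> M" using C \<beta> by (simp add: M_def)
  have G: "0 < Gamma \<beta>" using \<beta> by simp
  have dual: "integrable lborel (dual_integrand \<beta> l a)" "cmod (LINT \<tau>|lborel. dual_integrand \<beta> l a \<tau>) \<le> M * B"
    if "a \<in> analytic_disc" "0 < B" "hardy_norm p (disc_fun a) \<le> ennreal B" for a B
    using nn_integral_dual_integrand_le[OF p lA C _ that] L by (simp_all add: \<beta>_def M_def)
  have int: "integrable lborel (dual_integrand \<beta> l a)" if a: "a \<in> hardy_space p" for a
  proof -
    obtain N where N: "0 \<le> N" "hardy_norm p (disc_fun a) = ennreal N"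
      using a by (auto simp: hardy_space_def less_top_ennreal)
    have "hardy_norm p (disc_fun a) \<le> ennreal (N + 1)" unfolding N(2) by (rule ennreal_leI) simp
    then show ?thesis using dual(1)[of a "N + 1"] N(1) a by (simp add: hardy_space_def)
  qed
  define \<phi> where "\<phi> a = (LINT \<tau>|lborel. dual_integrand \<beta> l a \<tau>) / of_real (Gamma \<beta>)" for a
  have HA: "a \<in> analytic_disc" if "a \<in> hardy_space p" for a using that by (simp add: hardy_space_def)
  have "linear_functional_on (hardy_space p) \<phi>"
    unfolding linear_functional_on_def
  proof (intro conjI ballI allI)
    fix a b assume ab: "a \<in> hardy_space p" "b \<in> hardy_space p"
    have "(LINT \<tau>|lborel. dual_integrand \<beta> l (\<lambda>n. a n + b n) \<tau>) =
        (LINT \<tau>|lborel. dual_integrand \<beta> l a \<tau>) + (LINT \<tau>|lborel. dual_integrand \<beta> l b \<tau>)"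
      using \<beta> lA HA ab by (simp add: dual_integrand_add int)
    then show "\<phi> (\<lambda>n. a n + b n) = \<phi> a + \<phi> b" by (simp add: \<phi>_def add_divide_distrib)
  next
    fix c a assume "a \<in> hardy_space p"
    then show "\<phi> (\<lambda>n. c * a n) = c * \<phi> a"
      using \<beta> lA HA by (simp add: \<phi>_def dual_integrand_cmult)
  qed
  moreover have "hardy_continuous p \<phi>"
    unfolding hardy_continuous_def
  proof (intro ballI allI impI)
    fix a \<epsilon> assume a: "a \<in> hardy_space p" and \<epsilon>: "(0 :: real) < \<epsilon>"
    define \<delta> where "\<delta> = \<epsilon> * Gamma \<beta> / (M + 1)"
    have \<delta>: "0 < \<delta>" using \<epsilon> G M by (simp add: \<delta>_def)
    show "\<exists>\<delta>>0. \<forall>b\<in>hardy_space p. hardy_norm p (disc_fun (\<lambda>n. b n - a n)) < ennreal \<delta> \<longrightarrow> cmod (\<phi> b - \<phi> a) < \<epsilon>"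
    proof (intro exI[of _ \<delta>] conjI ballI impI \<delta>)
      fix b assume b: "b \<in> hardy_space p" and n: "hardy_norm p (disc_fun (\<lambda>n. b n - a n)) < ennreal \<delta>"
      have "(\<lambda>n. b n + (- 1) * a n) \<in> analytic_disc"
        by (intro disc_fun_add(1) disc_fun_cmult(1) HA a b)
      then have d: "(\<lambda>n. b n - a n) \<in> analytic_disc" by simp
      have "dual_integrand \<beta> l b \<tau> - dual_integrand \<beta> l a \<tau> = dual_integrand \<beta> l (\<lambda>n. b n - a n) \<tau>" for \<tau>
        using dual_integrand_add[OF _ lA HA[OF a] d, of \<beta> \<tau>] \<beta> by simp
      then have "\<phi> b - \<phi> a = (LINT \<tau>|lborel. dual_integrand \<beta> l (\<lambda>n. b n - a n) \<tau>) / of_real (Gamma \<beta>)"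
        unfolding \<phi>_def diff_divide_distrib[symmetric]
        by (subst Bochner_Integration.integral_diff[symmetric]) (auto intro!: int a b)
      moreover have "cmod (LINT \<tau>|lborel. dual_integrand \<beta> l (\<lambda>n. b n - a n) \<tau>) \<le> M * \<delta>"
        by (rule dual(2)[OF d \<delta> less_imp_le[OF n]])
      ultimately have "cmod (\<phi> b - \<phi> a) \<le> M * \<delta> / Gamma \<beta>"
        using G by (simp add: norm_divide divide_right_mono)
      also have "\<dots> < (M + 1) * \<delta> / Gamma \<beta>" using \<delta> G by (intro divide_strict_right_mono mult_strict_right_mono) auto
      also have "\<dots> = \<epsilon>" using G M by (simp add: \<delta>_def)
      finally show "cmod (\<phi> b - \<phi> a) < \<epsilon>" .
    qed
  qed
  moreover have "l n = \<phi> (monomial_seq n)" for n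
  proof -
    have ne: "complex_of_real (Gamma \<beta>) \<noteq> 0" using G by (metis less_irrefl of_real_eq_0_iff)
    have "0 < \<beta>" using \<beta> by simp
    show ?thesis
      unfolding \<phi>_def integral_dual_integrand_monomial[OF \<open>0 < \<beta>\<close>] nonzero_mult_div_cancel_left[OF ne] ..
  qed
  ultimately show "l \<in> hardy_dual p" unfolding hardy_dual_def by blast
qed

theorem corollary8p2:
  fixes p :: real and q :: ennreal
  assumes "0 < p" and "p < 1" and "0 < q"
  shows
    "(multipliers (hardy_lorentz p q) bloch = multipliers (hardy_lorentz0 p) bloch \<and>
      multipliers (hardy_lorentz0 p) bloch = bloch_type (1 / p) \<and>
      bloch_type (1 / p) = hardy_dual p) \<and>
     (q \<noteq> \<infinity> \<longrightarrow>
      multipliers (hardy_lorentz p q) little_bloch = multipliers (hardy_lorentz0 p) little_bloch \<and>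
      multipliers (hardy_lorentz0 p) little_bloch = bloch_type (1 / p) \<and>
      bloch_type (1 / p) = hardy_dual p) \<and>
     multipliers (hardy_lorentz p \<infinity>) little_bloch = bloch_type0 (1 / p)"
proof -
  note p = assms(1,2)
  have weak: "hardy_lorentz0 p \<subseteq> hardy_lorentz p \<infinity>" by (auto simp: hardy_lorentz0_def)
  have fin: "hardy_lorentz p r \<subseteq> hardy_lorentz0 p" if "0 < r" "r \<noteq> \<infinity>" for r
    by (rule hardy_lorentz_subset_lorentz0[OF p(1) that])
  \<comment> \<open>Multiplier spaces decrease as the domain grows, so every E between some
    \<open>hardy_lorentz p r\<close> with finite r and the weak space has the same multipliers:
    necessity is proved for the smallest domain, sufficiency for the largest. \<open>B0\<close>
    repeats this with the small class on top.\<close>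
  have B: "multipliers E bloch = bloch_type (1 / p)"
    if "E \<subseteq> hardy_lorentz p \<infinity>" "hardy_lorentz p r \<subseteq> E" "0 < r" "r \<noteq> \<infinity>" for E r
    using bloch_type_subset_multipliers[OF p] multipliers_mono[OF that(1) subset_refl, of bloch]
      multipliers_hardy_lorentz_bloch_subset[OF p that(3,4)] multipliers_mono[OF that(2) subset_refl, of bloch]
    by blast
  have B0: "multipliers E little_bloch = bloch_type (1 / p)"
    if "E \<subseteq> hardy_lorentz0 p" "hardy_lorentz p r \<subseteq> E" "0 < r" "r \<noteq> \<infinity>" for E r
    using bloch_type_subset_multipliers0[OF p] multipliers_mono[OF that(1) subset_refl, of little_bloch]
      multipliers_hardy_lorentz_bloch_subset[OF p that(3,4)] multipliers_mono[OF that(2) little_bloch_subset_bloch]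
    by blast
  have dual: "bloch_type (1 / p) = hardy_dual p"
    using bloch_type_subset_hardy_dual[OF p] hardy_dual_subset_bloch_type[OF p] by blast
  have i: "multipliers (hardy_lorentz p q) bloch = bloch_type (1 / p)"
  proof (cases "q = \<infinity>")
    case True
    \<comment> \<open>For infinite q the finite index 1 takes the place of the lower space.\<close>
    show ?thesis unfolding True by (rule B[of _ 1]) (use weak fin[of 1] in auto)
  next
    case False
    show ?thesis by (rule B[OF _ subset_refl assms(3) False]) (use weak fin[OF assms(3) False] in auto)
  qed
  have i0: "multipliers (hardy_lorentz0 p) bloch = bloch_type (1 / p)"
    by (rule B[of _ 1]) (use weak fin[of 1] in auto)
  have ii: "multipliers (hardy_lorentz p q) little_bloch = bloch_type (1 / p)" if "q \<noteq> \<infinity>"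
    by (rule B0[OF fin[OF assms(3) that] subset_refl assms(3) that])
  have ii0: "multipliers (hardy_lorentz0 p) little_bloch = bloch_type (1 / p)"
    by (rule B0[of _ 1]) (use fin[of 1] in auto)
  have iii: "multipliers (hardy_lorentz p \<infinity>) little_bloch = bloch_type0 (1 / p)"
    using multipliers_weak_little_bloch_subset[OF p] bloch_type0_subset_multipliers[OF p] by blast
  show ?thesis unfolding i0 ii0 iii using i ii dual by auto
qed

end
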